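(* Let $\mathfrak g$ be a complex simple Lie algebra with a non-degenerate invariant symmetric bilinear form $(\cdot,\cdot)$ and corresponding Casimir element $\Omega_{\mathfrak g}\in(S^2\mathfrak g)^{\mathfrak g}$. Let $\mathfrak l\subset\mathfrak g$ be a Levi subalgebra and let $\mathfrak l^\bot$ be the orthogonal complement of $\mathfrak l$ in $\mathfrak g$ with respect to the Killing form. Suppose $\mathfrak l$ is equipped with a factorizable quasitriangular Lie bialgebra structure with r-matrix $r_{\mathfrak l}\in\wedge^2\mathfrak l$ and Casimir element $\Omega_{\mathfrak l}$, where $\Omega_{\mathfrak l}$ is the Casimir element of the restriction of $(\cdot,\cdot)$ to $\mathfrak l$. Let $\varepsilon\in\mathbb C$, $\varepsilon\ne0$. Then the meromorphic function $r$ on $\mathcal N_{\mathfrak l}(0)$ with values in $\mathrm{End}(\mathfrak l)\oplus\mathrm{End}(\mathfrak l^\bot)\subset\mathrm{End}(\mathfrak g)\simeq\mathfrak g\otimes\mathfrak g$ given by $$r(\lambda)|_{\mathfrak l}=\tfrac12\coth\bigl(\tfrac12\,\mathrm{ad}\,\lambda\bigr)-\tfrac{\varepsilon}{2}\coth\bigl(\tfrac{\varepsilon}{2}\,\mathrm{ad}\,\lambda\bigr)-r_{\mathfrak l},\qquad r(\lambda)|_{\mathfrak l^\bot}=-\tfrac{\varepsilon}{2}\coth\bigl(\tfrac{\varepsilon}{2}\,\mathrm{ad}\,\lambda\bigr)$$ is a (Poisson Lie) dynamical r-matrix over $\mathcal N_{\mathfrak l}(0)$ for $Z=Z^\varepsilon_{\mathfrak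 g}=\tfrac{\varepsilon^2}{4}[\Omega_{\mathfrak g}^{12},\Omega_{\mathfrak g}^{23}]$.
   Context: Functions are analytic or meromorphic. An element $\sum a\otimes b\in\mathfrak g\otimes\mathfrak g$ is identified with the operator $x\mapsto\sum(a,x)b$ in $\mathrm{End}(\mathfrak g)$ via the form $(\cdot,\cdot)$ (pairing with the first tensor component), and likewise $r_{\mathfrak l}$ with an operator in $\mathrm{End}(\mathfrak l)$. The expression $\tfrac12\coth(\tfrac12 s)-\tfrac\varepsilon2\coth(\tfrac\varepsilon2 s)$ is understood as a function of $s$ regular at $s=0$ (value $0$ there), evaluated at $s=\mathrm{ad}\,\lambda$. For $A\in\mathfrak g\otimes\mathfrak g$ put $\mathrm{CYB}(A):=[A_{12},A_{13}]+[A_{12},A_{23}]+[A_{13},A_{23}]$. For $B\in\mathfrak g^{\otimes 3}$ put $\mathrm{Alt}(B):=B_{123}-B_{213}+B_{231}$, where for $B=b_1\otimes b_2\otimes b_3$ one has $B_{213}=b_2\otimes b_1\otimes b_3$ and $B_{231}=b_2\otimes b_3\otimes b_1$. Lie bialgebra: $\mathfrak l$ is quasitriangular, meaning that its cobracket is $\delta(\xi)=[\xi\otimes1+1\otimes\xi,r_{\mathfrak l}]$ with $r_{\mathfrak l}\in\wedge^2\mathfrak l$, and $\Omega_{\mathfrak l}\in(S^2\mathfrak l)^{\mathfrak l}$ satisfies $\mathrm{CYB}(r_{\mathfrak l}+\tfrac12\Omega_{\mathfrak l})=0$. Elements of $\mathfrak l\otimes\mathfrak l$ define linear operators $\mathfrak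 l^*\to\mathfrak l$ via pairing with the first tensor component. Factorizable means that $\Omega_{\mathfrak l}\colon\mathfrak l^*\to\mathfrak l$ is an isomorphism. The base manifold $\mathcal N_{\mathfrak l}(0)$: let $\mathrm{Exp}\,\mathfrak l$ be the connected simply connected Lie group of $\mathfrak l$. $\mathcal N_{\mathfrak l}(0)\subset\mathfrak l$ is an open domain (connected open set) containing $0$ that parameterizes, by the exponential map, a neighborhood of the identity in $\mathrm{Exp}\,\mathfrak l$. For $\xi\in\mathfrak l$ let $\xi^l f(g)=\frac{d}{dt}f(ge^{t\xi})|_{t=0}$ and $\xi^r f(g)=\frac{d}{dt}f(e^{t\xi}g)|_{t=0}$; these vector fields are transported to $\mathcal N_{\mathfrak l}(0)$ by the exponential map. The elements $\xi\in\mathfrak l$ and $\eta\in\mathfrak l^*_{op}$ of the double $\mathfrak D\mathfrak l=\mathfrak l\bowtie\mathfrak l^*_{op}$ act on functions by the vector fields $$\xi\triangleright:=\xi^l-\xi^r,\qquad \nabla_\eta:=r_{\mathfrak l}(\eta)^r-r_{\mathfrak l}(\eta)^l+\tfrac12\bigl(\Omega_{\mathfrak l}(\eta)^l+\Omega_{\mathfrak l}(\eta)^r\bigr).$$ A function $r\colon\mathcal N_{\mathfrak l}(0)\to\wedge^2\mathfrak g$ is quasi-invariant if $\xi\triangleright r(\lambda)+[\xi\otimes1+1\otimes\xi,r(\lambda)]=-\delta(\xi)$ for all $\xi\in\mathfrak l$. A quasi-invariant $r$ is a (Poisson Lie) dynamical r-matrix over $\mathcal N_{\mathfrak l}(0)$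 for $Z\in(\wedge^3\mathfrak g)^{\mathfrak g}$ if $$\sum_i\mathrm{Alt}\bigl(\xi_i\otimes\nabla_{\eta^i}r(\lambda)\bigr)+\mathrm{CYB}\bigl(r(\lambda)\bigr)=Z,$$ where $\{\xi_i\}\subset\mathfrak l$, $\{\eta^i\}\subset\mathfrak l^*$ are dual bases. *)

theory Defs
  imports "HOL-Analysis.Analysis"
begin

section \<open>Lie algebras, Levi subalgebras\<close>

text \<open>
  A finite-dimensional complex Lie algebra is given in coordinates: its underlying space is
  \<open>complex^'n\<close> with an arbitrary bracket \<open>br\<close>.  All notions over the complex numbers use the scalar
  multiplication \<open>(*s)\<close> (constants \<open>vec.subspace\<close>, \<open>vec.span\<close>, \<dots>).
\<close>

abbreviation complex_linear :: "(complex^'n \<Rightarrow> complex^'n) \<Rightarrow> bool" where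
  "complex_linear f \<equiv> Vector_Spaces.linear (*s) (*s) f"

abbreviation linear_functional :: "(complex^'n \<Rightarrow> complex) \<Rightarrow> bool" where
  "linear_functional \<eta> \<equiv> Vector_Spaces.linear (*s) (*) \<eta>"

definition lie_algebra :: "(complex^'n \<Rightarrow> complex^'n \<Rightarrow> complex^'n) \<Rightarrow> bool" where
  "lie_algebra br \<longleftrightarrow>
     (\<forall>x. complex_linear (br x)) \<and> (\<forall>y. complex_linear (\<lambda>x. br x y)) \<and>
     (\<forall>x. br x x = 0) \<and>
     (\<forall>x y z. br x (br y z) + br y (br z x) + br z (br x y) = 0)"

definition simple_lie_algebra :: "(complex^'n \<Rightarrow> complex^'n \<Rightarrow> complex^'n) \<Rightarrow> bool" where
  "simple_lie_algebra br \<longleftrightarrow>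
     lie_algebra br \<and> (\<exists>x y. br x y \<noteq> 0) \<and>
     (\<forall>I. vec.subspace I \<and> (\<forall>x. \<forall>y\<in>I. br x y \<in> I) \<longrightarrow> I = {0} \<or> I = UNIV)"

definition nondeg_invariant_form ::
  "(complex^'n \<Rightarrow> complex^'n \<Rightarrow> complex^'n) \<Rightarrow> (complex^'n \<Rightarrow> complex^'n \<Rightarrow> complex) \<Rightarrow> bool" where
  "nondeg_invariant_form br form \<longleftrightarrow>
     (\<forall>x. linear_functional (form x)) \<and> (\<forall>y. linear_functional (\<lambda>x. form x y)) \<and>
     (\<forall>x y. form x y = form y x) \<and>
     (\<forall>x y z. form (br x y) z = form x (br y z)) \<and>
     (\<forall>x. (\<forall>y. form x y = 0) \<longrightarrow> x = 0)"

definition killing_form ::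
  "(complex^'n \<Rightarrow> complex^'n \<Rightarrow> complex^'n) \<Rightarrow> complex^'n \<Rightarrow> complex^'n \<Rightarrow> complex" where
  "killing_form br x y = trace (matrix (br x) ** matrix (br y))"

definition killing_orthogonal ::
  "(complex^'n \<Rightarrow> complex^'n \<Rightarrow> complex^'n) \<Rightarrow> (complex^'n) set \<Rightarrow> (complex^'n) set" where
  "killing_orthogonal br l = {x. \<forall>y\<in>l. killing_form br x y = 0}"

text \<open>Cartan subalgebras of a semisimple Lie algebra: maximal abelian and acting diagonalizably.\<close>

definition cartan_subalgebra ::
  "(complex^'n \<Rightarrow> complex^'n \<Rightarrow> complex^'n) \<Rightarrow> (complex^'n) set \<Rightarrow> bool" where
  "cartan_subalgebra br h \<longleftrightarrow>
     vec.subspace h \<and> (\<forall>x\<in>h. \<forall>y\<in>h. br x y = 0) \<and>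
     (\<forall>x. (\<forall>y\<in>h. br y x = 0) \<longrightarrow> x \<in> h) \<and>
     (\<forall>y\<in>h. vec.span {x. \<exists>c. br y x = c *s x} = UNIV)"

definition root_space ::
  "(complex^'n \<Rightarrow> complex^'n \<Rightarrow> complex^'n) \<Rightarrow> (complex^'n) set \<Rightarrow> (complex^'n \<Rightarrow> complex) \<Rightarrow> (complex^'n) set"
  where "root_space br h \<alpha> = {x. \<forall>y\<in>h. br y x = \<alpha> y *s x}"

text \<open>An element of the dual of \<open>h\<close> is represented by the function that vanishes off \<open>h\<close>.\<close>

definition roots ::
  "(complex^'n \<Rightarrow> complex^'n \<Rightarrow> complex^'n) \<Rightarrow> (complex^'n) set \<Rightarrow> (complex^'n \<Rightarrow> complex) set" where
  "roots br h = {\<alpha>. (\<forall>x\<in>h. \<forall>y\<in>h. \<alpha> (x + y) = \<alpha> x + \<alpha> y) \<and> (\<forall>c. \<forall>x\<in>h. \<alpha> (c *s x) = c * \<alpha> x) \<and>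
     (\<forall>x. x \<notin> h \<longrightarrow> \<alpha> x = 0) \<and> (\<exists>x. \<alpha> x \<noteq> 0) \<and> root_space br h \<alpha> \<noteq> {0}}"

definition simple_roots ::
  "(complex^'n \<Rightarrow> complex^'n \<Rightarrow> complex^'n) \<Rightarrow> (complex^'n) set \<Rightarrow> (complex^'n \<Rightarrow> complex) set \<Rightarrow> bool"
  where
  "simple_roots br h \<Delta> \<longleftrightarrow>
     finite \<Delta> \<and> \<Delta> \<subseteq> roots br h \<and>
     (\<forall>c. (\<forall>y. (\<Sum>\<alpha>\<in>\<Delta>. c \<alpha> * \<alpha> y) = 0) \<longrightarrow> (\<forall>\<alpha>\<in>\<Delta>. c \<alpha> = 0)) \<and>
     (\<forall>\<beta>\<in>roots br h. \<exists>k :: _ \<Rightarrow> nat.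
        (\<forall>y. \<beta> y = (\<Sum>\<alpha>\<in>\<Delta>. of_nat (k \<alpha>) * \<alpha> y)) \<or> (\<forall>y. \<beta> y = - (\<Sum>\<alpha>\<in>\<Delta>. of_nat (k \<alpha>) * \<alpha> y)))"

text \<open>
  The standard Levi factor of the parabolic subalgebra attached to a set \<open>\<Gamma>\<close> of simple roots.
\<close>

definition levi_subalgebra ::
  "(complex^'n \<Rightarrow> complex^'n \<Rightarrow> complex^'n) \<Rightarrow> (complex^'n) set \<Rightarrow> bool" where
  "levi_subalgebra br l \<longleftrightarrow>
     (\<exists>h \<Delta> \<Gamma>. cartan_subalgebra br h \<and> simple_roots br h \<Delta> \<and> \<Gamma> \<subseteq> \<Delta> \<and>
       l = vec.span (h \<union> \<Union> {root_space br h \<beta> | \<beta>.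
             \<beta> \<in> roots br h \<and> (\<exists>m :: _ \<Rightarrow> int. \<forall>y. \<beta> y = (\<Sum>\<alpha>\<in>\<Gamma>. of_int (m \<alpha>) * \<alpha> y))}))"

section \<open>Tensors\<close>

text \<open>
  With \<open>e i = axis i 1\<close>, the array \<open>A :: complex^'n^'n\<close> stands for the tensor
  \<open>\<Sum>i j. A$i$j e i \<otimes> e j\<close>, and \<open>B :: complex^'n^'n^'n\<close> for \<open>\<Sum>i j k. B$i$j$k e i \<otimes> e j \<otimes> e k\<close>.
\<close>

definition tensor2 :: "complex^'n \<Rightarrow> complex^'n \<Rightarrow> complex^'n^'n" where
  "tensor2 x y = (\<chi> i j. x $ i * y $ j)"

definition tensor_left :: "complex^'n \<Rightarrow> complex^'n^'n \<Rightarrow> complex^'n^'n^'n" where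
  "tensor_left x A = (\<chi> a b c. x $ a * A $ b $ c)"

text \<open>
  \<open>V \<otimes> V\<close> for a complex subspace \<open>V\<close>; the real span below is a complex subspace because the
  generating set is closed under complex multiples.
\<close>

definition tensor_square :: "(complex^'n) set \<Rightarrow> (complex^'n^'n) set" where
  "tensor_square V = span {tensor2 x y | x y. x \<in> V \<and> y \<in> V}"

definition wedge2 :: "(complex^'n) set \<Rightarrow> (complex^'n^'n) set" where
  "wedge2 V = {A \<in> tensor_square V. \<forall>i j. A $ i $ j = - A $ j $ i}"

definition sym2 :: "(complex^'n) set \<Rightarrow> (complex^'n^'n) set" where
  "sym2 V = {A \<in> tensor_square V. \<forall>i j. A $ i $ j = A $ j $ i}"

definition wedge3 :: "(complex^'n^'n^'n) set" where
  "wedge3 = {B. \<forall>a b c. B $ a $ b $ c = - B $ b $ a $ c \<and> B $ a $ b $ c = - B $ a $ c $ b}"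

text \<open>\<open>\<Sum> a \<otimes> b \<mapsto> \<Sum> \<eta>(a) b\<close>\<close>

definition contract :: "complex^'n^'n \<Rightarrow> (complex^'n \<Rightarrow> complex) \<Rightarrow> complex^'n" where
  "contract A \<eta> = (\<chi> j. \<Sum>i\<in>UNIV. \<eta> (axis i 1) * A $ i $ j)"

definition operator_of ::
  "(complex^'n \<Rightarrow> complex^'n \<Rightarrow> complex) \<Rightarrow> complex^'n^'n \<Rightarrow> complex^'n \<Rightarrow> complex^'n" where
  "operator_of form A x = contract A (\<lambda>a. form a x)"

definition casimir_element ::
  "(complex^'n \<Rightarrow> complex^'n \<Rightarrow> complex) \<Rightarrow> (complex^'n) set \<Rightarrow> complex^'n^'n \<Rightarrow> bool" where
  "casimir_element form V \<Omega> \<longleftrightarrow>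
     (\<exists>d u v. u ` {..<d} \<subseteq> V \<and> vec.span (u ` {..<d}) = V \<and> v ` {..<d} \<subseteq> V \<and> vec.span (v ` {..<d}) = V \<and>
        (\<forall>i<d. \<forall>j<d. form (u i) (v j) = (if i = j then 1 else 0)) \<and>
        \<Omega> = (\<Sum>i<(d::nat). tensor2 (u i) (v i)))"

text \<open>\<open>[\<xi> \<otimes> 1 + 1 \<otimes> \<xi>, A]\<close> and its analogue on triple tensors\<close>

definition ad2 ::
  "(complex^'n \<Rightarrow> complex^'n \<Rightarrow> complex^'n) \<Rightarrow> complex^'n \<Rightarrow> complex^'n^'n \<Rightarrow> complex^'n^'n" where
  "ad2 br \<xi> A = matrix (br \<xi>) ** A + A ** transpose (matrix (br \<xi>))"

definition ad3 ::
  "(complex^'n \<Rightarrow> complex^'n \<Rightarrow> complex^'n) \<Rightarrow> complex^'n \<Rightarrow> complex^'n^'n^'n \<Rightarrow> complex^'n^'n^'n" where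
  "ad3 br \<xi> B = (\<chi> a b c. \<Sum>k\<in>UNIV.
     matrix (br \<xi>) $ a $ k * B $ k $ b $ c + matrix (br \<xi>) $ b $ k * B $ a $ k $ c
     + matrix (br \<xi>) $ c $ k * B $ a $ b $ k)"

text \<open>The commutators \<open>[A\<^sub>1\<^sub>2, B\<^sub>1\<^sub>3]\<close>, \<open>[A\<^sub>1\<^sub>2, B\<^sub>2\<^sub>3]\<close>, \<open>[A\<^sub>1\<^sub>3, B\<^sub>2\<^sub>3]\<close>.\<close>

definition comm_12_13 ::
  "(complex^'n \<Rightarrow> complex^'n \<Rightarrow> complex^'n) \<Rightarrow> complex^'n^'n \<Rightarrow> complex^'n^'n \<Rightarrow> complex^'n^'n^'n" where
  "comm_12_13 br A B = (\<chi> a b c. \<Sum>i\<in>UNIV. \<Sum>k\<in>UNIV.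
     A $ i $ b * B $ k $ c * br (axis i 1) (axis k 1) $ a)"

definition comm_12_23 ::
  "(complex^'n \<Rightarrow> complex^'n \<Rightarrow> complex^'n) \<Rightarrow> complex^'n^'n \<Rightarrow> complex^'n^'n \<Rightarrow> complex^'n^'n^'n" where
  "comm_12_23 br A B = (\<chi> a b c. \<Sum>j\<in>UNIV. \<Sum>k\<in>UNIV.
     A $ a $ j * B $ k $ c * br (axis j 1) (axis k 1) $ b)"

definition comm_13_23 ::
  "(complex^'n \<Rightarrow> complex^'n \<Rightarrow> complex^'n) \<Rightarrow> complex^'n^'n \<Rightarrow> complex^'n^'n \<Rightarrow> complex^'n^'n^'n" where
  "comm_13_23 br A B = (\<chi> a b c. \<Sum>j\<in>UNIV. \<Sum>m\<in>UNIV.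
     A $ a $ j * B $ b $ m * br (axis j 1) (axis m 1) $ c)"

definition CYB ::
  "(complex^'n \<Rightarrow> complex^'n \<Rightarrow> complex^'n) \<Rightarrow> complex^'n^'n \<Rightarrow> complex^'n^'n^'n" where
  "CYB br A = comm_12_13 br A A + comm_12_23 br A A + comm_13_23 br A A"

text \<open>
  \<open>B\<^sub>1\<^sub>2\<^sub>3 - B\<^sub>2\<^sub>1\<^sub>3 + B\<^sub>2\<^sub>3\<^sub>1\<close>, where \<open>B\<^sub>2\<^sub>3\<^sub>1 = b\<^sub>2 \<otimes> b\<^sub>3 \<otimes> b\<^sub>1\<close>, so the \<open>(a,b,c)\<close>
  component of \<open>B\<^sub>2\<^sub>3\<^sub>1\<close> is the \<open>(c,a,b)\<close> component of \<open>B\<close>.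
\<close>

definition Alt :: "complex^'n^'n^'n \<Rightarrow> complex^'n^'n^'n" where
  "Alt B = (\<chi> a b c. B $ a $ b $ c - B $ b $ a $ c + B $ c $ a $ b)"

section \<open>Factorizable Lie bialgebras\<close>

text \<open>
  Functionals on a subspace \<open>l\<close> are represented by functionals on the whole space; only their
  restriction to \<open>l\<close> matters when they are paired with tensors in \<open>l \<otimes> l\<close>.
  The last condition is the Jacobi identity for the bracket \<open>[\<eta>,\<zeta>](x) = \<langle>\<eta> \<otimes> \<zeta>, \<delta> x\<rangle>\<close> on the dual of \<open>l\<close>.
\<close>

definition pairing2 ::
  "(complex^'n \<Rightarrow> complex) \<Rightarrow> (complex^'n \<Rightarrow> complex) \<Rightarrow> complex^'n^'n \<Rightarrow> complex" where
  "pairing2 \<eta> \<zeta> A = (\<Sum>i\<in>UNIV. \<Sum>j\<in>UNIV. \<eta> (axis i 1) * \<zeta> (axis j 1) * A $ i $ j)"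

definition lie_bialgebra ::
  "(complex^'n \<Rightarrow> complex^'n \<Rightarrow> complex^'n) \<Rightarrow> (complex^'n) set \<Rightarrow> (complex^'n \<Rightarrow> complex^'n^'n) \<Rightarrow> bool"
  where
  "lie_bialgebra br l \<delta> \<longleftrightarrow>
     vec.subspace l \<and> (\<forall>x\<in>l. \<forall>y\<in>l. br x y \<in> l) \<and>
     (\<forall>x\<in>l. \<delta> x \<in> wedge2 l) \<and>
     (\<forall>x\<in>l. \<forall>y\<in>l. \<delta> (x + y) = \<delta> x + \<delta> y) \<and>
     (\<forall>c. \<forall>x\<in>l. \<forall>i j. \<delta> (c *s x) $ i $ j = c * \<delta> x $ i $ j) \<and>
     (\<forall>x\<in>l. \<forall>y\<in>l. \<delta> (br x y) = ad2 br x (\<delta> y) - ad2 br y (\<delta> x)) \<and>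
     (\<forall>x\<in>l. \<forall>\<eta> \<zeta> \<theta>. linear_functional \<eta> \<and> linear_functional \<zeta> \<and> linear_functional \<theta> \<longrightarrow>
        pairing2 \<eta> \<zeta> (\<delta> (contract (\<delta> x) \<theta>)) + pairing2 \<zeta> \<theta> (\<delta> (contract (\<delta> x) \<eta>))
        + pairing2 \<theta> \<eta> (\<delta> (contract (\<delta> x) \<zeta>)) = 0)"

definition quasitriangular ::
  "(complex^'n \<Rightarrow> complex^'n \<Rightarrow> complex^'n) \<Rightarrow> (complex^'n) set \<Rightarrow> (complex^'n \<Rightarrow> complex^'n^'n) \<Rightarrow>
   complex^'n^'n \<Rightarrow> complex^'n^'n \<Rightarrow> bool" where
  "quasitriangular br l \<delta> r\<^sub>l \<Omega>\<^sub>l \<longleftrightarrow>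
     lie_bialgebra br l \<delta> \<and> r\<^sub>l \<in> wedge2 l \<and> (\<forall>\<xi>\<in>l. \<delta> \<xi> = ad2 br \<xi> r\<^sub>l) \<and>
     \<Omega>\<^sub>l \<in> sym2 l \<and> (\<forall>\<xi>\<in>l. ad2 br \<xi> \<Omega>\<^sub>l = 0) \<and>
     CYB br (r\<^sub>l + (1/2) *\<^sub>R \<Omega>\<^sub>l) = 0"

text \<open>Bijectivity of the map from the dual of \<open>l\<close> to \<open>l\<close> given by \<open>\<Omega>\<close>.\<close>

definition factorizable :: "(complex^'n) set \<Rightarrow> complex^'n^'n \<Rightarrow> bool" where
  "factorizable l \<Omega> \<longleftrightarrow>
     {contract \<Omega> \<eta> | \<eta>. linear_functional \<eta>} = l \<and>
     (\<forall>\<eta>. linear_functional \<eta> \<and> contract \<Omega> \<eta> = 0 \<longrightarrow> (\<forall>x\<in>l. \<eta> x = 0))"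

section \<open>The base manifold\<close>

text \<open>
  The product \<open>*\<close> on \<open>complex^'n^'n\<close> is componentwise, so the library's \<open>exp\<close> is not the
  matrix exponential.
\<close>

definition matrix_exp :: "complex^'n^'n \<Rightarrow> complex^'n^'n" where
  "matrix_exp A = (\<Sum>k. (1 / fact k) *\<^sub>R (((**) A ^^ k) (mat 1)))"

definition Exp_ad :: "(complex^'n \<Rightarrow> complex^'n \<Rightarrow> complex^'n) \<Rightarrow> complex^'n \<Rightarrow> complex^'n^'n" where
  "Exp_ad br x = matrix_exp (matrix (br x))"

text \<open>
  A simple Lie algebra has trivial centre, so \<open>ad\<close> is faithful on a subalgebra \<open>l\<close>, and the group
  generated by the \<open>Exp_ad br x\<close>, \<open>x \<in> l\<close>, is a connected linear group with Lie algebra \<open>l\<close>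
  (closed if \<open>l\<close> is a Levi subalgebra).  The simply connected group of \<open>l\<close> is its universal cover,
  whose points are the classes of paths starting at the identity modulo homotopy with fixed
  endpoints; its exponential map sends \<open>x\<close> to the class of \<open>t \<mapsto> Exp_ad br (t x)\<close>.
\<close>

definition linear_group ::
  "(complex^'n \<Rightarrow> complex^'n \<Rightarrow> complex^'n) \<Rightarrow> (complex^'n) set \<Rightarrow> (complex^'n^'n) set" where
  "linear_group br l = {foldr (\<lambda>x M. Exp_ad br x ** M) xs (mat 1) | xs. set xs \<subseteq> l}"

definition simply_connected_exp ::
  "(complex^'n \<Rightarrow> complex^'n \<Rightarrow> complex^'n) \<Rightarrow> (complex^'n) set \<Rightarrow> complex^'n \<Rightarrow> (real \<Rightarrow> complex^'n^'n) set"
  where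
  "simply_connected_exp br l x =
     {p. homotopic_paths (linear_group br l) (\<lambda>t. Exp_ad br (t *\<^sub>R x)) p}"

text \<open>The covering map is a local diffeomorphism, so differentials can be computed in the linear group.\<close>

definition exponential_domain ::
  "(complex^'n \<Rightarrow> complex^'n \<Rightarrow> complex^'n) \<Rightarrow> (complex^'n) set \<Rightarrow> (complex^'n) set \<Rightarrow> bool" where
  "exponential_domain br l N \<longleftrightarrow>
     openin (top_of_set l) N \<and> connected N \<and> 0 \<in> N \<and>
     inj_on (simply_connected_exp br l) N \<and>
     (\<forall>\<mu>\<in>N. \<forall>v\<in>l. vector_derivative (\<lambda>s. Exp_ad br (\<mu> + s *\<^sub>R v)) (at 0) = 0 \<longrightarrow> v = 0)"

text \<open>
  The vector fields \<open>\<xi>\<^sup>l\<close>, \<open>\<xi>\<^sup>r\<close> transported to \<open>l\<close>: the tangent vector \<open>v\<close> at \<open>\<mu>\<close> which the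
  differential of the exponential map sends to the velocity of \<open>exp(\<mu>) exp(t\<xi>)\<close>, respectively
  \<open>exp(t\<xi>) exp(\<mu>)\<close>, at \<open>t = 0\<close>.
\<close>

definition left_vector ::
  "(complex^'n \<Rightarrow> complex^'n \<Rightarrow> complex^'n) \<Rightarrow> (complex^'n) set \<Rightarrow> complex^'n \<Rightarrow> complex^'n \<Rightarrow> complex^'n"
  where
  "left_vector br l \<xi> \<mu> = (THE v. v \<in> l \<and>
     vector_derivative (\<lambda>s. Exp_ad br (\<mu> + s *\<^sub>R v)) (at 0)
     = vector_derivative (\<lambda>t. Exp_ad br \<mu> ** Exp_ad br (t *\<^sub>R \<xi>)) (at 0))"

definition right_vector ::
  "(complex^'n \<Rightarrow> complex^'n \<Rightarrow> complex^'n) \<Rightarrow> (complex^'n) set \<Rightarrow> complex^'n \<Rightarrow> complex^'n \<Rightarrow> complex^'n"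
  where
  "right_vector br l \<xi> \<mu> = (THE v. v \<in> l \<and>
     vector_derivative (\<lambda>s. Exp_ad br (\<mu> + s *\<^sub>R v)) (at 0)
     = vector_derivative (\<lambda>t. Exp_ad br (t *\<^sub>R \<xi>) ** Exp_ad br \<mu>) (at 0))"

definition left_deriv ::
  "(complex^'n \<Rightarrow> complex^'n \<Rightarrow> complex^'n) \<Rightarrow> (complex^'n) set \<Rightarrow> complex^'n \<Rightarrow>
   (complex^'n \<Rightarrow> complex^'n^'n) \<Rightarrow> complex^'n \<Rightarrow> complex^'n^'n" where
  "left_deriv br l \<xi> f \<mu> = vector_derivative (\<lambda>s. f (\<mu> + s *\<^sub>R left_vector br l \<xi> \<mu>)) (at 0)"

definition right_deriv ::
  "(complex^'n \<Rightarrow> complex^'n \<Rightarrow> complex^'n) \<Rightarrow> (complex^'n) set \<Rightarrow> complex^'n \<Rightarrow>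
   (complex^'n \<Rightarrow> complex^'n^'n) \<Rightarrow> complex^'n \<Rightarrow> complex^'n^'n" where
  "right_deriv br l \<xi> f \<mu> = vector_derivative (\<lambda>s. f (\<mu> + s *\<^sub>R right_vector br l \<xi> \<mu>)) (at 0)"

definition act_l ::
  "(complex^'n \<Rightarrow> complex^'n \<Rightarrow> complex^'n) \<Rightarrow> (complex^'n) set \<Rightarrow> complex^'n \<Rightarrow>
   (complex^'n \<Rightarrow> complex^'n^'n) \<Rightarrow> complex^'n \<Rightarrow> complex^'n^'n" where
  "act_l br l \<xi> f \<mu> = left_deriv br l \<xi> f \<mu> - right_deriv br l \<xi> f \<mu>"

definition nabla ::
  "(complex^'n \<Rightarrow> complex^'n \<Rightarrow> complex^'n) \<Rightarrow> (complex^'n) set \<Rightarrow> complex^'n^'n \<Rightarrow> complex^'n^'n \<Rightarrow>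
   (complex^'n \<Rightarrow> complex) \<Rightarrow> (complex^'n \<Rightarrow> complex^'n^'n) \<Rightarrow> complex^'n \<Rightarrow> complex^'n^'n" where
  "nabla br l r\<^sub>l \<Omega>\<^sub>l \<eta> f \<mu> =
     right_deriv br l (contract r\<^sub>l \<eta>) f \<mu> - left_deriv br l (contract r\<^sub>l \<eta>) f \<mu>
     + (1/2) *\<^sub>R (left_deriv br l (contract \<Omega>\<^sub>l \<eta>) f \<mu> + right_deriv br l (contract \<Omega>\<^sub>l \<eta>) f \<mu>)"

section \<open>Meromorphic maps and dynamical r-matrices\<close>

definition holomorphic_in ::
  "(complex^'n) set \<Rightarrow> (complex^'n) set \<Rightarrow> (complex^'n \<Rightarrow> complex) \<Rightarrow> bool" where
  "holomorphic_in l U f \<longleftrightarrow>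
     (\<forall>x\<in>U. \<exists>f'. (f has_derivative f') (at x within U) \<and> (\<forall>c. \<forall>v\<in>l. f' (c *s v) = c * f' v))"

text \<open>
  A meromorphic tensor-valued map on the open subset \<open>N\<close> of \<open>l\<close>: it is holomorphic on the open set
  \<open>D\<close>, its values off \<open>D\<close> are irrelevant, and locally it is a quotient \<open>F / q\<close> of holomorphic maps
  with \<open>D\<close> containing the complement of the zeros of \<open>q\<close>.
\<close>

definition meromorphic_map ::
  "(complex^'n) set \<Rightarrow> (complex^'n) set \<Rightarrow> (complex^'n) set \<Rightarrow> (complex^'n \<Rightarrow> complex^'n^'n) \<Rightarrow> bool" where
  "meromorphic_map l N D r \<longleftrightarrow>
     D \<subseteq> N \<and> openin (top_of_set l) D \<and> (\<forall>i j. holomorphic_in l D (\<lambda>\<mu>. r \<mu> $ i $ j)) \<and>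
     (\<forall>p\<in>N. \<exists>U q F. p \<in> U \<and> U \<subseteq> N \<and> openin (top_of_set l) U \<and> connected U \<and>
        holomorphic_in l U q \<and> (\<exists>x\<in>U. q x \<noteq> 0) \<and> (\<forall>i j. holomorphic_in l U (\<lambda>\<mu>. F \<mu> $ i $ j)) \<and>
        (\<forall>x\<in>U. q x \<noteq> 0 \<longrightarrow> x \<in> D \<and> (\<forall>i j. q x * r x $ i $ j = (F x :: complex^'n^'n) $ i $ j)))"

definition quasi_invariant ::
  "(complex^'n \<Rightarrow> complex^'n \<Rightarrow> complex^'n) \<Rightarrow> (complex^'n) set \<Rightarrow> (complex^'n \<Rightarrow> complex^'n^'n) \<Rightarrow>
   (complex^'n) set \<Rightarrow> (complex^'n \<Rightarrow> complex^'n^'n) \<Rightarrow> bool" where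
  "quasi_invariant br l \<delta> D r \<longleftrightarrow>
     (\<forall>\<xi>\<in>l. \<forall>\<mu>\<in>D. act_l br l \<xi> r \<mu> + ad2 br \<xi> (r \<mu>) = - \<delta> \<xi>)"

text \<open>\<open>\<xi>\<close> is a basis of \<open>l\<close> (independence follows from duality), \<open>\<eta>\<close> restricts to the dual basis.\<close>

definition dual_bases ::
  "(complex^'n) set \<Rightarrow> nat \<Rightarrow> (nat \<Rightarrow> complex^'n) \<Rightarrow> (nat \<Rightarrow> complex^'n \<Rightarrow> complex) \<Rightarrow> bool" where
  "dual_bases l d \<xi> \<eta> \<longleftrightarrow>
     \<xi> ` {..<d} \<subseteq> l \<and> vec.span (\<xi> ` {..<d}) = l \<and> (\<forall>i<d. linear_functional (\<eta> i)) \<and>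
     (\<forall>i<d. \<forall>j<d. \<eta> i (\<xi> j) = (if i = j then 1 else 0))"

text \<open>The identities between meromorphic maps are required at every point of the domain \<open>D\<close> of \<open>r\<close>.\<close>

definition dynamical_r_matrix ::
  "(complex^'n \<Rightarrow> complex^'n \<Rightarrow> complex^'n) \<Rightarrow> (complex^'n) set \<Rightarrow> (complex^'n \<Rightarrow> complex^'n^'n) \<Rightarrow>
   complex^'n^'n \<Rightarrow> complex^'n^'n \<Rightarrow> (complex^'n) set \<Rightarrow> (complex^'n) set \<Rightarrow>
   (complex^'n \<Rightarrow> complex^'n^'n) \<Rightarrow> complex^'n^'n^'n \<Rightarrow> bool" where
  "dynamical_r_matrix br l \<delta> r\<^sub>l \<Omega>\<^sub>l N D r Z \<longleftrightarrow>
     meromorphic_map l N D r \<and> (\<forall>\<mu>\<in>D. r \<mu> \<in> wedge2 UNIV) \<and>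
     quasi_invariant br l \<delta> D r \<and>
     Z \<in> wedge3 \<and> (\<forall>x. ad3 br x Z = 0) \<and>
     (\<forall>d \<xi> \<eta>. dual_bases l d \<xi> \<eta> \<longrightarrow>
       (\<forall>\<mu>\<in>D. (\<Sum>i<d. Alt (tensor_left (\<xi> i) (nabla br l r\<^sub>l \<Omega>\<^sub>l (\<eta> i) r \<mu>))) + CYB br (r \<mu>) = Z))"

section \<open>The r-matrix\<close>

definition eigenvalues :: "(complex^'n) set \<Rightarrow> (complex^'n \<Rightarrow> complex^'n) \<Rightarrow> complex set" where
  "eigenvalues V T = {z. \<exists>x\<in>V. x \<noteq> 0 \<and> T x = z *s x}"

text \<open>
  \<open>F = f(T)\<close> on the \<open>T\<close>-invariant subspace \<open>V\<close>, for \<open>f\<close> analytic at the eigenvalues of \<open>T\<close> on \<open>V\<close>: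
  on the generalized eigenspace of \<open>z\<close>, \<open>f(T)\<close> is the (finite) Taylor expansion of \<open>f\<close> in \<open>T - z\<close>.
\<close>

definition holomorphic_calculus ::
  "(complex \<Rightarrow> complex) \<Rightarrow> (complex^'n) set \<Rightarrow> (complex^'n \<Rightarrow> complex^'n) \<Rightarrow> (complex^'n \<Rightarrow> complex^'n) \<Rightarrow> bool"
  where
  "holomorphic_calculus f V T F \<longleftrightarrow>
     F ` V \<subseteq> V \<and> (\<forall>x\<in>V. \<forall>y\<in>V. F (x + y) = F x + F y) \<and> (\<forall>c. \<forall>x\<in>V. F (c *s x) = c *s F x) \<and>
     (\<forall>z m. \<forall>x\<in>V. ((\<lambda>y. T y - z *s y) ^^ m) x = 0 \<longrightarrow>
        F x = (\<Sum>k<m. ((deriv ^^ k) f z / fact k) *s ((\<lambda>y. T y - z *s y) ^^ k) x))"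

definition coth :: "complex \<Rightarrow> complex" where
  "coth s = cosh s / sinh s"

definition symbol_l :: "complex \<Rightarrow> complex \<Rightarrow> complex" where
  "symbol_l \<epsilon> s = (if s = 0 then 0 else 1/2 * coth (s/2) - \<epsilon>/2 * coth (\<epsilon>/2 * s))"

definition symbol_perp :: "complex \<Rightarrow> complex \<Rightarrow> complex" where
  "symbol_perp \<epsilon> s = - \<epsilon>/2 * coth (\<epsilon>/2 * s)"

definition regular_points ::
  "(complex^'n \<Rightarrow> complex^'n \<Rightarrow> complex^'n) \<Rightarrow> (complex^'n) set \<Rightarrow> (complex^'n) set \<Rightarrow> complex \<Rightarrow> (complex^'n) set"
  where
  "regular_points br l N \<epsilon> = {\<mu>\<in>N. symbol_l \<epsilon> analytic_on eigenvalues l (br \<mu>) \<and>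
     symbol_perp \<epsilon> analytic_on eigenvalues (killing_orthogonal br l) (br \<mu>)}"

definition is_r_value ::
  "(complex^'n \<Rightarrow> complex^'n \<Rightarrow> complex^'n) \<Rightarrow> (complex^'n \<Rightarrow> complex^'n \<Rightarrow> complex) \<Rightarrow> (complex^'n) set \<Rightarrow>
   complex^'n^'n \<Rightarrow> complex \<Rightarrow> complex^'n \<Rightarrow> complex^'n^'n \<Rightarrow> bool" where
  "is_r_value br form l r\<^sub>l \<epsilon> \<mu> A \<longleftrightarrow>
     (\<exists>F G. holomorphic_calculus (symbol_l \<epsilon>) l (br \<mu>) F \<and>
        holomorphic_calculus (symbol_perp \<epsilon>) (killing_orthogonal br l) (br \<mu>) G \<and>
        (\<forall>x\<in>l. operator_of form A x = F x - operator_of form r\<^sub>l x) \<and>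
        (\<forall>x\<in>killing_orthogonal br l. operator_of form A x = G x))"

text \<open>The value is determined at regular points only.\<close>

definition r_matrix ::
  "(complex^'n \<Rightarrow> complex^'n \<Rightarrow> complex^'n) \<Rightarrow> (complex^'n \<Rightarrow> complex^'n \<Rightarrow> complex) \<Rightarrow> (complex^'n) set \<Rightarrow>
   complex^'n^'n \<Rightarrow> complex \<Rightarrow> complex^'n \<Rightarrow> complex^'n^'n" where
  "r_matrix br form l r\<^sub>l \<epsilon> \<mu> = (THE A. is_r_value br form l r\<^sub>l \<epsilon> \<mu> A)"

end

theory Submission
  imports Defs "HOL-Complex_Analysis.Complex_Analysis" "HOL-Computational_Algebra.Fundamental_Theorem_Algebra"
begin

text \<open>
  Identify tensors with operators through the form, and put \<open>T = ad \<mu>\<close> and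
  \<open>F x y z = ([x,y], z)\<close>, an alternating trilinear form.  The tensor \<open>r\<close> becomes \<open>R - r\<^sub>l\<close>, where \<open>R\<close> is
  a skew function of \<open>T\<close> that preserves \<open>l\<close> and its orthogonal complement, and \<open>CYB\<close> of a skew
  operator \<open>A\<close> becomes \<open>F (A x) (A y) z + F (A x) y (A z) + F x (A y) (A z)\<close>.  The theorem thus turns
  into an identity between trilinear forms at each regular point \<open>\<mu>\<close>.

  \<^bold>\<open>The addition theorem.\<close>  If operators \<open>a, b, c\<close> satisfy \<open>F (a x) (b y) (c z) = F x y z\<close>, then their
  Cayley transforms \<open>k (1 + a) / (1 - a)\<close>, \<dots> satisfy
  \<open>F (A x) (B y) z + F (A x) y (C z) + F x (B y) (C z) = - k\<^sup>2 F x y z\<close>: expand and use the hypothesis once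
  (\<open>cayley_sum\<close>).  Since \<open>T\<close> is a derivation, \<open>exp (- \<epsilon> T)\<close> preserves \<open>F\<close> (\<open>exp_F\<close>), and its Cayley
  transform with \<open>k = \<epsilon>/2\<close> is the hyperbolic cotangent \<open>\<epsilon>/2 coth (\<epsilon>/2 T)\<close>.  The two cotangents in \<open>R\<close>
  contribute the constants \<open>1/4\<close> (on \<open>l\<close>) and \<open>\<epsilon>\<^sup>2/4\<close>.

  \<^bold>\<open>Removing the poles.\<close>  The argument fails literally, because \<open>T \<mu> = 0\<close> and so \<open>1 - exp (- \<epsilon> T)\<close> is never
  invertible.  Therefore the three slots of \<open>F\<close> receive \<open>T + u\<close>, \<open>T + v\<close>, \<open>T + w\<close> with \<open>u + v + w = 0\<close>; the
  three exponentials still preserve \<open>F\<close> jointly, all cotangents exist for small shifts, and at the end the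
  shifts tend to zero (\<open>shifted_identity\<close>, \<open>operator_identity\<close>).

  \<^bold>\<open>The derivative.\<close>  The vector fields in \<open>nabla\<close> are the difference and the mean of the left and the right
  invariant ones.  At \<open>\<mu>\<close> they are \<open>[\<mu>, \<xi>]\<close> and \<open>T/2 coth (T/2) \<xi>\<close>, formally the bracket of
  \<open>\<mu>\<close> with \<open>1/2 coth (T/2) \<xi>\<close>; and the derivative of the equivariant function \<open>R\<close> along \<open>[\<mu>, w]\<close> is the
  commutator of \<open>R\<close> with \<open>ad w\<close>.  For shifted arguments the same is true of a divided difference \<open>G\<close> of
  \<open>R\<close>, \<open>R X * Z - Z * R Y = G X Y (X * Z - Z * Y)\<close> for \<open>Z\<close> preserving \<open>l\<close> and its complement, which is continuous up to the diagonal and equals the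
  derivative there (\<open>divided_difference\<close>, \<open>dvd_diff_has_derivative\<close>).  Hence the limit of zero shift produces
  the derivative term (\<open>derivative_limit\<close>), and writing \<open>R\<close> as a difference of two cotangents makes all
  mixed terms cancel.

  \<^bold>\<open>The constant part.\<close>  The terms of \<open>nabla\<close> that contain \<open>r\<^sub>l\<close> are derivatives along brackets \<open>[\<mu>, w]\<close>, hence
  commutators, and they cancel the mixed terms of \<open>CYB (R - r\<^sub>l)\<close>.  What remains is \<open>CYB r\<^sub>l\<close>, and
  \<open>CYB (r\<^sub>l + \<Omega>\<^sub>l/2) = 0\<close> evaluates it to \<open>- 1/4\<close> on \<open>l\<close> (\<open>Rl_sum\<close>), which cancels the \<open>1/4\<close> above.

  \<^bold>\<open>The surroundings.\<close>  A Levi subalgebra is the centralizer of a semisimple element \<open>\<rho>\<close>, and for any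
  nondegenerate invariant form its orthogonal complement is the range of \<open>ad \<rho>\<close>, so that the Killing form and
  the given one define the same complement (\<open>levi_structure\<close>).  The operator \<open>R\<close> is a quotient \<open>N / M\<close> of entire
  functions of \<open>T\<close>; multiplicativity of Taylor expansions identifies it with the prescribed functional
  calculus on generalized eigenspaces (\<open>quotient_taylor\<close>), the regular points are those where \<open>M\<close> is
  invertible (\<open>regular_iff_analytic\<close>), and Cramer's rule with denominator \<open>det M\<close>, which does not vanish
  at small nonzero multiples of \<open>\<rho>\<close>, shows that \<open>r\<close> is meromorphic.
\<close>

section \<open>The Banach algebra of complex linear operators\<close>

lemma complex_linear_iff:
  "complex_linear f \<longleftrightarrow> (\<forall>x y. f (x + y) = f x + f y) \<and> (\<forall>c x. f (c *s x) = c *s f x)"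
  by (auto simp: Vector_Spaces.linear_def module_hom_def module_hom_axioms_def
      vec.vector_space_axioms vec.module_axioms)

lemma scaleR_eq_complex_scale: "r *\<^sub>R (x::complex^'n) = complex_of_real r *s x"
  by (simp add: vec_eq_iff scaleR_conv_of_real[where 'a=complex])

lemma complex_linear_imp_bounded_linear:
  assumes "complex_linear (f :: complex^'n \<Rightarrow> complex^'n)"
  shows "bounded_linear f"
  using assms
  by (intro linear_conv_bounded_linear[THEN iffD1] linearI)
     (auto simp: complex_linear_iff scaleR_eq_complex_scale)

text \<open>
  Only complex linear operators are admitted, so that the scalar operators \<open>sc c\<close> below are central and
  complex power series can be evaluated in the algebra.
\<close>

typedef ('n::finite) endo =
  "{f :: (complex^'n) \<Rightarrow>\<^sub>L (complex^'n). \<forall>c x. blinfun_apply f (c *s x) = c *s blinfun_apply f x}"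
  morphisms blinfun_of_endo endo_of_blinfun
  by (rule exI[of _ 0]) simp

setup_lifting type_definition_endo

lift_definition app :: "'n::finite endo \<Rightarrow> complex^'n \<Rightarrow> complex^'n" is blinfun_apply .

lemma endo_eqI: "(\<And>x. app X x = app Y x) \<Longrightarrow> X = Y"
  by transfer (auto intro: blinfun_eqI)

instantiation endo :: (finite) real_normed_vector
begin

lift_definition zero_endo :: "'a endo" is 0 by simp
lift_definition plus_endo :: "'a endo \<Rightarrow> 'a endo \<Rightarrow> 'a endo" is "(+)"
  by (simp add: blinfun.add_left vector_add_ldistrib)
lift_definition uminus_endo :: "'a endo \<Rightarrow> 'a endo" is uminus
  by (simp add: blinfun.minus_left)
lift_definition minus_endo :: "'a endo \<Rightarrow> 'a endo \<Rightarrow> 'a endo" is "(-)"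
  by (simp add: blinfun.diff_left vector_ssub_ldistrib)
lift_definition scaleR_endo :: "real \<Rightarrow> 'a endo \<Rightarrow> 'a endo" is "(*\<^sub>R)"
  by (simp add: blinfun.scaleR_left scaleR_eq_complex_scale)
lift_definition norm_endo :: "'a endo \<Rightarrow> real" is norm .
definition dist_endo :: "'a endo \<Rightarrow> 'a endo \<Rightarrow> real" where "dist_endo a b = norm (a - b)"
definition uniformity_endo :: "('a endo \<times> 'a endo) filter"
  where "uniformity_endo = (INF e\<in>{0 <..}. principal {(x, y). dist x y < e})"
definition open_endo :: "'a endo set \<Rightarrow> bool"
  where "open_endo S = (\<forall>x\<in>S. \<forall>\<^sub>F (x', y) in uniformity. x' = x \<longrightarrow> y \<in> S)"
definition sgn_endo :: "'a endo \<Rightarrow> 'a endo" where "sgn_endo x = scaleR (inverse (norm x)) x"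

instance
proof
  fix a b c :: "'a endo" and r s :: real
  show "a + b + c = a + (b + c)" by transfer simp
  show "a + b = b + a" by transfer simp
  show "0 + a = a" by transfer simp
  show "- a + a = 0" by transfer simp
  show "a - b = a + - b" by transfer simp
  show "r *\<^sub>R (a + b) = r *\<^sub>R a + r *\<^sub>R b" by transfer (simp add: algebra_simps)
  show "(r + s) *\<^sub>R a = r *\<^sub>R a + s *\<^sub>R a" by transfer (simp add: algebra_simps)
  show "r *\<^sub>R s *\<^sub>R a = (r * s) *\<^sub>R a" by transfer simp
  show "1 *\<^sub>R a = a" by transfer simp
  show "norm a = 0 \<longleftrightarrow> a = 0" by transfer simp
  show "norm (a + b) \<le> norm a + norm b" by transfer (rule norm_triangle_ineq)
  show "norm (r *\<^sub>R a) = \<bar>r\<bar> * norm a" by transfer simp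
qed (rule dist_endo_def uniformity_endo_def open_endo_def sgn_endo_def)+

end

instantiation endo :: (finite) real_normed_algebra_1
begin

lift_definition times_endo :: "'a endo \<Rightarrow> 'a endo \<Rightarrow> 'a endo" is "(o\<^sub>L)"
  by (simp add: blinfun_apply_blinfun_compose)
lift_definition one_endo :: "'a endo" is "id_blinfun"
  by simp

instance
proof
  fix a b c :: "'a endo" and r :: real
  show "a * b * c = a * (b * c)"
    by transfer (auto intro: blinfun_eqI)
  show "(a + b) * c = a * c + b * c"
    by transfer (simp add: bounded_bilinear.add_left[OF bounded_bilinear_blinfun_compose])
  show "a * (b + c) = a * b + a * c"
    by transfer (simp add: bounded_bilinear.add_right[OF bounded_bilinear_blinfun_compose])
  show "r *\<^sub>R a * b = r *\<^sub>R (a * b)"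
    by transfer (simp add: bounded_bilinear.scaleR_left[OF bounded_bilinear_blinfun_compose])
  show "a * r *\<^sub>R b = r *\<^sub>R (a * b)"
    by transfer (simp add: bounded_bilinear.scaleR_right[OF bounded_bilinear_blinfun_compose])
  show "norm (a * b) \<le> norm a * norm b"
    by transfer (rule norm_blinfun_compose)
  show "1 * a = a" by transfer (auto intro: blinfun_eqI)
  show "a * 1 = a" by transfer (auto intro: blinfun_eqI)
  show "norm (1::'a endo) = 1" by transfer simp
  show "(0::'a endo) \<noteq> 1"
  proof transfer
    have "norm (id_blinfun :: (complex^'a) \<Rightarrow>\<^sub>L (complex^'a)) = 1" by (rule norm_blinfun_id)
    thus "(0 :: (complex^'a) \<Rightarrow>\<^sub>L (complex^'a)) \<noteq> id_blinfun" by (metis norm_zero zero_neq_one)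
  qed
qed

end

instance endo :: (finite) banach
proof
  fix X :: "nat \<Rightarrow> 'a endo" assume X: "Cauchy X"
  have d: "dist (blinfun_of_endo a) (blinfun_of_endo b) = dist a b" for a b :: "'a endo"
    unfolding dist_norm by transfer simp
  have "Cauchy (\<lambda>n. blinfun_of_endo (X n))"
    using X by (simp add: Cauchy_def d)
  then obtain f where f: "(\<lambda>n. blinfun_of_endo (X n)) \<longlonglongrightarrow> f"
    using Cauchy_convergent_iff convergent_def by blast
  have "blinfun_apply f (c *s x) = c *s blinfun_apply f x" for c x
  proof (rule LIMSEQ_unique)
    show "(\<lambda>n. blinfun_apply (blinfun_of_endo (X n)) (c *s x)) \<longlonglongrightarrow> blinfun_apply f (c *s x)"
      by (intro tendsto_intros f)
    have "bounded_linear (\<lambda>v. c *s (v::complex^'a))"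
      by (rule complex_linear_imp_bounded_linear)
         (simp add: complex_linear_iff vector_add_ldistrib vector_smult_assoc mult.commute)
    hence "(\<lambda>n. c *s blinfun_apply (blinfun_of_endo (X n)) x) \<longlonglongrightarrow> c *s blinfun_apply f x"
      by (rule bounded_linear.tendsto) (intro tendsto_intros f)
    moreover have "blinfun_apply (blinfun_of_endo (X n)) (c *s x)
        = c *s blinfun_apply (blinfun_of_endo (X n)) x" for n
      using blinfun_of_endo[of "X n"] by blast
    ultimately show "(\<lambda>n. blinfun_apply (blinfun_of_endo (X n)) (c *s x)) \<longlonglongrightarrow> c *s blinfun_apply f x"
      by simp
  qed
  hence "blinfun_of_endo (endo_of_blinfun f) = f"
    by (simp add: endo_of_blinfun_inverse)
  with f have "X \<longlonglongrightarrow> endo_of_blinfun f"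
    by (simp add: tendsto_iff flip: d)
  thus "convergent X" by (auto simp: convergent_def)
qed

lift_definition op :: "(complex^'n \<Rightarrow> complex^'n) \<Rightarrow> 'n::finite endo" is
  "\<lambda>f. if complex_linear f then Blinfun f else 0"
  by (auto simp: bounded_linear_Blinfun_apply complex_linear_imp_bounded_linear)
     (auto simp: complex_linear_iff)

lemma app_op [simp]: "complex_linear f \<Longrightarrow> app (op f) x = f x"
  by transfer (simp add: bounded_linear_Blinfun_apply complex_linear_imp_bounded_linear)

lemma app_simps [simp]:
  "app (X * Y) x = app X (app Y x)" "app (X + Y) x = app X x + app Y x"
  "app (X - Y) x = app X x - app Y x" "app (- X) x = - app X x"
  "app 1 x = x" "app 0 x = 0" "app (r *\<^sub>R X) x = r *\<^sub>R app X x"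
  by (transfer; simp add: blinfun.bilinear_simps)+

lemma app_arg [simp]:
  "app X (x + y) = app X x + app X y" "app X (x - y) = app X x - app X y"
  "app X (- x) = - app X x" "app X 0 = 0" "app X (c *s x) = c *s app X x"
  by (transfer; simp add: blinfun.bilinear_simps)+

lemma complex_linear_app [simp]: "complex_linear (app X)"
  by (simp add: complex_linear_iff)

lemma app_sum: "app X (sum f A) = (\<Sum>i\<in>A. app X (f i))"
  by (induction A rule: infinite_finite_induct) auto

lemma app_sum_left: "app (sum F A) x = (\<Sum>i\<in>A. app (F i) x)"
  by (induction A rule: infinite_finite_induct) auto

lemma norm_app: "norm (app X x) \<le> norm X * norm x"
  by transfer (rule norm_blinfun)

lemma bounded_bilinear_app: "bounded_bilinear app"
proof
  show "\<exists>K. \<forall>a b. norm (app a b) \<le> norm a * norm b * K"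
    by (rule exI[of _ 1]) (simp add: norm_app)
qed (auto simp: scaleR_eq_complex_scale)

lemmas tendsto_app [tendsto_intros] = bounded_bilinear.tendsto[OF bounded_bilinear_app]
lemmas bounded_linear_app_left = bounded_bilinear.bounded_linear_left[OF bounded_bilinear_app]

definition sc :: "complex \<Rightarrow> 'n::finite endo" where "sc c = op (\<lambda>x. c *s x)"

lemma app_sc [simp]: "app (sc c) x = c *s x"
  unfolding sc_def
  by (rule app_op) (simp add: complex_linear_iff vector_add_ldistrib vector_smult_assoc mult.commute)

lemma sc_simps: "sc (a + b) = sc a + sc b" "sc (a - b) = sc a - sc b" "sc (- a) = - sc a"
  "sc (a * b) = sc a * sc b"
  by (rule endo_eqI; simp add: vector_sadd_rdistrib vector_smult_assoc vector_sub_rdistrib)+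

lemma sc_0 [simp]: "sc 0 = 0" and sc_1 [simp]: "sc 1 = 1"
  by (rule endo_eqI; simp)+

lemma sc_left_commute: "sc c * (X * Y) = X * (sc c * Y)"
  by (rule endo_eqI) simp

lemma sc_of_real: "sc (of_real r) = r *\<^sub>R 1"
  by (rule endo_eqI) (simp add: scaleR_eq_complex_scale)

lemma sc_commute: "sc c * X = X * sc c"
  by (rule endo_eqI) simp

lemma sc_power: "sc c ^ n = sc (c ^ n)"
  by (induction n) (simp_all add: sc_simps)

lemma norm_sc [simp]: "norm (sc c :: 'n::finite endo) = cmod c"
proof (rule antisym)
  have "norm (c *s x) = cmod c * norm x" for x :: "complex^'n"
    by (simp add: norm_vec_def norm_mult L2_set_right_distrib)
  hence b: "norm (app (sc c) x) = cmod c * norm x" for x :: "complex^'n"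
    by simp
  have "norm (blinfun_of_endo (sc c :: 'n endo)) \<le> cmod c"
    by (rule norm_blinfun_bound) (use b in \<open>auto simp: app.rep_eq\<close>)
  thus "norm (sc c :: 'n endo) \<le> cmod c" by (simp add: norm_endo.rep_eq)
  show "cmod c \<le> norm (sc c :: 'n endo)"
    using norm_app[of "sc c" "axis (undefined::'n) 1"] b[of "axis (undefined::'n) 1"] by simp
qed

lemma bounded_linear_sc: "bounded_linear sc"
proof (rule bounded_linear_intro)
  fix r x
  have "sc (r *\<^sub>R x) = sc (of_real r) * (sc x :: 'a endo)"
    unfolding sc_simps(4)[symmetric] by (simp add: scaleR_conv_of_real)
  thus "sc (r *\<^sub>R x) = r *\<^sub>R (sc x :: 'a endo)" by (simp add: sc_of_real)
  show "norm (sc x :: 'a endo) \<le> norm x * 1" by simp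
qed (simp add: sc_simps)

lemma sc_sum: "sc (sum f A) = (\<Sum>i\<in>A. sc (f i))"
  by (rule linear_sum[OF bounded_linear.linear[OF bounded_linear_sc]])

lemmas tendsto_sc [tendsto_intros] = bounded_linear.tendsto[OF bounded_linear_sc]

subsection \<open>Invertible operators\<close>

definition unit :: "'n::finite endo \<Rightarrow> bool" where
  "unit X \<longleftrightarrow> (\<exists>Y. X * Y = 1 \<and> Y * X = 1)"

definition einv :: "'n::finite endo \<Rightarrow> 'n endo" where
  "einv X = (SOME Y. X * Y = 1 \<and> Y * X = 1)"

lemma einv: "unit X \<Longrightarrow> X * einv X = 1" "unit X \<Longrightarrow> einv X * X = 1"
  unfolding unit_def einv_def by (metis (mono_tags, lifting) someI_ex)+

lemma einv_app [simp]: "unit X \<Longrightarrow> app X (app (einv X) x) = x" "unit X \<Longrightarrow> app (einv X) (app X x) = x"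
  by (metis app_simps(1) app_simps(5) einv)+

lemma unit_mult: "unit X \<Longrightarrow> unit Y \<Longrightarrow> unit (X * Y)"
  unfolding unit_def
proof safe
  fix A B assume "X * A = 1" "A * X = 1" "Y * B = 1" "B * Y = 1"
  hence "X * Y * (B * A) = 1 \<and> B * A * (X * Y) = 1"
    by (metis mult.assoc mult_1_left)
  thus "\<exists>C. X * Y * C = 1 \<and> C * (X * Y) = 1" by blast
qed

lemma unit_1 [simp]: "unit 1" unfolding unit_def by force

lemma einv_commute:
  assumes "unit X" "X * Z = Z * X" shows "einv X * Z = Z * einv X"
proof -
  have "einv X * Z = einv X * (Z * X) * einv X" using einv[OF assms(1)] by (simp add: mult.assoc)
  also have "\<dots> = (einv X * X) * Z * einv X" using assms(2) by (simp add: mult.assoc)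
  finally show ?thesis using einv[OF assms(1)] by simp
qed

lemma unit_iff_inj: "unit X \<longleftrightarrow> (\<forall>x. app X x = 0 \<longrightarrow> x = 0)"
proof
  assume "unit X" thus "\<forall>x. app X x = 0 \<longrightarrow> x = 0"
    by (metis app_arg(4) einv_app(2))
next
  assume *: "\<forall>x. app X x = 0 \<longrightarrow> x = 0"
  have "inj (app X)"
    by (rule injI) (metis "*" app_arg(2) right_minus_eq)
  with vec.linear_inj_imp_surj[OF complex_linear_app this]
  obtain g where g: "complex_linear g" "g \<circ> app X = id" "app X \<circ> g = id"
    using vec.linear_injective_left_inverse[OF complex_linear_app \<open>inj (app X)\<close>]
    by (metis comp_assoc comp_id id_comp surj_iff)
  show "unit X" unfolding unit_def
    by (rule exI[of _ "op g"]) (use g in \<open>auto intro!: endo_eqI simp: fun_eq_iff\<close>)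
qed

lemma unit_multD:
  assumes "unit (X * Y)" shows "unit X"
proof -
  have "\<forall>x. app Y x = 0 \<longrightarrow> x = 0" using assms unfolding unit_iff_inj by auto
  hence Y: "unit Y" by (simp add: unit_iff_inj)
  have "X = (X * Y) * einv Y" using einv[OF Y] by (simp add: mult.assoc)
  moreover have "unit (einv Y)" unfolding unit_def using einv[OF Y] by blast
  ultimately show ?thesis using unit_mult[OF assms] by metis
qed

lemma unit_near:
  assumes "unit X" "norm (Y - X) * norm (einv X) < 1" shows "unit Y"
  unfolding unit_iff_inj
proof (intro allI impI)
  fix x assume x: "app Y x = 0"
  have "x = app (einv X) (app (X - Y) x)" using x assms(1) by simp
  hence "norm x \<le> norm (einv X * (X - Y)) * norm x"
    by (metis app_simps(1) norm_app)
  also have "\<dots> \<le> (norm (einv X) * norm (X - Y)) * norm x"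
    by (intro mult_right_mono norm_mult_ineq) simp
  finally have "norm x \<le> (norm (Y - X) * norm (einv X)) * norm x"
    by (simp add: norm_minus_commute mult.commute)
  thus "x = 0" using assms(2)
    by (metis mult_le_cancel_right1 norm_eq_zero norm_le_zero_iff not_less)
qed

lemma open_unit: "open {X. unit X}"
proof (rule openI, safe)
  fix X :: "'a endo" assume X: "unit X"
  have e: "einv X \<noteq> 0" using einv[OF X] by force
  have "unit Y" if "Y \<in> ball X (1 / norm (einv X))" for Y
    using that e by (intro unit_near[OF X]) (simp add: dist_norm norm_minus_commute field_simps)
  thus "\<exists>e>0. ball X e \<subseteq> {X. unit X}" using e
    by (intro exI[of _ "1 / norm (einv X)"]) auto
qed

lemma continuous_on_einv: "continuous_on {X. unit X} einv"
proof (clarsimp simp: continuous_on_def)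
  fix X :: "'a endo" assume X: "unit X"
  define c where "c = norm (einv X)"
  have "einv X \<noteq> 0" using einv[OF X] by force
  hence c: "c > 0" by (simp add: c_def)
  have ev: "\<forall>\<^sub>F Y in at X within {X. unit X}. norm (einv Y - einv X) \<le> 2 * c * c * norm (Y - X)"
    unfolding eventually_at
  proof (intro exI[of _ "1 / (2 * c)"] conjI ballI impI)
    fix Y assume "Y \<in> {X. unit X}" "Y \<noteq> X \<and> dist Y X < 1 / (2 * c)"
    hence Y: "unit Y" and d: "norm (Y - X) * c \<le> 1/2" using c by (auto simp: dist_norm field_simps)
    have "einv Y * ((X - Y) * einv X) = einv Y * (X * einv X) - (einv Y * Y) * einv X"
      by (simp add: algebra_simps)
    hence eq: "einv Y - einv X = einv Y * ((X - Y) * einv X)"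
      by (simp add: einv X Y)
    have "norm (einv Y - einv X) \<le> norm (einv Y) * (norm (X - Y) * norm (einv X))"
      unfolding eq
      by (rule order_trans[OF norm_mult_ineq mult_left_mono[OF norm_mult_ineq]]) simp
    also have "\<dots> = norm (einv Y) * (norm (Y - X) * c)"
      by (simp add: c_def norm_minus_commute)
    finally have 1: "norm (einv Y - einv X) \<le> norm (einv Y) * (norm (Y - X) * c)" .
    also have "\<dots> \<le> norm (einv Y) * (1/2)" by (intro mult_left_mono d) simp
    finally have "norm (einv Y) \<le> 2 * c"
      using norm_triangle_ineq2[of "einv Y" "einv X"] by (simp add: c_def)
    with 1 show "norm (einv Y - einv X) \<le> 2 * c * c * norm (Y - X)"
      using order_trans[OF 1 mult_right_mono[of "norm (einv Y)" "2 * c" "norm (Y - X) * c"]] c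
      by (simp add: mult.assoc mult.left_commute mult.commute)
  qed (use c in auto)
  have "((\<lambda>Y. 2 * c * c * norm (Y - X)) \<longlongrightarrow> 2 * c * c * norm (X - X)) (at X within {X. unit X})"
    by (intro tendsto_intros)
  hence "((\<lambda>Y. einv Y - einv X) \<longlongrightarrow> 0) (at X within {X. unit X})"
    by (intro Lim_null_comparison[OF ev]) simp
  thus "(einv \<longlongrightarrow> einv X) (at X within {X. unit X})" by (simp add: LIM_zero_iff)
qed

lemma tendsto_einv [tendsto_intros]:
  assumes "(f \<longlongrightarrow> X) F" "unit X" shows "((\<lambda>x. einv (f x)) \<longlongrightarrow> einv X) F"
proof -
  have "isCont einv X"
    using continuous_on_einv open_unit assms(2) continuous_on_eq_continuous_at by blast
  thus ?thesis using assms(1) isCont_tendsto_compose by blast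
qed

lemma eventually_unit:
  assumes "(f \<longlongrightarrow> X) F" "unit X" shows "eventually (\<lambda>x. unit (f x)) F"
  using topological_tendstoD[OF assms(1) open_unit] assms(2) by simp

subsection \<open>Operators and matrices\<close>

definition mat_of :: "'n::finite endo \<Rightarrow> complex^'n^'n" where "mat_of X = matrix (app X)"

lemma mat_of_mult: "mat_of (X * Y) = mat_of X ** mat_of Y"
  unfolding mat_of_def
  by (subst matrix_compose_gen[symmetric]) (simp_all add: comp_def fun_eq_iff app_simps(1)[abs_def] cong: arg_cong[of _ _ matrix])

lemma mat_of_component: "mat_of X $ i $ j = app X (axis j 1) $ i"
  by (simp add: mat_of_def matrix_def)

lemma mat_of_works: "mat_of X *v x = app X x"
  unfolding mat_of_def by (simp add: matrix_works)

lemma mat_of_1: "mat_of 1 = mat 1"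
  by (simp add: vec_eq_iff mat_of_component mat_def axis_def)

lemma bounded_linear_mat_of: "bounded_linear mat_of"
proof -
  have "bounded_linear (\<lambda>X. mat_of X $ i $ j)" for i j
    unfolding mat_of_component
    by (intro bounded_linear_compose[OF bounded_linear_vec_nth] bounded_linear_app_left)
  thus ?thesis
    by (subst bounded_linear_componentwise_iff)
       (auto simp: Basis_vec_def inner_axis intro!: bounded_linear_compose[OF bounded_linear_inner_left])
qed

lemma mat_of_inject: "mat_of X = mat_of Y \<Longrightarrow> X = Y"
  by (metis endo_eqI mat_of_works)

lemma unit_iff_det: "unit X \<longleftrightarrow> det (mat_of X) \<noteq> 0"
proof -
  have "det (mat_of X) \<noteq> 0 \<longleftrightarrow> (\<forall>x. mat_of X *v x = 0 \<longrightarrow> x = 0)"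
    using invertible_det_nz[of "mat_of X"] matrix_left_invertible_ker[of "mat_of X"]
      invertible_left_inverse[of "mat_of X"] by auto
  thus ?thesis by (simp add: unit_iff_inj mat_of_works)
qed

section \<open>Entire functions of an operator\<close>

definition entire :: "complex fps \<Rightarrow> bool" where "entire f \<longleftrightarrow> fps_conv_radius f = \<infinity>"

text \<open>
  Entire functions are represented by their power series: the coefficients define the operator
  \<open>f(X)\<close> directly, whether or not \<open>X\<close> is diagonalizable.
\<close>

definition ev :: "complex fps \<Rightarrow> 'n::finite endo \<Rightarrow> 'n endo" where
  "ev f X = (\<Sum>n. sc (fps_nth f n) * X ^ n)"

lemma entire_intros [simp, intro]:
  "entire (fps_const c)" "entire 0" "entire 1" "entire fps_X" "entire (fps_exp c)"
  "entire (fps_of_poly p)"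
  "entire f \<Longrightarrow> entire g \<Longrightarrow> entire (f + g)" "entire f \<Longrightarrow> entire g \<Longrightarrow> entire (f - g)"
  "entire f \<Longrightarrow> entire g \<Longrightarrow> entire (f * g)" "entire f \<Longrightarrow> entire (- f)"
  "entire f \<Longrightarrow> entire (fps_shift n f)"
  using fps_conv_radius_add[of f g] fps_conv_radius_diff[of f g] fps_conv_radius_mult[of f g]
  by (auto simp: entire_def)

lemma entire_deriv: "entire f \<Longrightarrow> entire (fps_deriv f)"
  using fps_conv_radius_deriv[of f] by (simp add: entire_def)

lemma entire_summable:
  assumes "entire f" "R \<ge> 0" shows "summable (\<lambda>n. cmod (fps_nth f n) * R ^ n)"
proof -
  have "summable (\<lambda>n. norm (fps_nth f n * (of_real R) ^ n))"
    using assms by (intro abs_summable_in_conv_radius) (simp add: entire_def fps_conv_radius_def)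
  thus ?thesis using assms(2) by (simp add: norm_mult norm_power)
qed

lemma ev_norm_summable:
  assumes "entire f" shows "summable (\<lambda>n. norm (sc (fps_nth f n) * X ^ n))"
proof (rule summable_comparison_test')
  show "summable (\<lambda>n. cmod (fps_nth f n) * norm X ^ n)" by (rule entire_summable[OF assms]) simp
  show "norm (norm (sc (fps_nth f n) * X ^ n)) \<le> cmod (fps_nth f n) * norm X ^ n" for n
    using order_trans[OF norm_mult_ineq[of "sc (fps_nth f n)" "X ^ n"]
        mult_left_mono[OF norm_power_ineq[of X n]]] by simp
qed

lemma ev_sums: "entire f \<Longrightarrow> (\<lambda>n. sc (fps_nth f n) * X ^ n) sums ev f X"
  unfolding ev_def by (rule summable_sums[OF summable_norm_cancel[OF ev_norm_summable]])

lemma ev_add: "entire f \<Longrightarrow> entire g \<Longrightarrow> ev (f + g) X = ev f X + ev g X"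
  by (rule sums_unique2[OF ev_sums]) (use sums_add[OF ev_sums ev_sums] in \<open>auto simp: sc_simps algebra_simps\<close>)

lemma ev_diff: "entire f \<Longrightarrow> entire g \<Longrightarrow> ev (f - g) X = ev f X - ev g X"
  by (rule sums_unique2[OF ev_sums]) (use sums_diff[OF ev_sums ev_sums] in \<open>auto simp: sc_simps algebra_simps\<close>)

lemma ev_const [simp]: "ev (fps_const c) X = sc c"
proof -
  have "(\<lambda>n. sc (fps_nth (fps_const c) n) * X ^ n) sums sc c"
    using sums_single[of 0 "\<lambda>_. sc c :: 'a endo"]
    by (rule sums_cong[THEN iffD1, rotated]) auto
  thus ?thesis by (simp add: ev_def sums_iff)
qed

lemma ev_X [simp]: "ev fps_X X = X"
proof -
  have "(\<lambda>n. sc (fps_nth fps_X n) * X ^ n) sums X"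
    using sums_single[of 1 "\<lambda>_. X"] by (rule sums_cong[THEN iffD1, rotated]) auto
  thus ?thesis by (simp add: ev_def sums_iff)
qed

lemma ev_1 [simp]: "ev 1 X = 1" using ev_const[of 1 X] by simp
lemma ev_0 [simp]: "ev 0 X = 0" using ev_const[of 0 X] by simp

lemma ev_mult:
  assumes "entire f" "entire g" shows "ev (f * g) X = ev f X * ev g X"
proof -
  have "(\<lambda>k. \<Sum>i\<le>k. (sc (fps_nth f i) * X ^ i) * (sc (fps_nth g (k - i)) * X ^ (k - i)))
      sums (ev f X * ev g X)"
    unfolding ev_def by (intro Cauchy_product_sums ev_norm_summable assms)
  moreover have "(sc (fps_nth f i) * X ^ i) * (sc (fps_nth g (k - i)) * X ^ (k - i))
      = sc (fps_nth f i * fps_nth g (k - i)) * X ^ k" if "i \<le> k" for i k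
  proof -
    have "(sc (fps_nth f i) * X ^ i) * (sc (fps_nth g (k - i)) * X ^ (k - i))
        = sc (fps_nth f i) * (sc (fps_nth g (k - i)) * (X ^ i * X ^ (k - i)))"
      by (simp only: mult.assoc sc_left_commute[of "fps_nth g (k - i)"])
    thus ?thesis using that by (simp add: sc_simps mult.assoc flip: power_add)
  qed
  hence "(\<Sum>i\<le>k. (sc (fps_nth f i) * X ^ i) * (sc (fps_nth g (k - i)) * X ^ (k - i)))
      = sc (fps_nth (f * g) k) * X ^ k" for k
    by (simp add: fps_mult_nth atLeast0AtMost sum_distrib_right sc_sum)
  ultimately show ?thesis using sums_unique2[OF ev_sums[of "f * g" X]] assms by simp
qed

lemma ev_exp:
  fixes X :: "'n::finite endo" shows "ev (fps_exp c) X = exp (sc c * X)"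
proof -
  have "sc (c ^ n / fact n) * X ^ n = (sc c * X) ^ n /\<^sub>R fact n" for n
  proof -
    have "(sc c * X) ^ n = sc c ^ n * X ^ n"
      by (induction n) (simp_all add: mult.assoc, metis mult.assoc sc_commute sc_power)
    moreover have "(sc (c ^ n / fact n) :: 'n endo) = sc (c ^ n) /\<^sub>R fact n"
      by (rule endo_eqI) (simp add: scaleR_eq_complex_scale vector_smult_assoc field_simps)
    ultimately show ?thesis by (simp add: sc_power)
  qed
  thus ?thesis by (simp add: ev_def exp_def)
qed

lemma ev_commute: "entire f \<Longrightarrow> X * Z = Z * X \<Longrightarrow> ev f X * Z = Z * ev f X"
proof -
  assume f: "entire f" and c: "X * Z = Z * X"
  have p: "X ^ n * Z = Z * X ^ n" for n
    using c by (induction n) (simp_all add: mult.assoc, metis mult.assoc)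
  have "(\<lambda>n. Z * (sc (fps_nth f n) * X ^ n)) sums (Z * ev f X)"
    by (intro sums_mult ev_sums f)
  moreover have "(\<lambda>n. (sc (fps_nth f n) * X ^ n) * Z) sums (ev f X * Z)"
    by (intro sums_mult2 ev_sums f)
  moreover have "Z * (sc (fps_nth f n) * X ^ n) = (sc (fps_nth f n) * X ^ n) * Z" for n
    by (metis mult.assoc p sc_commute)
  ultimately show ?thesis using sums_unique2 by simp
qed

lemma ev_zero_arg: "ev f 0 = sc (fps_nth f 0)"
proof -
  have "(\<lambda>n. sc (fps_nth f n) * (0::'a endo) ^ n) sums sc (fps_nth f 0)"
    using sums_single[of 0 "\<lambda>_. sc (fps_nth f 0) :: 'a endo"]
    by (rule sums_cong[THEN iffD1, rotated]) (auto simp: power_0_left)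
  thus ?thesis by (simp add: ev_def sums_iff)
qed

lemma ev_app_sums: "entire f \<Longrightarrow> (\<lambda>n. fps_nth f n *s app (X ^ n) x) sums app (ev f X) x"
  using bounded_linear.sums[OF bounded_linear_app_left ev_sums, of f X x] by simp

lemma eval_fps_sums: "entire f \<Longrightarrow> (\<lambda>n. fps_nth f n * z ^ n) sums eval_fps f z"
  unfolding eval_fps_def by (intro summable_sums summable_fps) (simp add: entire_def)

lemma eval_entire_simps:
  "entire f \<Longrightarrow> entire g \<Longrightarrow> eval_fps (f + g) z = eval_fps f z + eval_fps g z"
  "entire f \<Longrightarrow> entire g \<Longrightarrow> eval_fps (f - g) z = eval_fps f z - eval_fps g z"
  "entire f \<Longrightarrow> entire g \<Longrightarrow> eval_fps (f * g) z = eval_fps f z * eval_fps g z"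
  by (simp_all add: entire_def eval_fps_add eval_fps_diff eval_fps_mult)

lemma entire_analytic: "entire f \<Longrightarrow> eval_fps f analytic_on A"
  by (intro analytic_on_eval_fps) (auto simp: entire_def in_eball_iff)

subsection \<open>Divided differences\<close>

definition mulLR :: "'n::finite endo \<Rightarrow> 'n endo \<Rightarrow> 'n endo \<Rightarrow>\<^sub>L 'n endo" where
  "mulLR A B = blinfun_mult_right A o\<^sub>L blinfun_mult_left B"

lemma mulLR_apply [simp]: "blinfun_apply (mulLR A B) W = A * (W * B)"
  by (simp add: mulLR_def)

lemma norm_mulLR: "norm (mulLR A B) \<le> norm A * norm B"
proof (rule norm_blinfun_bound)
  fix W
  have "norm (A * (W * B)) \<le> norm A * (norm W * norm B)"
    by (rule order_trans[OF norm_mult_ineq mult_left_mono[OF norm_mult_ineq]]) simp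
  thus "norm (blinfun_apply (mulLR A B) W) \<le> norm A * norm B * norm W" by (simp add: mult_ac)
qed simp

lemma continuous_on_mulLR [continuous_intros]:
  "continuous_on S f \<Longrightarrow> continuous_on S g \<Longrightarrow> continuous_on S (\<lambda>x. mulLR (f x) (g x))"
  unfolding mulLR_def
  by (intro bounded_bilinear.continuous_on[OF bounded_bilinear_blinfun_compose]
      bounded_linear.continuous_on[OF bounded_linear_blinfun_mult_right]
      bounded_linear.continuous_on[OF bounded_linear_blinfun_mult_left])

text \<open>
  \<open>X ^ Suc n - Y ^ Suc n\<close> divided by \<open>X - Y\<close>, where \<open>X\<close> acts on the left and \<open>Y\<close> on the right, times the
  coefficient of \<open>X ^ Suc n\<close> in \<open>f\<close>.
\<close>

definition dd_term :: "complex fps \<Rightarrow> 'n::finite endo \<Rightarrow> 'n endo \<Rightarrow> nat \<Rightarrow> 'n endo \<Rightarrow>\<^sub>L 'n endo" where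
  "dd_term f X Y n = (\<Sum>i\<le>n. mulLR (sc (fps_nth f (Suc n)) * X ^ (n - i)) (Y ^ i))"

definition dd :: "complex fps \<Rightarrow> 'n::finite endo \<Rightarrow> 'n endo \<Rightarrow> 'n endo \<Rightarrow>\<^sub>L 'n endo" where
  "dd f X Y = (\<Sum>n. dd_term f X Y n)"

lemma norm_dd_term:
  assumes "norm X \<le> R" "norm Y \<le> R" "1 \<le> R"
  shows "norm (dd_term f X Y n) \<le> cmod (fps_nth f (Suc n)) * (2 * R) ^ Suc n"
proof -
  have "norm (mulLR (sc (fps_nth f (Suc n)) * X ^ (n - i)) (Y ^ i))
      \<le> cmod (fps_nth f (Suc n)) * R ^ n" if "i \<le> n" for i
  proof -
    have "norm (mulLR (sc (fps_nth f (Suc n)) * X ^ (n - i)) (Y ^ i))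
        \<le> norm (sc (fps_nth f (Suc n)) * X ^ (n - i)) * norm (Y ^ i)" by (rule norm_mulLR)
    also have "\<dots> \<le> (cmod (fps_nth f (Suc n)) * norm X ^ (n - i)) * norm Y ^ i"
      by (intro mult_mono norm_power_ineq order_trans[OF norm_mult_ineq]) (auto simp: norm_power_ineq)
    also have "\<dots> \<le> (cmod (fps_nth f (Suc n)) * R ^ (n - i)) * R ^ i"
      using assms by (intro mult_mono power_mono) auto
    also have "\<dots> = cmod (fps_nth f (Suc n)) * R ^ n"
      using that by (simp add: mult.assoc flip: power_add)
    finally show ?thesis .
  qed
  hence "norm (dd_term f X Y n) \<le> (\<Sum>i\<le>n. cmod (fps_nth f (Suc n)) * R ^ n)"
    unfolding dd_term_def by (intro order_trans[OF norm_sum] sum_mono) auto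
  also have "\<dots> = cmod (fps_nth f (Suc n)) * (real (Suc n) * R ^ n)" by simp
  also have "\<dots> \<le> cmod (fps_nth f (Suc n)) * (2 ^ Suc n * R ^ Suc n)"
  proof (intro mult_left_mono mult_mono)
    \<comment> \<open>The number of summands is absorbed by doubling the radius.\<close>
    show "real (Suc n) \<le> 2 ^ Suc n"
      using less_exp[of "Suc n"] by (metis of_nat_le_iff of_nat_numeral of_nat_power less_imp_le)
    show "R ^ n \<le> R ^ Suc n" using assms(3) by (intro power_increasing) auto
  qed (use assms in auto)
  finally show ?thesis by (simp only: power_mult_distrib)
qed

lemma dd_bound_summable:
  assumes "entire f" "1 \<le> R"
  shows "summable (\<lambda>n. cmod (fps_nth f (Suc n)) * (2 * R) ^ Suc n)"
  using entire_summable[OF assms(1), of "2 * R"] assms(2)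
  by (subst summable_Suc_iff) simp

lemma dd_sums:
  assumes "entire f" shows "(\<lambda>n. dd_term f X Y n) sums dd f X Y"
proof -
  define R where "R = Max {1, norm X, norm Y}"
  have "summable (\<lambda>n. dd_term f X Y n)"
    by (rule summable_comparison_test'[OF dd_bound_summable[OF assms, of R]])
       (use norm_dd_term[of X R Y f] in \<open>auto simp: R_def\<close>)
  thus ?thesis unfolding dd_def by (rule summable_sums)
qed

lemma dd_apply_sums:
  "entire f \<Longrightarrow> (\<lambda>n. \<Sum>i\<le>n. sc (fps_nth f (Suc n)) * (X ^ (n - i) * (W * Y ^ i))) sums
    blinfun_apply (dd f X Y) W"
  using bounded_linear.sums[OF bounded_linear_apply_blinfun dd_sums, of f X Y W]
  by (simp add: dd_term_def blinfun.sum_left mult.assoc)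

lemma dd_complex_linear:
  assumes "entire f" shows "blinfun_apply (dd f X Y) (sc c * W) = sc c * blinfun_apply (dd f X Y) W"
proof -
  have "(\<lambda>n. sc c * (\<Sum>i\<le>n. sc (fps_nth f (Suc n)) * (X ^ (n - i) * (W * Y ^ i)))) sums
      (sc c * blinfun_apply (dd f X Y) W)"
    by (intro sums_mult dd_apply_sums assms)
  moreover have "sc c * (sc (fps_nth f (Suc n)) * (X ^ (n - i) * (W * Y ^ i)))
      = sc (fps_nth f (Suc n)) * (X ^ (n - i) * (sc c * W * Y ^ i))" for n i
    by (simp only: mult.assoc sc_left_commute[of c])
  ultimately show ?thesis
    using sums_unique2[OF dd_apply_sums[OF assms, of X "sc c * W" Y]]
    by (simp add: sum_distrib_left)
qed

text \<open>
  For a monomial the sum of the \<open>X ^ (n - i) * (X * Z - Z * Y) * Y ^ i\<close> telescopes.  With \<open>Z = 1\<close> this is the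
  usual divided difference; a general \<open>Z\<close> gives access to the derivative in directions that are commutators
  \<open>[X, Z]\<close>.
\<close>

lemma dd_intertwine:
  assumes "entire f"
  shows "ev f X * Z - Z * ev f Y = blinfun_apply (dd f X Y) (X * Z - Z * Y)"
proof -
  have tele: "(\<Sum>i\<le>n. X ^ (n - i) * ((X * Z - Z * Y) * Y ^ i)) = X ^ Suc n * Z - Z * Y ^ Suc n" for n
  proof (induction n)
    case (Suc n)
    have "(\<Sum>i\<le>Suc n. X ^ (Suc n - i) * ((X * Z - Z * Y) * Y ^ i))
        = (\<Sum>i\<le>n. X * (X ^ (n - i) * ((X * Z - Z * Y) * Y ^ i))) + (X * Z - Z * Y) * Y ^ Suc n"
      by (auto simp: Suc_diff_le mult.assoc intro!: sum.cong)
    also have "\<dots> = X * (X ^ Suc n * Z - Z * Y ^ Suc n) + (X * Z - Z * Y) * Y ^ Suc n"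
      by (simp only: Suc flip: sum_distrib_left)
    also have "\<dots> = X ^ Suc (Suc n) * Z - Z * Y ^ Suc (Suc n)"
      by (simp add: algebra_simps)
    finally show ?case .
  qed simp
  have "(\<lambda>n. (sc (fps_nth f n) * X ^ n) * Z - Z * (sc (fps_nth f n) * Y ^ n)) sums
      (ev f X * Z - Z * ev f Y)"
    by (intro sums_diff sums_mult sums_mult2 ev_sums assms)
  hence "(\<lambda>n. (sc (fps_nth f (Suc n)) * X ^ Suc n) * Z - Z * (sc (fps_nth f (Suc n)) * Y ^ Suc n)) sums
      (ev f X * Z - Z * ev f Y)"
    by (subst sums_Suc_iff) (simp add: sc_commute)
  moreover have "(sc (fps_nth f (Suc n)) * X ^ Suc n) * Z - Z * (sc (fps_nth f (Suc n)) * Y ^ Suc n)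
      = (\<Sum>i\<le>n. sc (fps_nth f (Suc n)) * (X ^ (n - i) * ((X * Z - Z * Y) * Y ^ i)))" for n
  proof -
    have "Z * (sc (fps_nth f (Suc n)) * Y ^ Suc n) = sc (fps_nth f (Suc n)) * (Z * Y ^ Suc n)"
      by (metis mult.assoc sc_commute)
    thus ?thesis by (simp only: tele mult.assoc right_diff_distrib flip: sum_distrib_left)
  qed
  ultimately show ?thesis
    using sums_unique2[OF dd_apply_sums[OF assms, of X "X * Z - Z * Y" Y]] by simp
qed

text \<open>
  The series converges uniformly on bounded sets, by the bound \<open>norm_dd_term\<close>.
\<close>

lemma continuous_on_dd:
  assumes "entire f" shows "continuous_on UNIV (\<lambda>p. dd f (fst p) (snd p) :: 'n::finite endo \<Rightarrow>\<^sub>L 'n endo)"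
proof -
  have "isCont (\<lambda>p. dd f (fst p) (snd p)) p" for p :: "'n endo \<times> 'n endo"
  proof -
    define R where "R = norm p + 1"
    have "uniform_limit (ball 0 R) (\<lambda>n (p :: 'n endo \<times> 'n endo). \<Sum>k<n. dd_term f (fst p) (snd p) k)
        (\<lambda>p. \<Sum>k. dd_term f (fst p) (snd p) k) sequentially"
    proof (rule Weierstrass_m_test[OF _ dd_bound_summable[OF assms, of R]])
      fix n :: nat and q :: "'n endo \<times> 'n endo" assume "q \<in> ball 0 R"
      hence "norm (fst q) \<le> R" "norm (snd q) \<le> R"
        using norm_fst_le[of "fst q" "snd q"] norm_snd_le[of "snd q" "fst q"] by auto
      thus "norm (dd_term f (fst q) (snd q) n) \<le> cmod (fps_nth f (Suc n)) * (2 * R) ^ Suc n"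
        by (intro norm_dd_term) (auto simp: R_def)
    qed (simp add: R_def)
    moreover have "continuous_on (ball 0 R) (\<lambda>p :: 'n endo \<times> 'n endo. \<Sum>k<n. dd_term f (fst p) (snd p) k)" for n
      unfolding dd_term_def by (intro continuous_intros)
    ultimately have "continuous_on (ball 0 R) (\<lambda>p :: 'n endo \<times> 'n endo. dd f (fst p) (snd p))"
      unfolding dd_def by (intro uniform_limit_theorem[rotated]) (auto intro: eventuallyI)
    thus ?thesis by (simp add: continuous_on_eq_continuous_at R_def)
  qed
  thus ?thesis by (simp add: continuous_at_imp_continuous_on)
qed

subsection \<open>Functions with a continuous divided difference\<close>

text \<open>
  Only operators \<open>Z\<close> commuting with \<open>P\<close> are allowed; this admits functions such as
  \<open>\<lambda>X. f X * P + h X * (1 - P)\<close>, where \<open>P\<close> is a fixed projection.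
\<close>

definition divided_difference ::
  "'n::finite endo \<Rightarrow> 'n endo set \<Rightarrow> ('n endo \<Rightarrow> 'n endo) \<Rightarrow> ('n endo \<Rightarrow> 'n endo \<Rightarrow> 'n endo \<Rightarrow>\<^sub>L 'n endo) \<Rightarrow> bool"
  where
  "divided_difference P U g G \<longleftrightarrow>
     (\<forall>X\<in>U. \<forall>Y\<in>U. \<forall>Z. P * Z = Z * P \<longrightarrow> g X * Z - Z * g Y = blinfun_apply (G X Y) (X * Z - Z * Y)) \<and>
     (\<forall>X\<in>U. \<forall>Y\<in>U. \<forall>c W. blinfun_apply (G X Y) (sc c * W) = sc c * blinfun_apply (G X Y) W) \<and>
     continuous_on (U \<times> U) (\<lambda>p. G (fst p) (snd p))"

lemma dvd_diff_ev: "entire f \<Longrightarrow> divided_difference P U (ev f) (dd f)"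
  unfolding divided_difference_def
  by (auto simp: dd_intertwine dd_complex_linear intro: continuous_on_subset[OF continuous_on_dd])

lemma dvd_diff_const:
  "(\<And>Z. P * Z = Z * P \<Longrightarrow> A * Z = Z * A) \<Longrightarrow> divided_difference P U (\<lambda>_. A) (\<lambda>_ _. 0)"
  unfolding divided_difference_def by auto

lemma dvd_diff_diff:
  "divided_difference P U g G \<Longrightarrow> divided_difference P U h H \<Longrightarrow>
   divided_difference P U (\<lambda>X. g X - h X) (\<lambda>X Y. G X Y - H X Y)"
  unfolding divided_difference_def
  by (auto intro!: continuous_intros simp: blinfun.diff_left algebra_simps)

lemma dvd_diff_add:
  "divided_difference P U g G \<Longrightarrow> divided_difference P U h H \<Longrightarrow>
   divided_difference P U (\<lambda>X. g X + h X) (\<lambda>X Y. G X Y + H X Y)"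
  unfolding divided_difference_def
  by (auto intro!: continuous_intros simp: blinfun.add_left algebra_simps)

lemma dvd_diff_expand:
  assumes "divided_difference P U g G" "X \<in> U" "Y \<in> U"
  shows "g Y = g X + blinfun_apply (G Y X) (Y - X)"
proof -
  have "g Y * 1 - 1 * g X = blinfun_apply (G Y X) (Y * 1 - 1 * X)"
    using assms unfolding divided_difference_def by (metis mult_1_left mult_1_right)
  thus ?thesis by (simp add: algebra_simps)
qed

lemma dvd_diff_tendsto_diagonal:
  assumes "divided_difference P U g G" "X \<in> U"
  shows "((\<lambda>Y. G Y X) \<longlongrightarrow> G X X) (at X within U)"
proof -
  have "continuous_on (U \<times> U) (\<lambda>p. G (fst p) (snd p))"
    using assms by (simp add: divided_difference_def)
  hence "continuous_on U (\<lambda>Y. G (fst (Y, X)) (snd (Y, X)))"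
    by (rule continuous_on_compose2) (use assms in \<open>auto intro!: continuous_intros\<close>)
  thus ?thesis using assms by (auto simp: continuous_on_def)
qed

lemma dvd_diff_continuous:
  assumes "divided_difference P U g G" shows "continuous_on U g"
  unfolding continuous_on_def
proof
  fix X assume X: "X \<in> U"
  have "((\<lambda>Y. g X + blinfun_apply (G Y X) (Y - X)) \<longlongrightarrow> g X + blinfun_apply (G X X) (X - X)) (at X within U)"
    by (intro tendsto_intros dvd_diff_tendsto_diagonal[OF assms X])
  hence "((\<lambda>Y. g X + blinfun_apply (G Y X) (Y - X)) \<longlongrightarrow> g X) (at X within U)"
    by (simp add: blinfun.bilinear_simps)
  thus "(g \<longlongrightarrow> g X) (at X within U)"
    by (rule Lim_transform_eventually)
       (auto simp: eventually_at intro!: exI[of _ 1] dvd_diff_expand[OF assms X, symmetric])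
qed

text \<open>
  From the Leibniz rule \<open>A B Z - Z A' B' = (A Z - Z A') B' + A (B Z - Z B')\<close>.
\<close>

lemma dvd_diff_mult:
  assumes g: "divided_difference P U g G" and h: "divided_difference P U h H"
  shows "divided_difference P U (\<lambda>X. g X * h X) (\<lambda>X Y. (mulLR 1 (h Y) o\<^sub>L G X Y) + (mulLR (g X) 1 o\<^sub>L H X Y))"
  unfolding divided_difference_def
proof (intro conjI ballI allI impI)
  fix X Y Z assume X: "X \<in> U" and Y: "Y \<in> U" and Z: "P * Z = Z * P"
  have "g X * h X * Z - Z * (g Y * h Y) = (g X * Z - Z * g Y) * h Y + g X * (h X * Z - Z * h Y)"
    by (simp add: algebra_simps)
  thus "g X * h X * Z - Z * (g Y * h Y)
      = blinfun_apply ((mulLR 1 (h Y) o\<^sub>L G X Y) + (mulLR (g X) 1 o\<^sub>L H X Y)) (X * Z - Z * Y)"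
    using g h X Y Z by (simp add: divided_difference_def blinfun.add_left)
next
  fix X Y c W assume "X \<in> U" "Y \<in> U"
  moreover have "g X * (sc c * A) = sc c * (g X * A)" for A by (metis mult.assoc sc_commute)
  ultimately show "blinfun_apply ((mulLR 1 (h Y) o\<^sub>L G X Y) + (mulLR (g X) 1 o\<^sub>L H X Y)) (sc c * W)
      = sc c * blinfun_apply ((mulLR 1 (h Y) o\<^sub>L G X Y) + (mulLR (g X) 1 o\<^sub>L H X Y)) W"
    using g h by (simp add: divided_difference_def blinfun.add_left mult.assoc distrib_left)
next
  have f: "continuous_on (U \<times> U) (\<lambda>p. g (fst p))" "continuous_on (U \<times> U) (\<lambda>p. h (snd p))"
    by (rule continuous_on_compose2[OF dvd_diff_continuous[OF g] continuous_on_fst[OF continuous_on_id]]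
        continuous_on_compose2[OF dvd_diff_continuous[OF h] continuous_on_snd[OF continuous_on_id]]; auto)+
  show "continuous_on (U \<times> U) (\<lambda>p. (mulLR 1 (h (snd p)) o\<^sub>L G (fst p) (snd p)) + (mulLR (g (fst p)) 1 o\<^sub>L H (fst p) (snd p)))"
    using g h unfolding divided_difference_def
    by (intro continuous_intros f bounded_bilinear.continuous_on[OF bounded_bilinear_blinfun_compose]) auto
qed

text \<open>
  From \<open>A\<inverse> Z - Z B\<inverse> = - A\<inverse> (A Z - Z B) B\<inverse>\<close>.
\<close>

lemma dvd_diff_einv:
  assumes g: "divided_difference P U g G" and u: "\<And>X. X \<in> U \<Longrightarrow> unit (g X)"
  shows "divided_difference P U (\<lambda>X. einv (g X)) (\<lambda>X Y. - (mulLR (einv (g X)) (einv (g Y)) o\<^sub>L G X Y))"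
  unfolding divided_difference_def
proof (intro conjI ballI allI impI)
  fix X Y Z assume X: "X \<in> U" and Y: "Y \<in> U" and Z: "P * Z = Z * P"
  have "einv (g X) * ((g X * Z - Z * g Y) * einv (g Y))
      = (einv (g X) * g X) * (Z * einv (g Y)) - (einv (g X) * Z) * (g Y * einv (g Y))"
    by (simp add: algebra_simps)
  also have "\<dots> = Z * einv (g Y) - einv (g X) * Z"
    using einv[OF u[OF X]] einv[OF u[OF Y]] by simp
  finally show "einv (g X) * Z - Z * einv (g Y)
      = blinfun_apply (- (mulLR (einv (g X)) (einv (g Y)) o\<^sub>L G X Y)) (X * Z - Z * Y)"
    using g X Y Z by (simp add: divided_difference_def blinfun.minus_left)
next
  fix X Y c W assume "X \<in> U" "Y \<in> U"
  moreover have "einv (g X) * (sc c * A) = sc c * (einv (g X) * A)" for A by (metis mult.assoc sc_commute)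
  ultimately show "blinfun_apply (- (mulLR (einv (g X)) (einv (g Y)) o\<^sub>L G X Y)) (sc c * W)
      = sc c * blinfun_apply (- (mulLR (einv (g X)) (einv (g Y)) o\<^sub>L G X Y)) W"
    using g by (simp add: divided_difference_def blinfun.minus_left mult.assoc)
next
  have i: "continuous_on U (\<lambda>X. einv (g X))"
    by (rule continuous_on_compose2[OF continuous_on_einv dvd_diff_continuous[OF g]]) (use u in auto)
  have f: "continuous_on (U \<times> U) (\<lambda>p. einv (g (fst p)))" "continuous_on (U \<times> U) (\<lambda>p. einv (g (snd p)))"
    by (auto intro!: continuous_on_compose2[OF i] continuous_intros)
  show "continuous_on (U \<times> U) (\<lambda>p. - (mulLR (einv (g (fst p))) (einv (g (snd p))) o\<^sub>L G (fst p) (snd p)))"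
    using g unfolding divided_difference_def
    by (intro continuous_intros f bounded_bilinear.continuous_on[OF bounded_bilinear_blinfun_compose]) auto
qed

lemma dvd_diff_tendsto:
  assumes "divided_difference P U g G" "X \<in> U" "Y \<in> U"
    and "(a \<longlongrightarrow> X) F" "(b \<longlongrightarrow> Y) F" "(w \<longlongrightarrow> W) F"
    and "eventually (\<lambda>t. a t \<in> U) F" "eventually (\<lambda>t. b t \<in> U) F"
  shows "((\<lambda>t. blinfun_apply (G (a t) (b t)) (w t)) \<longlongrightarrow> blinfun_apply (G X Y) W) F"
proof -
  have "continuous_on (U \<times> U) (\<lambda>p. G (fst p) (snd p))" using assms(1) by (simp add: divided_difference_def)
  hence "((\<lambda>t. G (fst (a t, b t)) (snd (a t, b t))) \<longlongrightarrow> G (fst (X, Y)) (snd (X, Y))) F"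
    by (rule continuous_on_tendsto_compose)
       (use assms in \<open>auto intro!: tendsto_intros elim: eventually_elim2\<close>)
  thus ?thesis by (auto intro!: tendsto_intros assms)
qed

text \<open>
  With \<open>Z = 1\<close> the identity is \<open>g Y - g X = G Y X (Y - X)\<close> without remainder, so that continuity of \<open>G\<close>
  at the diagonal already gives differentiability.
\<close>

lemma dvd_diff_has_derivative:
  assumes "divided_difference P U g G" "X \<in> U"
  shows "(g has_derivative blinfun_apply (G X X)) (at X within U)"
  unfolding has_derivative_within
proof (intro conjI)
  show "bounded_linear (blinfun_apply (G X X))" by (rule blinfun.bounded_linear_right)
  have t: "((\<lambda>Y. G Y X) \<longlongrightarrow> G X X) (at X within U)"
    by (rule dvd_diff_tendsto_diagonal[OF assms])
  hence "((\<lambda>Y. norm (G Y X - G X X)) \<longlongrightarrow> 0) (at X within U)"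
    by (intro tendsto_norm_zero) (simp add: LIM_zero_iff)
  thus "((\<lambda>Y. (1 / norm (Y - X)) *\<^sub>R (g Y - (g X + blinfun_apply (G X X) (Y - X)))) \<longlongrightarrow> 0) (at X within U)"
  proof (rule Lim_null_comparison[rotated])
    show "\<forall>\<^sub>F Y in at X within U. norm ((1 / norm (Y - X)) *\<^sub>R (g Y - (g X + blinfun_apply (G X X) (Y - X))))
        \<le> norm (G Y X - G X X)"
    proof (rule eventually_at[THEN iffD2], intro exI[of _ 1] conjI ballI impI)
      fix Y assume Y: "Y \<in> U" "Y \<noteq> X \<and> dist Y X < 1"
      have "norm (g Y - (g X + blinfun_apply (G X X) (Y - X))) = norm (blinfun_apply (G Y X - G X X) (Y - X))"
        using dvd_diff_expand[OF assms Y(1)] by (simp add: blinfun.diff_left)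
      also have "\<dots> \<le> norm (G Y X - G X X) * norm (Y - X)" by (rule norm_blinfun)
      finally show "norm ((1 / norm (Y - X)) *\<^sub>R (g Y - (g X + blinfun_apply (G X X) (Y - X))))
        \<le> norm (G Y X - G X X)" unfolding norm_scaleR using Y by (simp add: field_simps)
    qed simp
  qed
qed

section \<open>Generalized eigenvectors\<close>

lemma funpow_minus_scale: "((\<lambda>y. app T y - z *s y) ^^ m) x = app ((T - sc z) ^ m) x"
  by (induction m) (simp_all add: power_commutes)

lemma app_power_zero_mono:
  assumes "app (S ^ m) x = 0" "m \<le> n" shows "app (S ^ n) x = 0"
proof -
  have "S ^ n = S ^ (n - m) * S ^ m" using assms(2) by (simp flip: power_add)
  thus ?thesis using assms(1) by simp
qed

text \<open>
  The value prescribed for \<open>g(T)\<close> at a generalized eigenvector for \<open>z\<close> of order at most \<open>m\<close>.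
\<close>

definition taylor :: "(complex \<Rightarrow> complex) \<Rightarrow> complex \<Rightarrow> 'n::finite endo \<Rightarrow> nat \<Rightarrow> complex^'n \<Rightarrow> complex^'n" where
  "taylor g z T m x = (\<Sum>k<m. ((deriv ^^ k) g z / fact k) *s app ((T - sc z) ^ k) x)"

lemma fps_nth_deriv_funpow:
  "fps_nth ((fps_deriv ^^ k) f) n = (fact (n + k) / fact n) * (fps_nth f (n + k) :: complex)"
proof (induction k arbitrary: n)
  case (Suc k)
  have "fps_nth ((fps_deriv ^^ Suc k) f) n = of_nat (Suc n) * fps_nth ((fps_deriv ^^ k) f) (Suc n)"
    by simp
  also have "\<dots> = fact (n + Suc k) / fact n * fps_nth f (n + Suc k)"
    unfolding Suc fact_Suc[of n] by (simp del: of_nat_Suc add: field_simps)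
  finally show ?case .
qed simp

lemma higher_deriv_eval_fps:
  assumes "entire f"
  shows "(deriv ^^ k) (eval_fps f) = eval_fps ((fps_deriv ^^ k) f)" and "entire ((fps_deriv ^^ k) f)"
proof -
  have e: "entire ((fps_deriv ^^ k) f)" for k
    by (induction k) (auto simp: assms entire_deriv)
  thus "entire ((fps_deriv ^^ k) f)" .
  show "(deriv ^^ k) (eval_fps f) = eval_fps ((fps_deriv ^^ k) f)"
  proof (induction k)
    case (Suc k)
    have "deriv (eval_fps ((fps_deriv ^^ k) f)) z = eval_fps (fps_deriv ((fps_deriv ^^ k) f)) z" for z
      by (intro DERIV_imp_deriv has_field_derivative_eval_fps) (use e[of k] in \<open>simp add: entire_def\<close>)
    thus ?case by (auto simp: Suc)
  qed simp
qed

text \<open>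
  Expand \<open>T ^ n\<close> in powers of \<open>S = T - z\<close>.  On \<open>x\<close> only the powers below \<open>m\<close> survive, and the coefficient of
  \<open>S ^ k\<close>, summed over \<open>n\<close>, is the \<open>k\<close>-th Taylor coefficient of \<open>f\<close> at \<open>z\<close>.
\<close>

lemma ev_taylor:
  assumes f: "entire f" and x: "app ((T - sc z) ^ m) x = 0"
  shows "app (ev f T) x = taylor (eval_fps f) z T m x"
proof -
  define S where "S = T - sc z"
  have T: "app (T ^ n) x = (\<Sum>k<m. (of_nat (n choose k) * z ^ (n - k)) *s app (S ^ k) x)" for n
  proof -
    have "(S + sc z) ^ n /\<^sub>R fact n = (\<Sum>k\<le>n. (S ^ k /\<^sub>R fact k) * (sc z ^ (n - k) /\<^sub>R fact (n - k)))"
      using exp_series_add_commuting[of S "sc z" n] sc_commute[of z S] by simp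
    also have "\<dots> = (\<Sum>k\<le>n. (of_nat (n choose k) / fact n :: real) *\<^sub>R (S ^ k * sc z ^ (n - k)))"
      by (intro sum.cong refl) (simp add: binomial_fact field_simps)
    finally have e: "(S + sc z) ^ n /\<^sub>R fact n
        = (\<Sum>k\<le>n. (of_nat (n choose k) / fact n :: real) *\<^sub>R (S ^ k * sc z ^ (n - k)))" .
    have "(S + sc z) ^ n = (fact n :: real) *\<^sub>R ((S + sc z) ^ n /\<^sub>R fact n)" by simp
    also have "\<dots> = (\<Sum>k\<le>n. (of_nat (n choose k) :: real) *\<^sub>R (S ^ k * sc z ^ (n - k)))"
      unfolding e scaleR_sum_right by (intro sum.cong refl) simp
    finally have "(S + sc z) ^ n = (\<Sum>k\<le>n. (of_nat (n choose k) :: real) *\<^sub>R (S ^ k * sc z ^ (n - k)))" .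
    hence "app (T ^ n) x = (\<Sum>k\<le>n. (of_nat (n choose k) * z ^ (n - k)) *s app (S ^ k) x)"
      by (simp add: S_def app_sum_left sc_power vector_smult_assoc scaleR_eq_complex_scale)
    also have "\<dots> = (\<Sum>k<max m (Suc n). (of_nat (n choose k) * z ^ (n - k)) *s app (S ^ k) x)"
      by (intro sum.mono_neutral_left) (auto simp: binomial_eq_0)
    also have "\<dots> = (\<Sum>k<m. (of_nat (n choose k) * z ^ (n - k)) *s app (S ^ k) x)"
      using app_power_zero_mono[OF x] by (intro sum.mono_neutral_right) (auto simp: S_def)
    finally show ?thesis .
  qed
  have c: "(\<lambda>n. fps_nth f n * (of_nat (n choose k) * z ^ (n - k))) sums ((deriv ^^ k) (eval_fps f) z / fact k)" for k
  proof -
    have "(\<lambda>n. fps_nth ((fps_deriv ^^ k) f) n * z ^ n / fact k) sums ((deriv ^^ k) (eval_fps f) z / fact k)"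
      unfolding higher_deriv_eval_fps(1)[OF f]
      by (intro sums_divide eval_fps_sums higher_deriv_eval_fps(2) f)
    moreover have "fps_nth ((fps_deriv ^^ k) f) n * z ^ n / fact k
        = fps_nth f (n + k) * (of_nat ((n + k) choose k) * z ^ (n + k - k))" for n
      by (simp add: fps_nth_deriv_funpow binomial_fact mult_ac)
    ultimately have "(\<lambda>n. fps_nth f (n + k) * (of_nat ((n + k) choose k) * z ^ (n + k - k))) sums
        ((deriv ^^ k) (eval_fps f) z / fact k)" by simp
    thus ?thesis by (subst (asm) sums_iff_shift) (auto simp: binomial_eq_0)
  qed
  have "(\<lambda>n. \<Sum>k<m. (fps_nth f n * (of_nat (n choose k) * z ^ (n - k))) *s app (S ^ k) x) sums
      taylor (eval_fps f) z T m x"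
    unfolding taylor_def S_def[symmetric]
    using c by (intro sums_sum bounded_linear.sums[OF bounded_linear_compose[OF bounded_linear_app_left bounded_linear_sc], simplified])
  moreover have "(\<Sum>k<m. (fps_nth f n * (of_nat (n choose k) * z ^ (n - k))) *s app (S ^ k) x)
      = fps_nth f n *s app (T ^ n) x" for n
    unfolding T by (simp add: vec.scale_sum_right vector_smult_assoc)
  ultimately show ?thesis using sums_unique2[OF ev_app_sums[OF f, of T x]] by simp
qed

lemma ev_eigenvector:
  assumes "entire f" "app T x = z *s x"
  shows "app (ev f T) x = eval_fps f z *s x"
  using ev_taylor[of f T z 1 x] assms by (simp add: taylor_def)

lemma exp_sc: "exp (sc c) = (sc (exp c) :: 'n::finite endo)"
proof -
  have "ev (fps_exp c) (1::'n endo) = sc (exp c)"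
    using ev_eigenvector[of "fps_exp c" 1 _ 1] by (intro endo_eqI) simp
  thus ?thesis using ev_exp[of c "1::'n endo"] by simp
qed

lemma taylor_sub: "app ((T - sc z) ^ m) x = 0 \<Longrightarrow> app ((T - sc z) ^ m) (taylor g z T m x) = 0"
proof -
  assume x: "app ((T - sc z) ^ m) x = 0"
  have "app ((T - sc z) ^ m) (app ((T - sc z) ^ k) x) = 0" for k
    using x by (simp flip: app_simps(1) power_add) (simp add: add.commute[of m] power_add)
  thus ?thesis by (simp add: taylor_def app_sum)
qed

lemma taylor_cong: "eventually (\<lambda>w. f w = g w) (nhds z) \<Longrightarrow> taylor f z T m x = taylor g z T m x"
  unfolding taylor_def by (intro sum.cong refl arg_cong2[where f="(*s)"] arg_cong2[where f="(/)"] higher_deriv_cong_ev) auto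

text \<open>
  By the Leibniz rule the Taylor coefficients of a product are the Cauchy products, and the terms of order
  at least \<open>m\<close>, which only occur on one side, vanish on \<open>x\<close>.
\<close>

lemma taylor_mult:
  assumes f: "f analytic_on {z}" and q: "q analytic_on {z}" and x: "app ((T - sc z) ^ m) x = 0"
  shows "taylor (\<lambda>w. q w * f w) z T m x = taylor q z T m (taylor f z T m x)"
proof -
  define S where "S = T - sc z"
  define a where "a k = (deriv ^^ k) q z / fact k" for k
  define b where "b k = (deriv ^^ k) f z / fact k" for k
  obtain A where A: "open A" "z \<in> A" "f holomorphic_on A" "q holomorphic_on A"
  proof -
    obtain A B where "open A" "z \<in> A" "f holomorphic_on A" "open B" "z \<in> B" "q holomorphic_on B"
      using f q unfolding analytic_at by blast
    thus ?thesis by (intro that[of "A \<inter> B"]) (auto intro: holomorphic_on_subset)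
  qed
  have D: "(deriv ^^ n) (\<lambda>w. q w * f w) z / fact n = (\<Sum>i\<le>n. a i * b (n - i))" for n
  proof -
    have "(deriv ^^ n) (\<lambda>w. q w * f w) z = (\<Sum>i = 0..n. of_nat (n choose i) * (deriv ^^ i) q z * (deriv ^^ (n - i)) f z)"
      using A by (intro higher_deriv_mult[of _ A])
    hence "(deriv ^^ n) (\<lambda>w. q w * f w) z / fact n
        = (\<Sum>i\<le>n. of_nat (n choose i) * (deriv ^^ i) q z * (deriv ^^ (n - i)) f z / fact n)"
      by (simp add: sum_divide_distrib atLeast0AtMost)
    also have "\<dots> = (\<Sum>i\<le>n. a i * b (n - i))"
      by (intro sum.cong refl) (simp add: a_def b_def binomial_fact)
    finally show ?thesis .
  qed
  have z0: "app (S ^ k) x = 0" if "k \<ge> m" for k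
    using app_power_zero_mono[OF x that] by (simp add: S_def)
  have "taylor q z T m (taylor f z T m x) = (\<Sum>i<m. \<Sum>j<m. (a i * b j) *s app (S ^ (i + j)) x)"
    unfolding taylor_def S_def[symmetric] a_def[symmetric] b_def[symmetric]
    by (simp add: app_sum vec.scale_sum_right vector_smult_assoc power_add)
  also have "\<dots> = (\<Sum>(i,j)\<in>{..<m}\<times>{..<m}. (a i * b j) *s app (S ^ (i + j)) x)"
    by (simp add: sum.cartesian_product)
  also have "\<dots> = (\<Sum>(i,j)\<in>{(i,j). i + j < m}. (a i * b j) *s app (S ^ (i + j)) x)"
    by (intro sum.mono_neutral_right) (auto, meson z0 not_le)
  also have "\<dots> = (\<Sum>k<m. \<Sum>i\<le>k. (a i * b (k - i)) *s app (S ^ k) x)"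
    by (subst sum.triangle_reindex) (auto intro!: sum.cong)
  also have "\<dots> = taylor (\<lambda>w. q w * f w) z T m x"
    unfolding taylor_def S_def[symmetric] D by (simp add: vec.scale_sum_left)
  finally show ?thesis ..
qed

subsection \<open>Polynomials in an operator\<close>

definition pev :: "complex poly \<Rightarrow> 'n::finite endo \<Rightarrow> 'n endo" where "pev p T = ev (fps_of_poly p) T"

lemma pev_simps: "pev (p + q) T = pev p T + pev q T" "pev (p * q) T = pev p T * pev q T"
  "pev 0 T = 0" "pev [:c:] T = sc c" "pev [:- z, 1:] T = T - sc z"
proof -
  show a: "pev (p + q) T = pev p T + pev q T" for p q by (simp add: pev_def fps_of_poly_add ev_add)
  show "pev (p * q) T = pev p T * pev q T" by (simp add: pev_def fps_of_poly_mult ev_mult)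
  show "pev 0 T = 0" by (simp add: pev_def)
  show c: "pev [:c:] T = sc c" for c by (simp add: pev_def fps_of_poly_const)
  have "pev ([:- z:] + monom 1 1) T = T - sc z"
    unfolding a c by (simp add: pev_def fps_of_poly_monom' sc_simps)
  thus "pev [:- z, 1:] T = T - sc z" by (simp add: monom_altdef)
qed

lemma pev_sum: "pev (sum p A) T = (\<Sum>i\<in>A. pev (p i) T)"
  by (induction A rule: infinite_finite_induct) (auto simp: pev_simps)

lemma pev_monom: "pev (monom c n) T = sc c * T ^ n"
proof -
  have "ev (fps_X ^ n) T = T ^ n \<and> entire (fps_X ^ n)"
    by (induction n) (auto simp: ev_mult)
  thus ?thesis by (simp add: pev_def fps_of_poly_monom ev_mult)
qed

text \<open>
  The powers \<open>T ^ i x\<close> cannot be infinitely many independent vectors; either two of them coincide or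
  they satisfy a nontrivial linear relation.
\<close>

lemma annihilating_polynomial_vector:
  fixes T :: "'n::finite endo"
  obtains p where "p \<noteq> 0" "app (pev p T) x = 0"
proof (cases "inj (\<lambda>i::nat. app (T ^ i) x)")
  case False
  then obtain i j :: nat where ij: "i \<noteq> j" "app (T ^ i) x = app (T ^ j) x" by (auto simp: inj_def)
  show ?thesis
  proof (rule that[of "monom 1 i + monom (-1) j"])
    have "coeff (monom 1 i + monom (-1) j) i = (1::complex)" using ij by simp
    thus "monom 1 i + monom (-1::complex) j \<noteq> 0" by force
  qed (use ij in \<open>simp add: pev_simps pev_monom\<close>)
next
  case True
  define v where "v i = app (T ^ i) x" for i :: nat
  have inj: "inj v" using True by (simp add: v_def[abs_def])
  have "vec.dependent (range v)"
    using inj vec.finiteI_independent finite_imageD infinite_UNIV_nat by blast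
  then obtain t u where t: "finite t" "t \<subseteq> range v" "(\<Sum>w\<in>t. u w *s w) = 0" and w: "\<exists>w\<in>t. u w \<noteq> 0"
    unfolding vec.dependent_explicit by blast
  define p where "p = (\<Sum>w\<in>t. monom (u w) (inv v w))"
  from w obtain w where w: "w \<in> t" "u w \<noteq> 0" by blast
  have "coeff p (inv v w) = (\<Sum>w'\<in>t. if w' = w then u w' else 0)"
    unfolding p_def coeff_sum
  proof (intro sum.cong refl)
    fix w' assume "w' \<in> t"
    hence "inv v w' = inv v w \<longleftrightarrow> w' = w" using t(2) w(1) by (metis f_inv_into_f subsetD)
    thus "coeff (monom (u w') (inv v w')) (inv v w) = (if w' = w then u w' else 0)" by simp
  qed
  also have "\<dots> = u w" using t(1) w(1) by simp
  finally have "p \<noteq> 0" using w(2) by force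
  moreover have "app (pev p T) x = (\<Sum>w\<in>t. u w *s v (inv v w))"
    by (simp add: p_def pev_sum app_sum_left pev_monom v_def)
  hence "app (pev p T) x = 0" using t by (simp add: f_inv_into_f subsetD cong: sum.cong)
  ultimately show ?thesis using that by blast
qed

lemma annihilating_polynomial:
  fixes T :: "'n::finite endo"
  obtains p where "p \<noteq> 0" "pev p T = 0"
proof -
  have "\<forall>i::'n. \<exists>p. p \<noteq> 0 \<and> app (pev p T) (axis i 1) = 0"
    using annihilating_polynomial_vector by metis
  then obtain p where p: "\<And>i::'n. p i \<noteq> 0" "\<And>i. app (pev (p i) T) (axis i 1) = 0" by metis
  have basis: "app (pev (\<Prod>i\<in>UNIV. p i) T) (axis j 1) = 0" for j
  proof -
    have "(\<Prod>i\<in>UNIV. p i) = (\<Prod>i\<in>UNIV - {j}. p i) * p j"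
      by (subst prod.remove[of UNIV j]) (auto simp: mult.commute)
    thus ?thesis using p(2) by (simp add: pev_simps)
  qed
  have "app (pev (\<Prod>i\<in>UNIV. p i) T) x = 0" for x
  proof -
    have "x = (\<Sum>j\<in>UNIV. x $ j *s axis j 1)" by (simp add: basis_expansion)
    hence "app (pev (\<Prod>i\<in>UNIV. p i) T) x = (\<Sum>j\<in>UNIV. x $ j *s app (pev (\<Prod>i\<in>UNIV. p i) T) (axis j 1))"
      by (metis (no_types, lifting) app_arg(5) app_sum sum.cong)
    also have "\<dots> = 0" by (simp only: basis) simp
    finally show ?thesis .
  qed
  moreover have "(\<Prod>i\<in>UNIV. p i) \<noteq> 0" using p(1) by simp
  ultimately show ?thesis using that by (metis app_simps(6) endo_eqI)
qed

lemma finite_spectrum: "finite {z. \<exists>x. x \<noteq> 0 \<and> app T x = z *s x}"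
proof -
  obtain p where p: "p \<noteq> 0" "pev p T = 0" by (rule annihilating_polynomial)
  have "poly p z = 0" if "x \<noteq> 0" "app T x = z *s x" for x z
    using ev_eigenvector[of "fps_of_poly p" T x z] that p(2) by (simp add: pev_def)
  thus ?thesis by (intro finite_subset[OF _ poly_roots_finite[OF p(1)]]) auto
qed

text \<open>
  The spectrum is finite.  This is what makes it possible to replace a singular operator by invertible ones and
  to take limits.
\<close>

lemma eventually_unit_shift: "eventually (\<lambda>u. unit (T + sc u)) (at 0)"
proof -
  let ?E = "{z. \<exists>x. x \<noteq> 0 \<and> app T x = z *s x}"
  have "eventually (\<lambda>u. \<forall>z\<in>?E. u \<noteq> - z) (at 0)"
  proof (rule eventually_ball_finite[OF finite_spectrum], safe)
    fix z x assume "x \<noteq> 0" "app T x = z *s x"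
    show "eventually (\<lambda>u. u \<noteq> - z) (at 0)"
    proof (cases "z = 0")
      case True thus ?thesis by (simp add: eventually_at_filter)
    next
      case False
      have "eventually (\<lambda>u. u \<noteq> - z) (nhds 0)" using False by (intro t1_space_nhds) auto
      thus ?thesis by (simp add: eventually_at_filter eventually_mono)
    qed
  qed
  thus ?thesis
  proof eventually_elim
    case (elim u)
    show ?case unfolding unit_iff_inj
    proof (intro allI impI)
      fix x assume "app (T + sc u) x = 0"
      hence "app T x = (- u) *s x" by (simp add: eq_neg_iff_add_eq_0)
      thus "x = 0" using elim by (metis (mono_tags, lifting) mem_Collect_eq minus_minus)
    qed
  qed
qed

subsection \<open>Decomposition of invariant subspaces\<close>

definition gen_span :: "'n::finite endo \<Rightarrow> (complex^'n) set \<Rightarrow> (complex^'n) set" where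
  "gen_span T V = vec.span {x\<in>V. \<exists>z m. app ((T - sc z) ^ m) x = 0}"

text \<open>
  On the generalized eigenvectors for \<open>w\<close> the operator \<open>T - z = (w - z) + (T - w)\<close> is a nonzero scalar plus
  a nilpotent operator, hence invertible.
\<close>

lemma shift_solve:
  assumes V: "vec.subspace V" "\<And>x. x \<in> V \<Longrightarrow> app T x \<in> V" and wz: "w \<noteq> z"
    and y: "y \<in> V" "app ((T - sc w) ^ m) y = 0"
  shows "\<exists>x\<in>V. app (T - sc z) x = y \<and> app ((T - sc w) ^ m) x = 0"
  using y
proof (induction m arbitrary: y)
  case 0 thus ?case using V(1) by (auto simp: vec.subspace_0 intro!: bexI[of _ 0])
next
  case (Suc m)
  have "app (T - sc w) y \<in> V" using Suc.prems V by (simp add: vec.subspace_diff vec.subspace_scale)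
  moreover have "app ((T - sc w) ^ m) (app (T - sc w) y) = 0"
    using Suc.prems(2) by (simp only: power_Suc2 app_simps(1))
  ultimately obtain x where x: "x \<in> V" "app (T - sc z) x = app (T - sc w) y" "app ((T - sc w) ^ m) x = 0"
    using Suc.IH by blast
  show ?case
  proof (intro bexI conjI)
    have "app (T - sc z) (y - x) = (w - z) *s y"
      using x(2) by (simp add: algebra_simps vector_sub_rdistrib)
    thus "app (T - sc z) ((1 / (w - z)) *s (y - x)) = y"
      using wz by (simp only: app_arg(5) vector_smult_assoc) simp
    show "app ((T - sc w) ^ Suc m) ((1 / (w - z)) *s (y - x)) = 0"
      unfolding app_arg(5) using Suc.prems(2) x(3) by simp
    show "(1 / (w - z)) *s (y - x) \<in> V"
      using Suc.prems(1) x(1) V(1) by (simp add: vec.subspace_diff vec.subspace_scale)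
  qed
qed

text \<open>
  Write \<open>(T - z) x\<close> as a sum of generalized eigenvectors.  Those for eigenvalues other than \<open>z\<close> have preimages
  under \<open>T - z\<close> of the same kind, by \<open>shift_solve\<close>; after subtracting these from \<open>x\<close>, what remains is a generalized
  eigenvector for \<open>z\<close>.
\<close>

lemma gen_span_step:
  assumes V: "vec.subspace V" "\<And>x. x \<in> V \<Longrightarrow> app T x \<in> V"
    and x: "x \<in> V" "app (T - sc z) x \<in> gen_span T V"
  shows "x \<in> gen_span T V"
proof -
  define K where "K = {w\<in>V. \<exists>m. app ((T - sc z) ^ m) w = 0}"
  have K: "vec.subspace K"
    unfolding vec.subspace_def
  proof (intro conjI ballI allI)
    show "0 \<in> K" using V(1) by (auto simp: K_def vec.subspace_0)
    fix a b assume "a \<in> K" "b \<in> K"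
    then obtain m n where "a \<in> V" "b \<in> V" "app ((T - sc z) ^ m) a = 0" "app ((T - sc z) ^ n) b = 0"
      by (auto simp: K_def)
    hence "a + b \<in> V" "app ((T - sc z) ^ (max m n)) (a + b) = 0"
      using V(1) app_power_zero_mono[of "T - sc z" m a "max m n"] app_power_zero_mono[of "T - sc z" n b "max m n"]
      by (auto simp: vec.subspace_add)
    thus "a + b \<in> K" unfolding K_def by blast
  next
    fix c a assume "a \<in> K" thus "c *s a \<in> K" using V(1) by (auto simp: K_def vec.subspace_scale)
  qed
  have KE: "K \<subseteq> gen_span T V" unfolding gen_span_def K_def by (auto intro: vec.span_base)
  have EV: "gen_span T V \<subseteq> V" unfolding gen_span_def using V(1) by (intro vec.span_minimal) auto
  have E: "vec.subspace (gen_span T V)" by (simp add: gen_span_def)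
  have "\<exists>x'\<in>gen_span T V. app (T - sc z) x' - y \<in> K" if "y \<in> gen_span T V" for y
    using that unfolding gen_span_def
  proof (induction y rule: vec.span_induct)
    case base
    show ?case unfolding vec.subspace_def gen_span_def[symmetric]
    proof (safe)
      show "\<exists>x'\<in>gen_span T V. app (T - sc z) x' - 0 \<in> K"
        using E K by (intro bexI[of _ 0]) (auto simp: vec.subspace_0)
      fix a b x y assume *: "x \<in> gen_span T V" "app (T - sc z) x - a \<in> K" "y \<in> gen_span T V" "app (T - sc z) y - b \<in> K"
      have "app (T - sc z) (x + y) - (a + b) = (app (T - sc z) x - a) + (app (T - sc z) y - b)"
        by (simp add: algebra_simps)
      thus "\<exists>x'\<in>gen_span T V. app (T - sc z) x' - (a + b) \<in> K"
        using * E K by (intro bexI[of _ "x + y"]) (simp_all only: vec.subspace_add)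
    next
      fix c a x assume *: "x \<in> gen_span T V" "app (T - sc z) x - a \<in> K"
      have "app (T - sc z) (c *s x) - c *s a = c *s (app (T - sc z) x - a)"
        unfolding app_arg(5) by (simp add: vector_ssub_ldistrib)
      thus "\<exists>x'\<in>gen_span T V. app (T - sc z) x' - c *s a \<in> K"
        using * E K by (intro bexI[of _ "c *s x"]) (simp_all only: vec.subspace_scale)
    qed
  next
    case (step y)
    then obtain w m where y: "y \<in> V" "app ((T - sc w) ^ m) y = 0" by blast
    show ?case unfolding gen_span_def[symmetric]
    proof (cases "w = z")
      case True
      thus "\<exists>x'\<in>gen_span T V. app (T - sc z) x' - y \<in> K"
        using y V(1) E by (intro bexI[of _ 0]) (auto simp: K_def vec.subspace_0 vec.subspace_neg)
    next
      case False
      from shift_solve[OF V False y] obtain x' where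
        x': "x' \<in> V" "app (T - sc z) x' = y" "app ((T - sc w) ^ m) x' = 0" by blast
      hence "x' \<in> gen_span T V" unfolding gen_span_def by (intro vec.span_base) blast
      thus "\<exists>x'\<in>gen_span T V. app (T - sc z) x' - y \<in> K"
        using x'(2) K by (intro bexI[of _ x']) (auto simp: vec.subspace_0)
    qed
  qed
  from this[OF x(2)] obtain x' where x': "x' \<in> gen_span T V" "app (T - sc z) x' - app (T - sc z) x \<in> K" by blast
  then obtain m where m: "app ((T - sc z) ^ m) (app (T - sc z) (x' - x)) = 0" by (auto simp: K_def)
  hence "app ((T - sc z) ^ Suc m) (x' - x) = 0" by (simp only: power_Suc2 app_simps(1))
  hence "x' - x \<in> K" using x(1) x'(1) EV V(1) unfolding K_def by (blast intro: vec.subspace_diff)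
  thus ?thesis using vec.subspace_diff[OF E x'(1), of "x' - x"] KE by auto
qed

text \<open>
  Split off the roots of an annihilating polynomial of \<open>x\<close> one at a time.
\<close>

lemma gen_span_eq:
  assumes V: "vec.subspace V" "\<And>x. x \<in> V \<Longrightarrow> app T x \<in> V"
  shows "gen_span T V = V"
proof
  show "gen_span T V \<subseteq> V" unfolding gen_span_def using V(1) by (intro vec.span_minimal) auto
  show "V \<subseteq> gen_span T V"
  proof
    fix x assume "x \<in> V"
    obtain p where "p \<noteq> 0" "app (pev p T) x = 0" by (rule annihilating_polynomial_vector)
    thus "x \<in> gen_span T V" using \<open>x \<in> V\<close>
    proof (induction "degree p" arbitrary: p x)
      case 0
      then obtain c where "p = [:c:]" "c \<noteq> 0" by (metis degree_eq_zeroE pCons_eq_0_iff)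
      with 0 have "x = 0" by (simp add: pev_simps)
      thus ?case by (simp add: gen_span_def vec.span_zero)
    next
      case (Suc d)
      obtain z where "poly p z = 0"
        using alg_closed_imp_poly_has_root[of p] Suc.hyps(2) by auto
      then obtain q where q: "p = [:- z, 1:] * q" by (metis dvdE poly_eq_0_iff_dvd)
      have "q \<noteq> 0" using Suc.prems(1) q by auto
      hence d: "d = degree q" using Suc.hyps(2) unfolding q by (subst (asm) degree_mult_eq) auto
      have "app (pev q T) (app (T - sc z) x) = 0"
        using Suc.prems(2) unfolding q mult.commute[of "[:- z, 1:]"] by (simp only: pev_simps app_simps)
      moreover have "app (T - sc z) x \<in> V" using Suc.prems(3) V by (simp add: vec.subspace_diff vec.subspace_scale)
      ultimately have "app (T - sc z) x \<in> gen_span T V" using Suc.hyps(1)[OF d \<open>q \<noteq> 0\<close>] by blast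
      thus ?case using gen_span_step[OF V(1) V(2) Suc.prems(3)] by blast
    qed
  qed
qed

lemma eigenvector_exists:
  assumes V: "vec.subspace V" "\<And>x. x \<in> V \<Longrightarrow> app T x \<in> V" and ne: "x0 \<in> V" "x0 \<noteq> 0"
  obtains x z where "x \<in> V" "x \<noteq> 0" "app T x = z *s x"
proof -
  have "\<not> {x\<in>V. \<exists>z m. app ((T - sc z) ^ m) x = 0} \<subseteq> {0}"
  proof
    assume "{x\<in>V. \<exists>z m. app ((T - sc z) ^ m) x = 0} \<subseteq> {0}"
    hence "gen_span T V \<subseteq> {0}" unfolding gen_span_def by (rule vec.span_minimal) simp
    thus False using ne gen_span_eq[OF V] by auto
  qed
  then obtain x z m where x: "x \<in> V" "x \<noteq> 0" "app ((T - sc z) ^ m) x = 0" by auto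
  \<comment> \<open>The last nonzero \<open>(T - z) ^ j x\<close> is an eigenvector.\<close>
  define k where "k = (LEAST m. app ((T - sc z) ^ m) x = 0)"
  have k: "app ((T - sc z) ^ k) x = 0" unfolding k_def using x(3) by (rule LeastI)
  have "k \<noteq> 0" using k x(2) by (intro notI) simp
  then obtain j where j: "k = Suc j" by (cases k) auto
  have "app ((T - sc z) ^ j) x \<noteq> 0" 
    using not_less_Least[of j "\<lambda>m. app ((T - sc z) ^ m) x = 0"] j by (simp only: k_def[symmetric]) simp
  moreover have "app ((T - sc z) ^ i) x \<in> V" for i
    by (induction i) (use x V in \<open>auto simp: vec.subspace_diff vec.subspace_scale\<close>)
  moreover have "app T (app ((T - sc z) ^ j) x) = z *s app ((T - sc z) ^ j) x"
    using k unfolding j by simp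
  ultimately show ?thesis using that by blast
qed

text \<open>
  The kernel of \<open>f(T)\<close> in \<open>V\<close> is invariant under \<open>T\<close>.  If it is not zero it contains an eigenvector of \<open>T\<close>,
  on which \<open>f(T)\<close> is multiplication by \<open>f(z)\<close>.
\<close>

lemma ev_inj_on_iff:
  assumes V: "vec.subspace V" "\<And>x. x \<in> V \<Longrightarrow> app T x \<in> V" and f: "entire f"
  shows "(\<forall>x\<in>V. app (ev f T) x = 0 \<longrightarrow> x = 0) \<longleftrightarrow> (\<forall>z\<in>eigenvalues V (app T). eval_fps f z \<noteq> 0)"
proof safe
  fix z assume *: "\<forall>x\<in>V. app (ev f T) x = 0 \<longrightarrow> x = 0" "z \<in> eigenvalues V (app T)" "eval_fps f z = 0"
  thus False using ev_eigenvector[OF f] by (fastforce simp: eigenvalues_def)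
next
  fix x assume *: "\<forall>z\<in>eigenvalues V (app T). eval_fps f z \<noteq> 0" "x \<in> V" "app (ev f T) x = 0"
  show "x = 0"
  proof (rule ccontr)
    assume "x \<noteq> 0"
    define V' where "V' = {x\<in>V. app (ev f T) x = 0}"
    have c: "app (ev f T) (app T x) = app T (app (ev f T) x)" for x
      by (simp flip: app_simps(1) add: ev_commute[OF f, of T T])
    have V': "vec.subspace V'" using V(1) unfolding V'_def vec.subspace_def by auto
    have inv': "app T x \<in> V'" if "x \<in> V'" for x
      using that V(2) by (simp add: V'_def c)
    have "x \<in> V'" using * by (simp add: V'_def)
    from eigenvector_exists[OF V' inv' this \<open>x \<noteq> 0\<close>] obtain y z
      where "y \<in> V'" "y \<noteq> 0" "app T y = z *s y" by blast
    thus False using *(1) ev_eigenvector[OF f, of T y z] by (auto simp: V'_def eigenvalues_def)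
  qed
qed

section \<open>Levi subalgebras as centralizers\<close>

lemma linear_functional_iff:
  "linear_functional \<eta> \<longleftrightarrow> (\<forall>x y. \<eta> (x + y) = \<eta> x + \<eta> y) \<and> (\<forall>c x. \<eta> (c *s x) = c * \<eta> x)"
  by (auto simp: Vector_Spaces.linear_def module_hom_def module_hom_axioms_def
      vec.vector_space_axioms vec.module_axioms vector_space_over_itself.vector_space_axioms
      vector_space_over_itself.module_axioms)

definition ad :: "(complex^'n \<Rightarrow> complex^'n \<Rightarrow> complex^'n) \<Rightarrow> complex^'n \<Rightarrow> 'n::finite endo" where
  "ad br x = op (br x)"

definition invariant_form ::
  "(complex^'n \<Rightarrow> complex^'n \<Rightarrow> complex^'n) \<Rightarrow> (complex^'n \<Rightarrow> complex^'n \<Rightarrow> complex) \<Rightarrow> bool" where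
  "invariant_form br B \<longleftrightarrow>
     (\<forall>x y z. B (x + y) z = B x z + B y z) \<and> (\<forall>c x z. B (c *s x) z = c * B x z) \<and>
     (\<forall>x y. B x y = B y x) \<and> (\<forall>x y z. B (br x y) z = B x (br y z))"

lemma nondeg_imp_invariant: "nondeg_invariant_form br form \<Longrightarrow> invariant_form br form"
  unfolding nondeg_invariant_form_def invariant_form_def linear_functional_iff by blast

context
  fixes br :: "complex^'n \<Rightarrow> complex^'n \<Rightarrow> complex^'n"
  assumes lie: "lie_algebra br"
begin

lemma app_ad [simp]: "app (ad br x) y = br x y"
  using lie unfolding ad_def lie_algebra_def by simp

lemma br_simps:
  "br (x + y) z = br x z + br y z" "br z (x + y) = br z x + br z y"
  "br (c *s x) z = c *s br x z" "br z (c *s x) = c *s br z x"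
  "br (x - y) z = br x z - br y z" "br z (x - y) = br z x - br z y"
  "br (- x) z = - br x z" "br z (- x) = - br z x"
  "br 0 z = 0" "br z 0 = 0" "br x x = 0"
proof -
  have 1: "complex_linear (br u)" "complex_linear (\<lambda>x. br x u)" for u
    using lie unfolding lie_algebra_def by blast+
  show "br (x + y) z = br x z + br y z" "br z (x + y) = br z x + br z y"
    "br (c *s x) z = c *s br x z" "br z (c *s x) = c *s br z x"
    using 1 unfolding complex_linear_iff by auto
  show "br (x - y) z = br x z - br y z" "br z (x - y) = br z x - br z y"
    "br (- x) z = - br x z" "br z (- x) = - br z x" "br 0 z = 0" "br z 0 = 0"
    using 1 by (auto dest: vec.linear_diff vec.linear_neg vec.linear_0)
  show "br x x = 0" using lie unfolding lie_algebra_def by blast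
qed

lemma br_anti: "br y x = - br x y"
proof -
  have "0 = br x (x + y) + br y (x + y)"
    using br_simps(1)[of x y "x + y"] br_simps(11)[of "x + y"] by simp
  also have "\<dots> = br x y + br y x" by (simp add: br_simps(2,11))
  finally show ?thesis by (metis add.commute eq_neg_iff_add_eq_0)
qed

lemma jacobi: "br x (br y z) = br (br x y) z + br y (br x z)"
proof -
  have J: "br x (br y z) + br y (br z x) + br z (br x y) = 0"
    using lie unfolding lie_algebra_def by blast
  have "br x (br y z) = (br x (br y z) + br y (br z x) + br z (br x y)) - br z (br x y) - br y (br z x)"
    by simp
  thus ?thesis unfolding J using br_anti[of "br x y" z] br_anti[of x z] by (simp add: br_simps(8))
qed

lemma ad_br: "ad br (br x y) = ad br x * ad br y - ad br y * ad br x"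
  by (rule endo_eqI) (simp add: jacobi[of x y])

lemma ad_linear: "ad br (x + y) = ad br x + ad br y" "ad br (x - y) = ad br x - ad br y"
  "ad br (c *s x) = sc c * ad br x" "ad br (- x) = - ad br x" "ad br 0 = 0"
  by (rule endo_eqI; simp add: br_simps)+

lemma bounded_linear_ad: "bounded_linear (ad br)"
  by (intro linear_conv_bounded_linear[THEN iffD1] linearI)
     (auto simp: ad_linear scaleR_eq_complex_scale sc_of_real)

lemma killing_form_trace: "killing_form br x y = trace (mat_of (ad br x * ad br y))"
  by (simp only: mat_of_mult) (simp add: killing_form_def mat_of_def fun_eq_iff app_ad[abs_def])

lemma killing_invariant: "invariant_form br (killing_form br)"
proof -
  define tr where "tr A = trace (mat_of A)" for A :: "'n endo"
  have l: "tr (A + B) = tr A + tr B" "tr (A - B) = tr A - tr B" "tr (sc c * A) = c * tr A"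
    for A B :: "'n endo" and c
    by (simp_all add: tr_def trace_def mat_of_component sum.distrib sum_subtractf sum_distrib_left)
  have t: "tr (A * B) = tr (B * A)" for A B :: "'n endo"
    unfolding tr_def mat_of_mult by (rule trace_mul_sym)
  have k: "killing_form br x y = tr (ad br x * ad br y)" for x y
    by (simp add: killing_form_trace tr_def)
  have "killing_form br (br x y) z = killing_form br x (br y z)" for x y z
    using t[of "ad br y" "ad br x * ad br z"] by (simp add: k ad_br l algebra_simps)
  thus ?thesis unfolding invariant_form_def
    by (auto simp: k ad_linear l distrib_right mult.assoc intro: t)
qed

end

subsection \<open>Simultaneous diagonalization\<close>

text \<open>
  Let \<open>q\<close> be the product of the \<open>T - w\<close> over the eigenvalues \<open>w\<close> other than \<open>z\<close>.  Then \<open>q(T) (T - z) = 0\<close> because \<open>T\<close> is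
  diagonalizable, and \<open>q(T)\<close> is injective on the kernel of \<open>(T - z) ^ m\<close>, where \<open>z\<close> is the only eigenvalue.
\<close>

lemma diagonalizable_gen_eigenvector:
  assumes d: "vec.span {x. \<exists>c. app T x = c *s x} = UNIV" and x: "app ((T - sc z) ^ m) x = 0"
  shows "app T x = z *s x"
proof -
  define E where "E = {z. \<exists>x. x \<noteq> 0 \<and> app T x = z *s x}"
  define q where "q = (\<Prod>w\<in>E - {z}. [:- w, 1:])"
  have fE: "finite E" unfolding E_def by (rule finite_spectrum)
  have q: "poly q w = 0 \<longleftrightarrow> w \<in> E - {z}" for w
    using fE by (auto simp: q_def poly_prod)
  have qe: "app (pev q T) y = poly q w *s y" if "app T y = w *s y" for w y
    using ev_eigenvector[of "fps_of_poly q" T y w] that by (simp add: pev_def)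
  define A where "A = pev q T * (T - sc z)"
  have "app A y = 0" for y
  proof -
    have "y \<in> vec.span {x. \<exists>c. app T x = c *s x}" using d by simp
    thus ?thesis
    proof (induction y rule: vec.span_induct)
      case base
      show ?case unfolding vec.subspace_def by simp
    next
      case (step y)
      then obtain w where w: "app T y = w *s y" by blast
      have "app (T - sc z) y = (w - z) *s y" using w by (simp add: vector_sub_rdistrib)
      hence "app A y = ((w - z) * poly q w) *s y"
        by (simp only: A_def app_simps(1) app_arg(5) qe[OF w] vector_smult_assoc)
      moreover have "y = 0 \<or> w = z \<or> poly q w = 0" using w q by (auto simp: E_def)
      ultimately show ?case by auto
    qed
  qed
  hence k: "app (pev q T) (app (T - sc z) x) = 0" by (simp only: A_def app_simps(1))
  define V where "V = {x. app ((T - sc z) ^ m) x = 0}"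
  have V: "vec.subspace V" unfolding V_def vec.subspace_def by auto
  have c: "app ((T - sc z) ^ m) (app T y) = app T (app ((T - sc z) ^ m) y)" for y
  proof -
    have "(T - sc z) * T = T * (T - sc z)" by (simp add: algebra_simps sc_commute)
    hence "(T - sc z) ^ m * T = T * (T - sc z) ^ m" by (rule power_commuting_commutes)
    thus ?thesis by (simp flip: app_simps(1))
  qed
  have inv: "app T y \<in> V" if "y \<in> V" for y using that by (simp add: V_def c)
  have "w = z" if "y \<in> V" "y \<noteq> 0" "app T y = w *s y" for y w
  proof -
    have "app ((T - sc z) ^ k) y = ((w - z) ^ k) *s y" for k
      using that(3) by (induction k) (auto simp: vector_sub_rdistrib vector_smult_assoc algebra_simps)
    thus ?thesis using that by (auto simp: V_def)
  qed
  hence "\<forall>w\<in>eigenvalues V (app T). eval_fps (fps_of_poly q) w \<noteq> 0"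
    using q by (auto simp: eigenvalues_def)
  moreover have "app (T - sc z) x \<in> V"
    using x inv[of x] V by (simp add: V_def vec.subspace_diff vec.subspace_scale)
  moreover have "\<forall>x\<in>V. app (ev (fps_of_poly q) T) x = 0 \<longrightarrow> x = 0"
    if "\<forall>w\<in>eigenvalues V (app T). eval_fps (fps_of_poly q) w \<noteq> 0"
    using ev_inj_on_iff[OF V inv, of "fps_of_poly q"] that by blast
  ultimately have "app (T - sc z) x = 0"
    using k unfolding pev_def by blast
  thus ?thesis by simp
qed

lemma diagonalizable_on_invariant:
  assumes d: "vec.span {x. \<exists>c. app T x = c *s x} = UNIV"
    and V: "vec.subspace V" "\<And>x. x \<in> V \<Longrightarrow> app T x \<in> V"
  shows "V \<subseteq> vec.span {x\<in>V. \<exists>c. app T x = c *s x}"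
proof -
  have "{x\<in>V. \<exists>z m. app ((T - sc z) ^ m) x = 0} \<subseteq> {x\<in>V. \<exists>c. app T x = c *s x}"
    using diagonalizable_gen_eigenvector[OF d] by blast
  hence "gen_span T V \<subseteq> vec.span {x\<in>V. \<exists>c. app T x = c *s x}"
    unfolding gen_span_def by (rule vec.span_mono)
  moreover have "gen_span T V = V" using V by (rule gen_span_eq)
  ultimately show ?thesis by simp
qed

text \<open>
  A joint eigenspace of the operators treated so far is invariant under the next one, which therefore
  restricts to a diagonalizable operator on it.
\<close>

lemma jointly_diagonalizable:
  fixes T :: "'b \<Rightarrow> 'n::finite endo"
  assumes "finite Y"
    and "\<And>y. y \<in> Y \<Longrightarrow> vec.span {x. \<exists>c. app (T y) x = c *s x} = UNIV"
    and "\<And>y y'. y \<in> Y \<Longrightarrow> y' \<in> Y \<Longrightarrow> T y * T y' = T y' * T y"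
    and V: "vec.subspace V" "\<And>x y. y \<in> Y \<Longrightarrow> x \<in> V \<Longrightarrow> app (T y) x \<in> V"
  shows "V \<subseteq> vec.span {x\<in>V. \<forall>y\<in>Y. \<exists>c. app (T y) x = c *s x}"
  using assms
proof (induction Y)
  case empty thus ?case by (auto intro: vec.span_base)
next
  case (insert y Y)
  let ?S = "{x\<in>V. \<forall>y'\<in>insert y Y. \<exists>c. app (T y') x = c *s x}"
  have "V \<subseteq> vec.span {x\<in>V. \<forall>y\<in>Y. \<exists>c. app (T y) x = c *s x}"
    by (rule insert.IH) (use insert.prems in auto)
  also have "\<dots> \<subseteq> vec.span ?S"
  proof (rule vec.span_minimal)
    show "{x\<in>V. \<forall>y\<in>Y. \<exists>c. app (T y) x = c *s x} \<subseteq> vec.span ?S"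
    proof safe
      fix x assume x: "x \<in> V" "\<forall>y\<in>Y. \<exists>c. app (T y) x = c *s x"
      then obtain c where c: "\<And>y. y \<in> Y \<Longrightarrow> app (T y) x = c y *s x" by metis
      define W where "W = {w\<in>V. \<forall>y\<in>Y. app (T y) w = c y *s w}"
      have W: "vec.subspace W" using insert.prems(3) unfolding W_def vec.subspace_def
        by (auto simp: vector_add_ldistrib vector_smult_assoc mult.commute)
      have "app (T y) w \<in> W" if "w \<in> W" for w
      proof -
        have "app (T y') (app (T y) w) = app (T y) (app (T y') w)" if "y' \<in> Y" for y'
          using insert.prems(2)[of y y'] that by (metis app_simps(1) insertI1 insertI2)
        thus ?thesis using that insert.prems(4) by (auto simp: W_def)
      qed
      from diagonalizable_on_invariant[OF insert.prems(1) W this]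
      have "x \<in> vec.span {w\<in>W. \<exists>c. app (T y) w = c *s w}" using x c by (auto simp: W_def)
      moreover have "{w\<in>W. \<exists>c. app (T y) w = c *s w} \<subseteq> ?S" by (auto simp: W_def)
      ultimately show "x \<in> vec.span ?S" using vec.span_mono by blast
    qed
  qed auto
  finally show ?case .
qed

text \<open>
  In a basis of eigenvectors the trace is a sum of squares of real numbers.
\<close>

lemma trace_square_real_spectrum:
  fixes T :: "'n::finite endo"
  assumes d: "vec.span {x. \<exists>c::real. app T x = of_real c *s x} = UNIV"
    and t: "trace (mat_of T ** mat_of T) = 0"
  shows "T = 0"
proof -
  obtain B where B: "B \<subseteq> {x. \<exists>c::real. app T x = of_real c *s x}" "vec.independent B"
    "{x. \<exists>c::real. app T x = of_real c *s x} \<subseteq> vec.span B"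
    by (rule vec.maximal_independent_subset)
  have sp: "vec.span B = UNIV"
    using d B(3) vec.span_minimal[OF B(3)] by auto
  have "card B = vec.dim (UNIV :: (complex^'n) set)"
    using vec.basis_card_eq_dim[of B UNIV] B(2) sp by auto
  hence "card B = CARD('n)" by (simp add: card_cart_basis)
  moreover have "finite B" by (rule vec.finiteI_independent[OF B(2)])
  ultimately obtain f :: "'n \<Rightarrow> complex^'n" where f: "bij_betw f UNIV B"
    using finite_same_card_bij[of "UNIV :: 'n set" B] by auto
  have "\<forall>i. \<exists>c::real. app T (f i) = of_real c *s f i"
    using f B(1) by (auto simp: bij_betw_def)
  then obtain c where c: "\<And>i. app T (f i) = of_real (c i) *s f i" by metis
  define E :: "complex^'n^'n" where "E = (\<chi> a i. f i $ a)"
  define D :: "complex^'n^'n" where "D = (\<chi> i j. if i = j then of_real (c i) else 0)"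
  have Ev: "E *v v = (\<Sum>i\<in>UNIV. v $ i *s f i)" for v
    by (simp add: vec_eq_iff E_def matrix_vector_mult_def mult.commute)
  have "v = 0" if "E *v v = 0" for v
  proof -
    have inj: "inj f" using f by (simp add: bij_betw_def)
    have "(\<Sum>w\<in>B. v $ (inv f w) *s w) = (\<Sum>i\<in>UNIV. v $ i *s f i)"
      by (subst sum.reindex_bij_betw[OF f, symmetric]) (simp add: inj)
    hence "\<forall>w\<in>B. v $ (inv f w) = 0"
      using B(2) that unfolding Ev vec.independent_explicit by metis
    hence "v $ i = 0" for i using f inj by (metis bij_betw_apply inv_f_f UNIV_I)
    thus ?thesis by (simp add: vec_eq_iff)
  qed
  then obtain E' where E': "E' ** E = mat 1" using matrix_left_invertible_ker[of E] by blast
  have "mat_of T ** E = E ** D"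
  proof -
    have "(mat_of T ** E) $ a $ i = app T (f i) $ a" for a i
      by (simp add: mat_of_works[symmetric] matrix_matrix_mult_def matrix_vector_mult_def E_def)
    moreover have "(E ** D) $ a $ i = of_real (c i) * f i $ a" for a i
      by (simp add: matrix_matrix_mult_def E_def D_def if_distrib mult.commute cong: if_cong)
    ultimately show ?thesis by (simp add: vec_eq_iff c)
  qed
  hence "mat_of T = E ** D ** E'"
    using E' matrix_left_right_inverse[of E' E] by (metis matrix_mul_assoc matrix_mul_rid)
  hence "mat_of T ** mat_of T = (E ** (D ** D)) ** E'"
    using E' by (metis matrix_mul_assoc matrix_mul_lid)
  hence "trace (mat_of T ** mat_of T) = trace (D ** D)"
    using E' by (metis trace_mul_sym matrix_mul_assoc matrix_mul_lid)
  also have "\<dots> = of_real (\<Sum>i\<in>UNIV. (c i)\<^sup>2)"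
    by (simp add: trace_def matrix_matrix_mult_def D_def if_distrib power2_eq_square cong: if_cong)
  finally have "(\<Sum>i\<in>UNIV. (c i)\<^sup>2) = 0" using t by (metis of_real_eq_0_iff)
  hence "c i = 0" for i by (subst (asm) sum_nonneg_eq_0_iff) auto
  hence "D = 0" by (simp add: D_def vec_eq_iff)
  hence "mat_of T = mat_of 0" using \<open>mat_of T = E ** D ** E'\<close> 
    by (simp add: vec_eq_iff mat_of_component matrix_matrix_mult_def)
  thus ?thesis by (rule mat_of_inject)
qed

text \<open>
  Functionals that are linear and linearly independent on \<open>h\<close> have dual points in \<open>h\<close>.  When a functional \<open>a\<close> is
  added, independence supplies a point on which \<open>a\<close> differs from the combination of the others that agrees with
  it at the dual points found so far; this point is corrected to a new dual point, which then corrects the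
  old ones.
\<close>

lemma dual_points:
  fixes \<Delta> :: "(complex^'n \<Rightarrow> complex) set" and h :: "(complex^'n) set"
  assumes "finite \<Delta>" "vec.subspace h"
    and "\<And>\<alpha>. \<alpha> \<in> \<Delta> \<Longrightarrow> (\<forall>x\<in>h. \<forall>y\<in>h. \<alpha> (x + y) = \<alpha> x + \<alpha> y) \<and> (\<forall>c. \<forall>x\<in>h. \<alpha> (c *s x) = c * \<alpha> x)"
    and "\<And>c. (\<forall>y\<in>h. (\<Sum>\<alpha>\<in>\<Delta>. c \<alpha> * \<alpha> y) = 0) \<Longrightarrow> \<forall>\<alpha>\<in>\<Delta>. c \<alpha> = 0"
  shows "\<exists>y. \<forall>\<alpha>\<in>\<Delta>. y \<alpha> \<in> h \<and> (\<forall>\<beta>\<in>\<Delta>. \<beta> (y \<alpha>) = (if \<alpha> = \<beta> then 1 else (0::complex)))"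
  using assms
proof (induction \<Delta>)
  case empty thus ?case by simp
next
  case (insert a \<Delta>)
  have "\<exists>y. \<forall>\<alpha>\<in>\<Delta>. y \<alpha> \<in> h \<and> (\<forall>\<beta>\<in>\<Delta>. \<beta> (y \<alpha>) = (if \<alpha> = \<beta> then 1 else 0))"
  proof (rule insert.IH)
    fix c assume "\<forall>y\<in>h. (\<Sum>\<alpha>\<in>\<Delta>. c \<alpha> * \<alpha> y) = 0"
    moreover have "(\<Sum>\<alpha>\<in>\<Delta>. (c(a := 0)) \<alpha> * \<alpha> y) = (\<Sum>\<alpha>\<in>\<Delta>. c \<alpha> * \<alpha> y)" for y
      using insert.hyps by (intro sum.cong) auto
    ultimately have "\<forall>\<alpha>\<in>insert a \<Delta>. (c(a := 0)) \<alpha> = 0"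
      using insert.hyps by (intro insert.prems(3)) auto
    thus "\<forall>\<alpha>\<in>\<Delta>. c \<alpha> = 0" using insert.hyps by (auto split: if_splits)
  qed (use insert.prems in auto)
  then obtain y where y: "\<And>\<alpha>. \<alpha> \<in> \<Delta> \<Longrightarrow> y \<alpha> \<in> h"
    "\<And>\<alpha> \<beta>. \<alpha> \<in> \<Delta> \<Longrightarrow> \<beta> \<in> \<Delta> \<Longrightarrow> \<beta> (y \<alpha>) = (if \<alpha> = \<beta> then 1 else 0)" by blast
  have lin: "\<alpha> (u + v) = \<alpha> u + \<alpha> v" "\<alpha> (k *s u) = k * \<alpha> u"
    if "\<alpha> \<in> insert a \<Delta>" "u \<in> h" "v \<in> h" for \<alpha> u v k
    using insert.prems(2)[OF that(1)] that by auto
  have lsum: "\<alpha> (\<Sum>i\<in>I. g i) = (\<Sum>i\<in>I. \<alpha> (g i)) \<and> (\<Sum>i\<in>I. g i) \<in> h"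
    if "\<alpha> \<in> insert a \<Delta>" "\<And>i. i \<in> I \<Longrightarrow> g i \<in> h" "finite I" for \<alpha> g and I :: "(complex^'n \<Rightarrow> complex) set"
    using that(3,2)
  proof (induction I)
    case empty
    have "0 \<in> h" using insert.prems(1) by (rule vec.subspace_0)
    thus ?case using lin(2)[OF that(1), of 0 0 0] by simp
  next
    case (insert i I)
    thus ?case using lin(1)[OF that(1), of "g i" "\<Sum>i\<in>I. g i"] \<open>vec.subspace h\<close> by (auto intro: vec.subspace_add)
  qed
  define c where "c \<alpha> = (if \<alpha> = a then 1 else - a (y \<alpha>))" for \<alpha>
  have "\<not> (\<forall>y\<in>h. (\<Sum>\<alpha>\<in>insert a \<Delta>. c \<alpha> * \<alpha> y) = 0)"
    using insert.prems(3)[of c] by (auto simp: c_def)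
  then obtain u where u: "u \<in> h" "(\<Sum>\<alpha>\<in>insert a \<Delta>. c \<alpha> * \<alpha> u) \<noteq> 0" by blast
  define k where "k = (\<Sum>\<alpha>\<in>insert a \<Delta>. c \<alpha> * \<alpha> u)"
  have k: "k = a u - (\<Sum>\<alpha>\<in>\<Delta>. a (y \<alpha>) * \<alpha> u)"
    unfolding k_def using insert.hyps
    by (subst sum.insert) (auto simp: c_def sum_negf[symmetric] intro!: sum.cong)
  define v where "v = (1 / k) *s (u + (\<Sum>\<alpha>\<in>\<Delta>. (- \<alpha> u) *s y \<alpha>))"
  have yh: "(- \<alpha> u) *s y \<alpha> \<in> h" if "\<alpha> \<in> \<Delta>" for \<alpha>
    using y(1)[OF that] insert.prems(1) by (intro vec.subspace_scale)
  have sh: "(\<Sum>\<alpha>\<in>\<Delta>. (- \<alpha> u) *s y \<alpha>) \<in> h"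
    using lsum[of a \<Delta> "\<lambda>\<alpha>. (- \<alpha> u) *s y \<alpha>"] yh insert.hyps by auto
  hence vh: "v \<in> h" unfolding v_def using u(1) insert.prems(1) by (intro vec.subspace_scale vec.subspace_add)
  have ev_v: "\<beta> v = (1 / k) * (\<beta> u + (\<Sum>\<alpha>\<in>\<Delta>. - \<alpha> u * \<beta> (y \<alpha>)))" if "\<beta> \<in> insert a \<Delta>" for \<beta>
  proof -
    have "\<beta> (\<Sum>\<alpha>\<in>\<Delta>. (- \<alpha> u) *s y \<alpha>) = (\<Sum>\<alpha>\<in>\<Delta>. \<beta> ((- \<alpha> u) *s y \<alpha>))"
      using lsum[OF that, of \<Delta> "\<lambda>\<alpha>. (- \<alpha> u) *s y \<alpha>"] yh insert.hyps(1) by blast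
    also have "\<dots> = (\<Sum>\<alpha>\<in>\<Delta>. - \<alpha> u * \<beta> (y \<alpha>))"
      by (intro sum.cong refl lin(2)[OF that y(1) y(1)])
    finally have S: "\<beta> (\<Sum>\<alpha>\<in>\<Delta>. (- \<alpha> u) *s y \<alpha>) = (\<Sum>\<alpha>\<in>\<Delta>. - \<alpha> u * \<beta> (y \<alpha>))" .
    have us: "u + (\<Sum>\<alpha>\<in>\<Delta>. (- \<alpha> u) *s y \<alpha>) \<in> h" using u(1) sh insert.prems(1) by (intro vec.subspace_add)
    show ?thesis unfolding v_def lin(2)[OF that us us] lin(1)[OF that u(1) sh] S ..
  qed
  have va: "a v = 1"
    using u(2) k unfolding ev_v[of a, simplified] k_def[symmetric]
    by (simp add: sum_negf mult.commute)
  have vb: "\<beta> v = 0" if "\<beta> \<in> \<Delta>" for \<beta>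
  proof -
    have "(\<Sum>\<alpha>\<in>\<Delta>. - \<alpha> u * \<beta> (y \<alpha>)) = (\<Sum>\<alpha>\<in>\<Delta>. if \<alpha> = \<beta> then - \<beta> u else 0)"
      by (intro sum.cong) (auto simp: y that)
    thus ?thesis using that insert.hyps by (simp add: ev_v)
  qed
  define y' where "y' \<alpha> = (if \<alpha> = a then v else y \<alpha> + (- a (y \<alpha>)) *s v)" for \<alpha>
  have "y' \<alpha> \<in> h \<and> (\<forall>\<beta>\<in>insert a \<Delta>. \<beta> (y' \<alpha>) = (if \<alpha> = \<beta> then 1 else 0))" if \<alpha>: "\<alpha> \<in> insert a \<Delta>" for \<alpha>
  proof (cases "\<alpha> = a")
    case True thus ?thesis using va vb vh insert.hyps by (auto simp: y'_def)
  next
    case False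
    hence d: "\<alpha> \<in> \<Delta>" using \<alpha> by simp
    have sv: "(- a (y \<alpha>)) *s v \<in> h" using vh insert.prems(1) by (intro vec.subspace_scale)
    have E: "\<beta> (y' \<alpha>) = \<beta> (y \<alpha>) - a (y \<alpha>) * \<beta> v" if "\<beta> \<in> insert a \<Delta>" for \<beta>
      using False lin(1)[OF that y(1)[OF d] sv] lin(2)[OF that vh vh, of "- a (y \<alpha>)"] by (simp add: y'_def)
    have "y' \<alpha> \<in> h" using False sv y(1)[OF d] insert.prems(1) by (simp only: y'_def if_False vec.subspace_add)
    moreover have "a (y' \<alpha>) = 0" using E[of a] va by simp
    moreover have "\<beta> (y' \<alpha>) = (if \<alpha> = \<beta> then 1 else 0)" if "\<beta> \<in> \<Delta>" for \<beta>
      using E[of \<beta>] vb[OF that] y(2)[OF d that] that by simp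
    ultimately show ?thesis using False by auto
  qed
  thus ?case by blast
qed

subsection \<open>The structure of a Levi subalgebra\<close>

context
  fixes br :: "complex^'n \<Rightarrow> complex^'n \<Rightarrow> complex^'n" and h \<Delta>
  assumes simple: "simple_lie_algebra br" and cartan: "cartan_subalgebra br h"
    and sroots: "simple_roots br h \<Delta>"
begin

lemma lie: "lie_algebra br" using simple by (simp add: simple_lie_algebra_def)

lemmas br = br_simps[OF lie]
lemmas app_ad' [simp] = app_ad[OF lie]

lemma subspace_h: "vec.subspace h"
  and h_abelian: "y \<in> h \<Longrightarrow> z \<in> h \<Longrightarrow> br y z = 0"
  and h_maximal: "(\<forall>y\<in>h. br y x = 0) \<Longrightarrow> x \<in> h"
  and h_diagonalizable: "y \<in> h \<Longrightarrow> vec.span {x. \<exists>c. br y x = c *s x} = UNIV"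
  using cartan unfolding cartan_subalgebra_def by blast+

text \<open>
  It suffices to diagonalize \<open>ad y\<close> simultaneously for the finitely many \<open>y\<close> in a basis of \<open>h\<close>.
\<close>

lemma joint_eigenvectors_span:
  assumes V: "vec.subspace V" "\<And>x y. y \<in> h \<Longrightarrow> x \<in> V \<Longrightarrow> br y x \<in> V"
  shows "V \<subseteq> vec.span {x\<in>V. \<forall>y\<in>h. \<exists>c. br y x = c *s x}"
proof -
  obtain B where B: "B \<subseteq> h" "vec.independent B" "h \<subseteq> vec.span B"
    by (rule vec.maximal_independent_subset)
  have fB: "finite B" by (rule vec.finiteI_independent[OF B(2)])
  have "V \<subseteq> vec.span {x\<in>V. \<forall>y\<in>B. \<exists>c. app (ad br y) x = c *s x}"
  proof (rule jointly_diagonalizable[OF fB _ _ V(1)])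
    fix y assume y: "y \<in> B"
    thus "vec.span {x. \<exists>c. app (ad br y) x = c *s x} = UNIV"
      using h_diagonalizable[of y] B(1) by auto
    fix y' assume "y' \<in> B"
    hence "br y y' = 0" using h_abelian y B(1) by blast
    thus "ad br y * ad br y' = ad br y' * ad br y"
      using ad_br[OF lie, of y y'] by (simp add: ad_linear[OF lie])
  qed (use V B(1) in auto)
  also have "{x\<in>V. \<forall>y\<in>B. \<exists>c. app (ad br y) x = c *s x} = {x\<in>V. \<forall>y\<in>h. \<exists>c. br y x = c *s x}"
  proof safe
    fix x y assume x: "\<forall>y\<in>B. \<exists>c. app (ad br y) x = c *s x" and y: "y \<in> h"
    have "y \<in> vec.span B" using y B(3) by blast
    thus "\<exists>c. br y x = c *s x"
    proof (induction y rule: vec.span_induct)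
      case base
      have "br 0 x = 0 *s x" by (simp add: br)
      moreover have "br (u + v) x = (c + d) *s x" if "br u x = c *s x" "br v x = d *s x" for u v c d
        using that by (simp add: br vector_sadd_rdistrib)
      moreover have "br (k *s u) x = (k * c) *s x" if "br u x = c *s x" for u c k
        using that by (simp add: br vector_smult_assoc)
      ultimately show ?case unfolding vec.subspace_def by blast
    qed (use x in auto)
  qed (use B(1) in auto)
  finally show ?thesis .
qed

lemma joint_eigenvector_cases:
  assumes x: "\<forall>y\<in>h. \<exists>c. br y x = c *s x" "x \<noteq> 0"
  shows "x \<in> h \<or> (\<exists>\<alpha>\<in>roots br h. x \<in> root_space br h \<alpha>)"
proof -
  from x(1) obtain c where c: "\<And>y. y \<in> h \<Longrightarrow> br y x = c y *s x" by metis
  define \<alpha> where "\<alpha> y = (if y \<in> h then c y else 0)" for y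
  have can: "a = b" if "a *s x = b *s x" for a b
    using that x(2) by (metis vector_mul_rcancel)
  have r: "x \<in> root_space br h \<alpha>" by (simp add: root_space_def \<alpha>_def c)
  show ?thesis
  proof (cases "\<exists>y. \<alpha> y \<noteq> 0")
    case True
    have "\<alpha> (u + v) = \<alpha> u + \<alpha> v" if "u \<in> h" "v \<in> h" for u v
    proof (rule can)
      have "u + v \<in> h" using that subspace_h by (rule_tac vec.subspace_add)
      thus "\<alpha> (u + v) *s x = (\<alpha> u + \<alpha> v) *s x"
        using that c[of "u + v"] c[of u] c[of v] by (simp add: \<alpha>_def br vector_sadd_rdistrib)
    qed
    moreover have "\<alpha> (k *s u) = k * \<alpha> u" if "u \<in> h" for u k
    proof (rule can)
      have "k *s u \<in> h" using that subspace_h by (rule_tac vec.subspace_scale)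
      thus "\<alpha> (k *s u) *s x = (k * \<alpha> u) *s x"
        using that c[of "k *s u"] c[of u] by (simp add: \<alpha>_def br(3) vector_smult_assoc del: vector_mul_rcancel)
    qed
    moreover have "root_space br h \<alpha> \<noteq> {0}" using r x(2) by blast
    ultimately have "\<alpha> \<in> roots br h" using True unfolding roots_def by (auto simp: \<alpha>_def)
    thus ?thesis using r by blast
  next
    case False
    hence "\<forall>y\<in>h. br y x = 0" using r by (auto simp: root_space_def)
    thus ?thesis using h_maximal by blast
  qed
qed

lemma simple_root_values:
  shows "\<exists>\<rho>\<in>h. \<forall>\<alpha>\<in>\<Delta>. \<alpha> \<rho> = t \<alpha>"
proof -
  have R: "\<Delta> \<subseteq> roots br h" "finite \<Delta>" using sroots by (auto simp: simple_roots_def)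
  have "\<exists>y. \<forall>\<alpha>\<in>\<Delta>. y \<alpha> \<in> h \<and> (\<forall>\<beta>\<in>\<Delta>. \<beta> (y \<alpha>) = (if \<alpha> = \<beta> then 1 else 0))"
  proof (rule dual_points[OF R(2) subspace_h])
    fix c assume c: "\<forall>y\<in>h. (\<Sum>\<alpha>\<in>\<Delta>. c \<alpha> * \<alpha> y) = 0"
    have "(\<Sum>\<alpha>\<in>\<Delta>. c \<alpha> * \<alpha> y) = 0" if "y \<notin> h" for y
      using R(1) that by (intro sum.neutral) (auto simp: roots_def)
    hence "\<forall>y. (\<Sum>\<alpha>\<in>\<Delta>. c \<alpha> * \<alpha> y) = 0" using c by blast
    thus "\<forall>\<alpha>\<in>\<Delta>. c \<alpha> = 0" using sroots unfolding simple_roots_def by blast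
  qed (use R in \<open>auto simp: roots_def\<close>)
  then obtain y where y: "\<And>\<alpha>. \<alpha> \<in> \<Delta> \<Longrightarrow> y \<alpha> \<in> h"
    "\<And>\<alpha> \<beta>. \<alpha> \<in> \<Delta> \<Longrightarrow> \<beta> \<in> \<Delta> \<Longrightarrow> \<beta> (y \<alpha>) = (if \<alpha> = \<beta> then 1 else 0)" by blast
  define \<rho> where "\<rho> = (\<Sum>\<alpha>\<in>\<Delta>. t \<alpha> *s y \<alpha>)"
  have "\<rho> \<in> h" unfolding \<rho>_def
    using y(1) subspace_h by (intro vec.subspace_sum vec.subspace_scale) auto
  moreover have "\<beta> \<rho> = t \<beta>" if b: "\<beta> \<in> \<Delta>" for \<beta>
  proof -
    have l: "\<beta> (u + v) = \<beta> u + \<beta> v" "\<beta> (k *s u) = k * \<beta> u" if "u \<in> h" "v \<in> h" for u v k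
      using b R(1) that by (auto simp: roots_def)
    have "\<beta> (\<Sum>\<alpha>\<in>I. t \<alpha> *s y \<alpha>) = (\<Sum>\<alpha>\<in>I. t \<alpha> * \<beta> (y \<alpha>)) \<and> (\<Sum>\<alpha>\<in>I. t \<alpha> *s y \<alpha>) \<in> h"
      if "I \<subseteq> \<Delta>" for I
      using finite_subset[OF that R(2)] that
    proof (induction I)
      case empty
      have "0 \<in> h" using subspace_h by (rule vec.subspace_0)
      thus ?case using l(2)[of 0 0 0] by simp
    next
      case (insert i I)
      have i: "t i *s y i \<in> h" using y(1)[of i] insert.prems subspace_h by (auto intro: vec.subspace_scale)
      have I: "\<beta> (\<Sum>\<alpha>\<in>I. t \<alpha> *s y \<alpha>) = (\<Sum>\<alpha>\<in>I. t \<alpha> * \<beta> (y \<alpha>))" "(\<Sum>\<alpha>\<in>I. t \<alpha> *s y \<alpha>) \<in> h"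
        using insert by auto
      show ?case using insert.hyps l(1)[OF i I(2)] l(2)[OF y(1) y(1), of i i "t i"] I i insert.prems subspace_h
        by (simp add: vec.subspace_add)
    qed
    from this[of \<Delta>] have "\<beta> \<rho> = (\<Sum>\<alpha>\<in>\<Delta>. t \<alpha> * (if \<alpha> = \<beta> then 1 else 0))"
      unfolding \<rho>_def using y(2)[OF _ b] by (auto intro!: sum.cong)
    thus ?thesis using b R(2) by (simp add: if_distrib cong: if_cong)
  qed
  ultimately show ?thesis by blast
qed

lemma center_trivial: assumes "\<And>y. br x y = 0" shows "x = 0"
proof -
  define C where "C = {x. \<forall>y. br x y = 0}"
  have "vec.subspace C" unfolding C_def vec.subspace_def by (auto simp: br)
  moreover have "br z c \<in> C" if "c \<in> C" for z c
    using that br_anti[OF lie, of z c] by (auto simp: C_def br)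
  ultimately have "C = {0} \<or> C = UNIV" using simple unfolding simple_lie_algebra_def by blast
  moreover have "C \<noteq> UNIV" using simple unfolding simple_lie_algebra_def C_def by blast
  ultimately show ?thesis using assms by (auto simp: C_def)
qed

lemma root_space_eigen:
  "\<alpha> \<in> roots br h \<Longrightarrow> x \<in> root_space br h \<alpha> \<Longrightarrow> y \<in> h \<Longrightarrow> br y x = \<alpha> y *s x"
  by (simp add: root_space_def)

lemma root_expansion:
  assumes "\<beta> \<in> roots br h"
  shows "\<exists>(s :: complex) (k :: _ \<Rightarrow> nat). (s = 1 \<or> s = -1) \<and>
    (\<forall>y. \<beta> y = s * (\<Sum>\<alpha>\<in>\<Delta>. of_nat (k \<alpha>) * \<alpha> y))"
proof -
  obtain k :: "_ \<Rightarrow> nat" where "(\<forall>y. \<beta> y = (\<Sum>\<alpha>\<in>\<Delta>. of_nat (k \<alpha>) * \<alpha> y)) \<or>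
      (\<forall>y. \<beta> y = - (\<Sum>\<alpha>\<in>\<Delta>. of_nat (k \<alpha>) * \<alpha> y))"
    using sroots assms unfolding simple_roots_def by blast
  thus ?thesis
  proof
    assume "\<forall>y. \<beta> y = (\<Sum>\<alpha>\<in>\<Delta>. of_nat (k \<alpha>) * \<alpha> y)"
    thus ?thesis by (intro exI[of _ 1] exI[of _ k]) simp
  next
    assume "\<forall>y. \<beta> y = - (\<Sum>\<alpha>\<in>\<Delta>. of_nat (k \<alpha>) * \<alpha> y)"
    thus ?thesis by (intro exI[of _ "-1"] exI[of _ k]) simp
  qed
qed

text \<open>
  The radical of the Killing form is an ideal, so it is zero or everything.  Suppose it is everything, and
  let \<open>\<rho>\<close> be the element of \<open>h\<close> on which every simple root is \<open>1\<close>.  Every root takes a nonzero integral value on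
  \<open>\<rho>\<close>, so \<open>ad \<rho>\<close> has real spectrum, and \<open>tr (ad \<rho>)\<^sup>2 = 0\<close> forces \<open>ad \<rho> = 0\<close>.  Then there are no roots, and the
  whole algebra is the abelian algebra \<open>h\<close>.
\<close>

lemma killing_nondegenerate:
  assumes "\<And>y. killing_form br x y = 0" shows "x = 0"
proof -
  define R where "R = {x. \<forall>y. killing_form br x y = 0}"
  have K: "invariant_form br (killing_form br)" by (rule killing_invariant[OF lie])
  have K0: "killing_form br 0 y = 0" for y
    using K unfolding invariant_form_def by (metis mult_zero_left vector_smult_lzero)
  have "vec.subspace R" using K K0 unfolding R_def vec.subspace_def invariant_form_def by auto
  moreover have "br z c \<in> R" if "c \<in> R" for z c
  proof -
    have "killing_form br (br z c) y = - killing_form br (br c z) y" for y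
    proof -
      have "br z c = (-1) *s br c z" using br_anti[OF lie, of z c] by simp
      thus ?thesis using K unfolding invariant_form_def by (metis mult_minus1)
    qed
    moreover have "killing_form br (br c z) y = killing_form br c (br z y)" for y
      using K unfolding invariant_form_def by blast
    ultimately show ?thesis using that by (auto simp: R_def)
  qed
  ultimately have "R = {0} \<or> R = UNIV" using simple unfolding simple_lie_algebra_def by blast
  moreover have False if R: "R = UNIV"
  proof -
    obtain \<rho> where \<rho>: "\<rho> \<in> h" "\<And>\<alpha>. \<alpha> \<in> \<Delta> \<Longrightarrow> \<alpha> \<rho> = 1" using simple_root_values[of "\<lambda>_. 1"] by auto
    have int: "\<exists>n::int. \<beta> \<rho> = of_int n \<and> n \<noteq> 0" if b: "\<beta> \<in> roots br h" for \<beta>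
    proof -
      obtain k :: "_ \<Rightarrow> nat" and s where k: "s = 1 \<or> s = (-1::complex)"
        "\<forall>y. \<beta> y = s * (\<Sum>\<alpha>\<in>\<Delta>. of_nat (k \<alpha>) * \<alpha> y)" using root_expansion[OF b] by blast
      have "(\<Sum>\<alpha>\<in>\<Delta>. of_nat (k \<alpha>) * \<alpha> \<rho>) = (\<Sum>\<alpha>\<in>\<Delta>. of_nat (k \<alpha>))"
      proof (rule sum.cong)
        fix \<alpha> assume "\<alpha> \<in> \<Delta>"
        from \<rho>(2)[OF this] show "of_nat (k \<alpha>) * \<alpha> \<rho> = of_nat (k \<alpha>)" by simp
      qed simp
      hence "\<beta> \<rho> = s * of_nat (\<Sum>\<alpha>\<in>\<Delta>. k \<alpha>)" using k(2)[THEN spec, of \<rho>] by simp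
      moreover have "(\<Sum>\<alpha>\<in>\<Delta>. k \<alpha>) \<noteq> 0"
      proof
        assume "(\<Sum>\<alpha>\<in>\<Delta>. k \<alpha>) = 0"
        hence "\<forall>\<alpha>\<in>\<Delta>. k \<alpha> = 0" using sroots by (simp add: simple_roots_def)
        hence "\<beta> y = 0" for y using k(2)[THEN spec, of y] by simp
        thus False using b by (simp add: roots_def)
      qed
      ultimately show ?thesis using k(1)
        by (auto intro: exI[of _ "int (\<Sum>\<alpha>\<in>\<Delta>. k \<alpha>)"] exI[of _ "- int (\<Sum>\<alpha>\<in>\<Delta>. k \<alpha>)"] simp del: of_nat_sum)
    qed
    let ?S = "{x\<in>UNIV. \<forall>y\<in>h. \<exists>c. br y x = c *s x}"
    have S: "vec.span ?S = UNIV" using joint_eigenvectors_span[of UNIV] by (auto simp: vec.subspace_UNIV)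
    have "?S \<subseteq> {x. \<exists>c::real. app (ad br \<rho>) x = of_real c *s x}"
    proof
      fix x assume x: "x \<in> ?S"
      consider "x = 0" | "x \<in> h" | \<alpha> where "\<alpha> \<in> roots br h" "x \<in> root_space br h \<alpha>"
        using joint_eigenvector_cases[of x] x by auto
      hence "\<exists>c::real. br \<rho> x = of_real c *s x"
      proof cases
        case 2
        hence "br \<rho> x = of_real 0 *s x" using h_abelian[OF \<rho>(1)] by simp
        thus ?thesis by blast
      next
        case 3
        obtain n :: int where "\<alpha> \<rho> = of_int n" using int[OF 3(1)] by blast
        hence "br \<rho> x = of_real (of_int n) *s x" using root_space_eigen[OF 3 \<rho>(1)] by simp
        thus ?thesis by blast
      qed (simp add: br)
      thus "x \<in> {x. \<exists>c::real. app (ad br \<rho>) x = of_real c *s x}" by simp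
    qed
    hence "vec.span {x. \<exists>c::real. app (ad br \<rho>) x = of_real c *s x} = UNIV"
      using S vec.span_mono by blast
    moreover have "trace (mat_of (ad br \<rho>) ** mat_of (ad br \<rho>)) = 0"
    proof -
      have "killing_form br \<rho> \<rho> = 0" using R unfolding R_def by blast
      thus ?thesis using killing_form_trace[OF lie, of \<rho> \<rho>] by (simp add: mat_of_mult)
    qed
    ultimately have ad0: "ad br \<rho> = 0" by (rule trace_square_real_spectrum)
    have no: "roots br h = {}"
    proof (rule ccontr)
      assume "roots br h \<noteq> {}"
      then obtain \<alpha> where a: "\<alpha> \<in> roots br h" by blast
      have "0 \<in> root_space br h \<alpha>" by (simp add: root_space_def br)
      then obtain x where x: "x \<in> root_space br h \<alpha>" "x \<noteq> 0" using a unfolding roots_def by blast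
      have "br \<rho> x = 0" using ad0 app_ad'[of \<rho> x] by simp
      hence "\<alpha> \<rho> = 0" using root_space_eigen[OF a x(1) \<rho>(1)] x(2) by simp
      thus False using int[OF a] by auto
    qed
    have "?S \<subseteq> h" using joint_eigenvector_cases no subspace_h by (fastforce simp: vec.subspace_0)
    hence "UNIV = h" using S vec.span_minimal[OF _ subspace_h, of ?S] by auto
    hence "br x y = 0" for x y using cartan unfolding cartan_subalgebra_def by blast
    thus False using simple unfolding simple_lie_algebra_def by blast
  qed
  ultimately show ?thesis using assms by (auto simp: R_def)
qed

text \<open>
  Take the element \<open>\<rho>\<close> of \<open>h\<close> on which the simple roots in \<open>\<Gamma>\<close> are \<open>0\<close> and the others are \<open>1\<close>.  The coefficients
  of a root with respect to \<open>\<Delta>\<close> have one sign, so the root vanishes at \<open>\<rho>\<close> exactly if it is a combination of \<open>\<Gamma>\<close>.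
\<close>

lemma levi_centralizer:
  assumes \<Gamma>: "\<Gamma> \<subseteq> \<Delta>"
    and l: "l = vec.span (h \<union> \<Union> {root_space br h \<beta> | \<beta>.
             \<beta> \<in> roots br h \<and> (\<exists>m :: _ \<Rightarrow> int. \<forall>y. \<beta> y = (\<Sum>\<alpha>\<in>\<Gamma>. of_int (m \<alpha>) * \<alpha> y))})"
  obtains \<rho> where "\<rho> \<in> h" "l = {x. br \<rho> x = 0}"
proof -
  obtain \<rho> where \<rho>: "\<rho> \<in> h" "\<And>\<alpha>. \<alpha> \<in> \<Delta> \<Longrightarrow> \<alpha> \<rho> = (if \<alpha> \<in> \<Gamma> then 0 else 1)"
    using simple_root_values[of "\<lambda>\<alpha>. if \<alpha> \<in> \<Gamma> then 0 else 1"] by auto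
  have fin: "finite \<Delta>" using sroots by (simp add: simple_roots_def)
  let ?Z = "{x. br \<rho> x = 0}"
  have Z: "vec.subspace ?Z" unfolding vec.subspace_def by (auto simp: br)
  have "l \<subseteq> ?Z" unfolding l
  proof (rule vec.span_minimal[OF _ Z], safe)
    fix x assume "x \<in> h" thus "br \<rho> x = 0" by (rule h_abelian[OF \<rho>(1)])
  next
    fix x \<beta> and m :: "_ \<Rightarrow> int"
    assume b: "\<beta> \<in> roots br h" "x \<in> root_space br h \<beta>" and m: "\<forall>y. \<beta> y = (\<Sum>\<alpha>\<in>\<Gamma>. of_int (m \<alpha>) * \<alpha> y)"
    have "\<beta> \<rho> = (\<Sum>\<alpha>\<in>\<Gamma>. of_int (m \<alpha>) * \<alpha> \<rho>)" using m by blast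
    also have "\<dots> = 0"
    proof (rule sum.neutral, safe)
      fix \<alpha> assume "\<alpha> \<in> \<Gamma>"
      with \<rho>(2)[of \<alpha>] \<Gamma> have "\<alpha> \<rho> = 0" by auto
      thus "of_int (m \<alpha>) * \<alpha> \<rho> = 0" by simp
    qed
    finally have "\<beta> \<rho> = 0" .
    thus "br \<rho> x = 0" using root_space_eigen[OF b \<rho>(1)] by simp
  qed
  moreover have "?Z \<subseteq> l"
  proof -
    have "?Z \<subseteq> vec.span {x\<in>?Z. \<forall>y\<in>h. \<exists>c. br y x = c *s x}"
    proof (rule joint_eigenvectors_span[OF Z])
      fix x y assume "y \<in> h" "x \<in> ?Z"
      moreover have "br \<rho> y = 0" using \<open>y \<in> h\<close> by (rule h_abelian[OF \<rho>(1)])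
      ultimately show "br y x \<in> ?Z" using jacobi[OF lie, of \<rho> y x] by (simp add: br)
    qed
    also have "\<dots> \<subseteq> l"
    proof (rule vec.span_minimal)
      show "vec.subspace l" by (simp add: l)
      show "{x\<in>?Z. \<forall>y\<in>h. \<exists>c. br y x = c *s x} \<subseteq> l"
      proof
        fix x assume x: "x \<in> {x\<in>?Z. \<forall>y\<in>h. \<exists>c. br y x = c *s x}"
        consider "x = 0" | "x \<in> h" | \<beta> where "x \<noteq> 0" "\<beta> \<in> roots br h" "x \<in> root_space br h \<beta>"
          using joint_eigenvector_cases[of x] x by auto
        thus "x \<in> l"
        proof cases
          case 3
          have "\<beta> \<rho> = 0" using root_space_eigen[OF 3(2,3) \<rho>(1)] x 3(1) by simp
          obtain k :: "_ \<Rightarrow> nat" and s where k: "s = 1 \<or> s = (-1::complex)"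
            "\<forall>y. \<beta> y = s * (\<Sum>\<alpha>\<in>\<Delta>. of_nat (k \<alpha>) * \<alpha> y)" using root_expansion[OF 3(2)] by blast
          have "(\<Sum>\<alpha>\<in>\<Delta>. of_nat (k \<alpha>) * \<alpha> \<rho>) = of_nat (\<Sum>\<alpha>\<in>\<Delta> - \<Gamma>. k \<alpha>)"
            unfolding of_nat_sum
          proof (rule sum.mono_neutral_cong_right[OF fin])
            show "\<forall>\<alpha>\<in>\<Delta> - (\<Delta> - \<Gamma>). of_nat (k \<alpha>) * \<alpha> \<rho> = 0"
            proof
              fix \<alpha> assume "\<alpha> \<in> \<Delta> - (\<Delta> - \<Gamma>)"
              with \<rho>(2)[of \<alpha>] have "\<alpha> \<rho> = 0" by auto
              thus "of_nat (k \<alpha>) * \<alpha> \<rho> = 0" by simp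
            qed
            fix \<alpha> assume "\<alpha> \<in> \<Delta> - \<Gamma>"
            with \<rho>(2)[of \<alpha>] have "\<alpha> \<rho> = 1" by auto
            thus "of_nat (k \<alpha>) * \<alpha> \<rho> = of_nat (k \<alpha>)" by simp
          qed auto
          hence "(\<Sum>\<alpha>\<in>\<Delta> - \<Gamma>. k \<alpha>) = 0" using k(1) k(2)[THEN spec, of \<rho>] \<open>\<beta> \<rho> = 0\<close>
            by (auto simp del: of_nat_sum)
          hence k0: "k \<alpha> = 0" if "\<alpha> \<in> \<Delta> - \<Gamma>" for \<alpha> using fin that by simp
          have "(\<Sum>\<alpha>\<in>\<Delta>. of_nat (k \<alpha>) * \<alpha> y) = (\<Sum>\<alpha>\<in>\<Gamma>. of_nat (k \<alpha>) * (\<alpha> y :: complex))" for y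
            using fin \<Gamma> k0 by (intro sum.mono_neutral_right) auto
          hence "\<beta> y = (\<Sum>\<alpha>\<in>\<Gamma>. of_int ((if s = 1 then 1 else -1) * int (k \<alpha>)) * \<alpha> y)" for y
            using k(1) k(2)[THEN spec, of y] by (auto simp: sum_negf)
          hence "\<exists>m :: _ \<Rightarrow> int. \<forall>y. \<beta> y = (\<Sum>\<alpha>\<in>\<Gamma>. of_int (m \<alpha>) * \<alpha> y)"
            by (intro exI[of _ "\<lambda>\<alpha>. (if s = 1 then 1 else -1) * int (k \<alpha>)"]) blast
          thus ?thesis using 3 unfolding l by (intro vec.span_base) blast
        qed (auto simp: l intro: vec.span_base vec.span_zero)
      qed
    qed
    finally show ?thesis .
  qed
  ultimately show ?thesis using that \<rho>(1) by blast
qed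

text \<open>
  Since \<open>ad \<rho>\<close> is diagonalizable and skew, the space is the orthogonal direct sum of its kernel and its range, for
  every invariant form.  The range does not depend on the form; this is why the Killing form and any other
  nondegenerate invariant form give the same orthogonal complement of the centralizer.
\<close>

lemma orthogonal_of_centralizer:
  assumes B: "invariant_form br B" "\<And>x. (\<And>y. B x y = 0) \<Longrightarrow> x = 0" and \<rho>: "\<rho> \<in> h"
  shows "{x. \<forall>y. br \<rho> y = 0 \<longrightarrow> B x y = 0} = range (br \<rho>)"
proof -
  have B0: "B 0 y = 0" for y using B(1) unfolding invariant_form_def by (metis mult_zero_left vector_smult_lzero)
  have sym: "B x y = B y x" and inv: "B (br x y) z = B x (br y z)"
    and add: "B (x + y) z = B x z + B y z" for x y z
    using B(1) unfolding invariant_form_def by blast+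
  have im: "B (br \<rho> x) y = 0" if "br \<rho> y = 0" for x y
    using that inv[of y \<rho> x] sym[of "br \<rho> x" y] br_anti[OF lie, of y \<rho>] B0 by simp
  have dec: "\<exists>a b. br \<rho> a = 0 \<and> x = a + br \<rho> b" for x
  proof -
    have "x \<in> vec.span {x. \<exists>c. br \<rho> x = c *s x}" using h_diagonalizable[OF \<rho>] by simp
    thus ?thesis
    proof (induction x rule: vec.span_induct)
      case base
      show ?case unfolding vec.subspace_def
      proof (safe)
        show "\<exists>a b. br \<rho> a = 0 \<and> 0 = a + br \<rho> b" by (rule exI[of _ 0], rule exI[of _ 0]) (simp add: br)
        fix a b a' b' assume "br \<rho> a = 0" "br \<rho> a' = 0"
        thus "\<exists>a'' b''. br \<rho> a'' = 0 \<and> a + br \<rho> b + (a' + br \<rho> b') = a'' + br \<rho> b''"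
          by (intro exI[of _ "a + a'"] exI[of _ "b + b'"]) (simp add: br)
      next
        fix c a b assume "br \<rho> a = 0"
        thus "\<exists>a' b'. br \<rho> a' = 0 \<and> c *s (a + br \<rho> b) = a' + br \<rho> b'"
          by (intro exI[of _ "c *s a"] exI[of _ "c *s b"]) (simp add: br vector_add_ldistrib)
      qed
    next
      case (step x)
      then obtain c where c: "br \<rho> x = c *s x" by blast
      show ?case
      proof (cases "c = 0")
        case True thus ?thesis using c by (intro exI[of _ x] exI[of _ 0]) (simp add: br)
      next
        case False
        thus ?thesis using c
          by (intro exI[of _ 0] exI[of _ "(1 / c) *s x"]) (simp add: br vector_smult_assoc)
      qed
    qed
  qed
  have ker: "a = 0" if a: "br \<rho> a = 0" "\<And>y. br \<rho> y = 0 \<Longrightarrow> B a y = 0" for a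
  proof (rule B(2))
    fix y obtain u v where "br \<rho> u = 0" "y = u + br \<rho> v" using dec by blast
    thus "B a y = 0" using a(2)[of u] im[OF a(1), of v] add[of u "br \<rho> v" a] sym[of a u] sym[of a y] by simp
  qed
  show ?thesis
  proof safe
    fix x assume x: "\<forall>y. br \<rho> y = 0 \<longrightarrow> B x y = 0"
    obtain a b where ab: "br \<rho> a = 0" "x = a + br \<rho> b" using dec by blast
    have "a = 0"
    proof (rule ker[OF ab(1)])
      fix y assume y: "br \<rho> y = 0"
      thus "B a y = 0" using x im[OF y, of b] add[of a "br \<rho> b" y] ab(2) by simp
    qed
    thus "x \<in> range (br \<rho>)" using ab by simp
  qed (use im in auto)
qed

end

lemma levi_structure:
  assumes "simple_lie_algebra br" "nondeg_invariant_form br form" "levi_subalgebra br l"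
  obtains \<rho> where "l = {x. br \<rho> x = 0}"
    "killing_orthogonal br l = {x. \<forall>y\<in>l. form x y = 0}"
    "\<And>x. (\<And>y. br x y = 0) \<Longrightarrow> x = 0"
proof -
  from assms(3) obtain h \<Delta> \<Gamma> where c: "cartan_subalgebra br h" and s: "simple_roots br h \<Delta>" and G: "\<Gamma> \<subseteq> \<Delta>"
    and l: "l = vec.span (h \<union> \<Union> {root_space br h \<beta> | \<beta>.
             \<beta> \<in> roots br h \<and> (\<exists>m :: _ \<Rightarrow> int. \<forall>y. \<beta> y = (\<Sum>\<alpha>\<in>\<Gamma>. of_int (m \<alpha>) * \<alpha> y))})"
    unfolding levi_subalgebra_def by blast
  obtain \<rho> where \<rho>: "\<rho> \<in> h" "l = {x. br \<rho> x = 0}"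
    by (rule levi_centralizer[OF assms(1) c s G l])
  have nd: "x = 0" if "\<And>y. form x y = 0" for x
    using assms(2) that unfolding nondeg_invariant_form_def by blast
  have "killing_orthogonal br l = range (br \<rho>)"
    unfolding killing_orthogonal_def \<rho>(2)
    using orthogonal_of_centralizer[OF assms(1) c s killing_invariant killing_nondegenerate[OF assms(1) c s] \<rho>(1)] assms(1)
    by (simp add: simple_lie_algebra_def)
  also have "\<dots> = {x. \<forall>y\<in>l. form x y = 0}" unfolding \<rho>(2)
    using orthogonal_of_centralizer[OF assms(1) c s nondeg_imp_invariant[OF assms(2)] nd \<rho>(1)] by simp
  finally show ?thesis using that[OF \<rho>(2)] center_trivial[OF assms(1) c s] by blast
qed

section \<open>A reductive pair and its exponential map\<close>

text \<open>
  \<open>P\<close> is the orthogonal projection onto \<open>l\<close>; its existence expresses that the form is nondegenerate on \<open>l\<close>.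
\<close>

locale reductive_pair =
  fixes br :: "complex^'n \<Rightarrow> complex^'n \<Rightarrow> complex^'n"
    and form :: "complex^'n \<Rightarrow> complex^'n \<Rightarrow> complex"
    and l :: "(complex^'n) set" and P :: "'n endo"
  assumes lie: "lie_algebra br"
    and form: "nondeg_invariant_form br form"
    and center: "\<And>x. (\<And>y. br x y = 0) \<Longrightarrow> x = 0"
    and subspace_l: "vec.subspace l"
    and closed_l: "\<And>x y. x \<in> l \<Longrightarrow> y \<in> l \<Longrightarrow> br x y \<in> l"
    and P_range: "\<And>x. app P x \<in> l"
    and P_id: "\<And>x. x \<in> l \<Longrightarrow> app P x = x"
    and P_sym: "\<And>x y. form (app P x) y = form x (app P y)"
begin

lemmas br = br_simps[OF lie]
lemmas anti = br_anti[OF lie]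
lemmas jac = jacobi[OF lie]
lemmas app_adb [simp] = app_ad[OF lie]
lemmas ad_lin = ad_linear[OF lie]

lemma form_simps:
  "form (x + y) z = form x z + form y z" "form z (x + y) = form z x + form z y"
  "form (c *s x) z = c * form x z" "form z (c *s x) = c * form z x"
  "form (x - y) z = form x z - form y z" "form z (x - y) = form z x - form z y"
  "form (- x) z = - form x z" "form z (- x) = - form z x"
  "form 0 z = 0" "form z 0 = 0"
proof -
  have a: "form (x + y) z = form x z + form y z" "form z (x + y) = form z x + form z y"
    and s: "form (c *s x) z = c * form x z" "form z (c *s x) = c * form z x" for x y z c
    using form unfolding nondeg_invariant_form_def linear_functional_iff by blast+
  show "form (x + y) z = form x z + form y z" "form z (x + y) = form z x + form z y"
    "form (c *s x) z = c * form x z" "form z (c *s x) = c * form z x" by (rule a s)+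
  show n: "form (- x) z = - form x z" "form z (- x) = - form z x" for x z
    using s(1)[of "-1" x z] s(2)[of z "-1" x] by (simp_all add: vector_sneg_minus1[symmetric])
  show "form (x - y) z = form x z - form y z" "form z (x - y) = form z x - form z y"
    using a(1)[of x "- y" z] a(2)[of z x "- y"] n by simp_all
  show "form 0 z = 0" "form z 0 = 0" using s(1)[of 0 0 z] s(2)[of z 0 0] by simp_all
qed

lemma form_commute: "form x y = form y x" using form unfolding nondeg_invariant_form_def by blast
lemma form_br: "form (br x y) z = form x (br y z)" using form unfolding nondeg_invariant_form_def by blast
lemma form_nondeg: "(\<And>y. form x y = 0) \<Longrightarrow> x = 0" using form unfolding nondeg_invariant_form_def by blast
lemma form_eqI: "(\<And>y. form x y = form x' y) \<Longrightarrow> x = x'"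
  using form_nondeg[of "x - x'"] by (simp add: form_simps)

lemma ad_inject: "ad br x = ad br y \<Longrightarrow> x = y"
  using center[of "x - y"] by (metis app_adb br(5) eq_iff_diff_eq_0)

lemma bounded_bilinear_form: "bounded_bilinear form"
proof -
  have "bounded_linear (\<lambda>x. form x y)" for y
    by (intro linear_conv_bounded_linear[THEN iffD1] linearI)
       (auto simp: form_simps scaleR_eq_complex_scale scaleR_conv_of_real)
  moreover have "bounded_linear (form x)" for x
    by (intro linear_conv_bounded_linear[THEN iffD1] linearI)
       (auto simp: form_simps scaleR_eq_complex_scale scaleR_conv_of_real)
  ultimately have "bilinear form" by (auto simp: bilinear_def bounded_linear.linear)
  thus ?thesis by (simp add: bilinear_conv_bounded_bilinear)
qed

lemma bounded_bilinear_br: "bounded_bilinear br"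
proof -
  have "bilinear br" unfolding bilinear_def
    by (auto intro!: linearI simp: br scaleR_eq_complex_scale)
  thus ?thesis by (simp add: bilinear_conv_bounded_bilinear)
qed

definition F :: "complex^'n \<Rightarrow> complex^'n \<Rightarrow> complex^'n \<Rightarrow> complex" where "F x y z = form (br x y) z"

lemma F_swap: "F y x z = - F x y z" unfolding F_def using anti[of y x] by (simp add: form_simps)
lemma F_cyc: "F y z x = F x y z" unfolding F_def using form_br[of x y z] form_commute by metis
lemma F_swap23: "F x z y = - F x y z" using F_swap[of x z y] F_cyc[of x z y] F_cyc by (metis F_swap)

lemma F_simps:
  "F (x + x') y z = F x y z + F x' y z" "F x (y + y') z = F x y z + F x y' z" "F x y (z + z') = F x y z + F x y z'"
  "F (x - x') y z = F x y z - F x' y z" "F x (y - y') z = F x y z - F x y' z" "F x y (z - z') = F x y z - F x y z'"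
  "F (- x) y z = - F x y z" "F x (- y) z = - F x y z" "F x y (- z) = - F x y z"
  "F (c *s x) y z = c * F x y z" "F x (c *s y) z = c * F x y z" "F x y (c *s z) = c * F x y z"
  by (simp_all add: F_def br form_simps)

lemma F_ad: "F (br a x) y z + F x (br a y) z + F x y (br a z) = 0"
proof -
  have "F x y (br a z) = - form (br a (br x y)) z"
    unfolding F_def using form_br[of "br x y" a z] anti[of "br x y" a] by (simp add: form_simps)
  thus ?thesis unfolding F_def by (simp add: jac[of a x y] form_simps)
qed

lemma PP [simp]: "app P (app P x) = app P x" by (simp add: P_id P_range)
lemma in_l_iff: "x \<in> l \<longleftrightarrow> app P x = x" using P_id P_range by metis
lemma P_idem: "P * P = P" by (rule endo_eqI) simp

lemma F_PP: "F (app P x) (app P y) z = F (app P x) (app P y) (app P z)"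
  unfolding F_def using P_sym[of "br (app P x) (app P y)" z] P_id[OF closed_l[OF P_range P_range]] by metis

lemma F_PP': "F (app P x) y (app P z) = F (app P x) (app P y) (app P z)"
  "F x (app P y) (app P z) = F (app P x) (app P y) (app P z)"
  using F_PP F_cyc by metis+

lemma ad_P: "x \<in> l \<Longrightarrow> ad br x * P = P * ad br x"
proof (rule endo_eqI)
  fix y assume x: "x \<in> l"
  have "app P (br x (y - app P y)) = 0"
  proof (rule form_nondeg)
    fix z
    have "form (app P (br x (y - app P y))) z = form (br x (y - app P y)) (app P z)" by (rule P_sym)
    also have "\<dots> = - form (y - app P y) (br x (app P z))"
      using form_br[of "y - app P y" x "app P z"] anti[of x "y - app P y"] by (simp add: form_simps)
    also have "\<dots> = - form (y - app P y) (app P (br x (app P z)))"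
      using P_id[OF closed_l[OF x P_range]] by simp
    also have "\<dots> = 0" by (simp add: P_sym[symmetric] form_simps)
    finally show "form (app P (br x (y - app P y))) z = 0" .
  qed
  thus "app (ad br x * P) y = app (P * ad br x) y"
    using P_id[OF closed_l[OF x P_range, of y]] by (simp add: br)
qed

lemma P_ad: "\<mu> \<in> l \<Longrightarrow> P * ad br \<mu> = ad br \<mu> * P" by (simp add: ad_P)

text \<open>
  The Jacobi identity \<open>[ad \<mu>, ad w] = ad [\<mu>, w]\<close> with scalar shifts.  Only the difference of the shifts enters on the
  right, so a given element \<open>v\<close> of the algebra can be written as \<open>(T + u) w\<close> for small \<open>u\<close> although \<open>T = ad \<mu>\<close> is
  not invertible.
\<close>

lemma shift_intertwine:
  "(ad br \<mu> + sc a) * ad br w - ad br w * (ad br \<mu> + sc b) = ad br (app (ad br \<mu> + sc (a - b)) w)"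
  by (rule endo_eqI) (simp add: br jac[of \<mu> w] sc_simps algebra_simps vector_sub_rdistrib)

lemma ev_adjoint:
  assumes f: "entire f" and XY: "\<And>x y. form (app X x) y = form x (app Y y)"
  shows "form (app (ev f X) x) y = form x (app (ev f Y) y)"
proof -
  have p: "form (app (X ^ n) x) y = form x (app (Y ^ n) y)" for n x y
  proof (induction n arbitrary: x y)
    case (Suc n)
    have "app (Y ^ Suc n) y = app (Y ^ n) (app Y y)" by (simp only: power_Suc2 app_simps(1))
    thus ?case by (simp add: XY Suc)
  qed simp
  have "(\<lambda>n. form (fps_nth f n *s app (X ^ n) x) y) sums form (app (ev f X) x) y"
    by (rule bounded_linear.sums[OF bounded_bilinear.bounded_linear_left[OF bounded_bilinear_form] ev_app_sums[OF f]])
  moreover have "(\<lambda>n. form x (fps_nth f n *s app (Y ^ n) y)) sums form x (app (ev f Y) y)"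
    by (rule bounded_linear.sums[OF bounded_bilinear.bounded_linear_right[OF bounded_bilinear_form] ev_app_sums[OF f]])
  ultimately show ?thesis using sums_unique2 by (simp add: form_simps p)
qed

text \<open>
  The derivative of \<open>F (exp (t D) x) (exp (t D) y) (exp (t D) z)\<close> in \<open>t\<close> vanishes.
\<close>

lemma exp_F:
  assumes D: "\<And>x y z. F (app D x) y z + F x (app D y) z + F x y (app D z) = 0"
  shows "F (app (exp D) x) (app (exp D) y) (app (exp D) z) = F x y z"
proof -
  define e where "e t x = app (exp (t *\<^sub>R D)) x" for t :: real and x
  have c: "e t (app D x) = app D (e t x)" for t x
  proof -
    have "exp (t *\<^sub>R D) * D = D * exp (t *\<^sub>R D)"
      using exp_times_scaleR_commute by blast
    thus ?thesis unfolding e_def by (metis app_simps(1))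
  qed
  have d: "((\<lambda>t. e t x) has_vector_derivative e t (app D x)) (at t)" for t x
    using bounded_linear.has_vector_derivative[OF bounded_linear_app_left exp_scaleR_has_vector_derivative_right[of D t UNIV], of x]
    by (simp add: e_def)
  have b: "((\<lambda>t. br (e t x) (e t y)) has_vector_derivative br (e t x) (e t (app D y)) + br (e t (app D x)) (e t y)) (at t)" for t x y
    by (rule bounded_bilinear.has_vector_derivative[OF bounded_bilinear_br d d])
  have "((\<lambda>t. F (e t x) (e t y) (e t z)) has_vector_derivative 0) (at t)" for t
  proof -
    have "((\<lambda>t. F (e t x) (e t y) (e t z)) has_vector_derivative
        form (br (e t x) (e t y)) (e t (app D z)) + form (br (e t x) (e t (app D y)) + br (e t (app D x)) (e t y)) (e t z)) (at t)"
      unfolding F_def by (rule bounded_bilinear.has_vector_derivative[OF bounded_bilinear_form b d])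
    moreover have "form (br (e t x) (e t y)) (e t (app D z)) + form (br (e t x) (e t (app D y)) + br (e t (app D x)) (e t y)) (e t z) = 0"
      using D[of "e t x" "e t y" "e t z"] by (simp add: c F_def form_simps algebra_simps)
    ultimately show ?thesis by simp
  qed
  then obtain k where "\<forall>t. F (e t x) (e t y) (e t z) = k"
    using has_vector_derivative_zero_constant[of UNIV "\<lambda>t. F (e t x) (e t y) (e t z)"] by auto
  hence "F (e 1 x) (e 1 y) (e 1 z) = F (e 0 x) (e 0 y) (e 0 z)" by simp
  thus ?thesis by (simp add: e_def)
qed

lemma F_scaled_ad:
  "F (app (sc c * ad br \<mu>) x) y z + F x (app (sc c * ad br \<mu>) y) z + F x y (app (sc c * ad br \<mu>) z) = 0"
proof -
  have "F (app (sc c * ad br \<mu>) x) y z + F x (app (sc c * ad br \<mu>) y) z + F x y (app (sc c * ad br \<mu>) z)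
      = c * (F (br \<mu> x) y z + F x (br \<mu> y) z + F x y (br \<mu> z))"
    by (simp add: F_simps algebra_simps)
  thus ?thesis by (simp add: F_ad)
qed

lemma form_ad: "form (app (ad br \<mu>) x) y = form x (app (- ad br \<mu>) y)"
  using form_br[of x \<mu> y] anti[of \<mu> x] by (simp add: form_simps)

lemma exp_minus_cancel: "exp X * exp (- X) = (1 :: 'n endo)" "exp (- X) * exp X = (1 :: 'n endo)"
  by (simp_all add: exp_minus_inverse flip: exp_add_commuting)

text \<open>
  The operator \<open>exp (ad \<mu>)\<close> preserves both the form and \<open>F\<close>, hence the bracket.
\<close>

lemma exp_ad_automorphism: "exp (ad br \<mu>) * ad br x = ad br (app (exp (ad br \<mu>)) x) * exp (ad br \<mu>)"
proof (rule endo_eqI)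
  fix y
  let ?e = "exp (ad br \<mu>)"
  show "app (?e * ad br x) y = app (ad br (app ?e x) * ?e) y"
  proof (rule form_eqI)
    fix z
    have iso: "form (app ?e u) (app ?e v) = form u v" for u v
    proof -
      have "form (app (ev (fps_exp 1) (ad br \<mu>)) u) (app ?e v) = form u (app (ev (fps_exp 1) (- ad br \<mu>)) (app ?e v))"
        by (rule ev_adjoint) (auto simp: form_ad simp del: app_adb)
      thus ?thesis using exp_minus_cancel(2)[of "ad br \<mu>"] by (simp add: ev_exp flip: app_simps(1))
    qed
    have z: "z = app ?e (app (exp (- ad br \<mu>)) z)" using exp_minus_cancel(1)[of "ad br \<mu>"] by (simp flip: app_simps(1))
    have "form (app (?e * ad br x) y) z = F x y (app (exp (- ad br \<mu>)) z)"
      by (subst z) (simp add: iso F_def)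
    also have "\<dots> = F (app ?e x) (app ?e y) z"
      using exp_F[of "ad br \<mu>" x y "app (exp (- ad br \<mu>)) z"] z F_scaled_ad[of 1 \<mu>] by simp
    finally show "form (app (?e * ad br x) y) z = form (app (ad br (app ?e x) * ?e) y) z"
      by (simp add: F_def)
  qed
qed

end

subsection \<open>The differential of the exponential map\<close>

text \<open>The power series of \<open>(1 - exp (- c s)) / s\<close>.\<close>

definition phi :: "complex \<Rightarrow> complex fps" where "phi c = fps_shift 1 (1 - fps_exp (- c))"

lemma entire_phi [simp, intro]: "entire (phi c)" by (auto simp: phi_def)

lemma X_times_shift: "fps_nth f 0 = 0 \<Longrightarrow> fps_X * fps_shift 1 f = (f :: complex fps)"
  by (auto simp: fps_eq_iff)

lemma X_phi: "fps_X * phi c = 1 - fps_exp (- c)"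
  unfolding phi_def by (rule X_times_shift) simp

lemma phi_0: "fps_nth (phi c) 0 = c" by (simp add: phi_def)

lemma ev_X_phi: "X * ev (phi c) X = 1 - exp (- (sc c * X))"
proof -
  have "ev (fps_X * phi c) X = 1 - exp (- (sc c * X))"
    unfolding X_phi by (simp add: ev_diff ev_exp sc_simps)
  thus ?thesis by (simp add: ev_mult)
qed

lemma ev_tendsto:
  fixes X :: "'n::finite endo"
  assumes "entire f" and g: "(g \<longlongrightarrow> X) A" shows "((\<lambda>t. ev f (g t)) \<longlongrightarrow> ev f X) A"
proof -
  have "continuous_on UNIV (ev f :: 'n endo \<Rightarrow> 'n endo)"
    by (rule dvd_diff_continuous[OF dvd_diff_ev[OF assms(1), of 0 UNIV]])
  from continuous_on_tendsto_compose[OF this g] show ?thesis by simp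
qed

lemma dd_tendsto:
  assumes "entire f" "(a \<longlongrightarrow> X) A" "(b \<longlongrightarrow> Y) A" "(w \<longlongrightarrow> W) A"
  shows "((\<lambda>t. blinfun_apply (dd f (a t) (b t)) (w t)) \<longlongrightarrow> blinfun_apply (dd f X Y) W) A"
  by (rule dvd_diff_tendsto[OF dvd_diff_ev[OF assms(1), of 0 UNIV]]) (use assms in auto)

lemma dvd_diff_line_derivative:
  assumes g: "divided_difference P U g G" and X: "X \<in> U"
    and ev: "eventually (\<lambda>s::real. X + s *\<^sub>R W \<in> U) (nhds 0)"
  shows "((\<lambda>s. g (X + s *\<^sub>R W)) has_vector_derivative blinfun_apply (G X X) W) (at 0)"
proof -
  from ev obtain S where S: "open S" "(0::real) \<in> S" "\<And>s. s \<in> S \<Longrightarrow> X + s *\<^sub>R W \<in> U"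
    unfolding eventually_nhds by blast
  have 1: "((\<lambda>s. X + s *\<^sub>R W) has_derivative (\<lambda>s. s *\<^sub>R W)) (at 0 within S)"
    by (auto intro!: derivative_eq_intros)
  have 2: "(g has_derivative blinfun_apply (G X X)) (at (X + 0 *\<^sub>R W) within (\<lambda>s. X + s *\<^sub>R W) ` S)"
  proof -
    have "(\<lambda>s. X + s *\<^sub>R W) ` S \<subseteq> U" using S(3) by auto
    from has_derivative_subset[OF dvd_diff_has_derivative[OF g X] this] show ?thesis by simp
  qed
  have "((\<lambda>s. g (X + s *\<^sub>R W)) has_derivative (\<lambda>s. blinfun_apply (G X X) (s *\<^sub>R W))) (at 0 within S)"
    using has_derivative_in_compose[OF 1 2] by simp
  hence "((\<lambda>s. g (X + s *\<^sub>R W)) has_vector_derivative blinfun_apply (G X X) W) (at 0 within S)"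
    by (simp add: has_vector_derivative_def blinfun.scaleR_right)
  thus ?thesis by (simp only: at_within_open[OF S(2,1)])
qed

context reductive_pair
begin

text \<open>
  If \<open>T = ad \<mu>\<close> were invertible, one could write \<open>v = [\<mu>, w]\<close>; then \<open>ad v = [T, ad w]\<close>, and the derivative of
  \<open>exp\<close> in the direction of a commutator is the commutator \<open>[exp T, ad w] = exp T * ad (w - exp (- T) w)\<close>, where
  \<open>w - exp (- T) w = (1 - exp (- T)) / T v\<close>.  As \<open>T\<close> is singular, the first argument is shifted to \<open>T + u\<close>, where
  \<open>v = (T + u) w\<close> can be solved, and \<open>u\<close> tends to \<open>0\<close>.
\<close>

lemma dd_exp_ad:
  "blinfun_apply (dd (fps_exp 1) (ad br \<mu>) (ad br \<mu>)) (ad br v)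
     = exp (ad br \<mu>) * ad br (app (ev (phi 1) (ad br \<mu>)) v)"
proof (rule tendsto_unique[of "at (0::complex)"])
  let ?T = "ad br \<mu>"
  show "((\<lambda>u. blinfun_apply (dd (fps_exp 1) (?T + sc u) ?T) (ad br v)) \<longlongrightarrow>
      blinfun_apply (dd (fps_exp 1) ?T ?T) (ad br v)) (at 0)"
    by (intro dd_tendsto) (auto intro!: tendsto_eq_intros)
  have "((\<lambda>u. ?T + sc u) \<longlongrightarrow> ?T) (at 0)" by (auto intro!: tendsto_eq_intros)
  hence "((\<lambda>u. exp ?T * ad br (exp u *s app (ev (phi 1) (?T + sc u)) v)) \<longlongrightarrow>
      exp ?T * ad br (exp 0 *s app (ev (phi 1) ?T) v)) (at 0)"
    unfolding ad_lin
    by (intro tendsto_intros bounded_linear.tendsto[OF bounded_linear_ad[OF lie]] ev_tendsto) auto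
  moreover have "eventually (\<lambda>u. exp ?T * ad br (exp u *s app (ev (phi 1) (?T + sc u)) v)
      = blinfun_apply (dd (fps_exp 1) (?T + sc u) ?T) (ad br v)) (at 0)"
    using eventually_unit_shift[of ?T]
  proof eventually_elim
    case (elim u)
    define X where "X = ?T + sc u"
    define w where "w = app (einv X) v"
    have w: "app X w = v" using einv_app(1)[OF elim, of v] by (simp only: w_def X_def)
    have "X * ad br w - ad br w * ?T = ad br v"
      using shift_intertwine[of \<mu> u w 0] w by (simp add: X_def)
    hence 1: "blinfun_apply (dd (fps_exp 1) X ?T) (ad br v) = exp X * ad br w - ad br w * exp ?T"
      using dd_intertwine[of "fps_exp 1" X "ad br w" ?T] by (simp add: ev_exp)
    have eX: "exp X = sc (exp u) * exp ?T"
      unfolding X_def by (subst exp_add_commuting) (simp_all add: exp_sc sc_commute)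
    have v: "app (ev (phi 1) X) v = w - exp (- u) *s app (exp (- ?T)) w"
    proof -
      have "app (ev (phi 1) X) v = app (X * ev (phi 1) X) w"
        using ev_commute[of "phi 1" X X] w by (metis app_simps(1) entire_phi)
      also have "\<dots> = w - app (exp (- X)) w" by (simp add: ev_X_phi)
      also have "exp (- X) = sc (exp (- u)) * exp (- ?T)"
        unfolding X_def minus_add_distrib sc_simps(3)[symmetric]
        by (subst exp_add_commuting) (simp_all add: exp_sc sc_commute)
      finally show ?thesis by simp
    qed
    have "ad br w * exp ?T = exp ?T * ad br (app (exp (- ?T)) w)"
      using exp_ad_automorphism[of \<mu> "app (exp (- ?T)) w"] exp_minus_cancel(1)[of ?T]
      by (simp flip: app_simps(1))
    moreover have "exp u *s app (ev (phi 1) X) v = exp u *s w - app (exp (- ?T)) w"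
      by (simp add: v vector_ssub_ldistrib vector_smult_assoc flip: exp_add)
    ultimately have "exp ?T * ad br (exp u *s app (ev (phi 1) X) v) = blinfun_apply (dd (fps_exp 1) X ?T) (ad br v)"
      unfolding 1 eX by (simp add: ad_lin right_diff_distrib mult.assoc sc_left_commute)
    thus ?case by (simp add: X_def)
  qed
  ultimately show "((\<lambda>u. blinfun_apply (dd (fps_exp 1) (?T + sc u) ?T) (ad br v)) \<longlongrightarrow>
      exp ?T * ad br (app (ev (phi 1) ?T) v)) (at 0)"
    by (simp add: Lim_transform_eventually)
qed simp

lemma Exp_ad_eq: "Exp_ad br x = mat_of (exp (ad br x))"
proof -
  define X where "X = ad br x"
  have m: "matrix (br x) = mat_of X" by (simp add: X_def mat_of_def app_adb[abs_def])
  have p: "((**) (mat_of X) ^^ k) (mat 1) = mat_of (X ^ k)" for k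
    by (induction k) (simp_all add: mat_of_1 mat_of_mult)
  have "(\<lambda>k. mat_of (X ^ k /\<^sub>R fact k)) sums mat_of (exp X)"
    by (rule bounded_linear.sums[OF bounded_linear_mat_of exp_converges])
  hence "(\<lambda>k. (1 / fact k) *\<^sub>R mat_of (X ^ k)) sums mat_of (exp X)"
    by (simp add: linear_scale[OF bounded_linear.linear[OF bounded_linear_mat_of]] inverse_eq_divide)
  thus ?thesis unfolding Exp_ad_def matrix_exp_def m p X_def[symmetric] by (simp add: sums_iff)
qed

lemma Exp_ad_derivative:
  "vector_derivative (\<lambda>s. Exp_ad br (\<mu> + s *\<^sub>R v)) (at 0)
     = mat_of (exp (ad br \<mu>) * ad br (app (ev (phi 1) (ad br \<mu>)) v))"
proof (rule vector_derivative_at)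
  have "((\<lambda>s. ev (fps_exp 1) (ad br \<mu> + s *\<^sub>R ad br v)) has_vector_derivative
      blinfun_apply (dd (fps_exp 1) (ad br \<mu>) (ad br \<mu>)) (ad br v)) (at 0)"
    by (rule dvd_diff_line_derivative[OF dvd_diff_ev[of _ 0 UNIV]]) auto
  hence "((\<lambda>s. exp (ad br (\<mu> + s *\<^sub>R v))) has_vector_derivative
      exp (ad br \<mu>) * ad br (app (ev (phi 1) (ad br \<mu>)) v)) (at 0)"
    by (simp add: dd_exp_ad ev_exp ad_lin scaleR_eq_complex_scale sc_of_real)
  from bounded_linear.has_vector_derivative[OF bounded_linear_mat_of this]
  show "((\<lambda>s. Exp_ad br (\<mu> + s *\<^sub>R v)) has_vector_derivative
      mat_of (exp (ad br \<mu>) * ad br (app (ev (phi 1) (ad br \<mu>)) v))) (at 0)"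
    by (simp add: Exp_ad_eq)
qed

lemma Exp_ad_zero_derivative: "((\<lambda>t. exp (ad br (t *\<^sub>R \<xi>))) has_vector_derivative ad br \<xi>) (at 0)"
  using exp_scaleR_has_vector_derivative_right[of "ad br \<xi>" 0 UNIV]
  by (simp add: ad_lin scaleR_eq_complex_scale sc_of_real)

lemma left_velocity:
  "vector_derivative (\<lambda>t. Exp_ad br \<mu> ** Exp_ad br (t *\<^sub>R \<xi>)) (at 0) = mat_of (exp (ad br \<mu>) * ad br \<xi>)"
  unfolding Exp_ad_eq mat_of_mult[symmetric]
  by (intro vector_derivative_at bounded_linear.has_vector_derivative[OF bounded_linear_mat_of]
      bounded_linear.has_vector_derivative[OF bounded_linear_mult_right] Exp_ad_zero_derivative)

lemma right_velocity:
  "vector_derivative (\<lambda>t. Exp_ad br (t *\<^sub>R \<xi>) ** Exp_ad br \<mu>) (at 0) = mat_of (ad br \<xi> * exp (ad br \<mu>))"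
  unfolding Exp_ad_eq mat_of_mult[symmetric]
  by (intro vector_derivative_at bounded_linear.has_vector_derivative[OF bounded_linear_mat_of]
      bounded_linear.has_vector_derivative[OF bounded_linear_mult_left] Exp_ad_zero_derivative)

text \<open>
  The points of \<open>l\<close> at which the differential of the exponential map is injective on \<open>l\<close>.
\<close>

definition nonsingular :: "complex^'n \<Rightarrow> bool" where
  "nonsingular \<mu> \<longleftrightarrow> \<mu> \<in> l \<and> (\<forall>v\<in>l. app (ev (phi 1) (ad br \<mu>)) v = 0 \<longrightarrow> v = 0)"

lemma exp_mult_cancel: "exp X * A = exp X * B \<Longrightarrow> A = (B :: 'n endo)"
  by (metis exp_minus_cancel(2) mult.assoc mult_1_left)

lemma nonsingularI:
  assumes "exponential_domain br l N" "\<mu> \<in> N" shows "nonsingular \<mu>"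
proof -
  have "N \<subseteq> l" using assms(1) openin_imp_subset unfolding exponential_domain_def by blast
  moreover have "v = 0" if "v \<in> l" "app (ev (phi 1) (ad br \<mu>)) v = 0" for v
  proof -
    have "vector_derivative (\<lambda>s. Exp_ad br (\<mu> + s *\<^sub>R v)) (at 0) = 0"
      unfolding Exp_ad_derivative that(2) ad_lin(5)
      by (simp add: vec_eq_iff mat_of_component)
    thus ?thesis using assms that(1) unfolding exponential_domain_def by blast
  qed
  ultimately show ?thesis using assms(2) by (auto simp: nonsingular_def)
qed

text \<open>
  Extended by the identity, \<open>(1 - exp (- X)) / X\<close> on \<open>l\<close> becomes an operator on the whole space which is
  invertible if its restriction to \<open>l\<close> is.
\<close>

definition phi_l :: "'n endo \<Rightarrow> 'n endo" where "phi_l X = ev (phi 1) X * P + (1 - P)"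

lemma ev_P: "entire f \<Longrightarrow> P * X = X * P \<Longrightarrow> ev f X * P = P * ev f X"
  by (rule ev_commute) simp_all

lemma ev_in_l: "entire f \<Longrightarrow> P * X = X * P \<Longrightarrow> x \<in> l \<Longrightarrow> app (ev f X) x \<in> l"
  using ev_P[of f X] unfolding in_l_iff by (metis app_simps(1))

lemma unit_phi_l: assumes "nonsingular \<mu>" shows "unit (phi_l (ad br \<mu>))"
  unfolding unit_iff_inj
proof (intro allI impI)
  fix x assume "app (phi_l (ad br \<mu>)) x = 0"
  hence x: "app (ev (phi 1) (ad br \<mu>)) (app P x) + (x - app P x) = 0" by (simp add: phi_l_def)
  have \<mu>: "\<mu> \<in> l" using assms by (simp add: nonsingular_def)
  have "app (ev (phi 1) (ad br \<mu>)) (app P x) \<in> l" using ev_in_l[OF _ P_ad[OF \<mu>] P_range] by auto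
  hence "app P (app (ev (phi 1) (ad br \<mu>)) (app P x) + (x - app P x)) = app (ev (phi 1) (ad br \<mu>)) (app P x)"
    by (simp add: P_id)
  hence "app (ev (phi 1) (ad br \<mu>)) (app P x) = 0" using x by simp
  hence "app P x = 0" using assms P_range unfolding nonsingular_def by blast
  thus "x = 0" using x by simp
qed

lemma phi_inj:
  assumes "nonsingular \<mu>" "v \<in> l" "w \<in> l"
    and "app (ev (phi 1) (ad br \<mu>)) v = app (ev (phi 1) (ad br \<mu>)) w"
  shows "v = w"
proof -
  have "v - w \<in> l" using vec.subspace_diff[OF subspace_l] assms by blast
  moreover have "app (ev (phi 1) (ad br \<mu>)) (v - w) = 0" using assms(4) by simp
  ultimately have "v - w = 0" using assms(1) unfolding nonsingular_def by blast
  thus ?thesis by simp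
qed

lemma phi_solve:
  assumes "nonsingular \<mu>" "\<xi> \<in> l"
  shows "\<exists>!v. v \<in> l \<and> app (ev (phi 1) (ad br \<mu>)) v = \<xi>"
proof -
  have \<mu>: "\<mu> \<in> l" using assms by (simp add: nonsingular_def)
  define v where "v = app (einv (phi_l (ad br \<mu>))) \<xi>"
  have u: "unit (phi_l (ad br \<mu>))" by (rule unit_phi_l[OF assms(1)])
  have "phi_l (ad br \<mu>) * P = P * phi_l (ad br \<mu>)"
    using ev_P[OF _ P_ad[OF \<mu>], of "phi 1"] by (simp add: phi_l_def algebra_simps P_idem mult.assoc[symmetric])
  hence "einv (phi_l (ad br \<mu>)) * P = P * einv (phi_l (ad br \<mu>))" using einv_commute[OF u] by simp
  hence vl: "v \<in> l" unfolding v_def using assms(2) in_l_iff by (metis app_simps(1))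
  have "app (phi_l (ad br \<mu>)) v = \<xi>" using u by (simp add: v_def)
  hence "app (ev (phi 1) (ad br \<mu>)) v = \<xi>" using vl by (simp add: phi_l_def P_id)
  thus ?thesis using vl phi_inj[OF assms(1)] by metis
qed

lemma left_vector:
  assumes "nonsingular \<mu>" "\<xi> \<in> l"
  shows "left_vector br l \<xi> \<mu> \<in> l" "app (ev (phi 1) (ad br \<mu>)) (left_vector br l \<xi> \<mu>) = \<xi>"
proof -
  have "(v \<in> l \<and> vector_derivative (\<lambda>s. Exp_ad br (\<mu> + s *\<^sub>R v)) (at 0)
     = vector_derivative (\<lambda>t. Exp_ad br \<mu> ** Exp_ad br (t *\<^sub>R \<xi>)) (at 0)) \<longleftrightarrow>
     v \<in> l \<and> app (ev (phi 1) (ad br \<mu>)) v = \<xi>" for v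
    unfolding Exp_ad_derivative left_velocity
    by (auto dest!: mat_of_inject exp_mult_cancel ad_inject)
  hence "left_vector br l \<xi> \<mu> = (THE v. v \<in> l \<and> app (ev (phi 1) (ad br \<mu>)) v = \<xi>)"
    unfolding left_vector_def by presburger
  thus "left_vector br l \<xi> \<mu> \<in> l" "app (ev (phi 1) (ad br \<mu>)) (left_vector br l \<xi> \<mu>) = \<xi>"
    using theI'[OF phi_solve[OF assms]] by auto
qed

text \<open>
  The right velocity \<open>ad \<xi> * exp T\<close> is the left velocity of \<open>exp (- T) \<xi>\<close>.
\<close>

lemma right_vector:
  assumes "nonsingular \<mu>" "\<xi> \<in> l"
  shows "right_vector br l \<xi> \<mu> \<in> l"
    "app (ev (phi 1) (ad br \<mu>)) (right_vector br l \<xi> \<mu>) = app (exp (- ad br \<mu>)) \<xi>"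
proof -
  have \<mu>: "\<mu> \<in> l" using assms by (simp add: nonsingular_def)
  have a: "ad br \<xi> * exp (ad br \<mu>) = exp (ad br \<mu>) * ad br (app (exp (- ad br \<mu>)) \<xi>)"
    using exp_ad_automorphism[of \<mu> "app (exp (- ad br \<mu>)) \<xi>"] exp_minus_cancel(1)[of "ad br \<mu>"]
    by (simp flip: app_simps(1))
  have "app (ev (fps_exp (-1)) (ad br \<mu>)) \<xi> \<in> l" by (intro ev_in_l P_ad \<mu> assms(2)) auto
  hence l: "app (exp (- ad br \<mu>)) \<xi> \<in> l" by (simp add: ev_exp sc_simps)
  have "(v \<in> l \<and> vector_derivative (\<lambda>s. Exp_ad br (\<mu> + s *\<^sub>R v)) (at 0)
     = vector_derivative (\<lambda>t. Exp_ad br (t *\<^sub>R \<xi>) ** Exp_ad br \<mu>) (at 0)) \<longleftrightarrow>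
     v \<in> l \<and> app (ev (phi 1) (ad br \<mu>)) v = app (exp (- ad br \<mu>)) \<xi>" for v
    unfolding Exp_ad_derivative right_velocity a
    by (auto dest!: mat_of_inject exp_mult_cancel ad_inject)
  hence "right_vector br l \<xi> \<mu> = (THE v. v \<in> l \<and> app (ev (phi 1) (ad br \<mu>)) v = app (exp (- ad br \<mu>)) \<xi>)"
    unfolding right_vector_def by presburger
  thus "right_vector br l \<xi> \<mu> \<in> l"
    "app (ev (phi 1) (ad br \<mu>)) (right_vector br l \<xi> \<mu>) = app (exp (- ad br \<mu>)) \<xi>"
    using theI'[OF phi_solve[OF assms(1) l]] by auto
qed

text \<open>
  Both sides are sent to \<open>\<xi> - exp (- T) \<xi>\<close> by the injective operator \<open>(1 - exp (- T)) / T\<close>.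
\<close>

lemma left_minus_right:
  assumes "nonsingular \<mu>" "\<xi> \<in> l"
  shows "left_vector br l \<xi> \<mu> - right_vector br l \<xi> \<mu> = br \<mu> \<xi>"
proof (rule phi_inj[OF assms(1)])
  have \<mu>: "\<mu> \<in> l" using assms by (simp add: nonsingular_def)
  show "left_vector br l \<xi> \<mu> - right_vector br l \<xi> \<mu> \<in> l"
    using left_vector[OF assms] right_vector[OF assms] subspace_l by (intro vec.subspace_diff)
  show "br \<mu> \<xi> \<in> l" using \<mu> assms(2) by (rule closed_l)
  have "app (ev (phi 1) (ad br \<mu>)) (br \<mu> \<xi>) = app (ad br \<mu> * ev (phi 1) (ad br \<mu>)) \<xi>"
    using ev_commute[of "phi 1" "ad br \<mu>" "ad br \<mu>"] by (metis app_adb app_simps(1) entire_phi)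
  also have "\<dots> = \<xi> - app (exp (- ad br \<mu>)) \<xi>" by (subst ev_X_phi) simp
  finally show "app (ev (phi 1) (ad br \<mu>)) (left_vector br l \<xi> \<mu> - right_vector br l \<xi> \<mu>)
      = app (ev (phi 1) (ad br \<mu>)) (br \<mu> \<xi>)"
    using left_vector[OF assms] right_vector[OF assms] by simp
qed

lemma left_plus_right:
  assumes "nonsingular \<mu>" "\<xi> \<in> l"
  shows "app (phi_l (ad br \<mu>)) (left_vector br l \<xi> \<mu> + right_vector br l \<xi> \<mu>) = \<xi> + app (exp (- ad br \<mu>)) \<xi>"
  using left_vector[OF assms] right_vector[OF assms] by (simp add: phi_l_def P_id)

end

section \<open>The r-matrix operator\<close>

text \<open>
  The numerator of \<open>1/2 coth (s/2) - \<epsilon>/2 coth (\<epsilon>/2 s)\<close> over the denominator \<open>phi 1 * phi \<epsilon>\<close>.  The poles at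
  \<open>s = 0\<close> cancel: the difference inside the shift has constant term \<open>0\<close>, and the shift divides it by \<open>s\<close>.
\<close>

definition numer_l :: "complex \<Rightarrow> complex fps" where
  "numer_l \<epsilon> = fps_shift 1 (fps_const (1/2) * (1 + fps_exp (-1)) * phi \<epsilon>
     - fps_const (\<epsilon>/2) * (1 + fps_exp (- \<epsilon>)) * phi 1)"

lemma entire_numer_l [simp, intro]: "entire (numer_l \<epsilon>)" by (auto simp: numer_l_def intro!: entire_intros)

lemma X_numer_l: "fps_X * numer_l \<epsilon> = fps_const (1/2) * (1 + fps_exp (-1)) * phi \<epsilon>
     - fps_const (\<epsilon>/2) * (1 + fps_exp (- \<epsilon>)) * phi 1"
  unfolding numer_l_def by (rule X_times_shift) (simp add: phi_0)

locale r_setting = reductive_pair +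
  fixes \<epsilon> :: complex
  assumes eps: "\<epsilon> \<noteq> 0"
begin

text \<open>
  The operator \<open>R = N / M\<close> as a quotient of entire functions of \<open>X = ad \<mu>\<close>, given separately on \<open>l\<close> and on
  the complement.  The formulas come from \<open>c/2 coth (c/2 s) = c/2 (1 + exp (- c s)) / (s phi\<^sub>c(s))\<close>.
\<close>

definition Mhat :: "'a endo \<Rightarrow> 'a endo" where
  "Mhat X = ev (phi 1 * phi \<epsilon>) X * P + ev (fps_X * phi \<epsilon>) X * (1 - P)"

definition Nhat :: "'a endo \<Rightarrow> 'a endo" where
  "Nhat X = ev (numer_l \<epsilon>) X * P - ev (fps_const (\<epsilon>/2) * (1 + fps_exp (- \<epsilon>))) X * (1 - P)"

definition Rhat :: "'a endo \<Rightarrow> 'a endo" where "Rhat X = Nhat X * einv (Mhat X)"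

definition Rhat_domain :: "'a endo set" where "Rhat_domain = {X. P * X = X * P \<and> unit (Mhat X)}"

lemma Mhat_divided_difference: "\<exists>M. divided_difference P U Mhat M"
  and Nhat_divided_difference: "\<exists>N. divided_difference P U Nhat N"
proof -
  have c: "divided_difference P U (\<lambda>_. P) (\<lambda>_ _. 0)" "divided_difference P U (\<lambda>_. 1 - P) (\<lambda>_ _. 0)"
    by (rule dvd_diff_const; simp add: algebra_simps)+
  show "\<exists>M. divided_difference P U Mhat M"
    using dvd_diff_add[OF dvd_diff_mult[OF dvd_diff_ev c(1)] dvd_diff_mult[OF dvd_diff_ev c(2)],
        of "phi 1 * phi \<epsilon>" "fps_X * phi \<epsilon>"] unfolding Mhat_def[abs_def] by auto
  show "\<exists>N. divided_difference P U Nhat N"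
    using dvd_diff_diff[OF dvd_diff_mult[OF dvd_diff_ev c(1)] dvd_diff_mult[OF dvd_diff_ev c(2)],
        of "numer_l \<epsilon>" "fps_const (\<epsilon>/2) * (1 + fps_exp (- \<epsilon>))"] unfolding Nhat_def[abs_def] by auto
qed

lemma Rhat_divided_difference: "\<exists>G. divided_difference P Rhat_domain Rhat G"
proof -
  obtain M N where M: "divided_difference P Rhat_domain Mhat M" and N: "divided_difference P Rhat_domain Nhat N"
    using Mhat_divided_difference Nhat_divided_difference by blast
  have "divided_difference P Rhat_domain (\<lambda>X. einv (Mhat X)) (\<lambda>X Y. - (mulLR (einv (Mhat X)) (einv (Mhat Y)) o\<^sub>L M X Y))"
    by (rule dvd_diff_einv[OF M]) (simp add: Rhat_domain_def)
  from dvd_diff_mult[OF N this] show ?thesis unfolding Rhat_def[abs_def] by blast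
qed

text \<open>
  Any divided difference serves: in admissible directions the diagonal values are the derivative of \<open>Rhat\<close>.
\<close>

definition Rhat_dd :: "'a endo \<Rightarrow> 'a endo \<Rightarrow> 'a endo \<Rightarrow>\<^sub>L 'a endo" where
  "Rhat_dd = (SOME G. divided_difference P Rhat_domain Rhat G)"

lemma Rhat_dd: "divided_difference P Rhat_domain Rhat Rhat_dd"
  unfolding Rhat_dd_def using Rhat_divided_difference by (rule someI_ex)

lemma Mhat_factor:
  assumes "P * X = X * P"
  shows "Mhat X = ev (phi \<epsilon>) X * (ev (phi 1) X * P + X * (1 - P))"
    and "P * Mhat X = phi_l X * (P * ev (phi \<epsilon>) X)"
    and "Mhat X * P = P * Mhat X"
proof -
  have c: "ev (phi 1) X * ev (phi \<epsilon>) X = ev (phi \<epsilon>) X * ev (phi 1) X" "X * ev (phi \<epsilon>) X = ev (phi \<epsilon>) X * X"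
    by (metis ev_mult entire_phi mult.commute) (metis ev_commute entire_phi)
  have p: "ev (phi 1) X * P = P * ev (phi 1) X" "ev (phi \<epsilon>) X * P = P * ev (phi \<epsilon>) X"
    using ev_P[OF _ assms] by auto
  show 1: "Mhat X = ev (phi \<epsilon>) X * (ev (phi 1) X * P + X * (1 - P))"
    by (simp add: Mhat_def ev_mult c distrib_left mult.assoc)
  have Pi: "P * (P * A) = P * A" for A by (simp add: P_idem flip: mult.assoc)
  have "P * Mhat X = ev (phi \<epsilon>) X * ((P * ev (phi 1) X) * P + (P * X) * (1 - P))"
    unfolding 1 using p(2) by (simp add: distrib_left flip: mult.assoc)
  also have "\<dots> = ev (phi \<epsilon>) X * (P * ev (phi 1) X)"
    unfolding assms p(1)[symmetric] by (simp add: mult.assoc P_idem right_diff_distrib)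
  also have "\<dots> = (P * ev (phi \<epsilon>) X) * ev (phi 1) X" using p(2) by (simp flip: mult.assoc)
  also have "\<dots> = P * (ev (phi 1) X * ev (phi \<epsilon>) X)" by (simp add: mult.assoc c)
  also have "\<dots> = phi_l X * (P * ev (phi \<epsilon>) X)"
    unfolding phi_l_def using p(1) by (simp add: distrib_right left_diff_distrib mult.assoc Pi) (simp add: P_idem flip: mult.assoc)
  finally show "P * Mhat X = phi_l X * (P * ev (phi \<epsilon>) X)" .
  have "Mhat X * P = ev (phi 1 * phi \<epsilon>) X * P"
    by (simp add: Mhat_def distrib_right mult.assoc P_idem left_diff_distrib)
  moreover have "P * Mhat X = (P * ev (phi 1 * phi \<epsilon>) X) * P + (P * ev (fps_X * phi \<epsilon>) X) * (1 - P)"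
    by (simp add: Mhat_def distrib_left mult.assoc)
  moreover have "P * ev (phi 1 * phi \<epsilon>) X = ev (phi 1 * phi \<epsilon>) X * P" "P * ev (fps_X * phi \<epsilon>) X = ev (fps_X * phi \<epsilon>) X * P"
    using ev_P[OF _ assms] by auto
  ultimately show "Mhat X * P = P * Mhat X" by (simp add: mult.assoc P_idem right_diff_distrib)
qed

lemma Rhat_P: assumes "P * X = X * P" "unit (Mhat X)" shows "Rhat X * P = P * Rhat X"
proof -
  have "einv (Mhat X) * P = P * einv (Mhat X)"
    using einv_commute[OF assms(2)] Mhat_factor(3)[OF assms(1)] by simp
  moreover have "Nhat X * P = P * Nhat X"
  proof -
    have e: "P * ev (numer_l \<epsilon>) X = ev (numer_l \<epsilon>) X * P"
      "P * ev (fps_const (\<epsilon>/2) * (1 + fps_exp (- \<epsilon>))) X = ev (fps_const (\<epsilon>/2) * (1 + fps_exp (- \<epsilon>))) X * P"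
      by (rule ev_P[OF _ assms(1), symmetric]; auto intro!: entire_intros)+
    have "P * Nhat X = (P * ev (numer_l \<epsilon>) X) * P - (P * ev (fps_const (\<epsilon>/2) * (1 + fps_exp (- \<epsilon>))) X) * (1 - P)"
      by (simp add: Nhat_def right_diff_distrib mult.assoc)
    thus ?thesis unfolding e by (simp add: Nhat_def left_diff_distrib right_diff_distrib mult.assoc P_idem)
  qed
  ultimately show ?thesis unfolding Rhat_def by (metis mult.assoc)
qed

subsection \<open>Splitting into two hyperbolic cotangents at an invertible argument\<close>

text \<open>
  The arguments at which the two hyperbolic cotangents in \<open>R\<close> exist separately.  No \<open>ad \<mu>\<close> is among them, but
  its small nonzero shifts are, for regular \<open>\<mu>\<close>.
\<close>

definition splittable :: "'a endo \<Rightarrow> bool" where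
  "splittable X \<longleftrightarrow> P * X = X * P \<and> unit X \<and> unit (phi_l X) \<and> unit (Mhat X)"

text \<open>
  \<open>1/2 coth (X/2)\<close> on \<open>l\<close>, and \<open>0\<close> on the complement.
\<close>

definition coth_l :: "'a endo \<Rightarrow> 'a endo" where
  "coth_l X = sc (1/2) * (1 + exp (- X)) * einv X * einv (phi_l X) * P"

text \<open>
  \<open>\<epsilon>/2 coth (\<epsilon>/2 X)\<close> on the whole space.
\<close>

definition coth_g :: "'a endo \<Rightarrow> 'a endo" where
  "coth_g X = sc (\<epsilon>/2) * (1 + exp (- (sc \<epsilon> * X))) * einv X * einv (ev (phi \<epsilon>) X)"

lemma exp_as_ev: "1 + exp (- (sc c * X)) = ev (1 + fps_exp (- c)) X"
  by (simp add: ev_add ev_exp sc_simps)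

lemma phi_l_P: "P * X = X * P \<Longrightarrow> phi_l X * P = P * phi_l X"
  using ev_P[of "phi 1" X] unfolding phi_l_def
  by (simp add: distrib_left distrib_right left_diff_distrib right_diff_distrib mult.assoc P_idem)

lemma splittable_commutes:
  assumes "splittable X"
  shows "einv X * P = P * einv X" "einv (phi_l X) * P = P * einv (phi_l X)"
    "unit (ev (phi \<epsilon>) X)"
    "X * (sc c * ev f X) = (sc c * ev f X) * X \<or> \<not> entire f"
proof -
  have u: "unit X" "P * X = X * P" "unit (phi_l X)" "unit (Mhat X)" using assms by (auto simp: splittable_def)
  show "einv X * P = P * einv X" by (rule einv_commute[OF u(1)]) (simp add: u)
  show "einv (phi_l X) * P = P * einv (phi_l X)" by (rule einv_commute[OF u(3)]) (simp add: phi_l_P[OF u(2)])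
  show "unit (ev (phi \<epsilon>) X)" using u(4) unfolding Mhat_factor(1)[OF u(2)] by (rule unit_multD)
  show "X * (sc c * ev f X) = (sc c * ev f X) * X \<or> \<not> entire f"
    using ev_commute[of f X X] by (metis mult.assoc sc_commute)
qed

lemma X_coth_l: assumes "splittable X" shows "X * coth_l X = sc (1/2) * (1 + exp (- X)) * einv (phi_l X) * P"
proof -
  have "coth_l X = (sc (1/2) * ev (1 + fps_exp (-1)) X) * einv X * einv (phi_l X) * P"
    using exp_as_ev[of 1 X] by (simp add: coth_l_def)
  hence "X * coth_l X = (sc (1/2) * ev (1 + fps_exp (-1)) X) * (X * einv X) * einv (phi_l X) * P"
    using splittable_commutes(4)[OF assms, of "1/2" "1 + fps_exp (-1)"] by (simp flip: mult.assoc)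
  thus ?thesis using assms exp_as_ev[of 1 X] by (simp add: einv splittable_def)
qed

lemma X_coth_g: assumes "splittable X" shows "X * coth_g X = sc (\<epsilon>/2) * (1 + exp (- (sc \<epsilon> * X))) * einv (ev (phi \<epsilon>) X)"
proof -
  have "coth_g X = (sc (\<epsilon>/2) * ev (1 + fps_exp (-\<epsilon>)) X) * einv X * einv (ev (phi \<epsilon>) X)"
    using exp_as_ev[of \<epsilon> X] by (simp add: coth_g_def)
  hence "X * coth_g X = (sc (\<epsilon>/2) * ev (1 + fps_exp (-\<epsilon>)) X) * (X * einv X) * einv (ev (phi \<epsilon>) X)"
    using splittable_commutes(4)[OF assms, of "\<epsilon>/2" "1 + fps_exp (-\<epsilon>)"] by (simp flip: mult.assoc)
  thus ?thesis using assms exp_as_ev[of \<epsilon> X] by (simp add: einv splittable_def)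
qed

text \<open>
  It suffices to compare after multiplication by the invertible operators \<open>X\<close> and \<open>M\<close>.
\<close>

lemma Rhat_split: assumes g: "splittable X" shows "Rhat X = coth_l X - coth_g X"
proof -
  have u: "unit X" "P * X = X * P" "unit (phi_l X)" "unit (Mhat X)" using g by (auto simp: splittable_def)
  let ?a = "ev (1 + fps_exp (-1)) X" and ?b = "ev (1 + fps_exp (-\<epsilon>)) X" and ?f = "ev (phi 1) X" and ?g = "ev (phi \<epsilon>) X"
  have k: "X * ev (numer_l \<epsilon>) X = sc (1/2) * ?a * ?g - sc (\<epsilon>/2) * ?b * ?f"
  proof -
    have "X * ev (numer_l \<epsilon>) X = ev (fps_X * numer_l \<epsilon>) X" by (simp add: ev_mult)
    thus ?thesis unfolding X_numer_l by (simp add: ev_diff ev_mult entire_intros)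
  qed
  have 1: "einv (phi_l X) * (P * Mhat X) = P * ?g"
    unfolding Mhat_factor(2)[OF u(2)] by (simp add: einv(2)[OF u(3)] flip: mult.assoc)
  have 2: "einv ?g * Mhat X = ?f * P + X * (1 - P)"
    unfolding Mhat_factor(1)[OF u(2)] by (simp add: einv(2)[OF splittable_commutes(3)[OF g]] flip: mult.assoc)
  have gP: "P * ?g = ?g * P" using ev_P[OF _ u(2)] by simp
  have "X * ((coth_l X - coth_g X) * Mhat X) = (X * coth_l X) * Mhat X - (X * coth_g X) * Mhat X"
    by (simp add: algebra_simps)
  also have "\<dots> = sc (1/2) * ?a * (einv (phi_l X) * (P * Mhat X)) - sc (\<epsilon>/2) * ?b * (einv ?g * Mhat X)"
    unfolding X_coth_l[OF g] X_coth_g[OF g] using exp_as_ev[of 1 X] exp_as_ev[of \<epsilon> X] by (simp add: mult.assoc)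
  also have "\<dots> = (sc (1/2) * ?a * ?g - sc (\<epsilon>/2) * ?b * ?f) * P - (sc (\<epsilon>/2) * ?b) * X * (1 - P)"
    unfolding 1 2 gP by (simp add: algebra_simps)
  also have "(sc (\<epsilon>/2) * ?b) * X = X * (sc (\<epsilon>/2) * ?b)"
    using splittable_commutes(4)[OF g, of "\<epsilon>/2" "1 + fps_exp (-\<epsilon>)"] by (simp add: entire_intros)
  also have "(sc (1/2) * ?a * ?g - sc (\<epsilon>/2) * ?b * ?f) * P - X * (sc (\<epsilon>/2) * ?b) * (1 - P) = X * Nhat X"
    unfolding k[symmetric] Nhat_def by (simp add: ev_mult entire_intros right_diff_distrib mult.assoc)
  finally have "einv X * (X * ((coth_l X - coth_g X) * Mhat X)) = einv X * (X * Nhat X)" by simp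
  hence "(coth_l X - coth_g X) * Mhat X = Nhat X" using einv(2)[OF u(1)] by (simp flip: mult.assoc)
  hence "Rhat X = (coth_l X - coth_g X) * (Mhat X * einv (Mhat X))" unfolding Rhat_def by (simp flip: mult.assoc)
  thus ?thesis using einv(1)[OF u(4)] by simp
qed

text \<open>
  The hyperbolic cotangent as a Cayley transform: it sends \<open>(1 - exp (- X)) x'\<close> to \<open>1/2 (1 + exp (- X)) x'\<close>.
\<close>

lemma coth_l_cayley:
  assumes g: "splittable X"
  obtains x' where "app P x = x' - app (exp (- X)) x'" "app (coth_l X) x = (1/2) *s (x' + app (exp (- X)) x')"
    "app P x' = x'"
proof
  define x' where "x' = app (einv X * einv (phi_l X) * P) x"
  have u: "unit X" "P * X = X * P" "unit (phi_l X)" using g by (auto simp: splittable_def)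
  show "app (coth_l X) x = (1/2) *s (x' + app (exp (- X)) x')"
    by (simp add: coth_l_def x'_def)
  show Px': "app P x' = x'"
    unfolding x'_def using splittable_commutes(1,2)[OF g] by (metis (no_types, lifting) P_idem app_simps(1) mult.assoc)
  have "x' - app (exp (- X)) x' = app (X * ev (phi 1) X) x'"
    using ev_X_phi[of X 1] by simp
  also have "X * ev (phi 1) X = ev (phi 1) X * X" by (simp add: ev_commute)
  also have "app (ev (phi 1) X * X) x' = app (ev (phi 1) X) (app (einv (phi_l X)) (app P x))"
    by (simp add: x'_def u)
  also have "\<dots> = app (phi_l X) (app (einv (phi_l X)) (app P x))"
  proof -
    have "app P (app (einv (phi_l X)) (app P x)) = app (einv (phi_l X)) (app P x)"
      using splittable_commutes(2)[OF g] by (metis (no_types, lifting) P_idem app_simps(1) mult.assoc)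
    thus ?thesis by (simp add: phi_l_def)
  qed
  also have "\<dots> = app P x" by (simp add: u)
  finally show "app P x = x' - app (exp (- X)) x'" ..
qed

lemma coth_g_cayley:
  assumes g: "splittable X"
  obtains x' where "x = x' - app (exp (- (sc \<epsilon> * X))) x'"
    "app (coth_g X) x = (\<epsilon>/2) *s (x' + app (exp (- (sc \<epsilon> * X))) x')"
proof
  define x' where "x' = app (einv X * einv (ev (phi \<epsilon>) X)) x"
  have u: "unit X" "unit (ev (phi \<epsilon>) X)" using g splittable_commutes(3)[OF g] by (auto simp: splittable_def)
  show "app (coth_g X) x = (\<epsilon>/2) *s (x' + app (exp (- (sc \<epsilon> * X))) x')"
    by (simp add: coth_g_def x'_def)
  have "x' - app (exp (- (sc \<epsilon> * X))) x' = app (X * ev (phi \<epsilon>) X) x'"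
    using ev_X_phi[of X \<epsilon>] by simp
  also have "X * ev (phi \<epsilon>) X = ev (phi \<epsilon>) X * X" by (simp add: ev_commute)
  also have "app (ev (phi \<epsilon>) X * X) x' = x" by (simp add: x'_def u)
  finally show "x = x' - app (exp (- (sc \<epsilon> * X))) x'" ..
qed

subsection \<open>The addition theorem and skew-symmetry\<close>

lemma exp_shift: "exp (- (sc c * (ad br \<mu> + sc u))) = sc (exp (- (c * u))) * exp (sc (- c) * ad br \<mu>)"
proof -
  have "- (sc c * (ad br \<mu> + sc u)) = sc (- (c * u)) + sc (- c) * ad br \<mu>"
    by (simp add: distrib_left sc_simps)
  thus ?thesis by (subst \<open>- _ = _\<close>, subst exp_add_commuting) (simp_all add: exp_sc sc_commute)
qed

text \<open>
  The scalars \<open>exp (- c u)\<close>, \<open>exp (- c v)\<close>, \<open>exp (- c w)\<close> multiply to \<open>1\<close>.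
\<close>

lemma F_exp_shift:
  assumes "u + v + w = 0"
  shows "F (app (exp (- (sc c * (ad br \<mu> + sc u)))) x) (app (exp (- (sc c * (ad br \<mu> + sc v)))) y)
      (app (exp (- (sc c * (ad br \<mu> + sc w)))) z) = F x y z"
proof -
  let ?D = "sc (- c) * ad br \<mu>"
  have "exp (- (c * u)) * (exp (- (c * v)) * exp (- (c * w))) = exp (- c * (u + v + w))"
    by (simp add: algebra_simps flip: exp_add)
  hence e: "exp (- (c * u)) * (exp (- (c * v)) * exp (- (c * w))) = 1" using assms by simp
  have "F (app (exp (- (sc c * (ad br \<mu> + sc u)))) x) (app (exp (- (sc c * (ad br \<mu> + sc v)))) y)
      (app (exp (- (sc c * (ad br \<mu> + sc w)))) z)
    = exp (- (c * u)) * (exp (- (c * v)) * exp (- (c * w))) * F (app (exp ?D) x) (app (exp ?D) y) (app (exp ?D) z)"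
    unfolding exp_shift by (simp add: F_simps mult_ac)
  thus ?thesis unfolding e using exp_F[OF F_scaled_ad, of "- c" \<mu> x y z] by simp
qed

lemma form_exp_shift:
  "form (app (exp (- (sc c * (ad br \<mu> + sc u)))) x) (app (exp (- (sc c * (ad br \<mu> + sc (- u))))) y) = form x y"
proof -
  let ?D = "sc (- c) * ad br \<mu>"
  have "form (app (ev (fps_exp 1) ?D) x) (app (exp ?D) y) = form x (app (ev (fps_exp 1) (- ?D)) (app (exp ?D) y))"
  proof (rule ev_adjoint)
    show "form (app ?D x) y = form x (app (- ?D) y)" for x y
      using form_ad[of \<mu> x y] by (simp add: form_simps)
  qed simp
  hence "form (app (exp ?D) x) (app (exp ?D) y) = form x y"
    using exp_minus_cancel(2)[of ?D] by (simp add: ev_exp flip: app_simps(1))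
  moreover have "exp (c * u) * exp (- (c * u)) = 1" "exp (- (c * u)) * exp (c * u) = 1"
    by (simp_all flip: exp_add)
  ultimately show ?thesis unfolding exp_shift by (simp add: form_simps flip: mult.assoc)
qed

text \<open>
  For a number \<open>a = exp (- 2 s)\<close> the quotient \<open>(1 + a) / (1 - a)\<close> is \<open>coth s\<close>.  So this is the addition theorem
  \<open>coth u coth v + coth u coth w + coth v coth w = - 1\<close> for \<open>u + v + w = 0\<close>, with the exponentials replaced by
  operators that preserve \<open>F\<close> jointly.
\<close>

lemma cayley_sum:
  assumes inv: "\<And>x y z. F (app a x) (app b y) (app c z) = F x y z"
  shows "F (k *s (x + app a x)) (k *s (y + app b y)) (z - app c z)
    + F (k *s (x + app a x)) (y - app b y) (k *s (z + app c z))
    + F (x - app a x) (k *s (y + app b y)) (k *s (z + app c z))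
    = - (k * k) * F (x - app a x) (y - app b y) (z - app c z)"
  using inv[of x y z] by (simp add: F_simps algebra_simps)

lemma coth_l_in_l: assumes "splittable X" shows "app P (app (coth_l X) x) = app (coth_l X) x"
proof -
  obtain x' where x': "app (coth_l X) x = (1/2) *s (x' + app (exp (- X)) x')" "app P x' = x'"
    by (rule coth_l_cayley[OF assms])
  have "app (exp (- X)) x' = app (ev (fps_exp (-1)) X) x'" by (simp add: ev_exp sc_simps)
  moreover have "app P (app (ev (fps_exp (-1)) X) x') = app (ev (fps_exp (-1)) X) x'"
    using ev_P[of "fps_exp (-1)" X] assms x'(2) unfolding splittable_def by (metis app_simps(1) entire_intros(5))
  ultimately show ?thesis using x' by simp
qed

text \<open>
  The values of \<open>coth_l\<close> lie in \<open>l\<close>, so that the remaining argument of \<open>F\<close> may be projected to \<open>l\<close>.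
\<close>

lemma coth_l_sum:
  assumes g: "splittable (ad br \<mu> + sc u)" "splittable (ad br \<mu> + sc v)" "splittable (ad br \<mu> + sc w)" and s: "u + v + w = 0"
  shows "F (app (coth_l (ad br \<mu> + sc u)) x) (app (coth_l (ad br \<mu> + sc v)) y) z
    + F (app (coth_l (ad br \<mu> + sc u)) x) y (app (coth_l (ad br \<mu> + sc w)) z)
    + F x (app (coth_l (ad br \<mu> + sc v)) y) (app (coth_l (ad br \<mu> + sc w)) z)
    = - (1/4) * F (app P x) (app P y) (app P z)"
proof -
  let ?U = "ad br \<mu> + sc u" and ?V = "ad br \<mu> + sc v" and ?W = "ad br \<mu> + sc w"
  obtain x' where x: "app P x = x' - app (exp (- ?U)) x'"
    "app (coth_l ?U) x = (1/2) *s (x' + app (exp (- ?U)) x')" by (rule coth_l_cayley[OF g(1)])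
  obtain y' where y: "app P y = y' - app (exp (- ?V)) y'"
    "app (coth_l ?V) y = (1/2) *s (y' + app (exp (- ?V)) y')" by (rule coth_l_cayley[OF g(2)])
  obtain z' where z: "app P z = z' - app (exp (- ?W)) z'"
    "app (coth_l ?W) z = (1/2) *s (z' + app (exp (- ?W)) z')" by (rule coth_l_cayley[OF g(3)])
  have P1: "F (app (coth_l ?U) x) (app (coth_l ?V) y) z
      = F (app (coth_l ?U) x) (app (coth_l ?V) y) (app P z)"
    "F (app (coth_l ?U) x) y (app (coth_l ?W) z)
      = F (app (coth_l ?U) x) (app P y) (app (coth_l ?W) z)"
    "F x (app (coth_l ?V) y) (app (coth_l ?W) z)
      = F (app P x) (app (coth_l ?V) y) (app (coth_l ?W) z)"
    using F_PP F_PP' coth_l_in_l[OF g(1)] coth_l_in_l[OF g(2)] coth_l_in_l[OF g(3)] by metis+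
  show ?thesis unfolding P1 unfolding x y z
    using cayley_sum[of "exp (- ?U)" "exp (- ?V)" "exp (- ?W)" "1/2" x' y' z']
      F_exp_shift[OF s, of 1 \<mu>] by simp
qed

lemma coth_g_sum:
  assumes g: "splittable (ad br \<mu> + sc u)" "splittable (ad br \<mu> + sc v)" "splittable (ad br \<mu> + sc w)" and s: "u + v + w = 0"
  shows "F (app (coth_g (ad br \<mu> + sc u)) x) (app (coth_g (ad br \<mu> + sc v)) y) z
    + F (app (coth_g (ad br \<mu> + sc u)) x) y (app (coth_g (ad br \<mu> + sc w)) z)
    + F x (app (coth_g (ad br \<mu> + sc v)) y) (app (coth_g (ad br \<mu> + sc w)) z)
    = - (\<epsilon>\<^sup>2/4) * F x y z"
proof -
  let ?U = "ad br \<mu> + sc u" and ?V = "ad br \<mu> + sc v" and ?W = "ad br \<mu> + sc w"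
  obtain x' where x: "x = x' - app (exp (- (sc \<epsilon> * ?U))) x'"
    "app (coth_g ?U) x = (\<epsilon>/2) *s (x' + app (exp (- (sc \<epsilon> * ?U))) x')" by (rule coth_g_cayley[OF g(1)])
  obtain y' where y: "y = y' - app (exp (- (sc \<epsilon> * ?V))) y'"
    "app (coth_g ?V) y = (\<epsilon>/2) *s (y' + app (exp (- (sc \<epsilon> * ?V))) y')" by (rule coth_g_cayley[OF g(2)])
  obtain z' where z: "z = z' - app (exp (- (sc \<epsilon> * ?W))) z'"
    "app (coth_g ?W) z = (\<epsilon>/2) *s (z' + app (exp (- (sc \<epsilon> * ?W))) z')" by (rule coth_g_cayley[OF g(3)])
  have "F (app (coth_g ?U) x) (app (coth_g ?V) y) (z' - app (exp (- (sc \<epsilon> * ?W))) z')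
    + F (app (coth_g ?U) x) (y' - app (exp (- (sc \<epsilon> * ?V))) y') (app (coth_g ?W) z)
    + F (x' - app (exp (- (sc \<epsilon> * ?U))) x') (app (coth_g ?V) y) (app (coth_g ?W) z)
    = - (\<epsilon>/2 * (\<epsilon>/2)) * F (x' - app (exp (- (sc \<epsilon> * ?U))) x')
        (y' - app (exp (- (sc \<epsilon> * ?V))) y') (z' - app (exp (- (sc \<epsilon> * ?W))) z')"
    unfolding x(2) y(2) z(2) by (rule cayley_sum[OF F_exp_shift[OF s]])
  thus ?thesis unfolding x(1)[symmetric] y(1)[symmetric] z(1)[symmetric] by (simp add: power2_eq_square)
qed

lemma cayley_skew:
  assumes inv: "\<And>x y. form (app a x) (app b y) = form x y"
  shows "form (k *s (x + app a x)) (y - app b y) = - form (x - app a x) (k *s (y + app b y))"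
  using inv[of x y] by (simp add: form_simps algebra_simps)

lemma Rhat_shift_skew:
  assumes g: "splittable (ad br \<mu> + sc u)" "splittable (ad br \<mu> + sc (- u))"
  shows "form (app (Rhat (ad br \<mu> + sc u)) x) y = - form x (app (Rhat (ad br \<mu> + sc (- u))) y)"
proof -
  let ?X = "ad br \<mu> + sc u" and ?Y = "ad br \<mu> + sc (- u)"
  have "form (app (coth_l ?X) x) y = - form x (app (coth_l ?Y) y)"
  proof -
    obtain x' where x: "app P x = x' - app (exp (- ?X)) x'"
      "app (coth_l ?X) x = (1/2) *s (x' + app (exp (- ?X)) x')" by (rule coth_l_cayley[OF g(1)])
    obtain y' where y: "app P y = y' - app (exp (- ?Y)) y'"
      "app (coth_l ?Y) y = (1/2) *s (y' + app (exp (- ?Y)) y')" by (rule coth_l_cayley[OF g(2)])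
    have "form (app (coth_l ?X) x) y = form (app (coth_l ?X) x) (app P y)" using coth_l_in_l[OF g(1), of x] P_sym by metis
    also have "\<dots> = - form (app P x) (app (coth_l ?Y) y)"
      unfolding x y using form_exp_shift[of 1 \<mu> u] by (intro cayley_skew) simp
    also have "form (app P x) (app (coth_l ?Y) y) = form x (app (coth_l ?Y) y)" using coth_l_in_l[OF g(2), of y] P_sym by metis
    finally show ?thesis .
  qed
  moreover have "form (app (coth_g ?X) x) y = - form x (app (coth_g ?Y) y)"
  proof -
    obtain x' where x: "x = x' - app (exp (- (sc \<epsilon> * ?X))) x'"
      "app (coth_g ?X) x = (\<epsilon>/2) *s (x' + app (exp (- (sc \<epsilon> * ?X))) x')" by (rule coth_g_cayley[OF g(1)])
    obtain y' where y: "y = y' - app (exp (- (sc \<epsilon> * ?Y))) y'"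
      "app (coth_g ?Y) y = (\<epsilon>/2) *s (y' + app (exp (- (sc \<epsilon> * ?Y))) y')" by (rule coth_g_cayley[OF g(2)])
    have "form (app (coth_g ?X) x) (y' - app (exp (- (sc \<epsilon> * ?Y))) y')
        = - form (x' - app (exp (- (sc \<epsilon> * ?X))) x') (app (coth_g ?Y) y)"
      unfolding x(2) y(2) by (rule cayley_skew[OF form_exp_shift])
    thus ?thesis unfolding x(1)[symmetric] y(1)[symmetric] .
  qed
  ultimately show ?thesis by (simp add: Rhat_split[OF g(1)] Rhat_split[OF g(2)] form_simps)
qed

text \<open>
  The first three brackets will tend to the derivative term.  With \<open>R = p - q\<close> all products of a \<open>p\<close> and a \<open>q\<close> cancel,
  and the two addition theorems evaluate the rest.
\<close>

lemma shifted_identity: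
  fixes \<mu> u v w
  defines "p \<equiv> \<lambda>u. app (coth_l (ad br \<mu> + sc u))" and "R \<equiv> \<lambda>u. app (Rhat (ad br \<mu> + sc u))"
  assumes g: "splittable (ad br \<mu> + sc u)" "splittable (ad br \<mu> + sc v)" "splittable (ad br \<mu> + sc w)" and s: "u + v + w = 0"
  shows "- (F (p u x) y (R w z) + F (p u x) (R v y) z) + (F (p v y) x (R w z) + F (p v y) (R u x) z)
      - (F (p w z) x (R v y) + F (p w z) (R u x) y)
      + F (R u x) (R v y) z + F (R u x) y (R w z) + F x (R v y) (R w z)
    = F (app P x) (app P y) (app P z) / 4 - \<epsilon>\<^sup>2 / 4 * F x y z"
proof -
  define q where "q u = app (coth_g (ad br \<mu> + sc u))" for u
  have R: "R u x = p u x - q u x" "R v y = p v y - q v y" "R w z = p w z - q w z"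
    using Rhat_split[OF g(1)] Rhat_split[OF g(2)] Rhat_split[OF g(3)] by (simp_all add: R_def p_def q_def)
  have sw: "F (p v y) a b = - F a (p v y) b" "F (p w z) a b = F a b (p w z)" for a b
    using F_swap F_cyc by metis+
  have coth_l: "F (p u x) (p v y) z + F (p u x) y (p w z) + F x (p v y) (p w z) = - (1/4) * F (app P x) (app P y) (app P z)"
    unfolding p_def by (rule coth_l_sum[OF g s])
  have coth_g: "F (q u x) (q v y) z + F (q u x) y (q w z) + F x (q v y) (q w z) = - (\<epsilon>\<^sup>2/4) * F x y z"
    unfolding q_def by (rule coth_g_sum[OF g s])
  have "- (F (p u x) y (R w z) + F (p u x) (R v y) z) + (F (p v y) x (R w z) + F (p v y) (R u x) z)
      - (F (p w z) x (R v y) + F (p w z) (R u x) y)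
      + F (R u x) (R v y) z + F (R u x) y (R w z) + F x (R v y) (R w z)
    = (F (q u x) (q v y) z + F (q u x) y (q w z) + F x (q v y) (q w z))
      - (F (p u x) (p v y) z + F (p u x) y (p w z) + F x (p v y) (p w z))"
    unfolding sw R by (simp add: F_simps)
  thus ?thesis unfolding coth_l coth_g by simp
qed

subsection \<open>Passing to the limit of zero shift\<close>

text \<open>
  Where \<open>R\<close> is defined and the exponential map is nonsingular.
\<close>

definition regular :: "complex^'a \<Rightarrow> bool" where
  "regular \<mu> \<longleftrightarrow> nonsingular \<mu> \<and> unit (Mhat (ad br \<mu>))"

lemma P_shift: "\<mu> \<in> l \<Longrightarrow> P * (ad br \<mu> + sc u) = (ad br \<mu> + sc u) * P"
  by (simp add: distrib_left distrib_right P_ad sc_commute)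

lemma shift_tendsto: "((\<lambda>u. ad br \<mu> + sc u) \<longlongrightarrow> ad br \<mu>) (at 0)"
  by (auto intro!: tendsto_eq_intros)

lemma Mhat_tendsto: "(g \<longlongrightarrow> X) A \<Longrightarrow> ((\<lambda>t. Mhat (g t)) \<longlongrightarrow> Mhat X) A"
  unfolding Mhat_def by (intro tendsto_intros ev_tendsto entire_intros) auto

lemma phi_l_tendsto: "(g \<longlongrightarrow> X) A \<Longrightarrow> ((\<lambda>t. phi_l (g t)) \<longlongrightarrow> phi_l X) A"
  unfolding phi_l_def by (intro tendsto_intros ev_tendsto entire_intros) auto

lemma regularD: "regular \<mu> \<Longrightarrow> \<mu> \<in> l" "regular \<mu> \<Longrightarrow> ad br \<mu> \<in> Rhat_domain"
  unfolding regular_def nonsingular_def Rhat_domain_def by (auto simp: P_ad)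

lemma eventually_splittable: assumes "regular \<mu>" shows "eventually (\<lambda>u. splittable (ad br \<mu> + sc u)) (at 0)"
proof -
  have "unit (phi_l (ad br \<mu>))" "unit (Mhat (ad br \<mu>))" using assms unit_phi_l by (auto simp: regular_def)
  hence "eventually (\<lambda>u. unit (phi_l (ad br \<mu> + sc u))) (at 0)" "eventually (\<lambda>u. unit (Mhat (ad br \<mu> + sc u))) (at 0)"
    by (auto intro!: eventually_unit[OF phi_l_tendsto[OF shift_tendsto]] eventually_unit[OF Mhat_tendsto[OF shift_tendsto]])
  with eventually_unit_shift[of "ad br \<mu>"] show ?thesis
    by eventually_elim (simp add: splittable_def P_shift[OF regularD(1)[OF assms]])
qed

lemma eventually_splittable_multiple:
  assumes "regular \<mu>" "c \<noteq> 0" shows "eventually (\<lambda>t. splittable (ad br \<mu> + sc (c * t))) (at 0)"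
proof -
  have "filterlim (\<lambda>t. c * t) (at 0) (at 0)"
    using assms(2) by (auto simp: filterlim_at eventually_at_filter intro!: tendsto_eq_intros)
  thus ?thesis using eventually_splittable[OF assms(1)] eventually_compose_filterlim by blast
qed

lemma Rhat_tendsto:
  assumes "regular \<mu>" "(g \<longlongrightarrow> ad br \<mu>) A" "eventually (\<lambda>t. g t \<in> Rhat_domain) A"
  shows "((\<lambda>t. Rhat (g t)) \<longlongrightarrow> Rhat (ad br \<mu>)) A"
  by (rule continuous_on_tendsto_compose[OF dvd_diff_continuous[OF Rhat_dd] assms(2) regularD(2)[OF assms(1)] assms(3)])

lemma Rhat_shift_tendsto:
  assumes "regular \<mu>" "c \<noteq> 0"
  shows "((\<lambda>t. Rhat (ad br \<mu> + sc (c * t))) \<longlongrightarrow> Rhat (ad br \<mu>)) (at 0)"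
proof (rule Rhat_tendsto[OF assms(1)])
  show "((\<lambda>t. ad br \<mu> + sc (c * t)) \<longlongrightarrow> ad br \<mu>) (at 0)" by (auto intro!: tendsto_eq_intros)
  show "eventually (\<lambda>t. ad br \<mu> + sc (c * t) \<in> Rhat_domain) (at 0)"
    using eventually_splittable_multiple[OF assms] by eventually_elim (simp add: splittable_def Rhat_domain_def)
qed

lemmas tendsto_form [tendsto_intros] = bounded_bilinear.tendsto[OF bounded_bilinear_form]
lemmas tendsto_br [tendsto_intros] = bounded_bilinear.tendsto[OF bounded_bilinear_br]

lemma tendsto_F [tendsto_intros]:
  "(a \<longlongrightarrow> x) A \<Longrightarrow> (b \<longlongrightarrow> y) A \<Longrightarrow> (c \<longlongrightarrow> z) A \<Longrightarrow> ((\<lambda>t. F (a t) (b t) (c t)) \<longlongrightarrow> F x y z) A"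
  unfolding F_def by (intro tendsto_intros)

lemma Rhat_skew:
  assumes "regular \<mu>" shows "form (app (Rhat (ad br \<mu>)) x) y = - form x (app (Rhat (ad br \<mu>)) y)"
proof (rule tendsto_unique[of "at (0::complex)"])
  show "((\<lambda>t. form (app (Rhat (ad br \<mu> + sc (1 * t))) x) y) \<longlongrightarrow> form (app (Rhat (ad br \<mu>)) x) y) (at 0)"
    by (intro tendsto_intros Rhat_shift_tendsto assms) simp
  have "((\<lambda>t. - form x (app (Rhat (ad br \<mu> + sc (-1 * t))) y)) \<longlongrightarrow> - form x (app (Rhat (ad br \<mu>)) y)) (at 0)"
    by (intro tendsto_intros Rhat_shift_tendsto assms) simp
  moreover have "eventually (\<lambda>t. - form x (app (Rhat (ad br \<mu> + sc (-1 * t))) y) = form (app (Rhat (ad br \<mu> + sc (1 * t))) x) y) (at 0)"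
    using eventually_splittable_multiple[OF assms, of 1, simplified] eventually_splittable_multiple[OF assms, of "-1", simplified]
    by eventually_elim (simp add: Rhat_shift_skew)
  ultimately show "((\<lambda>t. form (app (Rhat (ad br \<mu> + sc (1 * t))) x) y) \<longlongrightarrow> - form x (app (Rhat (ad br \<mu>)) y)) (at 0)"
    by (rule Lim_transform_eventually)
qed simp

text \<open>
  In closed form \<open>T/2 coth (T/2) \<xi>\<close> with \<open>T = ad \<mu>\<close>.
\<close>

definition mean_vector :: "complex^'a \<Rightarrow> complex^'a \<Rightarrow> complex^'a" where
  "mean_vector \<mu> \<xi> = (1/2) *s (left_vector br l \<xi> \<mu> + right_vector br l \<xi> \<mu>)"

lemma mean_vector_eq:
  assumes "nonsingular \<mu>" "\<xi> \<in> l"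
  shows "mean_vector \<mu> \<xi> = (1/2) *s app (einv (phi_l (ad br \<mu>))) (\<xi> + app (exp (- ad br \<mu>)) \<xi>)"
  unfolding mean_vector_def left_plus_right[OF assms, symmetric] using unit_phi_l[OF assms(1)] by simp

text \<open>
  The function \<open>s/2 coth (s/2)\<close> is regular at \<open>0\<close>, although its factor \<open>coth\<close> is not.
\<close>

lemma X_coth_l_tendsto:
  assumes "regular \<mu>" "c \<noteq> 0"
  shows "((\<lambda>t. app (ad br \<mu> + sc (c * t)) (app (coth_l (ad br \<mu> + sc (c * t))) x)) \<longlongrightarrow> mean_vector \<mu> (app P x)) (at 0)"
proof -
  have n: "nonsingular \<mu>" using assms(1) by (simp add: regular_def)
  have t: "((\<lambda>t. ad br \<mu> + sc (c * t)) \<longlongrightarrow> ad br \<mu>) (at 0)" by (auto intro!: tendsto_eq_intros)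
  let ?h = "\<lambda>X. app (sc (1/2) * ev (1 + fps_exp (-1)) X * einv (phi_l X) * P) x"
  have "((\<lambda>t. ?h (ad br \<mu> + sc (c * t))) \<longlongrightarrow> ?h (ad br \<mu>)) (at 0)"
    by (intro tendsto_intros ev_tendsto phi_l_tendsto t unit_phi_l n entire_intros)
  moreover have "?h (ad br \<mu>) = mean_vector \<mu> (app P x)"
  proof -
    let ?e = "ev (1 + fps_exp (-1)) (ad br \<mu>)"
    have 1: "?e * P = P * ?e" using n by (intro ev_P entire_intros) (auto simp: nonsingular_def P_ad)
    have 2: "?e * ev (phi 1) (ad br \<mu>) = ev (phi 1) (ad br \<mu>) * ?e"
    proof -
      have "ev ((1 + fps_exp (-1)) * phi 1) (ad br \<mu>) = ev (phi 1 * (1 + fps_exp (-1))) (ad br \<mu>)"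
        by (simp only: mult.commute)
      thus ?thesis by (simp add: ev_mult entire_intros)
    qed
    have "?e * (ev (phi 1) (ad br \<mu>) * P) = ev (phi 1) (ad br \<mu>) * P * ?e"
      by (simp only: mult.assoc[symmetric] 2) (simp only: mult.assoc 1)
    hence "phi_l (ad br \<mu>) * ?e = ?e * phi_l (ad br \<mu>)"
      using 1 by (simp only: phi_l_def distrib_left distrib_right left_diff_distrib right_diff_distrib mult_1_left mult_1_right)
    from einv_commute[OF unit_phi_l[OF n] this]
    have c: "einv (phi_l (ad br \<mu>)) * ?e = ?e * einv (phi_l (ad br \<mu>))" .
    have "?h (ad br \<mu>) = (1/2) *s app (ev (1 + fps_exp (-1)) (ad br \<mu>) * einv (phi_l (ad br \<mu>))) (app P x)" by simp
    also have "\<dots> = (1/2) *s app (einv (phi_l (ad br \<mu>))) (app (ev (1 + fps_exp (-1)) (ad br \<mu>)) (app P x))"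
      unfolding c[symmetric] by simp
    also have "app (ev (1 + fps_exp (-1)) (ad br \<mu>)) (app P x) = app P x + app (exp (- ad br \<mu>)) (app P x)"
      using exp_as_ev[of 1 "ad br \<mu>", symmetric] by simp
    finally show ?thesis by (simp only: mean_vector_eq[OF n P_range])
  qed
  moreover have "eventually (\<lambda>t. ?h (ad br \<mu> + sc (c * t)) = app (ad br \<mu> + sc (c * t)) (app (coth_l (ad br \<mu> + sc (c * t))) x)) (at 0)"
    using eventually_splittable_multiple[OF assms]
  proof eventually_elim
    case (elim t)
    have "app (ad br \<mu> + sc (c * t)) (app (coth_l (ad br \<mu> + sc (c * t))) x) = app ((ad br \<mu> + sc (c * t)) * coth_l (ad br \<mu> + sc (c * t))) x"
      by (simp only: app_simps(1))
    moreover have "1 + exp (- (ad br \<mu> + sc (c * t))) = ev (1 + fps_exp (-1)) (ad br \<mu> + sc (c * t))"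
      using exp_as_ev[of 1 "ad br \<mu> + sc (c * t)"] by (simp only: sc_1 mult_1_left)
    ultimately show ?case by (simp only: X_coth_l[OF elim])
  qed
  ultimately show ?thesis by (simp add: Lim_transform_eventually)
qed

text \<open>
  Let \<open>X\<^sub>k = ad \<mu> + k t\<close> and \<open>w = coth_l X\<^sub>a x\<close>.  Because \<open>- c - b = a\<close>, the commutator \<open>X\<^sub>-\<^sub>c * ad w - ad w * X\<^sub>b\<close> is \<open>ad (X\<^sub>a w)\<close>,
  and the divided difference of \<open>R\<close> at \<open>(X\<^sub>-\<^sub>c, X\<^sub>b)\<close> maps it to \<open>R X\<^sub>-\<^sub>c * ad w - ad w * R X\<^sub>b\<close>.  The transpose of \<open>R X\<^sub>-\<^sub>c\<close> is
  \<open>- R X\<^sub>c\<close>, which gives the left-hand side; and \<open>X\<^sub>a w\<close> converges to the mean vector.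
\<close>

lemma derivative_limit:
  assumes reg: "regular \<mu>" and abc: "a \<noteq> 0" "b \<noteq> 0" "c \<noteq> 0" "a + b + c = 0"
  shows "((\<lambda>t. - (F (app (coth_l (ad br \<mu> + sc (a * t))) x) y (app (Rhat (ad br \<mu> + sc (c * t))) z)
        + F (app (coth_l (ad br \<mu> + sc (a * t))) x) (app (Rhat (ad br \<mu> + sc (b * t))) y) z))
      \<longlongrightarrow> form (app (blinfun_apply (Rhat_dd (ad br \<mu>) (ad br \<mu>)) (ad br (mean_vector \<mu> (app P x)))) y) z) (at 0)"
proof -
  let ?X = "\<lambda>k t. ad br \<mu> + sc (k * t)"
  let ?w = "\<lambda>t. app (?X a t) (app (coth_l (?X a t)) x)"
  have tX: "(?X k \<longlongrightarrow> ad br \<mu>) (at 0)" for k by (auto intro!: tendsto_eq_intros)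
  have eU: "eventually (\<lambda>t. ?X k t \<in> Rhat_domain) (at 0)" if "k \<noteq> 0" for k
    using eventually_splittable_multiple[OF reg that] by eventually_elim (simp add: splittable_def Rhat_domain_def)
  have c': "- c \<noteq> 0" using abc by simp
  have "((\<lambda>t. form (app (blinfun_apply (Rhat_dd (?X (- c) t) (?X b t)) (ad br (?w t))) y) z) \<longlongrightarrow>
      form (app (blinfun_apply (Rhat_dd (ad br \<mu>) (ad br \<mu>)) (ad br (mean_vector \<mu> (app P x)))) y) z) (at 0)"
    by (intro tendsto_intros dvd_diff_tendsto[OF Rhat_dd] tX eU regularD reg abc c' X_coth_l_tendsto
        bounded_linear.tendsto[OF bounded_linear_ad[OF lie]])
  moreover have "eventually (\<lambda>t. form (app (blinfun_apply (Rhat_dd (?X (- c) t) (?X b t)) (ad br (?w t))) y) z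
      = - (F (app (coth_l (?X a t)) x) y (app (Rhat (?X c t)) z) + F (app (coth_l (?X a t)) x) (app (Rhat (?X b t)) y) z)) (at 0)"
    using eventually_splittable_multiple[OF reg abc(1)] eventually_splittable_multiple[OF reg abc(2)]
      eventually_splittable_multiple[OF reg abc(3)] eventually_splittable_multiple[OF reg c']
  proof eventually_elim
    case (elim t)
    define w where "w = app (coth_l (?X a t)) x"
    have wl: "w \<in> l" using coth_l_in_l[OF elim(1)] by (simp add: in_l_iff w_def)
    have ab: "- c * t - b * t = a * t" 
    proof -
      have "- c * t - b * t = a * t - (a + b + c) * t" by (simp add: algebra_simps)
      thus ?thesis using abc(4) by simp
    qed
    have "?X (- c) t * ad br w - ad br w * ?X b t = ad br (app (?X a t) w)"
      unfolding shift_intertwine ab ..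
    moreover have "Rhat (?X (- c) t) * ad br w - ad br w * Rhat (?X b t)
        = blinfun_apply (Rhat_dd (?X (- c) t) (?X b t)) (?X (- c) t * ad br w - ad br w * ?X b t)"
      using Rhat_dd elim(2,4) P_ad[OF wl] unfolding divided_difference_def Rhat_domain_def splittable_def by blast
    ultimately have E: "blinfun_apply (Rhat_dd (?X (- c) t) (?X b t)) (ad br (?w t))
        = Rhat (?X (- c) t) * ad br w - ad br w * Rhat (?X b t)" by (simp only: w_def)
    have "form (app (blinfun_apply (Rhat_dd (?X (- c) t) (?X b t)) (ad br (?w t))) y) z
        = form (app (Rhat (?X (- c) t)) (br w y)) z - form (br w (app (Rhat (?X b t)) y)) z"
      unfolding E by (simp add: form_simps)
    also have "form (app (Rhat (?X (- c) t)) (br w y)) z = - form (br w y) (app (Rhat (?X c t)) z)"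
      using Rhat_shift_skew[of \<mu> "- c * t" "br w y" z] elim(3,4) by simp
    finally show ?case by (simp add: F_def w_def)
  qed
  ultimately show ?thesis by (rule Lim_transform_eventually)
qed

text \<open>
  The dynamical equation for \<open>R\<close> alone, with the defect \<open>1/4 F\<close> on \<open>l\<close> that \<open>r\<^sub>l\<close> has to compensate.
\<close>

theorem operator_identity:
  assumes reg: "regular \<mu>"
  defines "B \<equiv> \<lambda>x y z. form (app (blinfun_apply (Rhat_dd (ad br \<mu>) (ad br \<mu>)) (ad br (mean_vector \<mu> (app P x)))) y) z"
    and "R \<equiv> app (Rhat (ad br \<mu>))"
  shows "B x y z - B y x z + B z x y + F (R x) (R y) z + F (R x) y (R z) + F x (R y) (R z)
    = F (app P x) (app P y) (app P z) / 4 - \<epsilon>\<^sup>2 / 4 * F x y z"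
proof -
  let ?X = "\<lambda>k t. ad br \<mu> + sc (k * t)"
  let ?p = "\<lambda>k t. app (coth_l (?X k t))" and ?R = "\<lambda>k t. app (Rhat (?X k t))"
  have L: "((\<lambda>t. - (F (?p 1 t x) y (?R (-2) t z) + F (?p 1 t x) (?R 1 t y) z)
      - (- (F (?p 1 t y) x (?R (-2) t z) + F (?p 1 t y) (?R 1 t x) z))
      + (- (F (?p (-2) t z) x (?R 1 t y) + F (?p (-2) t z) (?R 1 t x) y))
      + F (?R 1 t x) (?R 1 t y) z + F (?R 1 t x) y (?R (-2) t z) + F x (?R 1 t y) (?R (-2) t z))
    \<longlongrightarrow> B x y z - B y x z + B z x y + F (R x) (R y) z + F (R x) y (R z) + F x (R y) (R z)) (at 0)"
    unfolding B_def R_def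
    by (intro tendsto_intros derivative_limit Rhat_shift_tendsto reg) auto
  have neg2: "(- 2 :: complex) \<noteq> 0" by simp
  have "eventually (\<lambda>t. - (F (?p 1 t x) y (?R (-2) t z) + F (?p 1 t x) (?R 1 t y) z)
      - (- (F (?p 1 t y) x (?R (-2) t z) + F (?p 1 t y) (?R 1 t x) z))
      + (- (F (?p (-2) t z) x (?R 1 t y) + F (?p (-2) t z) (?R 1 t x) y))
      + F (?R 1 t x) (?R 1 t y) z + F (?R 1 t x) y (?R (-2) t z) + F x (?R 1 t y) (?R (-2) t z)
    = F (app P x) (app P y) (app P z) / 4 - \<epsilon>\<^sup>2 / 4 * F x y z) (at 0)"
    using eventually_splittable_multiple[OF reg one_neq_zero] eventually_splittable_multiple[OF reg neg2]
  proof eventually_elim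
    case (elim t)
    \<comment> \<open>Shifts by \<open>t\<close>, \<open>t\<close>, \<open>- 2 t\<close>: nonzero with sum zero.\<close>
    have s: "1 * t + 1 * t + -2 * t = (0 :: complex)" by simp
    show ?case
      using shifted_identity[OF elim(1) elim(1) elim(2) s, of x y z] by (simp add: algebra_simps)
  qed
  hence "((\<lambda>t. F (app P x) (app P y) (app P z) / 4 - \<epsilon>\<^sup>2 / 4 * F x y z)
    \<longlongrightarrow> B x y z - B y x z + B z x y + F (R x) (R y) z + F (R x) y (R z) + F x (R y) (R z)) (at (0::complex))"
    by (rule Lim_transform_eventually[OF L])
  thus ?thesis by (simp add: tendsto_const_iff)
qed

end

section \<open>Tensors and operators\<close>

\<comment> \<open>The infix is reserved for vector components from here on.\<close>
no_notation fps_nth (infixl "$" 75)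

lemma linear_functional_expansion:
  assumes "linear_functional \<eta>" shows "(\<Sum>i\<in>UNIV. \<eta> (axis i 1) * x $ i) = \<eta> x"
proof -
  have "\<eta> (\<Sum>i\<in>I. x $ i *s axis i 1) = (\<Sum>i\<in>I. \<eta> (axis i 1) * x $ i)" for I
    using assms by (induction I rule: infinite_finite_induct)
      (auto simp: linear_functional_iff mult.commute, metis mult_zero_left vector_smult_lzero)+
  from this[of UNIV] show ?thesis by (simp add: basis_expansion)
qed

lemma contract_tensor2: "linear_functional \<eta> \<Longrightarrow> contract (tensor2 x y) \<eta> = \<eta> x *s y"
  by (simp add: vec_eq_iff contract_def tensor2_def mult.assoc[symmetric] sum_distrib_right[symmetric]
      linear_functional_expansion)

lemma contract_linear:
  "contract (A + B) \<eta> = contract A \<eta> + contract B \<eta>" "contract (k *\<^sub>R A) \<eta> = k *\<^sub>R contract A \<eta>"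
  "contract 0 \<eta> = 0"
  by (simp_all add: vec_eq_iff contract_def sum.distrib distrib_left scaleR_sum_right)

lemma tensor_square_UNIV: "A \<in> tensor_square UNIV"
proof -
  have "(\<Sum>k\<in>UNIV. axis k 1 $ i * A $ k $ j) = (\<Sum>k\<in>UNIV. if k = i then A $ k $ j else 0)" for i j
    by (intro sum.cong) (auto simp: axis_def)
  hence "A = (\<Sum>i\<in>UNIV. tensor2 (axis i 1) (A $ i))"
    by (simp add: vec_eq_iff tensor2_def)
  also have "\<dots> \<in> tensor_square UNIV"
    unfolding tensor_square_def by (intro span_sum span_base) blast
  finally show ?thesis .
qed

lemma contract_in:
  assumes V: "vec.subspace V" and A: "A \<in> tensor_square V" and \<eta>: "linear_functional \<eta>"
  shows "contract A \<eta> \<in> V"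
  using A unfolding tensor_square_def
proof (induction rule: span_induct)
  case base
  have "k *\<^sub>R x \<in> V" if "x \<in> V" for k x using V that by (simp add: scaleR_eq_complex_scale vec.subspace_scale)
  thus ?case using V unfolding subspace_def by (auto simp: contract_linear vec.subspace_0 vec.subspace_add)
next
  case (step A)
  thus ?case using V \<eta> by (auto simp: contract_tensor2 vec.subspace_scale)
qed

lemma dual_bases_expand:
  assumes "dual_bases l d \<xi> \<eta>" "x \<in> l"
  shows "(\<Sum>i<d. \<eta> i x *s \<xi> i) = x"
proof -
  have D: "vec.span (\<xi> ` {..<d}) = l" "\<And>i. i < d \<Longrightarrow> linear_functional (\<eta> i)"
    "\<And>i j. i < d \<Longrightarrow> j < d \<Longrightarrow> \<eta> i (\<xi> j) = (if i = j then 1 else 0)"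
    using assms(1) unfolding dual_bases_def by auto
  have "x \<in> vec.span (\<xi> ` {..<d})" using assms(2) D(1) by simp
  thus ?thesis
  proof (induction x rule: vec.span_induct)
    case base
    have "\<eta> i 0 = 0" if "i < d" for i using D(2)[OF that] unfolding linear_functional_iff by (metis mult_zero_left vector_smult_lzero)
    moreover have "(\<Sum>i<d. \<eta> i (c *s x) *s \<xi> i) = c *s (\<Sum>i<d. \<eta> i x *s \<xi> i)" for c x
      using D(2) by (auto simp: linear_functional_iff vec.scale_sum_right vector_smult_assoc intro!: sum.cong)
    moreover have "(\<Sum>i<d. \<eta> i (x + y) *s \<xi> i) = (\<Sum>i<d. \<eta> i x *s \<xi> i) + (\<Sum>i<d. \<eta> i y *s \<xi> i)" for x y
      using D(2) by (auto simp: linear_functional_iff vector_sadd_rdistrib simp flip: sum.distrib intro!: sum.cong)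
    ultimately show ?case unfolding vec.subspace_def by simp
  next
    case (step x)
    then obtain j where j: "j < d" "x = \<xi> j" by auto
    have "(\<Sum>i<d. \<eta> i x *s \<xi> i) = (\<Sum>i<d. if i = j then \<xi> j else 0)"
      using j D(3) by (intro sum.cong) auto
    thus ?case using j by simp
  qed
qed

text \<open>
  Contracting both tensor factors with dual bases gives back the tensor.
\<close>

lemma dual_bases_contract:
  assumes D: "dual_bases l d \<xi> \<eta>" and A: "A \<in> tensor_square l"
  shows "(\<Sum>i<d. \<xi> i $ a *s contract A (\<eta> i)) = A $ a"
  using A unfolding tensor_square_def
proof (induction rule: span_induct)
  case base
  have "(\<Sum>i<d. \<xi> i $ a *s contract (k *\<^sub>R A) (\<eta> i)) = k *\<^sub>R (\<Sum>i<d. \<xi> i $ a *s contract A (\<eta> i))" for k A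
    unfolding scaleR_sum_right
    by (intro sum.cong refl) (simp add: contract_linear scaleR_eq_complex_scale vector_smult_assoc mult.commute)
  thus ?case unfolding subspace_def by (simp add: contract_linear vector_add_ldistrib sum.distrib)
next
  case (step A)
  then obtain x y where xy: "A = tensor2 x y" "x \<in> l" by blast
  have "linear_functional (\<eta> i)" if "i < d" for i using D that by (simp add: dual_bases_def)
  hence "(\<Sum>i<d. \<xi> i $ a *s contract A (\<eta> i)) = (\<Sum>i<d. (\<eta> i x *s \<xi> i) $ a *s y)"
    unfolding xy by (intro sum.cong) (auto simp: contract_tensor2 vector_smult_assoc mult.commute)
  also have "\<dots> = (\<Sum>i<d. \<eta> i x *s \<xi> i) $ a *s y" by (simp add: vec.scale_sum_left)
  also have "\<dots> = A $ a" unfolding dual_bases_expand[OF D xy(2)] xy(1) by (simp add: vec_eq_iff tensor2_def)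
  finally show ?case .
qed

text \<open>
  The Casimir operator expands a vector in a basis of \<open>l\<close> by pairing with the dual basis.
\<close>

lemma casimir_projection:
  assumes form: "nondeg_invariant_form br form" and l: "casimir_element form l \<Omega>"
  defines "P \<equiv> op (operator_of form \<Omega>)"
  shows "app P x \<in> l" "x \<in> l \<Longrightarrow> app P x = x" "form (app P x) y = form x (app P y)"
proof -
  have f: "form (x + y) z = form x z + form y z" "form z (x + y) = form z x + form z y"
    "form (c *s x) z = c * form x z" "form z (c *s x) = c * form z x" "form x y = form y x" for x y z c
    using form unfolding nondeg_invariant_form_def linear_functional_iff by blast+
  have f0: "form 0 z = 0" "form z 0 = 0" for z using f(3)[of 0 0 z] f(4)[of z 0 0] by simp_all
  have "complex_linear (operator_of form \<Omega>)"
    by (simp add: complex_linear_iff operator_of_def contract_def vec_eq_iff f(2,4) sum.distrib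
      distrib_right sum_distrib_left mult.assoc)
  hence P: "app P x = operator_of form \<Omega> x" for x by (simp add: P_def)
  obtain d u v where d: "vec.span (u ` {..<d}) = l" "vec.span (v ` {..<d}) = l" "u ` {..<d} \<subseteq> l" "v ` {..<d} \<subseteq> l"
    "\<forall>i<d. \<forall>j<d. form (u i) (v j) = (if i = j then 1 else 0)"
    "\<Omega> = (\<Sum>i<(d::nat). tensor2 (u i) (v i))"
    using l unfolding casimir_element_def by blast
  have o: "app P x = (\<Sum>i<d. form (u i) x *s v i)" for x
  proof -
    have lf: "linear_functional (\<lambda>a. form a x)" by (simp add: linear_functional_iff f)
    have "contract (\<Sum>i<n. tensor2 (u i) (v i)) (\<lambda>a. form a x) = (\<Sum>i<n. form (u i) x *s v i)" for n
      by (induction n) (auto simp: contract_linear contract_tensor2[OF lf])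
    thus ?thesis by (simp add: P operator_of_def d(6))
  qed
  have sub: "vec.subspace l" using d(1) vec.subspace_span by metis
  show Pl: "app P x \<in> l" for x
    unfolding o by (intro vec.subspace_sum vec.subspace_scale sub) (use d(4) in auto)
  have uP: "form (u j) (app P x) = form (u j) x" if "j < d" for j x
  proof -
    have "form (u j) (\<Sum>i<n. form (u i) x *s v i) = (\<Sum>i<n. form (u i) x * form (u j) (v i))" for n
      by (induction n) (auto simp: f f0)
    hence "form (u j) (app P x) = (\<Sum>i<d. if i = j then form (u j) x else 0)"
      unfolding o by (simp only:) (rule sum.cong, use d(5) that in auto)
    thus ?thesis using that by simp
  qed
  have lP: "form z (app P x) = form z x" if "z \<in> l" for z x
  proof -
    have "z \<in> vec.span (u ` {..<d})" using that d(1) by simp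
    thus ?thesis
    proof (induction z rule: vec.span_induct)
      case base show ?case unfolding vec.subspace_def by (auto simp: f f0)
    qed (use uP in auto)
  qed
  show "form (app P x) y = form x (app P y)" for x y
    using lP[OF Pl[of x], of y] lP[OF Pl[of y], of x] f(5) by metis
  show "app P x = x" if "x \<in> l" for x
  proof -
    have "x \<in> vec.span (v ` {..<d})" using that d(2) by simp
    thus ?thesis
    proof (induction x rule: vec.span_induct)
      case base show ?case unfolding vec.subspace_def by simp
    next
      case (step x)
      then obtain j where j: "j < d" "x = v j" by auto
      have "(\<Sum>i<d. form (u i) x *s v i) = (\<Sum>i<d. if i = j then v j else 0)"
        using j d(5) by (intro sum.cong) auto
      thus ?case using j by (simp add: o)
    qed
  qed
qed

context reductive_pair
begin

definition dual_axis :: "'n \<Rightarrow> complex^'n" where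
  "dual_axis i = (SOME d. \<forall>j. form (axis j 1) d = (if i = j then 1 else 0))"

lemma form_expand: "form v y = (\<Sum>j\<in>UNIV. v $ j * form (axis j 1) y)"
proof -
  have "linear_functional (\<lambda>v. form v y)" by (simp add: linear_functional_iff form_simps)
  from linear_functional_expansion[OF this, of v] show ?thesis by (simp add: mult.commute)
qed

lemma dual_axis: "form (axis j 1) (dual_axis i) = (if i = j then 1 else 0)"
proof -
  have lin: "complex_linear (\<lambda>x. \<chi> i. form (axis i 1) x)"
    by (simp add: complex_linear_iff vec_eq_iff form_simps)
  define J where "J = op (\<lambda>x. \<chi> i. form (axis i 1) x)"
  have J: "app J x $ i = form (axis i 1) x" for x i using lin by (simp add: J_def)
  have "unit J" unfolding unit_iff_inj
  proof (intro allI impI)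
    fix x assume "app J x = 0"
    hence "form v x = 0" for v using J[of x] by (simp add: form_expand[of v] flip: J)
    thus "x = 0" using form_nondeg form_commute by metis
  qed
  hence "\<forall>j. form (axis j 1) (app (einv J) (axis i 1)) = (if i = j then 1 else 0)"
    unfolding J[symmetric] by (simp add: axis_def)
  hence "\<exists>d. \<forall>j. form (axis j 1) d = (if i = j then 1 else 0)" by blast
  from someI_ex[OF this] show ?thesis unfolding dual_axis_def by blast
qed

lemma form_dual_axis: "form v (dual_axis a) = v $ a"
  by (simp add: form_expand[of v] dual_axis if_distrib cong: if_cong)

lemma dual_axis_expand: "(\<Sum>i\<in>UNIV. form (axis i 1) x *s dual_axis i) = x"
proof (rule form_eqI)
  fix y
  have "form (\<Sum>i\<in>I. form (axis i 1) x *s dual_axis i) y = (\<Sum>i\<in>I. form (axis i 1) x * form (dual_axis i) y)" for I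
    by (induction I rule: infinite_finite_induct) (auto simp: form_simps)
  thus "form (\<Sum>i\<in>UNIV. form (axis i 1) x *s dual_axis i) y = form x y"
    using form_expand[of y x] by (simp add: form_commute[of "dual_axis _" y] form_dual_axis form_commute[of x y] mult.commute)
qed

lemma operator_of_linear: "complex_linear (operator_of form A)"
  by (simp add: complex_linear_iff operator_of_def contract_def vec_eq_iff form_simps sum.distrib
      distrib_right sum_distrib_left mult.assoc)

definition oper :: "complex^'n^'n \<Rightarrow> 'n endo" where "oper A = op (operator_of form A)"

lemma app_oper: "app (oper A) x = operator_of form A x" by (simp add: oper_def operator_of_linear)

lemma oper_dual_axis: "app (oper A) (dual_axis a) = A $ a"
  by (simp add: app_oper operator_of_def contract_def vec_eq_iff dual_axis if_distrib[where f="\<lambda>c. c * _"] cong: if_cong)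

lemma oper_component: "A $ a $ b = form (app (oper A) (dual_axis a)) (dual_axis b)"
  by (simp add: oper_dual_axis form_dual_axis)

lemma dual_axis_eqI: "(\<And>a. app X (dual_axis a) = app Y (dual_axis a)) \<Longrightarrow> X = Y"
proof (rule endo_eqI)
  fix x assume *: "\<And>a. app X (dual_axis a) = app Y (dual_axis a)"
  show "app X x = app Y x"
    by (subst (1 2) dual_axis_expand[of x, symmetric]) (simp add: app_sum *)
qed

lemma oper_inject: "oper A = oper B \<Longrightarrow> A = B"
  using oper_dual_axis by (metis vec_eq_iff)

lemma oper_add: "oper (A + B) = oper A + oper B" and oper_diff: "oper (A - B) = oper A - oper B"
  and oper_scale: "oper (k *\<^sub>R A) = k *\<^sub>R oper A"
  by (rule dual_axis_eqI; simp add: oper_dual_axis)+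

definition tensor_of :: "'n endo \<Rightarrow> complex^'n^'n" where "tensor_of R = (\<chi> i. app R (dual_axis i))"

lemma oper_tensor_of [simp]: "oper (tensor_of R) = R"
  by (rule dual_axis_eqI) (simp add: oper_dual_axis tensor_of_def)

lemma tensor_of_component: "tensor_of R $ a $ b = form (app R (dual_axis a)) (dual_axis b)"
  by (simp add: tensor_of_def form_dual_axis)

lemma oper_skew:
  assumes "\<forall>i j. A $ i $ j = k * A $ j $ i"
  shows "form (app (oper A) x) y = k * form x (app (oper A) y)"
proof -
  have dd: "form (app (oper A) (dual_axis a)) (dual_axis b) = k * form (dual_axis a) (app (oper A) (dual_axis b))" for a b
    using assms oper_component[of A a b] oper_component[of A b a] form_commute by metis
  have 1: "form (app (oper A) (dual_axis a)) y = k * form (dual_axis a) (app (oper A) y)" for a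
  proof -
    have "form (app (oper A) (dual_axis a)) (\<Sum>i\<in>I. c i *s dual_axis i) = k * form (dual_axis a) (app (oper A) (\<Sum>i\<in>I. c i *s dual_axis i))" for I c
      by (induction I rule: infinite_finite_induct) (auto simp: form_simps dd algebra_simps)
    from this[of "\<lambda>i. form (axis i 1) y" UNIV] show ?thesis by (simp only: dual_axis_expand)
  qed
  have "form (app (oper A) (\<Sum>i\<in>I. c i *s dual_axis i)) y = k * form (\<Sum>i\<in>I. c i *s dual_axis i) (app (oper A) y)" for I c
    by (induction I rule: infinite_finite_induct) (auto simp: form_simps 1 algebra_simps)
  from this[of "\<lambda>i. form (axis i 1) x" UNIV] show ?thesis by (simp only: dual_axis_expand)
qed

lemma br_bilinear_expand:
  "br u v $ a = (\<Sum>i\<in>UNIV. \<Sum>k\<in>UNIV. u $ i * v $ k * br (axis i 1) (axis k 1) $ a)"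
proof -
  have 1: "br (\<Sum>i\<in>I. u $ i *s axis i 1) w = (\<Sum>i\<in>I. u $ i *s br (axis i 1) w)" for I w
    by (induction I rule: infinite_finite_induct) (auto simp: br)
  have 2: "br w (\<Sum>i\<in>I. v $ i *s axis i 1) = (\<Sum>i\<in>I. v $ i *s br w (axis i 1))" for I w
    by (induction I rule: infinite_finite_induct) (auto simp: br)
  have "br u v = (\<Sum>i\<in>UNIV. u $ i *s (\<Sum>k\<in>UNIV. v $ k *s br (axis i 1) (axis k 1)))"
    using 1[of UNIV v] 2[of _ UNIV] by (simp add: basis_expansion)
  thus ?thesis by (simp add: sum_distrib_left mult.assoc)
qed

text \<open>
  \<open>Ot\<close> is the operator of the tensor with its two factors exchanged.
\<close>

lemma CYB_component:
  assumes "\<And>a. app Ot (dual_axis a) = (\<chi> i. A $ i $ a)"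
  shows "CYB br A $ a $ b $ c = F (app Ot (dual_axis b)) (app Ot (dual_axis c)) (dual_axis a)
    + F (app (oper A) (dual_axis a)) (app Ot (dual_axis c)) (dual_axis b) + F (app (oper A) (dual_axis a)) (app (oper A) (dual_axis b)) (dual_axis c)"
  unfolding F_def form_dual_axis assms oper_dual_axis
  by (subst (1 2 3) br_bilinear_expand) (simp add: CYB_def comm_12_13_def comm_12_23_def comm_13_23_def)

lemma transpose_skew:
  assumes "\<forall>i j. A $ i $ j = k * A $ j $ i"
  shows "app (sc k * oper A) (dual_axis a) = (\<chi> i. A $ i $ a)"
proof -
  have "k * A $ a $ i = A $ i $ a" for i using assms by metis
  thus ?thesis by (simp add: oper_dual_axis vec_eq_iff)
qed

lemma ad_row: "(\<Sum>k\<in>UNIV. (br \<xi> (axis k 1) $ a) *s dual_axis k) = - br \<xi> (dual_axis a)"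
proof -
  have "br \<xi> (axis k 1) $ a = - form (axis k 1) (br \<xi> (dual_axis a))" for k
    using form_ad[of \<xi> "axis k 1" "dual_axis a"] by (simp add: form_dual_axis form_simps)
  hence "(\<Sum>k\<in>UNIV. (br \<xi> (axis k 1) $ a) *s dual_axis k) = - (\<Sum>k\<in>UNIV. form (axis k 1) (br \<xi> (dual_axis a)) *s dual_axis k)"
    by (simp add: sum_negf)
  thus ?thesis by (simp only: dual_axis_expand)
qed

text \<open>
  The adjoint action on the second factor is composition with \<open>ad \<xi>\<close>; on the first factor it is composition with
  the transpose \<open>- ad \<xi>\<close> on the other side.
\<close>

lemma oper_ad2: "oper (ad2 br \<xi> A) = ad br \<xi> * oper A - oper A * ad br \<xi>"
proof (rule dual_axis_eqI)
  fix a
  have "ad2 br \<xi> A $ a $ b = app (ad br \<xi> * oper A - oper A * ad br \<xi>) (dual_axis a) $ b" for b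
  proof -
    have m: "matrix (br \<xi>) $ i $ k = br \<xi> (axis k 1) $ i" for i k by (simp add: matrix_def)
    have 1: "(\<Sum>k\<in>UNIV. br \<xi> (axis k 1) $ a * A $ k $ b) = - app (oper A) (br \<xi> (dual_axis a)) $ b"
    proof -
      have "(\<Sum>k\<in>UNIV. br \<xi> (axis k 1) $ a * A $ k $ b) = (\<Sum>k\<in>UNIV. br \<xi> (axis k 1) $ a *s app (oper A) (dual_axis k)) $ b"
        by (simp add: oper_dual_axis)
      also have "\<dots> = app (oper A) (\<Sum>k\<in>UNIV. br \<xi> (axis k 1) $ a *s dual_axis k) $ b"
        by (simp only: app_sum app_arg(5))
      finally show ?thesis by (simp only: ad_row app_arg(3) vector_uminus_component)
    qed
    have 2: "(\<Sum>k\<in>UNIV. A $ a $ k * br \<xi> (axis k 1) $ b) = br \<xi> (A $ a) $ b"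
    proof -
      have "br \<xi> (\<Sum>k\<in>I. A $ a $ k *s axis k 1) = (\<Sum>k\<in>I. A $ a $ k *s br \<xi> (axis k 1))" for I
        by (induction I rule: infinite_finite_induct) (auto simp: br)
      from this[of UNIV] show ?thesis by (simp add: basis_expansion)
    qed
    show ?thesis
      by (simp add: ad2_def matrix_matrix_mult_def transpose_def m 1 2 oper_dual_axis)
  qed
  thus "app (oper (ad2 br \<xi> A)) (dual_axis a) = app (ad br \<xi> * oper A - oper A * ad br \<xi>) (dual_axis a)"
    by (simp only: oper_dual_axis vec_eq_iff) simp
qed

lemma Casimir_tensor:
  assumes "casimir_element form UNIV \<Omega>" shows "oper \<Omega> = 1" "\<Omega> $ a $ b = \<Omega> $ b $ a"
proof -
  show one: "oper \<Omega> = 1"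
    unfolding oper_def by (rule endo_eqI) (simp add: casimir_projection(2)[OF form assms])
  show "\<Omega> $ a $ b = \<Omega> $ b $ a" by (simp add: oper_component one form_commute[of "dual_axis a"])
qed

lemma Z_component:
  assumes "casimir_element form UNIV \<Omega>"
  shows "comm_12_23 br \<Omega> \<Omega> $ a $ b $ c = - F (dual_axis a) (dual_axis b) (dual_axis c)"
proof -
  have "\<Omega> $ a = dual_axis a" "(\<chi> i. \<Omega> $ i $ c) = dual_axis c" for a c
    using Casimir_tensor(1)[OF assms] oper_dual_axis[of \<Omega>] Casimir_tensor(2)[OF assms] by (auto simp: vec_eq_iff)
  hence "F (dual_axis a) (dual_axis c) (dual_axis b) = br (\<Omega> $ a) (\<chi> i. \<Omega> $ i $ c) $ b"
    by (simp add: F_def form_dual_axis)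
  also have "\<dots> = comm_12_23 br \<Omega> \<Omega> $ a $ b $ c"
    by (subst br_bilinear_expand) (simp add: comm_12_23_def)
  finally show ?thesis using F_swap23[of "dual_axis a" "dual_axis c" "dual_axis b"] by simp
qed

lemma F_sum1: "F (\<Sum>i\<in>I. c i *s g i) y z = (\<Sum>i\<in>I. c i * F (g i) y z)"
  by (induction I rule: infinite_finite_induct) (auto simp: F_simps F_def br form_simps)
lemma F_sum2: "F x (\<Sum>i\<in>I. c i *s g i) z = (\<Sum>i\<in>I. c i * F x (g i) z)"
  by (induction I rule: infinite_finite_induct) (auto simp: F_simps F_def br form_simps)
lemma F_sum3: "F x y (\<Sum>i\<in>I. c i *s g i) = (\<Sum>i\<in>I. c i * F x y (g i))"
  by (induction I rule: infinite_finite_induct) (auto simp: F_simps F_def br form_simps)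

lemma Z_invariant:
  assumes Z: "\<And>a b c. Z $ a $ b $ c = k * F (dual_axis a) (dual_axis b) (dual_axis c)"
  shows "Z \<in> wedge3" "ad3 br x Z = 0"
proof -
  show "Z \<in> wedge3"
    unfolding wedge3_def mem_Collect_eq Z
    by (intro allI conjI) (subst F_swap, simp, subst F_swap23, simp)
  have m: "matrix (br x) $ i $ j = br x (axis j 1) $ i" for i j by (simp add: matrix_def)
  have "ad3 br x Z $ a $ b $ c = 0" for a b c
  proof -
    have "ad3 br x Z $ a $ b $ c = k * (F (\<Sum>j\<in>UNIV. br x (axis j 1) $ a *s dual_axis j) (dual_axis b) (dual_axis c)
        + F (dual_axis a) (\<Sum>j\<in>UNIV. br x (axis j 1) $ b *s dual_axis j) (dual_axis c)
        + F (dual_axis a) (dual_axis b) (\<Sum>j\<in>UNIV. br x (axis j 1) $ c *s dual_axis j))"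
      unfolding F_sum1 F_sum2 F_sum3
      by (simp add: ad3_def m Z sum.distrib sum_distrib_left distrib_left mult_ac)
    also have "\<dots> = - k * (F (br x (dual_axis a)) (dual_axis b) (dual_axis c) + F (dual_axis a) (br x (dual_axis b)) (dual_axis c) + F (dual_axis a) (dual_axis b) (br x (dual_axis c)))"
      unfolding ad_row by (simp add: F_simps algebra_simps)
    finally show ?thesis by (simp add: F_ad)
  qed
  thus "ad3 br x Z = 0" by (simp add: vec_eq_iff)
qed

end

section \<open>The hyperbolic cotangent symbols\<close>

lemma coth_exp: "coth (c / 2 * s) = (1 + exp (- (c * s))) / (1 - exp (- (c * s)))"
proof -
  define w where "w = c / 2 * s"
  have e: "exp (- (c * s)) = exp (- w) * exp (- w)" by (simp add: w_def flip: exp_add)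
  have 1: "exp w * exp (- w) = 1" by (simp flip: exp_add)
  have "coth w = (exp w + exp (- w)) / (exp w - exp (- w))"
  proof -
    have "(a / 2) / (b / 2) = a / b" for a b :: complex by simp
    thus ?thesis unfolding coth_def cosh_field_def sinh_field_def .
  qed
  also have "\<dots> = ((exp w + exp (- w)) * exp (- w)) / ((exp w - exp (- w)) * exp (- w))" by simp
  also have "\<dots> = (1 + exp (- (c * s))) / (1 - exp (- (c * s)))"
    unfolding distrib_right left_diff_distrib 1 e ..
  finally show ?thesis by (simp add: w_def)
qed

lemma eval_phi: "s * eval_fps (phi c) s = 1 - exp (- (c * s))"
proof -
  have "eval_fps (fps_X * phi c) s = 1 - exp (- (c * s))"
    unfolding X_phi by (simp add: eval_entire_simps)
  thus ?thesis by (simp add: eval_entire_simps)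
qed

lemma eval_phi_0: "eval_fps (phi c) 0 = c" by (simp add: eval_fps_at_0 phi_0)

lemma phi_nth_1: "fps_nth (phi c) (Suc 0) = - c\<^sup>2 / 2"
  by (simp add: phi_def power2_eq_square numeral_2_eq_2)

lemma eval_numer_l: "s * eval_fps (numer_l \<epsilon>) s
    = 1/2 * (1 + exp (- s)) * eval_fps (phi \<epsilon>) s - \<epsilon>/2 * (1 + exp (- (\<epsilon> * s))) * eval_fps (phi 1) s"
proof -
  have "s * eval_fps (numer_l \<epsilon>) s = eval_fps (fps_X * numer_l \<epsilon>) s" by (simp add: eval_entire_simps)
  thus ?thesis unfolding X_numer_l by (simp add: eval_entire_simps entire_intros)
qed

lemma eval_numer_l_0: "eval_fps (numer_l \<epsilon>) 0 = 0"
  by (simp add: eval_fps_at_0 numer_l_def fps_mult_nth_1 phi_0 phi_nth_1 power2_eq_square field_simps)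

lemma symbol_l_quotient:
  assumes "eval_fps (phi 1 * phi \<epsilon>) s \<noteq> 0"
  shows "symbol_l \<epsilon> s * eval_fps (phi 1 * phi \<epsilon>) s = eval_fps (numer_l \<epsilon>) s"
proof (cases "s = 0")
  case True thus ?thesis by (simp add: symbol_l_def eval_numer_l_0)
next
  case False
  let ?f = "eval_fps (phi 1) s" and ?g = "eval_fps (phi \<epsilon>) s"
  have n: "?f \<noteq> 0" "?g \<noteq> 0" using assms by (auto simp: eval_entire_simps)
  have "symbol_l \<epsilon> s = 1/2 * ((1 + exp (- s)) / (s * ?f)) - \<epsilon>/2 * ((1 + exp (- (\<epsilon> * s))) / (s * ?g))"
    using False coth_exp[of 1 s] coth_exp[of \<epsilon> s] by (simp add: symbol_l_def eval_phi)
  moreover have "s * ((1/2 * (a / (s * f)) - c/2 * (b / (s * g))) * (f * g)) = 1/2 * a * g - c/2 * b * f"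
    if "f \<noteq> 0" "g \<noteq> 0" for a b c f g using False that by (simp add: field_simps)
  ultimately have "s * (symbol_l \<epsilon> s * (?f * ?g)) = s * eval_fps (numer_l \<epsilon>) s"
    unfolding eval_numer_l using n by simp
  thus ?thesis using False by (simp add: eval_entire_simps)
qed

lemma cancel_denominator: "d \<noteq> 0 \<Longrightarrow> k * (b / d) * d = k * (b :: complex)" by simp

lemma symbol_perp_quotient:
  assumes "eval_fps (fps_X * phi \<epsilon>) s \<noteq> 0"
  shows "symbol_perp \<epsilon> s * eval_fps (fps_X * phi \<epsilon>) s = eval_fps (- (fps_const (\<epsilon>/2) * (1 + fps_exp (- \<epsilon>)))) s"
proof -
  have u: "eval_fps (- f) s = - eval_fps f s" if "entire f" for f
    using eval_entire_simps(2)[of 0 f s] that by simp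
  have x: "eval_fps (fps_X * phi \<epsilon>) s = 1 - exp (- (\<epsilon> * s))"
    unfolding X_phi by (simp add: eval_entire_simps)
  have "symbol_perp \<epsilon> s * (1 - exp (- (\<epsilon> * s))) = - \<epsilon> / 2 * (1 + exp (- (\<epsilon> * s)))"
    unfolding symbol_perp_def coth_exp using assms unfolding x by (rule cancel_denominator)
  thus ?thesis unfolding x by (simp add: u entire_intros eval_entire_simps)
qed

text \<open>
  Let \<open>s\<close> approach \<open>z\<close> along \<open>z + t/\<epsilon>\<close> with \<open>t > 0\<close>, where \<open>exp (- \<epsilon> s) = exp (- t)\<close> is real.  Multiplied by \<open>1 - exp (- t)\<close>, the
  cotangent tends to \<open>\<epsilon>\<close>, while a continuous function would tend to \<open>0\<close>.
\<close>

lemma coth_pole: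
  assumes "\<epsilon> \<noteq> 0" "exp (- (\<epsilon> * z)) = 1" "isCont h z"
    and ev: "eventually (\<lambda>s. h s = \<epsilon> / 2 * coth (\<epsilon> / 2 * s)) (at z)"
  shows False
proof -
  define s where "s t = z + of_real t / \<epsilon>" for t :: real
  have e: "exp (- (\<epsilon> * s t)) = of_real (exp (- t))" for t
  proof -
    have "- (\<epsilon> * s t) = - (\<epsilon> * z) + of_real (- t)" using assms(1) by (simp add: s_def field_simps)
    thus ?thesis using assms(2) by (simp only: exp_add exp_of_real) simp
  qed
  have s: "(s \<longlongrightarrow> z) (at_right 0)" unfolding s_def by (auto intro!: tendsto_eq_intros simp: assms(1))
  have "filterlim s (at z) (at_right 0)"
    unfolding filterlim_at using s assms(1) by (auto simp: s_def eventually_at_filter)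
  from eventually_compose_filterlim[OF ev this]
  have "eventually (\<lambda>t. h (s t) = \<epsilon> / 2 * coth (\<epsilon> / 2 * s t)) (at_right 0)" .
  moreover have "eventually (\<lambda>t::real. t > 0) (at_right 0)" by (simp add: eventually_at_filter)
  ultimately have "eventually (\<lambda>t. h (s t) * of_real (1 - exp (- t)) = \<epsilon> / 2 * of_real (1 + exp (- t))) (at_right 0)"
  proof eventually_elim
    case (elim t)
    have "of_real (1 - exp (- t)) \<noteq> (0::complex)" using elim(2) by (simp only: of_real_eq_0_iff) simp
    hence "1 - complex_of_real (exp (- t)) \<noteq> 0" by simp
    thus ?case unfolding elim(1) coth_exp e of_real_diff of_real_add of_real_1 by (rule cancel_denominator)
  qed
  moreover have "((\<lambda>t. h (s t) * of_real (1 - exp (- t))) \<longlongrightarrow> h z * of_real (1 - exp (- 0))) (at_right 0)"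
    using isCont_tendsto_compose[OF assms(3) s] by (intro tendsto_intros) auto
  ultimately have "((\<lambda>t. \<epsilon> / 2 * of_real (1 + exp (- t))) \<longlongrightarrow> h z * of_real (1 - exp (- 0))) (at_right (0::real))"
    by (rule Lim_transform_eventually[rotated])
  moreover have "((\<lambda>t. \<epsilon> / 2 * of_real (1 + exp (- t))) \<longlongrightarrow> \<epsilon> / 2 * of_real (1 + exp (- 0))) (at_right (0::real))"
    by (intro tendsto_intros)
  ultimately have "h z * of_real (1 - exp (- 0)) = \<epsilon> / 2 * of_real (1 + exp (- 0))"
    by (intro tendsto_unique[of "at_right (0::real)"]) auto
  thus False using assms(1) by simp
qed

lemma quotient_analytic:
  assumes "entire N" "entire M" "eval_fps M z \<noteq> 0"
    and f: "\<And>s. eval_fps M s \<noteq> 0 \<Longrightarrow> f s * eval_fps M s = eval_fps N s"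
  shows "f analytic_on {z}"
proof -
  have h: "eval_fps M holomorphic_on UNIV" "eval_fps N holomorphic_on UNIV"
    using entire_analytic assms(1,2) analytic_imp_holomorphic by blast+
  define S where "S = {s. eval_fps M s \<noteq> 0}"
  have "open S" unfolding S_def
    using continuous_open_preimage[OF holomorphic_on_imp_continuous_on[OF h(1)] open_UNIV, of "- {0}"]
    by (simp add: vimage_def Collect_neg_eq open_Compl)
  moreover have "(\<lambda>s. eval_fps N s / eval_fps M s) holomorphic_on S"
    using h by (intro holomorphic_on_divide) (auto simp: S_def intro: holomorphic_on_subset)
  hence "f holomorphic_on S"
    by (rule holomorphic_transform) (use f in \<open>auto simp: S_def field_simps\<close>)
  ultimately show ?thesis unfolding analytic_at using assms(3) by (auto simp: S_def)
qed

text \<open>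
  Taylor expansion at \<open>z\<close> is multiplicative, and for entire functions it computes \<open>ev\<close>.
\<close>

lemma quotient_taylor:
  assumes NM: "entire N" "entire M" "eval_fps M z \<noteq> 0"
    and f: "\<And>s. eval_fps M s \<noteq> 0 \<Longrightarrow> f s * eval_fps M s = eval_fps N s"
    and x: "app ((T - sc z) ^ m) x = 0"
  shows "app (ev M T) (taylor f z T m x) = app (ev N T) x"
proof -
  have "app (ev M T) (taylor f z T m x) = taylor (eval_fps M) z T m (taylor f z T m x)"
    by (rule ev_taylor[OF NM(2) taylor_sub[OF x]])
  also have "\<dots> = taylor (\<lambda>w. eval_fps M w * f w) z T m x"
    by (rule taylor_mult[OF quotient_analytic[OF NM f] entire_analytic[OF NM(2)] x, symmetric])
  also have "\<dots> = taylor (eval_fps N) z T m x"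
  proof (rule taylor_cong)
    have "isCont (eval_fps M) z"
      using entire_analytic[OF NM(2), of UNIV] analytic_at_imp_isCont analytic_on_analytic_at by blast
    hence "eventually (\<lambda>s. eval_fps M s \<noteq> 0) (nhds z)"
      using NM(3) tendsto_imp_eventually_ne[of "eval_fps M" "eval_fps M z" "nhds z" 0]
      by (simp add: isCont_def tendsto_at_iff_tendsto_nhds)
    thus "eventually (\<lambda>w. eval_fps M w * f w = eval_fps N w) (nhds z)"
      by eventually_elim (use f in \<open>simp add: mult.commute\<close>)
  qed
  also have "\<dots> = app (ev N T) x" by (rule ev_taylor[OF NM(1) x, symmetric])
  finally show ?thesis .
qed

lemma gen_eigenvalue:
  assumes V: "vec.subspace V" "\<And>x. x \<in> V \<Longrightarrow> app T x \<in> V"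
    and x: "x \<in> V" "x \<noteq> 0" "app ((T - sc z) ^ m) x = 0"
  shows "z \<in> eigenvalues V (app T)"
proof (rule ccontr)
  assume z: "z \<notin> eigenvalues V (app T)"
  have e: "ev (fps_X - fps_const z) T = T - sc z" by (simp add: ev_diff)
  have "\<forall>w\<in>eigenvalues V (app T). eval_fps (fps_X - fps_const z) w \<noteq> 0"
    using z by (auto simp: eval_entire_simps)
  hence inj: "\<forall>x\<in>V. app (T - sc z) x = 0 \<longrightarrow> x = 0"
    using ev_inj_on_iff[OF V, of "fps_X - fps_const z"] unfolding e by blast
  have "app ((T - sc z) ^ k) x \<in> V \<and> app ((T - sc z) ^ k) x \<noteq> 0" for k
  proof (induction k)
    case (Suc k)
    have "app (T - sc z) (app ((T - sc z) ^ k) x) \<in> V"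
      using Suc V by (simp add: vec.subspace_diff vec.subspace_scale)
    moreover have "app (T - sc z) (app ((T - sc z) ^ k) x) \<noteq> 0" using Suc inj by blast
    ultimately show ?case by (simp only: power_Suc app_simps(1) simp_thms)
  qed (use x in auto)
  thus False using x(3) by blast
qed

context r_setting
begin

abbreviation lperp where "lperp \<equiv> {x. app P x = 0}"

lemma subspace_lperp: "vec.subspace lperp" unfolding vec.subspace_def by auto

lemma ad_lperp: "\<mu> \<in> l \<Longrightarrow> x \<in> lperp \<Longrightarrow> br \<mu> x \<in> lperp"
proof -
  assume "\<mu> \<in> l" "x \<in> lperp"
  hence "app (P * ad br \<mu>) x = app (ad br \<mu> * P) x" "app P x = 0" using P_ad by auto
  thus "br \<mu> x \<in> lperp" by (simp add: br)
qed

lemma P_minus: "x - app P x \<in> lperp" by simp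

lemma Mhat_l: "x \<in> l \<Longrightarrow> app (Mhat X) x = app (ev (phi 1 * phi \<epsilon>) X) x"
  and Mhat_perp: "x \<in> lperp \<Longrightarrow> app (Mhat X) x = app (ev (fps_X * phi \<epsilon>) X) x"
  and Nhat_l: "x \<in> l \<Longrightarrow> app (Nhat X) x = app (ev (numer_l \<epsilon>) X) x"
  and Nhat_perp: "x \<in> lperp \<Longrightarrow> app (Nhat X) x = app (ev (- (fps_const (\<epsilon>/2) * (1 + fps_exp (- \<epsilon>)))) X) x"
proof -
  have u: "ev (- f) X = - ev f X" if "entire f" for f using ev_diff[of 0 f X] that by simp
  show "x \<in> l \<Longrightarrow> app (Mhat X) x = app (ev (phi 1 * phi \<epsilon>) X) x"
    "x \<in> lperp \<Longrightarrow> app (Mhat X) x = app (ev (fps_X * phi \<epsilon>) X) x"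
    "x \<in> l \<Longrightarrow> app (Nhat X) x = app (ev (numer_l \<epsilon>) X) x"
    by (simp_all add: Mhat_def Nhat_def P_id)
  show "x \<in> lperp \<Longrightarrow> app (Nhat X) x = app (ev (- (fps_const (\<epsilon>/2) * (1 + fps_exp (- \<epsilon>)))) X) x"
    by (simp add: Nhat_def u entire_intros)
qed

lemma unit_Mhat_iff:
  assumes \<mu>: "\<mu> \<in> l"
  shows "unit (Mhat (ad br \<mu>)) \<longleftrightarrow> (\<forall>z\<in>eigenvalues l (br \<mu>). eval_fps (phi 1 * phi \<epsilon>) z \<noteq> 0) \<and>
    (\<forall>z\<in>eigenvalues lperp (br \<mu>). eval_fps (fps_X * phi \<epsilon>) z \<noteq> 0)"
proof -
  have e: "app (ad br \<mu>) = br \<mu>" by (simp add: fun_eq_iff)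
  have 1: "(\<forall>z\<in>eigenvalues l (br \<mu>). eval_fps (phi 1 * phi \<epsilon>) z \<noteq> 0) \<longleftrightarrow>
      (\<forall>x\<in>l. app (Mhat (ad br \<mu>)) x = 0 \<longrightarrow> x = 0)"
    using ev_inj_on_iff[OF subspace_l, of "ad br \<mu>" "phi 1 * phi \<epsilon>"] closed_l[OF \<mu>] Mhat_l[of _ "ad br \<mu>"]
    unfolding e by (auto simp: entire_intros)
  have 2: "(\<forall>z\<in>eigenvalues lperp (br \<mu>). eval_fps (fps_X * phi \<epsilon>) z \<noteq> 0) \<longleftrightarrow>
      (\<forall>x\<in>lperp. app (Mhat (ad br \<mu>)) x = 0 \<longrightarrow> x = 0)"
    using ev_inj_on_iff[OF subspace_lperp, of "ad br \<mu>" "fps_X * phi \<epsilon>"] ad_lperp[OF \<mu>] Mhat_perp[of _ "ad br \<mu>"]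
    unfolding e by (auto simp: entire_intros)
  have "unit (Mhat (ad br \<mu>)) \<longleftrightarrow> (\<forall>x\<in>l. app (Mhat (ad br \<mu>)) x = 0 \<longrightarrow> x = 0) \<and>
      (\<forall>x\<in>lperp. app (Mhat (ad br \<mu>)) x = 0 \<longrightarrow> x = 0)"
    unfolding unit_iff_inj
  proof safe
    fix x assume *: "\<forall>x\<in>l. app (Mhat (ad br \<mu>)) x = 0 \<longrightarrow> x = 0" "\<forall>x\<in>lperp. app (Mhat (ad br \<mu>)) x = 0 \<longrightarrow> x = 0"
      and x: "app (Mhat (ad br \<mu>)) x = 0"
    have c: "app (Mhat (ad br \<mu>)) (app P x) = app P (app (Mhat (ad br \<mu>)) x)"
      using Mhat_factor(3)[OF P_ad[OF \<mu>]] by (metis app_simps(1))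
    hence "app P x = 0" using *(1) x P_range[of x] by simp
    thus "x = 0" using *(2) x by blast
  qed blast+
  thus ?thesis using 1 2 by blast
qed

lemma nonsingular_iff:
  "nonsingular \<mu> \<longleftrightarrow> \<mu> \<in> l \<and> (\<forall>z\<in>eigenvalues l (br \<mu>). eval_fps (phi 1) z \<noteq> 0)"
proof -
  have e: "app (ad br \<mu>) = br \<mu>" by (simp add: fun_eq_iff)
  show ?thesis
    using ev_inj_on_iff[OF subspace_l, of "ad br \<mu>" "phi 1"] closed_l unfolding e nonsingular_def by auto
qed

text \<open>
  A pole of \<open>\<epsilon>/2 coth (\<epsilon>/2 s)\<close> at a nonzero eigenvalue on \<open>l\<close> could only be cancelled by a pole of \<open>1/2 coth (s/2)\<close>, and
  the poles of the latter off \<open>0\<close> are exactly the eigenvalues that make the exponential map singular.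
\<close>

lemma regular_iff_analytic:
  assumes n: "nonsingular \<mu>"
  shows "regular \<mu> \<longleftrightarrow> symbol_l \<epsilon> analytic_on eigenvalues l (br \<mu>) \<and>
    symbol_perp \<epsilon> analytic_on eigenvalues lperp (br \<mu>)"
proof
  assume "regular \<mu>"
  hence *: "\<And>z. z \<in> eigenvalues l (br \<mu>) \<Longrightarrow> eval_fps (phi 1 * phi \<epsilon>) z \<noteq> 0"
    "\<And>z. z \<in> eigenvalues lperp (br \<mu>) \<Longrightarrow> eval_fps (fps_X * phi \<epsilon>) z \<noteq> 0"
    using unit_Mhat_iff regularD(1) unfolding regular_def by blast+
  have "symbol_l \<epsilon> analytic_on {z}" if "z \<in> eigenvalues l (br \<mu>)" for z
    by (rule quotient_analytic[OF _ _ *(1)[OF that] symbol_l_quotient]) auto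
  moreover have "symbol_perp \<epsilon> analytic_on {z}" if "z \<in> eigenvalues lperp (br \<mu>)" for z
    by (rule quotient_analytic[OF _ _ *(2)[OF that] symbol_perp_quotient]) (auto intro!: entire_intros)
  ultimately show "symbol_l \<epsilon> analytic_on eigenvalues l (br \<mu>) \<and> symbol_perp \<epsilon> analytic_on eigenvalues lperp (br \<mu>)"
    using analytic_on_analytic_at by blast
next
  assume a: "symbol_l \<epsilon> analytic_on eigenvalues l (br \<mu>) \<and> symbol_perp \<epsilon> analytic_on eigenvalues lperp (br \<mu>)"
  have \<mu>: "\<mu> \<in> l" using n by (simp add: nonsingular_def)
  have "eval_fps (phi 1 * phi \<epsilon>) z \<noteq> 0" if z: "z \<in> eigenvalues l (br \<mu>)" for z
  proof
    assume "eval_fps (phi 1 * phi \<epsilon>) z = 0"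
    moreover have f: "eval_fps (phi 1) z \<noteq> 0" using n z nonsingular_iff by blast
    ultimately have g: "eval_fps (phi \<epsilon>) z = 0" by (simp add: eval_entire_simps)
    hence z0: "z \<noteq> 0" using eps eval_phi_0[of \<epsilon>] by auto
    have "exp (- (\<epsilon> * z)) = 1" using eval_phi[of z \<epsilon>] g by simp
    have "z * eval_fps (phi 1) z \<noteq> 0" using f z0 by simp
    hence "1 - exp (- z) \<noteq> 0" unfolding eval_phi by simp
    define h where "h s = 1/2 * ((1 + exp (- s)) / (1 - exp (- s))) - symbol_l \<epsilon> s" for s
    have "symbol_l \<epsilon> analytic_on {z}" using a z analytic_on_analytic_at by blast
    hence "isCont (symbol_l \<epsilon>) z" by (rule analytic_at_imp_isCont)
    hence "isCont h z" unfolding h_def using \<open>1 - exp (- z) \<noteq> 0\<close> by (intro continuous_intros) auto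
    moreover have "eventually (\<lambda>s. h s = \<epsilon> / 2 * coth (\<epsilon> / 2 * s)) (at z)"
    proof -
      have "eventually (\<lambda>s. s \<noteq> 0) (nhds z)" using z0 by (rule t1_space_nhds)
      hence "eventually (\<lambda>s. s \<noteq> 0) (at z)" by (simp add: eventually_at_filter eventually_mono)
      thus ?thesis
        by eventually_elim (use coth_exp[of 1] in \<open>simp add: h_def symbol_l_def\<close>)
    qed
    ultimately show False using coth_pole[OF eps \<open>exp (- (\<epsilon> * z)) = 1\<close>] by blast
  qed
  moreover have "eval_fps (fps_X * phi \<epsilon>) z \<noteq> 0" if z: "z \<in> eigenvalues lperp (br \<mu>)" for z
  proof
    assume "eval_fps (fps_X * phi \<epsilon>) z = 0"
    hence 1: "exp (- (\<epsilon> * z)) = 1" unfolding X_phi by (simp add: eval_entire_simps)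
    have "symbol_perp \<epsilon> analytic_on {z}" using a z analytic_on_analytic_at by blast
    hence "isCont (symbol_perp \<epsilon>) z" by (rule analytic_at_imp_isCont)
    hence "isCont (\<lambda>s. - symbol_perp \<epsilon> s) z" by (intro continuous_intros)
    thus False using coth_pole[OF eps 1, of "\<lambda>s. - symbol_perp \<epsilon> s"] by (simp add: symbol_perp_def)
  qed
  ultimately show "regular \<mu>" using n unit_Mhat_iff[OF \<mu>] by (simp add: regular_def)
qed

lemma Nhat_Mhat_commute:
  assumes "P * X = X * P" shows "Mhat X * Nhat X = Nhat X * Mhat X"
proof -
  have c: "ev f X * ev g X = ev g X * ev f X" if "entire f" "entire g" for f g
    by (metis ev_mult mult.commute that)
  have p: "ev f X * P = P * ev f X" if "entire f" for f by (rule ev_P[OF that assms])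
  have u: "ev (- f) X = - ev f X" if "entire f" for f using ev_diff[of 0 f X] that by simp
  show ?thesis
  proof (rule endo_eqI)
    fix x
    have Pev: "app P (app (ev f X) y) = app (ev f X) (app P y)" if "entire f" for f y
      using p[OF that] by (metis app_simps(1))
    have cc: "app (ev f X) (app (ev g X) y) = app (ev g X) (app (ev f X) y)" if "entire f" "entire g" for f g y
      using c[OF that] by (metis app_simps(1))
    show "app (Mhat X * Nhat X) x = app (Nhat X * Mhat X) x"
      by (simp add: Mhat_def Nhat_def Pev entire_intros cc[of "numer_l \<epsilon>"] cc[of "fps_const (\<epsilon>/2) * (1 + fps_exp (- \<epsilon>))"])
  qed
qed

lemma Rhat_solve:
  assumes \<mu>: "\<mu> \<in> l" "unit (Mhat (ad br \<mu>))" and y: "app (Mhat (ad br \<mu>)) y = app (Nhat (ad br \<mu>)) x"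
  shows "app (Rhat (ad br \<mu>)) x = y"
proof -
  let ?T = "ad br \<mu>"
  have "einv (Mhat ?T) * Nhat ?T = Rhat ?T"
    unfolding Rhat_def by (rule einv_commute[OF \<mu>(2) Nhat_Mhat_commute[OF P_ad[OF \<mu>(1)]]])
  hence "app (Rhat ?T) x = app (einv (Mhat ?T)) (app (Nhat ?T) x)" by (metis app_simps(1))
  also have "\<dots> = y" unfolding y[symmetric] using \<mu>(2) by simp
  finally show ?thesis .
qed

lemma taylor_in:
  assumes "vec.subspace V" "\<And>x. x \<in> V \<Longrightarrow> app T x \<in> V" "x \<in> V"
  shows "taylor f z T m x \<in> V"
proof -
  have "app ((T - sc z) ^ k) x \<in> V" for k
    by (induction k) (use assms in \<open>auto simp: vec.subspace_diff vec.subspace_scale\<close>)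
  thus ?thesis unfolding taylor_def using assms(1) by (intro vec.subspace_sum vec.subspace_scale) auto
qed

text \<open>
  On the generalized eigenspace of \<open>z\<close> both sides solve \<open>M y = N x\<close>.
\<close>

lemma Rhat_taylor_l:
  assumes \<mu>: "\<mu> \<in> l" "unit (Mhat (ad br \<mu>))" and x: "x \<in> l" "app ((ad br \<mu> - sc z) ^ m) x = 0"
  shows "app (Rhat (ad br \<mu>)) x = taylor (symbol_l \<epsilon>) z (ad br \<mu>) m x"
proof (cases "x = 0")
  case True thus ?thesis by (simp add: taylor_def)
next
  case False
  let ?T = "ad br \<mu>"
  have inv: "\<And>x. x \<in> l \<Longrightarrow> app ?T x \<in> l" using closed_l[OF \<mu>(1)] by simp
  have "z \<in> eigenvalues l (app ?T)" by (rule gen_eigenvalue[OF subspace_l inv x(1) False x(2)])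
  hence "z \<in> eigenvalues l (br \<mu>)" by (simp add: app_adb[abs_def])
  hence nz: "eval_fps (phi 1 * phi \<epsilon>) z \<noteq> 0" using \<mu> unit_Mhat_iff by blast
  have "app (ev (phi 1 * phi \<epsilon>) ?T) (taylor (symbol_l \<epsilon>) z ?T m x) = app (ev (numer_l \<epsilon>) ?T) x"
    by (rule quotient_taylor[OF _ _ nz symbol_l_quotient x(2)]) auto
  thus ?thesis
    by (intro Rhat_solve[OF \<mu>]) (simp add: Mhat_l[OF taylor_in[OF subspace_l inv x(1)]] Nhat_l[OF x(1)])
qed

lemma Rhat_taylor_perp:
  assumes \<mu>: "\<mu> \<in> l" "unit (Mhat (ad br \<mu>))" and x: "x \<in> lperp" "app ((ad br \<mu> - sc z) ^ m) x = 0"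
  shows "app (Rhat (ad br \<mu>)) x = taylor (symbol_perp \<epsilon>) z (ad br \<mu>) m x"
proof (cases "x = 0")
  case True thus ?thesis by (simp add: taylor_def)
next
  case False
  let ?T = "ad br \<mu>"
  have inv: "\<And>x. x \<in> lperp \<Longrightarrow> app ?T x \<in> lperp" using ad_lperp[OF \<mu>(1)] by simp
  have "z \<in> eigenvalues lperp (app ?T)" by (rule gen_eigenvalue[OF subspace_lperp inv x(1) False x(2)])
  hence "z \<in> eigenvalues lperp (br \<mu>)" by (simp add: app_adb[abs_def])
  hence nz: "eval_fps (fps_X * phi \<epsilon>) z \<noteq> 0" using \<mu> unit_Mhat_iff by blast
  have "app (ev (fps_X * phi \<epsilon>) ?T) (taylor (symbol_perp \<epsilon>) z ?T m x)
      = app (ev (- (fps_const (\<epsilon>/2) * (1 + fps_exp (- \<epsilon>)))) ?T) x"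
    by (rule quotient_taylor[OF _ _ nz symbol_perp_quotient x(2)]) (auto intro!: entire_intros)
  thus ?thesis
    by (intro Rhat_solve[OF \<mu>]) (simp only: Mhat_perp[OF taylor_in[OF subspace_lperp inv x(1)]] Nhat_perp[OF x(1)])
qed

lemma holomorphic_calculus_taylor:
  "holomorphic_calculus f V (br \<mu>) G \<longleftrightarrow> G ` V \<subseteq> V \<and> (\<forall>x\<in>V. \<forall>y\<in>V. G (x + y) = G x + G y) \<and>
     (\<forall>c. \<forall>x\<in>V. G (c *s x) = c *s G x) \<and>
     (\<forall>z m. \<forall>x\<in>V. app ((ad br \<mu> - sc z) ^ m) x = 0 \<longrightarrow> G x = taylor f z (ad br \<mu>) m x)"
  unfolding holomorphic_calculus_def taylor_def
  by (simp add: funpow_minus_scale[where T = "ad br \<mu>", simplified])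

lemma Rhat_preserves:
  assumes "\<mu> \<in> l" "unit (Mhat (ad br \<mu>))"
  shows "x \<in> l \<Longrightarrow> app (Rhat (ad br \<mu>)) x \<in> l" "x \<in> lperp \<Longrightarrow> app (Rhat (ad br \<mu>)) x \<in> lperp"
proof -
  have "Rhat (ad br \<mu>) * P = P * Rhat (ad br \<mu>)" by (rule Rhat_P[OF P_ad[OF assms(1)] assms(2)])
  hence c: "app (Rhat (ad br \<mu>)) (app P x) = app P (app (Rhat (ad br \<mu>)) x)" by (metis app_simps(1))
  show "x \<in> l \<Longrightarrow> app (Rhat (ad br \<mu>)) x \<in> l" using c by (simp add: in_l_iff)
  show "x \<in> lperp \<Longrightarrow> app (Rhat (ad br \<mu>)) x \<in> lperp" using c by simp
qed

lemma Rhat_calculus: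
  assumes "\<mu> \<in> l" "unit (Mhat (ad br \<mu>))"
  shows "holomorphic_calculus (symbol_l \<epsilon>) l (br \<mu>) (app (Rhat (ad br \<mu>)))"
    "holomorphic_calculus (symbol_perp \<epsilon>) lperp (br \<mu>) (app (Rhat (ad br \<mu>)))"
  unfolding holomorphic_calculus_taylor
  using Rhat_preserves[OF assms] Rhat_taylor_l[OF assms] Rhat_taylor_perp[OF assms] by auto

text \<open>
  The generalized eigenvectors, on which the values are prescribed, span \<open>V\<close>.
\<close>

lemma holomorphic_calculus_unique:
  assumes V: "vec.subspace V" "\<And>x. x \<in> V \<Longrightarrow> br \<mu> x \<in> V"
    and H: "holomorphic_calculus f V (br \<mu>) H" and G: "holomorphic_calculus f V (br \<mu>) G" and x: "x \<in> V"
  shows "H x = G x"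
proof -
  let ?S = "{x\<in>V. \<exists>z m. app ((ad br \<mu> - sc z) ^ m) x = 0}"
  have "x \<in> gen_span (ad br \<mu>) V" using gen_span_eq[of V "ad br \<mu>"] V x by simp
  hence xs: "x \<in> vec.span ?S" by (simp add: gen_span_def)
  have sub: "vec.subspace {x\<in>V. H x = G x}"
  proof -
    have "H (0 *s 0) = 0 *s H 0" "G (0 *s 0) = 0 *s G 0"
      using H G vec.subspace_0[OF V(1)] unfolding holomorphic_calculus_taylor by blast+
    hence "H 0 = 0" "G 0 = 0" by simp_all
    thus ?thesis using V(1) H G unfolding vec.subspace_def holomorphic_calculus_taylor by simp
  qed
  have "?S \<subseteq> {x\<in>V. H x = G x}" using H G unfolding holomorphic_calculus_taylor by fastforce
  from vec.span_minimal[OF this sub] show ?thesis using xs by blast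
qed

lemma r_value:
  assumes K: "killing_orthogonal br l = lperp" and reg: "regular \<mu>"
  shows "is_r_value br form l r\<^sub>l \<epsilon> \<mu> A \<longleftrightarrow>
    (\<forall>x\<in>l. app (oper A) x = app (Rhat (ad br \<mu>)) x - app (oper r\<^sub>l) x) \<and>
    (\<forall>x\<in>lperp. app (oper A) x = app (Rhat (ad br \<mu>)) x)"
proof -
  have \<mu>: "\<mu> \<in> l" "unit (Mhat (ad br \<mu>))" using reg regularD(1) by (auto simp: regular_def)
  note C = Rhat_calculus[OF \<mu>]
  show ?thesis
  proof
    assume "is_r_value br form l r\<^sub>l \<epsilon> \<mu> A"
    then obtain H G where FG: "holomorphic_calculus (symbol_l \<epsilon>) l (br \<mu>) H"
        "holomorphic_calculus (symbol_perp \<epsilon>) lperp (br \<mu>) G"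
        "\<forall>x\<in>l. operator_of form A x = H x - operator_of form r\<^sub>l x" "\<forall>x\<in>lperp. operator_of form A x = G x"
      unfolding is_r_value_def K by blast
    have "H x = app (Rhat (ad br \<mu>)) x" if "x \<in> l" for x
      using holomorphic_calculus_unique[OF subspace_l closed_l[OF \<mu>(1)] FG(1) C(1) that] by blast
    moreover have "G x = app (Rhat (ad br \<mu>)) x" if "x \<in> lperp" for x
      using holomorphic_calculus_unique[OF subspace_lperp ad_lperp[OF \<mu>(1)] FG(2) C(2) that] by blast
    ultimately show "(\<forall>x\<in>l. app (oper A) x = app (Rhat (ad br \<mu>)) x - app (oper r\<^sub>l) x) \<and>
        (\<forall>x\<in>lperp. app (oper A) x = app (Rhat (ad br \<mu>)) x)"
      using FG(3,4) by (simp add: app_oper)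
  next
    assume "(\<forall>x\<in>l. app (oper A) x = app (Rhat (ad br \<mu>)) x - app (oper r\<^sub>l) x) \<and>
        (\<forall>x\<in>lperp. app (oper A) x = app (Rhat (ad br \<mu>)) x)"
    thus "is_r_value br form l r\<^sub>l \<epsilon> \<mu> A"
      unfolding is_r_value_def K using C by (auto simp: app_oper)
  qed
qed

lemma r_matrix_eq:
  assumes K: "killing_orthogonal br l = lperp" and reg: "regular \<mu>"
    and rP: "\<And>x. app (oper r\<^sub>l) (app P x) = app (oper r\<^sub>l) x"
  shows "r_matrix br form l r\<^sub>l \<epsilon> \<mu> = tensor_of (Rhat (ad br \<mu>)) - r\<^sub>l"
    and "is_r_value br form l r\<^sub>l \<epsilon> \<mu> (r_matrix br form l r\<^sub>l \<epsilon> \<mu>)"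
proof -
  let ?A = "tensor_of (Rhat (ad br \<mu>)) - r\<^sub>l"
  have o: "oper ?A = Rhat (ad br \<mu>) - oper r\<^sub>l" by (simp add: oper_diff)
  have "app (oper r\<^sub>l) x = 0" if "x \<in> lperp" for x using rP[of x] that by simp
  hence v: "is_r_value br form l r\<^sub>l \<epsilon> \<mu> ?A" unfolding r_value[OF K reg] o by simp
  have u: "A = ?A" if A: "is_r_value br form l r\<^sub>l \<epsilon> \<mu> A" for A
  proof (rule oper_inject, rule endo_eqI)
    fix x
    have A': "\<forall>x\<in>l. app (oper A) x = app (Rhat (ad br \<mu>)) x - app (oper r\<^sub>l) x"
      "\<forall>x\<in>lperp. app (oper A) x = app (Rhat (ad br \<mu>)) x"
      using A unfolding r_value[OF K reg] by blast+
    have "app (oper A) x = app (oper A) (app P x) + app (oper A) (x - app P x)" by simp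
    also have "\<dots> = (app (Rhat (ad br \<mu>)) (app P x) - app (oper r\<^sub>l) (app P x)) + app (Rhat (ad br \<mu>)) (x - app P x)"
      using A'(1) P_range[of x] A'(2) P_minus[of x] by (simp only:)
    also have "\<dots> = app (oper ?A) x" unfolding o rP by simp
    finally show "app (oper A) x = app (oper ?A) x" .
  qed
  show 1: "r_matrix br form l r\<^sub>l \<epsilon> \<mu> = ?A" unfolding r_matrix_def by (rule the_equality[where P = "is_r_value br form l r\<^sub>l \<epsilon> \<mu>", OF v u])
  show "is_r_value br form l r\<^sub>l \<epsilon> \<mu> (r_matrix br form l r\<^sub>l \<epsilon> \<mu>)" unfolding 1 by (rule v)
qed

end

section \<open>Holomorphic functions on a subspace\<close>

lemma holomorphic_in_const: "holomorphic_in l U (\<lambda>_. c)"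
  unfolding holomorphic_in_def by (auto intro!: exI[of _ "\<lambda>_. 0"])

lemma holomorphic_in_add: "holomorphic_in l U f \<Longrightarrow> holomorphic_in l U g \<Longrightarrow> holomorphic_in l U (\<lambda>x. f x + g x)"
  unfolding holomorphic_in_def
proof
  fix x assume x: "x \<in> U" and fg: "\<forall>x\<in>U. \<exists>f'. (f has_derivative f') (at x within U) \<and> (\<forall>c. \<forall>v\<in>l. f' (c *s v) = c * f' v)"
    "\<forall>x\<in>U. \<exists>f'. (g has_derivative f') (at x within U) \<and> (\<forall>c. \<forall>v\<in>l. f' (c *s v) = c * f' v)"
  obtain f' g' where d: "(f has_derivative f') (at x within U)" "\<forall>c. \<forall>v\<in>l. f' (c *s v) = c * f' v"
    "(g has_derivative g') (at x within U)" "\<forall>c. \<forall>v\<in>l. g' (c *s v) = c * g' v" using fg x by blast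
  show "\<exists>h'. ((\<lambda>x. f x + g x) has_derivative h') (at x within U) \<and> (\<forall>c. \<forall>v\<in>l. h' (c *s v) = c * h' v)"
    using has_derivative_add[OF d(1,3)] d(2,4) by (intro exI[of _ "\<lambda>v. f' v + g' v"]) (simp add: distrib_left)
qed

lemma holomorphic_in_mult: "holomorphic_in l U f \<Longrightarrow> holomorphic_in l U g \<Longrightarrow> holomorphic_in l U (\<lambda>x. f x * g x)"
  unfolding holomorphic_in_def
proof
  fix x assume x: "x \<in> U" and fg: "\<forall>x\<in>U. \<exists>f'. (f has_derivative f') (at x within U) \<and> (\<forall>c. \<forall>v\<in>l. f' (c *s v) = c * f' v)"
    "\<forall>x\<in>U. \<exists>f'. (g has_derivative f') (at x within U) \<and> (\<forall>c. \<forall>v\<in>l. f' (c *s v) = c * f' v)"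
  obtain f' g' where d: "(f has_derivative f') (at x within U)" "\<forall>c. \<forall>v\<in>l. f' (c *s v) = c * f' v"
    "(g has_derivative g') (at x within U)" "\<forall>c. \<forall>v\<in>l. g' (c *s v) = c * g' v" using fg x by blast
  show "\<exists>h'. ((\<lambda>x. f x * g x) has_derivative h') (at x within U) \<and> (\<forall>c. \<forall>v\<in>l. h' (c *s v) = c * h' v)"
    using has_derivative_mult[OF d(1,3)] d(2,4) by (intro exI[of _ "\<lambda>v. f x * g' v + f' v * g x"]) (simp add: algebra_simps)
qed

lemma holomorphic_in_diff: "holomorphic_in l U f \<Longrightarrow> holomorphic_in l U g \<Longrightarrow> holomorphic_in l U (\<lambda>x. f x - g x)"
  using holomorphic_in_add[of l U f "\<lambda>x. - 1 * g x"] holomorphic_in_mult[OF holomorphic_in_const, of l U g "- 1"] by simp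

lemma holomorphic_in_sum: "(\<And>i. i \<in> I \<Longrightarrow> holomorphic_in l U (f i)) \<Longrightarrow> holomorphic_in l U (\<lambda>x. \<Sum>i\<in>I. f i x)"
  by (induction I rule: infinite_finite_induct) (auto intro: holomorphic_in_const holomorphic_in_add)

lemma holomorphic_in_prod: "(\<And>i. i \<in> I \<Longrightarrow> holomorphic_in l U (f i)) \<Longrightarrow> holomorphic_in l U (\<lambda>x. \<Prod>i\<in>I. f i x)"
  by (induction I rule: infinite_finite_induct) (auto intro: holomorphic_in_const holomorphic_in_mult)

lemma holomorphic_in_det:
  "(\<And>i j. holomorphic_in l U (\<lambda>x. A x $ i $ j)) \<Longrightarrow> holomorphic_in l U (\<lambda>x. det (A x))"
  unfolding det_def
  by (intro holomorphic_in_sum holomorphic_in_mult holomorphic_in_prod holomorphic_in_const)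

lemma holomorphic_in_line:
  assumes q: "holomorphic_in l l q" and l: "vec.subspace l" "p \<in> l" "w \<in> l"
  shows "(\<lambda>t. q (p + t *s w)) holomorphic_on UNIV"
  unfolding holomorphic_on_open[OF open_UNIV]
proof
  fix t :: complex
  have in_l: "p + s *s w \<in> l" for s using l by (intro vec.subspace_add vec.subspace_scale)
  obtain q' where q': "(q has_derivative q') (at (p + t *s w) within l)" "\<And>c. q' (c *s w) = c * q' w"
    using q in_l l(3) unfolding holomorphic_in_def by metis
  have "bounded_linear (\<lambda>s. s *s w)"
    by (intro linear_conv_bounded_linear[THEN iffD1] linearI)
       (auto simp: vector_sadd_rdistrib scaleR_eq_complex_scale vector_smult_assoc scaleR_conv_of_real)
  hence "((\<lambda>s. p + s *s w) has_derivative (\<lambda>s. s *s w)) (at t within UNIV)"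
    by (auto intro!: derivative_eq_intros bounded_linear_imp_has_derivative)
  moreover have "(q has_derivative q') (at (p + t *s w) within (\<lambda>s. p + s *s w) ` UNIV)"
    by (rule has_derivative_subset[OF q'(1)]) (use in_l in auto)
  ultimately have "((\<lambda>s. q (p + s *s w)) has_derivative (\<lambda>s. q' (s *s w))) (at t within UNIV)"
    by (rule has_derivative_in_compose)
  hence "((\<lambda>s. q (p + s *s w)) has_field_derivative q' w) (at t)"
    unfolding has_field_derivative_def q'(2) by (simp add: mult.commute[of _ "q' w"])
  thus "\<exists>f'. ((\<lambda>s. q (p + s *s w)) has_field_derivative f') (at t)" by blast
qed

section \<open>The dynamical r-matrix\<close>

locale levi_setting = r_setting +
  fixes r\<^sub>l \<Omega>\<^sub>l :: "complex^'a^'a" and \<delta> :: "complex^'a \<Rightarrow> complex^'a^'a" and N :: "(complex^'a) set"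
    and \<rho> :: "complex^'a"
  assumes killing: "killing_orthogonal br l = {x. app P x = 0}"
    and P_Omega: "P = oper \<Omega>\<^sub>l"
    and Omega_sym: "\<And>i j. \<Omega>\<^sub>l $ i $ j = \<Omega>\<^sub>l $ j $ i" and Omega_in: "\<Omega>\<^sub>l \<in> tensor_square l"
    and r_anti: "\<And>i j. r\<^sub>l $ i $ j = - r\<^sub>l $ j $ i" and r_in: "r\<^sub>l \<in> tensor_square l"
    and CYB0: "CYB br (r\<^sub>l + (1/2) *\<^sub>R \<Omega>\<^sub>l) = 0"
    and delta: "\<And>\<xi>. \<xi> \<in> l \<Longrightarrow> \<delta> \<xi> = ad2 br \<xi> r\<^sub>l"
    and N: "exponential_domain br l N"
    and rho: "\<rho> \<in> l" "\<And>x. br \<rho> x = 0 \<Longrightarrow> x \<in> l"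
begin

abbreviation D where "D \<equiv> regular_points br l N \<epsilon>"
abbreviation r where "r \<equiv> r_matrix br form l r\<^sub>l \<epsilon>"
abbreviation Rl where "Rl \<equiv> oper r\<^sub>l"

lemma N_l: "N \<subseteq> l" using N openin_imp_subset unfolding exponential_domain_def by blast

lemma D_iff: "\<mu> \<in> D \<longleftrightarrow> \<mu> \<in> N \<and> regular \<mu>"
  unfolding regular_points_def killing using regular_iff_analytic[OF nonsingularI[OF N]] by auto

lemma D_nonsingular: "\<mu> \<in> D \<Longrightarrow> nonsingular \<mu>" using D_iff by (simp add: regular_def)
lemma D_l: "\<mu> \<in> D \<Longrightarrow> \<mu> \<in> l" using D_iff N_l by auto

lemma r_skew: "\<forall>i j. r\<^sub>l $ i $ j = - 1 * r\<^sub>l $ j $ i"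
  by (intro allI, subst r_anti) simp

lemma Rl_skew: "form (app Rl x) y = - form x (app Rl y)"
  using oper_skew[OF r_skew, of x y] by simp

lemma Rl_in: "app Rl x \<in> l"
  unfolding app_oper operator_of_def
  by (rule contract_in[OF subspace_l r_in]) (simp add: linear_functional_iff form_simps)

lemma Rl_P: "app Rl (app P x) = app Rl x"
proof (rule form_eqI)
  fix y
  have "form (app Rl (app P x)) y = - form x (app P (app Rl y))" by (simp add: Rl_skew P_sym)
  thus "form (app Rl (app P x)) y = form (app Rl x) y" by (simp add: P_id[OF Rl_in] Rl_skew)
qed

lemma r_eq: "\<mu> \<in> D \<Longrightarrow> r \<mu> = tensor_of (Rhat (ad br \<mu>)) - r\<^sub>l"
  and r_value_D: "\<mu> \<in> D \<Longrightarrow> is_r_value br form l r\<^sub>l \<epsilon> \<mu> (r \<mu>)"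
  using r_matrix_eq[OF killing _ Rl_P] D_iff by auto

lemma openin_D: "openin (top_of_set l) D"
proof -
  have "continuous_on UNIV (\<lambda>\<mu>. Mhat (ad br \<mu>))"
    unfolding continuous_on_def
    by (auto intro!: Mhat_tendsto bounded_linear.tendsto[OF bounded_linear_ad[OF lie]])
  hence "open ((\<lambda>\<mu>. Mhat (ad br \<mu>)) -` {X. unit X})"
    using open_unit by (rule open_vimage[rotated])
  moreover have "D = N \<inter> ((\<lambda>\<mu>. Mhat (ad br \<mu>)) -` {X. unit X})"
    using D_iff nonsingularI[OF N] by (auto simp: regular_def)
  ultimately show ?thesis using N by (simp add: exponential_domain_def openin_Int_open)
qed

lemma bounded_linear_tensor_of: "bounded_linear tensor_of"
proof -
  have "bounded_linear (\<lambda>X. tensor_of X $ i $ j)" for i j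
    unfolding tensor_of_def
    by (simp add: bounded_linear_compose[OF bounded_linear_vec_nth bounded_linear_app_left])
  thus ?thesis
    by (subst bounded_linear_componentwise_iff)
       (auto simp: Basis_vec_def inner_axis intro!: bounded_linear_compose[OF bounded_linear_inner_left])
qed

lemma line_in_D:
  assumes "\<mu> \<in> D" "v \<in> l" obtains S where "open S" "(0::real) \<in> S" "\<And>s. s \<in> S \<Longrightarrow> \<mu> + s *\<^sub>R v \<in> D"
proof -
  obtain W where W: "open W" "D = l \<inter> W" using openin_D by (auto simp: openin_open)
  have "open ((\<lambda>s::real. \<mu> + s *\<^sub>R v) -` W)" by (intro open_vimage W continuous_intros)
  moreover have "\<mu> + s *\<^sub>R v \<in> l" for s
    using assms(2) D_l[OF assms(1)] subspace_l
    by (simp add: scaleR_eq_complex_scale vec.subspace_add vec.subspace_scale)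
  ultimately show ?thesis using that[of "(\<lambda>s::real. \<mu> + s *\<^sub>R v) -` W"] W(2) assms(1) by auto
qed

text \<open>
  The operator of \<open>r\<close> is \<open>R\<close> up to a constant, and its derivative is the divided difference at the diagonal.
\<close>

lemma r_derivative:
  assumes "\<mu> \<in> D" "v \<in> l"
  shows "vector_derivative (\<lambda>s. r (\<mu> + s *\<^sub>R v)) (at 0)
    = tensor_of (blinfun_apply (Rhat_dd (ad br \<mu>) (ad br \<mu>)) (ad br v))"
proof (rule vector_derivative_at)
  obtain S where S: "open S" "(0::real) \<in> S" "\<And>s. s \<in> S \<Longrightarrow> \<mu> + s *\<^sub>R v \<in> D" using line_in_D[OF assms] by blast
  have line: "ad br (\<mu> + s *\<^sub>R v) = ad br \<mu> + s *\<^sub>R ad br v" for s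
    by (simp add: ad_lin scaleR_eq_complex_scale sc_of_real)
  have "ad br \<mu> + s *\<^sub>R ad br v \<in> Rhat_domain" if "s \<in> S" for s
    using S(3)[OF that] D_iff regularD(2) by (simp flip: line)
  hence "eventually (\<lambda>s. ad br \<mu> + s *\<^sub>R ad br v \<in> Rhat_domain) (nhds 0)"
    using S by (auto simp: eventually_nhds)
  moreover have "ad br \<mu> \<in> Rhat_domain" using assms(1) D_iff regularD(2) by blast
  ultimately have "((\<lambda>s. Rhat (ad br \<mu> + s *\<^sub>R ad br v)) has_vector_derivative
      blinfun_apply (Rhat_dd (ad br \<mu>) (ad br \<mu>)) (ad br v)) (at 0)"
    by (intro dvd_diff_line_derivative[OF Rhat_dd])
  from bounded_linear.has_vector_derivative[OF bounded_linear_tensor_of this]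
  have "((\<lambda>s. tensor_of (Rhat (ad br (\<mu> + s *\<^sub>R v))) - r\<^sub>l) has_vector_derivative
      tensor_of (blinfun_apply (Rhat_dd (ad br \<mu>) (ad br \<mu>)) (ad br v)) - 0) (at 0)"
    unfolding line by (intro has_vector_derivative_diff has_vector_derivative_const)
  thus "((\<lambda>s. r (\<mu> + s *\<^sub>R v)) has_vector_derivative
      tensor_of (blinfun_apply (Rhat_dd (ad br \<mu>) (ad br \<mu>)) (ad br v))) (at 0)"
    using has_vector_derivative_transform_within_open[OF _ S(1,2), of
        "\<lambda>s. tensor_of (Rhat (ad br (\<mu> + s *\<^sub>R v))) - r\<^sub>l" _ "\<lambda>s. r (\<mu> + s *\<^sub>R v)"] r_eq[OF S(3)]
    by simp
qed

definition dR :: "complex^'a \<Rightarrow> complex^'a \<Rightarrow> 'a endo" where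
  "dR \<mu> v = blinfun_apply (Rhat_dd (ad br \<mu>) (ad br \<mu>)) (ad br v)"

lemma dR_linear:
  "dR \<mu> (v + w) = dR \<mu> v + dR \<mu> w" "dR \<mu> (v - w) = dR \<mu> v - dR \<mu> w"
  by (simp_all add: dR_def ad_lin blinfun.bilinear_simps)

lemma dR_scale: "\<mu> \<in> D \<Longrightarrow> dR \<mu> (c *s v) = sc c * dR \<mu> v"
  using Rhat_dd regularD(2) D_iff unfolding dR_def ad_lin divided_difference_def by blast

text \<open>
  Infinitesimal equivariance of \<open>R\<close>: the intertwining identity of the divided difference on the diagonal, with
  \<open>Z = ad w\<close>.
\<close>

lemma dR_bracket:
  assumes "\<mu> \<in> D" "w \<in> l"
  shows "dR \<mu> (br \<mu> w) = Rhat (ad br \<mu>) * ad br w - ad br w * Rhat (ad br \<mu>)"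
proof -
  have "Rhat (ad br \<mu>) * ad br w - ad br w * Rhat (ad br \<mu>)
      = blinfun_apply (Rhat_dd (ad br \<mu>) (ad br \<mu>)) (ad br \<mu> * ad br w - ad br w * ad br \<mu>)"
    using Rhat_dd regularD(2) D_iff assms P_ad[OF assms(2)] unfolding divided_difference_def by blast
  thus ?thesis by (simp add: dR_def ad_br[OF lie])
qed

lemma left_right_deriv:
  assumes "\<mu> \<in> D" "\<xi> \<in> l"
  shows "left_deriv br l \<xi> r \<mu> = tensor_of (dR \<mu> (left_vector br l \<xi> \<mu>))"
    "right_deriv br l \<xi> r \<mu> = tensor_of (dR \<mu> (right_vector br l \<xi> \<mu>))"
  unfolding left_deriv_def right_deriv_def dR_def
  using r_derivative[OF assms(1)] left_vector(1) right_vector(1) D_nonsingular[OF assms(1)] assms(2) by auto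

lemma tensor_of_linear:
  "tensor_of (A + B) = tensor_of A + tensor_of B" "tensor_of (A - B) = tensor_of A - tensor_of B"
  "tensor_of (k *\<^sub>R A) = k *\<^sub>R tensor_of A"
  by (simp_all add: tensor_of_def vec_eq_iff)

lemma r_wedge: assumes "\<mu> \<in> D" shows "r \<mu> \<in> wedge2 UNIV" "r \<mu> $ i $ j = - 1 * r \<mu> $ j $ i"
proof -
  have reg: "regular \<mu>" using assms D_iff by blast
  have "r \<mu> $ i $ j = - r \<mu> $ j $ i" for i j
    unfolding r_eq[OF assms] using r_anti[of i j] Rhat_skew[OF reg, of "dual_axis i" "dual_axis j"]
      form_commute[of "dual_axis i" "app (Rhat (ad br \<mu>)) (dual_axis j)"]
    by (simp add: tensor_of_component)
  hence *: "\<forall>i j. r \<mu> $ i $ j = - r \<mu> $ j $ i" by blast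
  show "r \<mu> \<in> wedge2 UNIV" unfolding wedge2_def using * tensor_square_UNIV by blast
  show "r \<mu> $ i $ j = - 1 * r \<mu> $ j $ i" using * mult_minus1 by metis
qed

lemma r_quasi_invariant: "quasi_invariant br l \<delta> D r"
  unfolding quasi_invariant_def
proof (intro ballI)
  fix \<xi> \<mu> assume \<xi>: "\<xi> \<in> l" and \<mu>: "\<mu> \<in> D"
  have "act_l br l \<xi> r \<mu> = tensor_of (dR \<mu> (left_vector br l \<xi> \<mu> - right_vector br l \<xi> \<mu>))"
    by (simp add: act_l_def left_right_deriv[OF \<mu> \<xi>] tensor_of_linear dR_linear)
  also have "\<dots> = tensor_of (Rhat (ad br \<mu>) * ad br \<xi> - ad br \<xi> * Rhat (ad br \<mu>))"
    unfolding left_minus_right[OF D_nonsingular[OF \<mu>] \<xi>] dR_bracket[OF \<mu> \<xi>] ..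
  finally have 1: "oper (act_l br l \<xi> r \<mu>) = Rhat (ad br \<mu>) * ad br \<xi> - ad br \<xi> * Rhat (ad br \<mu>)" by simp
  have "oper (act_l br l \<xi> r \<mu> + ad2 br \<xi> (r \<mu>)) = oper (- \<delta> \<xi>)"
  proof -
    have "oper (- \<delta> \<xi>) = - oper (ad2 br \<xi> r\<^sub>l)" using oper_diff[of 0 "\<delta> \<xi>"] oper_diff[of 0 0] delta[OF \<xi>] by simp
    thus ?thesis unfolding oper_add 1 oper_ad2 r_eq[OF \<mu>] by (simp add: oper_diff algebra_simps)
  qed
  thus "act_l br l \<xi> r \<mu> + ad2 br \<xi> (r \<mu>) = - \<delta> \<xi>" by (rule oper_inject)
qed

lemma nabla_eq:
  assumes \<mu>: "\<mu> \<in> D" and \<eta>: "linear_functional \<eta>"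
  shows "nabla br l r\<^sub>l \<Omega>\<^sub>l \<eta> r \<mu> = tensor_of (dR \<mu> (mean_vector \<mu> (contract \<Omega>\<^sub>l \<eta>) - br \<mu> (contract r\<^sub>l \<eta>)))"
proof -
  have l: "contract r\<^sub>l \<eta> \<in> l" "contract \<Omega>\<^sub>l \<eta> \<in> l"
    by (rule contract_in[OF subspace_l _ \<eta>], rule r_in Omega_in)+
  let ?vl = "left_vector br l (contract r\<^sub>l \<eta>) \<mu>" and ?vr = "right_vector br l (contract r\<^sub>l \<eta>) \<mu>"
    and ?wl = "left_vector br l (contract \<Omega>\<^sub>l \<eta>) \<mu>" and ?wr = "right_vector br l (contract \<Omega>\<^sub>l \<eta>) \<mu>"
  have "mean_vector \<mu> (contract \<Omega>\<^sub>l \<eta>) - br \<mu> (contract r\<^sub>l \<eta>) = (?vr - ?vl) + (1/2) *s (?wl + ?wr)"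
    using left_minus_right[OF D_nonsingular[OF \<mu>] l(1)] by (simp add: mean_vector_def algebra_simps)
  moreover have "sc (1/2) * A = (1/2) *\<^sub>R A" for A :: "'a endo"
    using arg_cong[OF sc_of_real[of "1/2"], of "\<lambda>X. X * A"] by simp
  ultimately show ?thesis
    unfolding nabla_def left_right_deriv[OF \<mu> l(1)] left_right_deriv[OF \<mu> l(2)]
    by (simp add: dR_linear dR_scale[OF \<mu>] tensor_of_linear distrib_left vector_add_ldistrib scaleR_add_right)
qed

text \<open>
  The mean vector as an operator on the whole space, so that it can be taken out of the sum over a basis.
\<close>

definition mean_op :: "complex^'a \<Rightarrow> 'a endo" where
  "mean_op \<mu> = sc (1/2) * einv (phi_l (ad br \<mu>)) * (1 + exp (- ad br \<mu>))"

lemma mean_vector_mean_op: "nonsingular \<mu> \<Longrightarrow> \<xi> \<in> l \<Longrightarrow> mean_vector \<mu> \<xi> = app (mean_op \<mu>) \<xi>"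
  by (simp add: mean_vector_eq mean_op_def)

text \<open>
  Summation over dual bases replaces the functional \<open>\<eta>\<close> by the first tensor slot, so that \<open>\<Omega>\<^sub>l\<close> acts as \<open>P\<close> and
  \<open>r\<^sub>l\<close> as its operator.
\<close>

lemma nabla_sum:
  assumes \<mu>: "\<mu> \<in> D" and B: "dual_bases l d \<xi> \<eta>"
  shows "(\<Sum>i<d. \<xi> i $ a * nabla br l r\<^sub>l \<Omega>\<^sub>l (\<eta> i) r \<mu> $ b $ c)
    = form (app (dR \<mu> (mean_vector \<mu> (app P (dual_axis a)) - br \<mu> (app Rl (dual_axis a)))) (dual_axis b)) (dual_axis c)"
proof -
  have n: "nonsingular \<mu>" by (rule D_nonsingular[OF \<mu>])
  have lf: "linear_functional (\<eta> i)" if "i < d" for i using B that by (simp add: dual_bases_def)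
  define w where "w i = app (mean_op \<mu>) (contract \<Omega>\<^sub>l (\<eta> i)) - br \<mu> (contract r\<^sub>l (\<eta> i))" for i
  have nab: "nabla br l r\<^sub>l \<Omega>\<^sub>l (\<eta> i) r \<mu> $ b $ c = form (app (dR \<mu> (w i)) (dual_axis b)) (dual_axis c)" if "i < d" for i
    using mean_vector_mean_op[OF n contract_in[OF subspace_l Omega_in lf[OF that]]]
    by (simp add: nabla_eq[OF \<mu> lf[OF that]] tensor_of_component w_def)
  have lin: "(\<Sum>i<k. \<xi> i $ a * form (app (dR \<mu> (w i)) (dual_axis b)) (dual_axis c))
      = form (app (dR \<mu> (\<Sum>i<k. \<xi> i $ a *s w i)) (dual_axis b)) (dual_axis c)" for k
  proof (induction k)
    case 0
    have "dR \<mu> 0 = 0" using dR_scale[OF \<mu>, of 0 0] by simp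
    thus ?case by (simp add: form_simps)
  next
    case (Suc k) thus ?case by (simp add: dR_linear dR_scale[OF \<mu>] form_simps)
  qed
  have "(\<Sum>i<k. \<xi> i $ a *s w i) = app (mean_op \<mu>) (\<Sum>i<k. \<xi> i $ a *s contract \<Omega>\<^sub>l (\<eta> i))
      - br \<mu> (\<Sum>i<k. \<xi> i $ a *s contract r\<^sub>l (\<eta> i))" for k
    by (induction k) (auto simp: w_def br vector_ssub_ldistrib algebra_simps)
  hence "(\<Sum>i<d. \<xi> i $ a *s w i) = app (mean_op \<mu>) (app P (dual_axis a)) - br \<mu> (app Rl (dual_axis a))"
    using dual_bases_contract[OF B Omega_in] dual_bases_contract[OF B r_in]
    by (simp add: P_Omega oper_dual_axis)
  also have "app (mean_op \<mu>) (app P (dual_axis a)) = mean_vector \<mu> (app P (dual_axis a))" using mean_vector_mean_op[OF n P_range] by simp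
  finally show ?thesis using lin[of d] nab by simp
qed

text \<open>
  The operator of \<open>r\<^sub>l + \<Omega>\<^sub>l/2\<close> is \<open>r\<^sub>l + P/2\<close> and that of the flipped tensor is \<open>- r\<^sub>l + P/2\<close>.  In the
  trilinear form of \<open>CYB (r\<^sub>l + \<Omega>\<^sub>l/2) = 0\<close> the terms linear in \<open>r\<^sub>l\<close> cancel, because two entries in \<open>l\<close> project
  the third one to \<open>l\<close>; the terms quadratic in \<open>P/2\<close> add up to a quarter of \<open>F\<close> on \<open>l\<close>.
\<close>

lemma Rl_sum:
  "F (app Rl (dual_axis a)) (app Rl (dual_axis b)) (dual_axis c) + F (app Rl (dual_axis a)) (dual_axis b) (app Rl (dual_axis c)) + F (dual_axis a) (app Rl (dual_axis b)) (app Rl (dual_axis c))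
    = - (1/4) * F (app P (dual_axis a)) (app P (dual_axis b)) (app P (dual_axis c))"
proof -
  let ?A = "r\<^sub>l + (1/2) *\<^sub>R \<Omega>\<^sub>l"
  define h where "h x = (1/2) *s app P x" for x
  have A: "app (oper ?A) x = app Rl x + h x" for x
    by (simp add: oper_add oper_scale P_Omega h_def scaleR_eq_complex_scale)
  have "app (sc (-1) * Rl + sc (1/2) * P) (dual_axis a) = (\<chi> i. ?A $ i $ a)" for a
  proof -
    have "app (sc (-1) * Rl) (dual_axis a) = (\<chi> i. r\<^sub>l $ i $ a)" by (rule transpose_skew[OF r_skew])
    moreover have "app (sc 1 * oper \<Omega>\<^sub>l) (dual_axis a) = (\<chi> i. \<Omega>\<^sub>l $ i $ a)" by (rule transpose_skew) (metis Omega_sym mult_1)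
    ultimately show ?thesis
      by (simp add: P_Omega vec_eq_iff scaleR_conv_of_real[where 'a=complex])
  qed
  from CYB_component[OF this, of a b c]
  have "0 = F (h (dual_axis b) - app Rl (dual_axis b)) (h (dual_axis c) - app Rl (dual_axis c)) (dual_axis a)
      + F (app Rl (dual_axis a) + h (dual_axis a)) (h (dual_axis c) - app Rl (dual_axis c)) (dual_axis b)
      + F (app Rl (dual_axis a) + h (dual_axis a)) (app Rl (dual_axis b) + h (dual_axis b)) (dual_axis c)"
    unfolding CYB0 A by (simp add: h_def)
  also have "\<dots> = F (dual_axis a) (h (dual_axis b) - app Rl (dual_axis b)) (h (dual_axis c) - app Rl (dual_axis c))
      - F (app Rl (dual_axis a) + h (dual_axis a)) (dual_axis b) (h (dual_axis c) - app Rl (dual_axis c))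
      + F (app Rl (dual_axis a) + h (dual_axis a)) (app Rl (dual_axis b) + h (dual_axis b)) (dual_axis c)"
    using F_cyc F_swap23 by (metis diff_conv_add_uminus)
  finally have E: "0 = F (dual_axis a) (h (dual_axis b) - app Rl (dual_axis b)) (h (dual_axis c) - app Rl (dual_axis c))
      - F (app Rl (dual_axis a) + h (dual_axis a)) (dual_axis b) (h (dual_axis c) - app Rl (dual_axis c))
      + F (app Rl (dual_axis a) + h (dual_axis a)) (app Rl (dual_axis b) + h (dual_axis b)) (dual_axis c)" .
  \<comment> \<open>Two entries in \<open>l\<close> project the third one to \<open>l\<close>.\<close>
  have p: "F x y z = F x y (app P z)" "F x z y = F x (app P z) y" "F z x y = F (app P z) x y"
    if "x \<in> l" "y \<in> l" for x y z
    using F_PP F_PP' that P_id PP by metis+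
  have hl: "h x \<in> l" for x unfolding h_def using subspace_l P_range by (intro vec.subspace_scale)
  have R: "app Rl x \<in> l" for x by (rule Rl_in)
  let ?x = "app P (dual_axis a)" and ?y = "app P (dual_axis b)" and ?z = "app P (dual_axis c)"
  have m: "F (dual_axis a) (h (dual_axis b)) (h (dual_axis c)) = 1/4 * F ?x ?y ?z" "F (h (dual_axis a)) (dual_axis b) (h (dual_axis c)) = 1/4 * F ?x ?y ?z"
    "F (h (dual_axis a)) (h (dual_axis b)) (dual_axis c) = 1/4 * F ?x ?y ?z"
    using p[OF hl hl] by (simp_all add: h_def F_simps)
  have c: "F (dual_axis a) (h (dual_axis b)) (app Rl (dual_axis c)) = F (h (dual_axis a)) (dual_axis b) (app Rl (dual_axis c))"
    "F (dual_axis a) (app Rl (dual_axis b)) (h (dual_axis c)) = F (h (dual_axis a)) (app Rl (dual_axis b)) (dual_axis c)"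
    "F (app Rl (dual_axis a)) (dual_axis b) (h (dual_axis c)) = F (app Rl (dual_axis a)) (h (dual_axis b)) (dual_axis c)"
    using p[OF hl R] p[OF R hl] by (simp_all add: h_def F_simps)
  have "0 = (F (dual_axis a) (app Rl (dual_axis b)) (app Rl (dual_axis c)) + F (app Rl (dual_axis a)) (dual_axis b) (app Rl (dual_axis c))
      + F (app Rl (dual_axis a)) (app Rl (dual_axis b)) (dual_axis c))
      + F (dual_axis a) (h (dual_axis b)) (h (dual_axis c)) - F (h (dual_axis a)) (dual_axis b) (h (dual_axis c)) + F (h (dual_axis a)) (h (dual_axis b)) (dual_axis c)"
    using E unfolding F_simps c by (simp add: algebra_simps)
  thus ?thesis unfolding m by (simp add: eq_neg_iff_add_eq_0 add_ac)
qed

text \<open>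
  The \<open>r\<^sub>l\<close>-part of \<open>nabla\<close> differentiates along brackets \<open>[\<mu>, S x]\<close>, with \<open>S\<close> the operator of \<open>r\<^sub>l\<close>, and
  so contributes commutators of \<open>R\<close> with \<open>ad (S x)\<close>.  These are the mixed terms of \<open>CYB (R - S)\<close> with the
  opposite sign.
\<close>

lemma r_dynamical:
  assumes \<mu>: "\<mu> \<in> D" and B: "dual_bases l d \<xi> \<eta>"
  shows "((\<Sum>i<d. Alt (tensor_left (\<xi> i) (nabla br l r\<^sub>l \<Omega>\<^sub>l (\<eta> i) r \<mu>))) + CYB br (r \<mu>)) $ a $ b $ c
    = - (\<epsilon>\<^sup>2 / 4) * F (dual_axis a) (dual_axis b) (dual_axis c)"
proof -
  have reg: "regular \<mu>" using \<mu> D_iff by blast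
  let ?x = "dual_axis a" and ?y = "dual_axis b" and ?z = "dual_axis c"
  define R where "R = app (Rhat (ad br \<mu>))"
  define S where "S = app Rl"
  define E where "E x y z = form (app (dR \<mu> (mean_vector \<mu> (app P x))) y) z" for x y z
  have bk: "form (app (dR \<mu> (mean_vector \<mu> (app P x) - br \<mu> (app Rl x))) y) z
      = E x y z + F (S x) y (R z) + F (S x) (R y) z" for x y z
  proof -
    have "form (app (dR \<mu> (br \<mu> (app Rl x))) y) z = form (R (br (S x) y)) z - form (br (S x) (R y)) z"
      unfolding dR_bracket[OF \<mu> Rl_in] by (simp add: R_def S_def form_simps)
    also have "form (R (br (S x) y)) z = - form (br (S x) y) (R z)" unfolding R_def by (rule Rhat_skew[OF reg])
    finally show ?thesis by (simp add: dR_linear form_simps E_def F_def)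
  qed
  have "(\<Sum>i<d. Alt (tensor_left (\<xi> i) (nabla br l r\<^sub>l \<Omega>\<^sub>l (\<eta> i) r \<mu>))) $ a $ b $ c
      = (\<Sum>i<d. \<xi> i $ a * nabla br l r\<^sub>l \<Omega>\<^sub>l (\<eta> i) r \<mu> $ b $ c)
        - (\<Sum>i<d. \<xi> i $ b * nabla br l r\<^sub>l \<Omega>\<^sub>l (\<eta> i) r \<mu> $ a $ c)
        + (\<Sum>i<d. \<xi> i $ c * nabla br l r\<^sub>l \<Omega>\<^sub>l (\<eta> i) r \<mu> $ a $ b)"
    by (simp add: Alt_def tensor_left_def sum.distrib sum_subtractf)
  hence L: "(\<Sum>i<d. Alt (tensor_left (\<xi> i) (nabla br l r\<^sub>l \<Omega>\<^sub>l (\<eta> i) r \<mu>))) $ a $ b $ c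
      = (E ?x ?y ?z + F (S ?x) ?y (R ?z) + F (S ?x) (R ?y) ?z)
        - (E ?y ?x ?z + F (S ?y) ?x (R ?z) + F (S ?y) (R ?x) ?z)
        + (E ?z ?x ?y + F (S ?z) ?x (R ?y) + F (S ?z) (R ?x) ?y)"
    unfolding nabla_sum[OF \<mu> B] bk .
  have o: "app (oper (r \<mu>)) x = R x - S x" for x by (simp add: r_eq[OF \<mu>] oper_diff R_def S_def)
  have "app (sc (- 1) * oper (r \<mu>)) (dual_axis a) = (\<chi> i. r \<mu> $ i $ a)" for a
    by (rule transpose_skew) (use r_wedge(2)[OF \<mu>] in blast)
  from CYB_component[OF this, of a b c]
  have "CYB br (r \<mu>) $ a $ b $ c = F (R ?y - S ?y) (R ?z - S ?z) ?x - F (R ?x - S ?x) (R ?z - S ?z) ?y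
      + F (R ?x - S ?x) (R ?y - S ?y) ?z"
    by (simp add: o F_simps)
  also have "\<dots> = F ?x (R ?y - S ?y) (R ?z - S ?z) + F (R ?x - S ?x) ?y (R ?z - S ?z) + F (R ?x - S ?x) (R ?y - S ?y) ?z"
    using F_cyc[of "R ?y - S ?y" "R ?z - S ?z" ?x] F_cyc[of ?x "R ?y - S ?y" "R ?z - S ?z"] F_swap23[of "R ?x - S ?x" "R ?z - S ?z" ?y] by simp
  finally have C: "CYB br (r \<mu>) $ a $ b $ c
      = F ?x (R ?y - S ?y) (R ?z - S ?z) + F (R ?x - S ?x) ?y (R ?z - S ?z) + F (R ?x - S ?x) (R ?y - S ?y) ?z" .
  have I: "E ?x ?y ?z - E ?y ?x ?z + E ?z ?x ?y + F (R ?x) (R ?y) ?z + F (R ?x) ?y (R ?z) + F ?x (R ?y) (R ?z)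
      = F (app P ?x) (app P ?y) (app P ?z) / 4 - \<epsilon>\<^sup>2 / 4 * F ?x ?y ?z"
    using operator_identity[OF reg, of ?x ?y ?z] by (simp add: E_def dR_def R_def)
  have sw: "F (S ?y) u v = - F u (S ?y) v" "F (S ?z) u v = F u v (S ?z)" for u v
    using F_swap F_cyc by metis+
  have Q: "F (S ?x) (S ?y) ?z + F (S ?x) ?y (S ?z) + F ?x (S ?y) (S ?z) = - (1/4) * F (app P ?x) (app P ?y) (app P ?z)"
    unfolding S_def by (rule Rl_sum)
  have "((\<Sum>i<d. Alt (tensor_left (\<xi> i) (nabla br l r\<^sub>l \<Omega>\<^sub>l (\<eta> i) r \<mu>))) + CYB br (r \<mu>)) $ a $ b $ c
      = (E ?x ?y ?z - E ?y ?x ?z + E ?z ?x ?y + F (R ?x) (R ?y) ?z + F (R ?x) ?y (R ?z) + F ?x (R ?y) (R ?z))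
        + (F (S ?x) (S ?y) ?z + F (S ?x) ?y (S ?z) + F ?x (S ?y) (S ?z))"
    unfolding vector_add_component L C sw by (simp add: F_simps)
  thus ?thesis unfolding I Q by simp
qed

subsection \<open>Meromorphy\<close>

lemma holomorphic_dvd_diff:
  assumes g: "divided_difference P V g G" and U: "\<And>\<mu>. \<mu> \<in> U \<Longrightarrow> ad br \<mu> \<in> V"
  shows "holomorphic_in l U (\<lambda>\<mu>. app (g (ad br \<mu>)) x $ j)"
  unfolding holomorphic_in_def
proof
  fix \<mu> assume \<mu>: "\<mu> \<in> U"
  have 1: "(ad br has_derivative ad br) (at \<mu> within U)"
    by (rule bounded_linear_imp_has_derivative[OF bounded_linear_ad[OF lie]])
  have 2: "(g has_derivative blinfun_apply (G (ad br \<mu>) (ad br \<mu>))) (at (ad br \<mu>) within ad br ` U)"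
    by (rule has_derivative_subset[OF dvd_diff_has_derivative[OF g U[OF \<mu>]]]) (use U in auto)
  have "bounded_linear (\<lambda>R. app R x $ j)"
    by (rule bounded_linear_compose[OF bounded_linear_vec_nth bounded_linear_app_left])
  from bounded_linear.has_derivative[OF this has_derivative_in_compose[OF 1 2]]
  have "((\<lambda>\<mu>. app (g (ad br \<mu>)) x $ j) has_derivative
      (\<lambda>v. app (blinfun_apply (G (ad br \<mu>) (ad br \<mu>)) (ad br v)) x $ j)) (at \<mu> within U)" .
  moreover have "app (blinfun_apply (G (ad br \<mu>) (ad br \<mu>)) (ad br (c *s v))) x $ j
      = c * app (blinfun_apply (G (ad br \<mu>) (ad br \<mu>)) (ad br v)) x $ j" for c v
    using g U[OF \<mu>] unfolding divided_difference_def ad_lin by simp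
  ultimately show "\<exists>f'. ((\<lambda>\<mu>. app (g (ad br \<mu>)) x $ j) has_derivative f') (at \<mu> within U) \<and>
      (\<forall>c. \<forall>v\<in>l. f' (c *s v) = c * f' v)" by blast
qed

definition denominator :: "complex^'a \<Rightarrow> complex" where "denominator \<mu> = det (mat_of (Mhat (ad br \<mu>)))"

text \<open>
  The numerator in Cramer's rule for the solution of \<open>M y = dual_axis i\<close>.
\<close>

definition cofactor :: "complex^'a \<Rightarrow> 'a \<Rightarrow> 'a \<Rightarrow> complex" where
  "cofactor \<mu> i k = det (\<chi> a b. if b = k then dual_axis i $ a else mat_of (Mhat (ad br \<mu>)) $ a $ b)"

definition numerator :: "complex^'a \<Rightarrow> complex^'a^'a" where
  "numerator \<mu> = (\<chi> i j. (\<Sum>k\<in>UNIV. mat_of (Nhat (ad br \<mu>)) $ j $ k * cofactor \<mu> i k) - denominator \<mu> * r\<^sub>l $ i $ j)"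

lemma holomorphic_entries:
  "holomorphic_in l U (\<lambda>\<mu>. mat_of (Mhat (ad br \<mu>)) $ i $ j)" "holomorphic_in l U (\<lambda>\<mu>. mat_of (Nhat (ad br \<mu>)) $ i $ j)"
proof -
  obtain M M' where "divided_difference P UNIV Mhat M" "divided_difference P UNIV Nhat M'"
    using Mhat_divided_difference Nhat_divided_difference by blast
  thus "holomorphic_in l U (\<lambda>\<mu>. mat_of (Mhat (ad br \<mu>)) $ i $ j)" "holomorphic_in l U (\<lambda>\<mu>. mat_of (Nhat (ad br \<mu>)) $ i $ j)"
    unfolding mat_of_component by (auto intro: holomorphic_dvd_diff)
qed

lemma holomorphic_denominator: "holomorphic_in l U denominator"
  unfolding denominator_def[abs_def] by (intro holomorphic_in_det holomorphic_entries)

lemma holomorphic_numerator: "holomorphic_in l U (\<lambda>\<mu>. numerator \<mu> $ i $ j)"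
proof -
  have "holomorphic_in l U (\<lambda>\<mu>. cofactor \<mu> i k)" for k
    unfolding cofactor_def
  proof (rule holomorphic_in_det)
    fix a b
    show "holomorphic_in l U (\<lambda>\<mu>. (\<chi> a b. if b = k then dual_axis i $ a else mat_of (Mhat (ad br \<mu>)) $ a $ b) $ a $ b)"
      by (cases "b = k") (simp_all add: holomorphic_in_const holomorphic_entries)
  qed
  thus ?thesis unfolding numerator_def
    by (simp add: holomorphic_in_diff holomorphic_in_sum holomorphic_in_mult holomorphic_entries
        holomorphic_denominator holomorphic_in_const)
qed

lemma denominator_numerator:
  assumes "\<mu> \<in> D" shows "denominator \<mu> * r \<mu> $ i $ j = numerator \<mu> $ i $ j"
proof -
  have u: "unit (Mhat (ad br \<mu>))" using assms D_iff by (simp add: regular_def)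
  hence q: "denominator \<mu> \<noteq> 0" by (simp add: denominator_def unit_iff_det)
  define y where "y = app (einv (Mhat (ad br \<mu>))) (dual_axis i)"
  have "mat_of (Mhat (ad br \<mu>)) *v y = dual_axis i" using u by (simp add: mat_of_works y_def)
  hence y: "y $ k = cofactor \<mu> i k / denominator \<mu>" for k
    using cramer[of "mat_of (Mhat (ad br \<mu>))" y "dual_axis i"] q by (simp add: denominator_def cofactor_def)
  have "r \<mu> $ i $ j = app (Nhat (ad br \<mu>)) y $ j - r\<^sub>l $ i $ j"
    by (simp add: r_eq[OF assms] tensor_of_def Rhat_def y_def)
  also have "app (Nhat (ad br \<mu>)) y $ j = (\<Sum>k\<in>UNIV. mat_of (Nhat (ad br \<mu>)) $ j $ k * y $ k)"
    by (simp add: mat_of_works[symmetric] matrix_vector_mult_def)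
  finally have "r \<mu> $ i $ j = (\<Sum>k\<in>UNIV. mat_of (Nhat (ad br \<mu>)) $ j $ k * cofactor \<mu> i k) / denominator \<mu> - r\<^sub>l $ i $ j"
    by (simp add: y sum_divide_distrib)
  thus ?thesis using q by (simp add: numerator_def field_simps)
qed

text \<open>
  At \<open>t \<rho>\<close> with small \<open>t \<noteq> 0\<close> the factors \<open>phi\<close> of \<open>M\<close> are close to their nonzero values at \<open>0\<close>, and the remaining
  factor \<open>ad (t \<rho>)\<close> on the complement is injective because \<open>l\<close> is the whole centralizer of \<open>\<rho>\<close>.
\<close>

lemma denominator_nonzero_somewhere: "\<exists>\<mu>\<in>l. denominator \<mu> \<noteq> 0"
proof -
  let ?X = "\<lambda>t::complex. sc t * ad br \<rho>"
  have t: "(?X \<longlongrightarrow> 0) (at 0)" by (auto intro!: tendsto_eq_intros)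
  have "eventually (\<lambda>t. unit (ev (phi \<epsilon>) (?X t))) (at 0)"
  proof (rule eventually_unit[OF ev_tendsto[OF _ t]])
    have "sc \<epsilon> * sc (1 / \<epsilon>) = (1 :: 'a endo)" "sc (1 / \<epsilon>) * sc \<epsilon> = (1 :: 'a endo)"
      using eps by (simp_all flip: sc_simps)
    thus "unit (ev (phi \<epsilon>) 0 :: 'a endo)" unfolding ev_zero_arg phi_0 unit_def by blast
  qed simp
  moreover have "eventually (\<lambda>t. unit (phi_l (?X t))) (at 0)"
    by (rule eventually_unit[OF phi_l_tendsto[OF t]]) (simp add: phi_l_def ev_zero_arg phi_0)
  moreover have "eventually (\<lambda>t::complex. t \<noteq> 0) (at 0)" by (simp add: eventually_at_filter)
  ultimately have "eventually (\<lambda>t. unit (Mhat (?X t))) (at 0)"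
  proof eventually_elim
    case (elim t)
    have X: "?X t = ad br (t *s \<rho>)" by (simp add: ad_lin)
    have tl: "t *s \<rho> \<in> l" using rho(1) subspace_l by (rule_tac vec.subspace_scale)
    have PX: "P * ?X t = ?X t * P" unfolding X by (rule P_ad[OF tl])
    have "unit (ev (phi 1) (?X t) * P + ?X t * (1 - P))"
      unfolding unit_iff_inj
    proof (intro allI impI)
      fix x assume "app (ev (phi 1) (?X t) * P + ?X t * (1 - P)) x = 0"
      hence x: "app (ev (phi 1) (?X t)) (app P x) + t *s br \<rho> (x - app P x) = 0"
        by (simp add: br vector_ssub_ldistrib)
      have in1: "app P (app (ev (phi 1) (?X t)) (app P x)) = app (ev (phi 1) (?X t)) (app P x)"
        using ev_in_l[OF _ PX P_range, of "phi 1"] by (simp add: in_l_iff)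
      have in2: "app P (br \<rho> (x - app P x)) = 0" using ad_lperp[OF rho(1) P_minus] by simp
      have "app P (app (ev (phi 1) (?X t)) (app P x) + t *s br \<rho> (x - app P x)) = 0" unfolding x by simp
      hence 1: "app (ev (phi 1) (?X t)) (app P x) = 0" using in1 in2 by (simp del: app_arg(2))
      hence "app (phi_l (?X t)) (app P x) = 0" by (simp add: phi_l_def)
      hence Px: "app P x = 0" using elim(2) unfolding unit_iff_inj by blast
      have "br \<rho> x = 0" using x elim(3) unfolding 1 Px by (simp add: vector_mul_eq_0)
      thus "x = 0" using rho(2) Px P_id by metis
    qed
    thus ?case unfolding Mhat_factor(1)[OF PX] using elim(1) by (rule unit_mult[rotated])
  qed
  then obtain t where "unit (Mhat (?X t))" using eventually_happens at_neq_bot by blast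
  hence "denominator (t *s \<rho>) \<noteq> 0" by (simp add: denominator_def unit_iff_det ad_lin)
  thus ?thesis using rho(1) subspace_l vec.subspace_scale by blast
qed

text \<open>
  The identity theorem on the complex line through \<open>p\<close> and a point where the denominator does not vanish.
\<close>

lemma denominator_nonzero_near:
  assumes p: "p \<in> l" and e: "e > 0" shows "\<exists>x\<in>l \<inter> ball p e. denominator x \<noteq> 0"
proof (rule ccontr)
  assume none: "\<not> (\<exists>x\<in>l \<inter> ball p e. denominator x \<noteq> 0)"
  obtain x0 where x0: "x0 \<in> l" "denominator x0 \<noteq> 0" using denominator_nonzero_somewhere by blast
  define w where "w = x0 - p"
  have w: "w \<in> l" using x0(1) p subspace_l by (simp add: w_def vec.subspace_diff)
  define g where "g t = denominator (p + t *s w)" for t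
  have g: "g holomorphic_on UNIV" unfolding g_def
    by (rule holomorphic_in_line[OF holomorphic_denominator subspace_l p w])
  have nw: "norm (t *s w) = cmod t * norm w" for t
    using norm_sc by (simp add: norm_vec_def norm_mult L2_set_right_distrib)
  have "g t = 0" if "t \<in> ball 0 (e / (norm w + 1))" for t
  proof -
    have "cmod t * norm w \<le> cmod t * (norm w + 1)" by (intro mult_left_mono) auto
    also have "\<dots> < e" using that by (simp add: pos_less_divide_eq add_nonneg_pos)
    finally have "p + t *s w \<in> ball p e" by (simp add: dist_norm nw)
    moreover have "p + t *s w \<in> l" using p w subspace_l by (intro vec.subspace_add vec.subspace_scale)
    ultimately show ?thesis using none by (auto simp: g_def)
  qed
  moreover have "e / (norm w + 1) > 0" using e by (simp add: add_nonneg_pos)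
  ultimately have "g 1 = 0"
    by (intro analytic_continuation_open[of "ball 0 (e / (norm w + 1))" UNIV g "\<lambda>_. 0" 1]) (auto simp: g)
  thus False using x0(2) by (simp add: g_def w_def)
qed

lemma r_meromorphic: "meromorphic_map l N D r"
  unfolding meromorphic_map_def
proof (intro conjI allI ballI)
  show "D \<subseteq> N" using D_iff by blast
  show "openin (top_of_set l) D" by (rule openin_D)
  show "holomorphic_in l D (\<lambda>\<mu>. r \<mu> $ i $ j)" for i j
  proof -
    have "holomorphic_in l D (\<lambda>\<mu>. app (Rhat (ad br \<mu>)) (dual_axis i) $ j - r\<^sub>l $ i $ j)"
      by (intro holomorphic_in_diff holomorphic_in_const holomorphic_dvd_diff[OF Rhat_dd])
         (use D_iff regularD(2) in blast)
    thus ?thesis unfolding holomorphic_in_def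
    proof (intro ballI)
      fix x assume x: "x \<in> D" and h: "\<forall>x\<in>D. \<exists>f'. ((\<lambda>\<mu>. app (Rhat (ad br \<mu>)) (dual_axis i) $ j - r\<^sub>l $ i $ j) has_derivative f') (at x within D) \<and> (\<forall>c. \<forall>v\<in>l. f' (c *s v) = c * f' v)"
      then obtain f' where f': "((\<lambda>\<mu>. app (Rhat (ad br \<mu>)) (dual_axis i) $ j - r\<^sub>l $ i $ j) has_derivative f') (at x within D)"
        "\<forall>c. \<forall>v\<in>l. f' (c *s v) = c * f' v" by blast
      have "((\<lambda>\<mu>. r \<mu> $ i $ j) has_derivative f') (at x within D)"
        by (rule has_derivative_transform[OF x _ f'(1)]) (simp add: r_eq tensor_of_def)
      thus "\<exists>f'. ((\<lambda>\<mu>. r \<mu> $ i $ j) has_derivative f') (at x within D) \<and> (\<forall>c. \<forall>v\<in>l. f' (c *s v) = c * f' v)"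
        using f'(2) by blast
    qed
  qed
  fix p assume p: "p \<in> N"
  obtain W where W: "open W" "N = l \<inter> W" using N by (auto simp: exponential_domain_def openin_open)
  then obtain e where e: "e > 0" "ball p e \<subseteq> W" using p openE by blast
  let ?U = "l \<inter> ball p e"
  have conv: "convex ?U"
  proof (rule convex_Int[OF _ convex_ball])
    show "convex l" unfolding convex_def using subspace_l
      by (simp add: scaleR_eq_complex_scale vec.subspace_add vec.subspace_scale)
  qed
  have sub: "?U \<subseteq> N" using W e by blast
  show "\<exists>U q F. p \<in> U \<and> U \<subseteq> N \<and> openin (top_of_set l) U \<and> connected U \<and> holomorphic_in l U q \<and>
      (\<exists>x\<in>U. q x \<noteq> 0) \<and> (\<forall>i j. holomorphic_in l U (\<lambda>\<mu>. F \<mu> $ i $ j)) \<and>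
      (\<forall>x\<in>U. q x \<noteq> 0 \<longrightarrow> x \<in> D \<and> (\<forall>i j. q x * r x $ i $ j = (F x :: complex^'a^'a) $ i $ j))"
  proof (intro exI conjI allI ballI impI)
    show "p \<in> ?U" using p N_l e by auto
    show "?U \<subseteq> N" by (rule sub)
    show "openin (top_of_set l) ?U" by (auto simp: openin_open)
    show "connected ?U" using conv by (rule convex_connected)
    show "holomorphic_in l ?U denominator" by (rule holomorphic_denominator)
    show "\<exists>x\<in>?U. denominator x \<noteq> 0" using denominator_nonzero_near[of p e] p N_l e(1) by blast
    show "holomorphic_in l ?U (\<lambda>\<mu>. numerator \<mu> $ i $ j)" for i j by (rule holomorphic_numerator)
    fix x assume x: "x \<in> ?U" "denominator x \<noteq> 0"
    show "x \<in> D" using x sub nonsingularI[OF N] unfolding D_iff regular_def denominator_def unit_iff_det by blast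
    thus "denominator x * r x $ i $ j = numerator x $ i $ j" for i j by (rule denominator_numerator)
  qed
qed

lemma r_matrix_dynamical:
  assumes "casimir_element form UNIV \<Omega>\<^sub>g"
  shows "(\<forall>\<mu>\<in>D. is_r_value br form l r\<^sub>l \<epsilon> \<mu> (r \<mu>)) \<and>
    dynamical_r_matrix br l \<delta> r\<^sub>l \<Omega>\<^sub>l N D r (\<chi> a b c. \<epsilon>\<^sup>2 / 4 * comm_12_23 br \<Omega>\<^sub>g \<Omega>\<^sub>g $ a $ b $ c)"
proof -
  let ?Z = "\<chi> a b c. \<epsilon>\<^sup>2 / 4 * comm_12_23 br \<Omega>\<^sub>g \<Omega>\<^sub>g $ a $ b $ c"
  have Z: "?Z $ a $ b $ c = - (\<epsilon>\<^sup>2 / 4) * F (dual_axis a) (dual_axis b) (dual_axis c)" for a b c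
    by (simp add: Z_component[OF assms])
  have "dynamical_r_matrix br l \<delta> r\<^sub>l \<Omega>\<^sub>l N D r ?Z"
    unfolding dynamical_r_matrix_def
  proof (intro conjI ballI allI impI)
    show "meromorphic_map l N D r" by (rule r_meromorphic)
    show "r \<mu> \<in> wedge2 UNIV" if "\<mu> \<in> D" for \<mu> by (rule r_wedge(1)[OF that])
    show "quasi_invariant br l \<delta> D r" by (rule r_quasi_invariant)
    show "?Z \<in> wedge3" "ad3 br x ?Z = 0" for x by (rule Z_invariant[OF Z])+
    fix d \<xi> \<eta> \<mu> assume "dual_bases l d \<xi> \<eta>" "\<mu> \<in> D"
    from r_dynamical[OF this(2,1)] Z
    show "(\<Sum>i<d. Alt (tensor_left (\<xi> i) (nabla br l r\<^sub>l \<Omega>\<^sub>l (\<eta> i) r \<mu>))) + CYB br (r \<mu>) = ?Z"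
      unfolding vec_eq_iff by metis
  qed
  thus ?thesis using r_value_D by blast
qed

end

lemma levi_setting_intro:
  assumes simple: "simple_lie_algebra br" and form: "nondeg_invariant_form br form"
    and levi: "levi_subalgebra br l" and qt: "quasitriangular br l \<delta> r\<^sub>l \<Omega>\<^sub>l"
    and cas: "casimir_element form l \<Omega>\<^sub>l" and N: "exponential_domain br l N" and eps: "\<epsilon> \<noteq> 0"
  shows "\<exists>P \<rho>. levi_setting br form l P \<epsilon> r\<^sub>l \<Omega>\<^sub>l \<delta> N \<rho>"
proof -
  define P where "P = op (operator_of form \<Omega>\<^sub>l)"
  note P = casimir_projection[OF form cas, folded P_def]
  obtain \<rho> where \<rho>: "l = {x. br \<rho> x = 0}" "killing_orthogonal br l = {x. \<forall>y\<in>l. form x y = 0}"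
    and cen: "\<And>x. (\<And>y. br x y = 0) \<Longrightarrow> x = 0"
    using levi_structure[OF simple form levi] by blast
  have lie: "lie_algebra br" using simple by (simp add: simple_lie_algebra_def)
  have l: "vec.subspace l" "\<And>x y. x \<in> l \<Longrightarrow> y \<in> l \<Longrightarrow> br x y \<in> l"
    using qt unfolding quasitriangular_def lie_bialgebra_def by blast+
  interpret reductive_pair br form l P
    by unfold_locales (use lie form cen l P(1-3) in auto)
  have "{x. \<forall>y\<in>l. form x y = 0} = {x. app P x = 0}"
  proof (intro Collect_cong iffI)
    fix x assume "\<forall>y\<in>l. form x y = 0"
    hence "form (app P x) z = 0" for z using P(1) P(3) by metis
    thus "app P x = 0" by (rule form_nondeg)
  next
    fix x assume "app P x = 0"
    thus "\<forall>y\<in>l. form x y = 0" using P(2,3) form_simps(9) by metis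
  qed
  moreover have "\<rho> \<in> l" unfolding \<rho>(1) by (simp add: br)
  moreover have "P = oper \<Omega>\<^sub>l" by (simp add: P_def oper_def)
  ultimately have "levi_setting br form l P \<epsilon> r\<^sub>l \<Omega>\<^sub>l \<delta> N \<rho>"
    using qt N eps \<rho> unfolding quasitriangular_def wedge2_def sym2_def
    by (intro levi_setting.intro r_setting.intro r_setting_axioms.intro levi_setting_axioms.intro reductive_pair_axioms) (fast | simp)+
  thus ?thesis by blast
qed

theorem corollary5p2:
  fixes br :: "complex^'n \<Rightarrow> complex^'n \<Rightarrow> complex^'n"
    and form :: "complex^'n \<Rightarrow> complex^'n \<Rightarrow> complex"
    and l N :: "(complex^'n) set"
    and \<Omega>\<^sub>g r\<^sub>l \<Omega>\<^sub>l :: "complex^'n^'n"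
    and \<delta> :: "complex^'n \<Rightarrow> complex^'n^'n"
    and \<epsilon> :: complex
  assumes "simple_lie_algebra br"
    and "nondeg_invariant_form br form"
    and "casimir_element form UNIV \<Omega>\<^sub>g"
    and "levi_subalgebra br l"
    and "quasitriangular br l \<delta> r\<^sub>l \<Omega>\<^sub>l"
    and "factorizable l \<Omega>\<^sub>l"
    and "casimir_element form l \<Omega>\<^sub>l"
    and "exponential_domain br l N"
    and "\<epsilon> \<noteq> 0"
  shows "(\<forall>\<mu>\<in>regular_points br l N \<epsilon>. is_r_value br form l r\<^sub>l \<epsilon> \<mu> (r_matrix br form l r\<^sub>l \<epsilon> \<mu>)) \<and>
    dynamical_r_matrix br l \<delta> r\<^sub>l \<Omega>\<^sub>l N (regular_points br l N \<epsilon>) (r_matrix br form l r\<^sub>l \<epsilon>)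
      (\<chi> a b c. \<epsilon>\<^sup>2 / 4 * comm_12_23 br \<Omega>\<^sub>g \<Omega>\<^sub>g $ a $ b $ c)"
proof -
  obtain P \<rho> where "levi_setting br form l P \<epsilon> r\<^sub>l \<Omega>\<^sub>l \<delta> N \<rho>"
    using levi_setting_intro[OF assms(1,2,4,5,7,8,9)] by blast
  then interpret levi_setting br form l P \<epsilon> r\<^sub>l \<Omega>\<^sub>l \<delta> N \<rho> .
  show ?thesis by (rule r_matrix_dynamical[OF assms(3)])
qed

end
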